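(* Let $\mathcal F$ be a minimal twist and consider an action $S[\hat\Psi]=S_{free}[\hat a]+S_{int}[\hat a]$, where $$S_{free}[\hat a]=\tfrac12\sum_{K=0}^ND_K\,\tilde g^K_{mn}\,\hat a^{K,n}\hat a^{K,m},\qquad D_K\in\mathbb C,$$ and $S_{int}$ is an invariant polynomial in the modes (a sum of contractions of the modes with invariant tensors of $\tilde U_q(su(2))$). Put $$\hat b^{K,n}=D_K^{-1}\,\hat j^{K,n}+\hat\partial^{K,n},\qquad \int\hat JD^{-1}\hat J:=\sum_{K}D_K^{-1}\,\tilde g^K_{mn}\,\hat j^{K,n}\hat j^{K,m}.$$ Then for every noncommutative polynomial $P$ in the modes $$\langle P(\hat a)\rangle=\frac1{\mathcal N'}\;{}_{J=0}\big\langle P(\hat\partial)\,e^{-S_{int}[\hat\partial]}\,e^{\frac12\int\hat JD^{-1}\hat J}\big\rangle_{\partial=0} =\frac1{\mathcal N'}\;{}_{J=0}\big\langle e^{\frac12\int\hat JD^{-1}\hat J}\,P(\hat b)\,e^{-S_{int}[\hat b]}\big\rangle_{\partial=0} =\frac{{}_{J=0}\langle P(\hat b)\,e^{-S_{int}[\hat b]}\rangle_{\partial=0}}{{}_{J=0}\langle e^{-S_{int}[\hat b]}\rangle_{\partial=0}},$$ where $\mathcal N'$ is the normalization constant for which $\langle 1\rangle=1$.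
   Context: Hopf algebras: $U(su(2))$ has undeformed structure $(\Delta,\varepsilon,S)$. $U_q(su(2))$, $q=e^h$ real near $1$, has coproduct $\Delta_q$; $\tilde U_q(su(2))$ is $U_q(su(2))$ with flipped coproduct. $\varphi:U_q(su(2))\to U(su(2))$ is Drinfel'd's algebra isomorphism (on finite-dimensional representations). A twist $\mathcal F=\mathcal F_1\otimes\mathcal F_2$ (sum implicit) satisfies $(\varphi\otimes\varphi)\Delta_q(u)=\mathcal F\Delta(\varphi(u))\mathcal F^{-1}$, $(\varepsilon\otimes\mathrm{id})\mathcal F=\mathbf 1=(\mathrm{id}\otimes\varepsilon)\mathcal F$, $\mathcal F=\mathbf 1\otimes\mathbf 1+o(h)$, $(\varphi\otimes\varphi)\mathcal R=\mathcal F_{21}q^{t/2}\mathcal F^{-1}$ with $\mathcal R$ the universal $R$-matrix, $t=\Delta(C)-\mathbf 1\otimes C-C\otimes\mathbf 1$, $C$ the quadratic Casimir. It is minimal if its coassociator $\phi=[(\Delta\otimes\mathrm{id})\mathcal F^{-1}](\mathcal F^{-1}\otimes\mathbf 1)(\mathbf 1\otimes\mathcal F)[(\mathrm{id}\otimes\Delta)\mathcal F]$ equals $$\lim_{x_0,y_0\to0^+}\Big\{x_0^{-\frac h{2\pi i}t_{12}}\vec P\exp\Big[-\frac h{2\pi i}\int_{x_0}^{1-y_0}dx\Big(\frac{t_{12}}x+\frac{t_{23}}{x-1}\Big)\Big]y_0^{\frac h{2\pi i}t_{23}}\Big\}$$ ($\vec P$ = path ordering). Put $\tilde{\mathcal F}=\mathcal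 F_{21}$, the twist for $\tilde U_q(su(2))$. Modes and currents: for each integer $0\le K\le N$ let $a_{K,n}$ and $j_{K,n}$ be commuting variables, each transforming in the spin $K$ representation $\pi=\pi_K$, $u\triangleright a_{K,n}=a_{K,m}\pi^m_n(u)$ for $u\in U(su(2))$, and likewise for $j$. $(g_c^K)_{nm}$ is the real symmetric invariant tensor with inverse $(g_c^K)^{nm}$. The polynomials in the $a_{K,n}$ are regarded as complex polynomial functions on $\prod_K\mathbb R^{2K+1}$, with reality structure $a_{K,n}^*=(g_c^K)^{nm}a_{K,m}$. $\partial_{K,n}$ are derivatives with respect to the currents, $\partial_{K,n}j_{K',m}=\delta_{KK'}(g_c^K)_{nm}+j_{K',m}\partial_{K,n}$, $u\triangleright\partial_{K,n}=\partial_{K,m}\pi^m_n(u)$. Deformed invariant tensors: $\tilde g^K_{nm}=(g_c^K)_{rs}\pi^r_n(\tilde{\mathcal F}_1^{-1})\pi^s_m(\tilde{\mathcal F}_2^{-1})$. Contragredient (upper-index) variables are defined by $x_{K,n}=\tilde g^K_{nm}x^{K,m}$ for $x=a,j,\partial$. Twisted operators: for $x=a^{K,n},j^{K,n},\partial^{K,n}$ put $\hat x=(\tilde{\mathcal F}_1^{-1}\triangleright x)\,\tilde{\mathcal F}_2^{-1}$. These act on functions of the variables, where variables act by multiplication, $\partial$ by differentiation, and $u\in U(su(2))$ by $\triangleright$, with $u\cdot1=\varepsilon(u)1$. Invariant tensors of $\tilde U_q(su(2))$ are those on which $\tilde U_q(su(2))$, acting via its iterated coproduct, acts by the counit; here $u\in\tilde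 U_q(su(2))$ acts on the modes as $\varphi(u)\triangleright$. For a noncommutative polynomial $P$, $P(\hat a)$, $P(\hat b)$, $P(\hat\partial)$ denote substitution of the respective operators for the modes; likewise for $S_{int}$. Correlation functions: $$\langle P(\hat a)\rangle=\frac{\int\mathcal D\hat\Psi\,e^{-S[\hat\Psi]}P(\hat a)}{\int\mathcal D\hat\Psi\,e^{-S[\hat\Psi]}},$$ where $\int\mathcal D\hat\Psi$ is the classical integral over $\prod_K\mathbb R^{2K+1}$ of functions of the $a$-variables, extended to operators by evaluating the $U(su(2))$ factors with $\varepsilon$ (i.e. acting on the vacuum $1$). Here $S_{free}[\hat a]$ equals the classical invariant quadratic function $\tfrac12\sum_KD_K(g_c^K)^{nm}a_{K,n}a_{K,m}$. The integrals are Gaussian integrals with $e^{-S_{int}}$ expanded perturbatively, and the identities are understood on this formal level. The bracket ${}_{J=0}\langle X\rangle_{\partial=0}$ of an operator $X$ built from $\hat j,\hat\partial$ (and $U(su(2))$) means: order the derivatives to the right of the currents and then set $\partial$ and $j$ to zero, i.e. apply $X$ to the constant function $1$ of the variables $j$ and evaluate the result at $j=0$.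
   Formalization: S_free and ∫ĴD⁻¹Ĵ carry a common factor ν_K before g̃^K, fixed by requiring S_free to be the classical invariant quadratic function; without it the clauses disagree by [2K+1]_q/(2K+1). The condition F=1⊗1+o(h) is read as 1⊗1 up to terms of order h. *)

theory Defs
  imports
    "HOL-Analysis.Analysis"
    "HOL-Computational_Algebra.Formal_Power_Series"
    "HOL-Library.Landau_Symbols"
    "HOL-Library.Poly_Mapping"
    "Jordan_Normal_Form.Matrix"
begin

hide_const (open) Finite_Cartesian_Product.mat

section \<open>Matrices\<close>

text \<open>Kronecker product; with this row-major index convention it is strictly associative.\<close>

definition kron :: "complex mat \<Rightarrow> complex mat \<Rightarrow> complex mat" where
  "kron A B = Matrix.mat (dim_row A * dim_row B) (dim_col A * dim_col B)
     (\<lambda>(i, j). A $$ (i div dim_row B, j div dim_col B) * B $$ (i mod dim_row B, j mod dim_col B))"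

definition mexp :: "complex mat \<Rightarrow> complex mat" where
  "mexp A = Matrix.mat (dim_row A) (dim_row A) (\<lambda>(i, j). suminf (\<lambda>k. (A ^\<^sub>m k) $$ (i, j) / fact k))"

definition minv :: "complex mat \<Rightarrow> complex mat" where
  "minv A = (SOME B. B \<in> carrier_mat (dim_row A) (dim_row A)
                      \<and> inverts_mat A B \<and> inverts_mat B A)"

definition minvertible :: "complex mat \<Rightarrow> bool" where
  "minvertible A \<longleftrightarrow> (\<exists>B. B \<in> carrier_mat (dim_row A) (dim_row A)
                      \<and> inverts_mat A B \<and> inverts_mat B A)"


section \<open>Finite-dimensional representations\<close>

text \<open>A matrix representation, given by the images of the generators \<open>H\<close>, \<open>X\<^sup>+\<close>, \<open>X\<^sup>-\<close>,
  either of \<open>U(su(2))\<close> or of \<open>U\<^sub>q(su(2))\<close>.\<close>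

datatype rep = Rep (opH: "complex mat") (opX: "complex mat") (opY: "complex mat")

definition rdim :: "rep \<Rightarrow> nat" where
  "rdim \<rho> = dim_row (opH \<rho>)"

definition rep_carrier :: "rep \<Rightarrow> bool" where
  "rep_carrier \<rho> \<longleftrightarrow> opH \<rho> \<in> carrier_mat (rdim \<rho>) (rdim \<rho>)
     \<and> opX \<rho> \<in> carrier_mat (rdim \<rho>) (rdim \<rho>) \<and> opY \<rho> \<in> carrier_mat (rdim \<rho>) (rdim \<rho>)"

definition is_rep :: "rep \<Rightarrow> bool" where
  "is_rep \<rho> \<longleftrightarrow> rep_carrier \<rho>
     \<and> opH \<rho> * opX \<rho> - opX \<rho> * opH \<rho> = 2 \<cdot>\<^sub>m opX \<rho>
     \<and> opH \<rho> * opY \<rho> - opY \<rho> * opH \<rho> = (- 2) \<cdot>\<^sub>m opY \<rho>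
     \<and> opX \<rho> * opY \<rho> - opY \<rho> * opX \<rho> = opH \<rho>"

text \<open>\<open>qpow h c \<rho>\<close> is \<open>q\<^bsup>cH\<^esup>\<close> with \<open>q = e\<^sup>h\<close>.\<close>

definition qpow :: "real \<Rightarrow> real \<Rightarrow> rep \<Rightarrow> complex mat" where
  "qpow h c \<rho> = mexp (complex_of_real (c * h) \<cdot>\<^sub>m opH \<rho>)"

text \<open>The last line restricts to the representations with integral weights. For \<open>q\<close> close to \<open>1\<close>
  these are the ones that correspond to representations of \<open>su(2)\<close>; the others have weights of
  order \<open>1/h\<close> and are absent over formal power series in \<open>h\<close>.\<close>

definition is_qrep :: "real \<Rightarrow> rep \<Rightarrow> bool" where
  "is_qrep h \<rho> \<longleftrightarrow> rep_carrier \<rho>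
     \<and> opH \<rho> * opX \<rho> - opX \<rho> * opH \<rho> = 2 \<cdot>\<^sub>m opX \<rho>
     \<and> opH \<rho> * opY \<rho> - opY \<rho> * opH \<rho> = (- 2) \<cdot>\<^sub>m opY \<rho>
     \<and> opX \<rho> * opY \<rho> - opY \<rho> * opX \<rho>
         = (1 / complex_of_real (exp h - exp (- h))) \<cdot>\<^sub>m (qpow h 1 \<rho> - qpow h (- 1) \<rho>)
     \<and> (\<exists>D. similar_mat (opH \<rho>) D \<and> diagonal_mat D \<and> (\<forall>i<rdim \<rho>. D $$ (i, i) \<in> \<int>))"

definition intertwiner :: "rep \<Rightarrow> rep \<Rightarrow> complex mat \<Rightarrow> bool" where
  "intertwiner \<rho> \<sigma> T \<longleftrightarrow> T \<in> carrier_mat (rdim \<sigma>) (rdim \<rho>)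
     \<and> T * opH \<rho> = opH \<sigma> * T \<and> T * opX \<rho> = opX \<sigma> * T \<and> T * opY \<rho> = opY \<sigma> * T"

text \<open>The counit, as a representation (both for \<open>U(su(2))\<close> and \<open>U\<^sub>q(su(2))\<close>).\<close>

definition triv :: rep where
  "triv = Rep (0\<^sub>m 1 1) (0\<^sub>m 1 1) (0\<^sub>m 1 1)"

text \<open>Tensor products of representations are taken through the coproducts: \<open>tens\<close> for \<open>\<Delta>\<close>,
  \<open>qtens\<close> for \<open>\<Delta>\<^sub>q(X) = X \<otimes> q\<^bsup>H/2\<^esup> + q\<^bsup>-H/2\<^esup> \<otimes> X\<close>, and \<open>qtens_flip\<close> for the flipped
  coproduct of \<open>\<tilde>U\<^sub>q(su(2))\<close>.\<close>

definition tens :: "rep \<Rightarrow> rep \<Rightarrow> rep" where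
  "tens \<rho> \<sigma> = (let D = (\<lambda>X Y. kron X (1\<^sub>m (rdim \<sigma>)) + kron (1\<^sub>m (rdim \<rho>)) Y) in
     Rep (D (opH \<rho>) (opH \<sigma>)) (D (opX \<rho>) (opX \<sigma>)) (D (opY \<rho>) (opY \<sigma>)))"

definition qtens :: "real \<Rightarrow> rep \<Rightarrow> rep \<Rightarrow> rep" where
  "qtens h \<rho> \<sigma> = (let D = (\<lambda>X Y. kron X (qpow h (1/2) \<sigma>) + kron (qpow h (- 1/2) \<rho>) Y) in
     Rep (kron (opH \<rho>) (1\<^sub>m (rdim \<sigma>)) + kron (1\<^sub>m (rdim \<rho>)) (opH \<sigma>))
       (D (opX \<rho>) (opX \<sigma>)) (D (opY \<rho>) (opY \<sigma>)))"

definition qtens_flip :: "real \<Rightarrow> rep \<Rightarrow> rep \<Rightarrow> rep" where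
  "qtens_flip h \<rho> \<sigma> = (let D = (\<lambda>X Y. kron X (qpow h (- 1/2) \<sigma>) + kron (qpow h (1/2) \<rho>) Y) in
     Rep (kron (opH \<rho>) (1\<^sub>m (rdim \<sigma>)) + kron (1\<^sub>m (rdim \<rho>)) (opH \<sigma>))
       (D (opX \<rho>) (opX \<sigma>)) (D (opY \<rho>) (opY \<sigma>)))"

text \<open>Elements of the algebras, as seen in finite-dimensional representations: an element of
  (the completion of) \<open>U\<close> is a family of operators, one for each representation in the class
  \<open>S\<close>, that commutes with all intertwiners; similarly for \<open>U \<otimes> U\<close>. Products are taken
  representation by representation, \<open>(\<Delta> u)(\<rho>, \<sigma>) = u (\<rho> \<otimes> \<sigma>)\<close> and
  \<open>\<epsilon>(u) = u triv\<close>.\<close>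

definition uhat :: "(rep \<Rightarrow> bool) \<Rightarrow> (rep \<Rightarrow> complex mat) set" where
  "uhat S = {u. (\<forall>\<rho>. S \<rho> \<longrightarrow> u \<rho> \<in> carrier_mat (rdim \<rho>) (rdim \<rho>))
     \<and> (\<forall>\<rho> \<sigma> T. S \<rho> \<longrightarrow> S \<sigma> \<longrightarrow> intertwiner \<rho> \<sigma> T \<longrightarrow> T * u \<rho> = u \<sigma> * T)}"

definition uhat2 :: "(rep \<Rightarrow> bool) \<Rightarrow> (rep \<Rightarrow> rep \<Rightarrow> complex mat) set" where
  "uhat2 S = {F. (\<forall>\<rho> \<sigma>. S \<rho> \<longrightarrow> S \<sigma> \<longrightarrow>
        F \<rho> \<sigma> \<in> carrier_mat (rdim \<rho> * rdim \<sigma>) (rdim \<rho> * rdim \<sigma>))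
     \<and> (\<forall>\<rho> \<rho>' \<sigma> \<sigma>' T T'. S \<rho> \<longrightarrow> S \<rho>' \<longrightarrow> S \<sigma> \<longrightarrow> S \<sigma>' \<longrightarrow>
          intertwiner \<rho> \<rho>' T \<longrightarrow> intertwiner \<sigma> \<sigma>' T' \<longrightarrow> kron T T' * F \<rho> \<sigma> = F \<rho>' \<sigma>' * kron T T')}"

definition uinv2 :: "(rep \<Rightarrow> rep \<Rightarrow> complex mat) \<Rightarrow> rep \<Rightarrow> rep \<Rightarrow> complex mat" where
  "uinv2 F \<rho> \<sigma> = minv (F \<rho> \<sigma>)"

text \<open>\<open>F\<^sub>2\<^sub>1\<close>\<close>

definition flip2 :: "(rep \<Rightarrow> rep \<Rightarrow> complex mat) \<Rightarrow> rep \<Rightarrow> rep \<Rightarrow> complex mat" where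
  "flip2 F \<rho> \<sigma> = Matrix.mat (rdim \<rho> * rdim \<sigma>) (rdim \<rho> * rdim \<sigma>) (\<lambda>(i, j).
     F \<sigma> \<rho> $$ ((i mod rdim \<sigma>) * rdim \<rho> + i div rdim \<sigma>, (j mod rdim \<sigma>) * rdim \<rho> + j div rdim \<sigma>))"


section \<open>The isomorphism, the R-matrix and the twist\<close>

text \<open>An algebra homomorphism from \<open>U\<^sub>q(su(2))\<close> to \<open>U(su(2))\<close> (on finite-dimensional
  representations) is given by the images of the generators, that is, by its pullback
  \<open>\<rho> \<mapsto> \<rho> \<circ> \<phi>\<close> of representations, which is natural and keeps the underlying space;
  on elements, \<open>(\<phi> u)(\<rho>) = u (\<rho> \<circ> \<phi>)\<close>.\<close>

definition alg_hom :: "(rep \<Rightarrow> bool) \<Rightarrow> (rep \<Rightarrow> bool) \<Rightarrow> (rep \<Rightarrow> rep) \<Rightarrow> bool" where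
  "alg_hom S S' \<phi> \<longleftrightarrow> (\<forall>\<rho>. S \<rho> \<longrightarrow> S' (\<phi> \<rho>) \<and> rdim (\<phi> \<rho>) = rdim \<rho>)
     \<and> (\<forall>\<rho> \<sigma> T. S \<rho> \<longrightarrow> S \<sigma> \<longrightarrow> intertwiner \<rho> \<sigma> T \<longrightarrow> intertwiner (\<phi> \<rho>) (\<phi> \<sigma>) T)"

definition alg_iso :: "real \<Rightarrow> (rep \<Rightarrow> rep) \<Rightarrow> bool" where
  "alg_iso h \<phi> \<longleftrightarrow> alg_hom is_rep (is_qrep h) \<phi> \<and>
     (\<exists>\<psi>. alg_hom (is_qrep h) is_rep \<psi>
        \<and> (\<forall>\<rho>. is_rep \<rho> \<longrightarrow> \<psi> (\<phi> \<rho>) = \<rho>) \<and> (\<forall>\<sigma>. is_qrep h \<sigma> \<longrightarrow> \<phi> (\<psi> \<sigma>) = \<sigma>))"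

definition casimir :: "rep \<Rightarrow> complex mat" where
  "casimir \<rho> = (1/2) \<cdot>\<^sub>m (opH \<rho> * opH \<rho>) + opX \<rho> * opY \<rho> + opY \<rho> * opX \<rho>"

definition tinv :: "rep \<Rightarrow> rep \<Rightarrow> complex mat" where
  "tinv \<rho> \<sigma> = casimir (tens \<rho> \<sigma>) - kron (1\<^sub>m (rdim \<rho>)) (casimir \<sigma>) - kron (casimir \<rho>) (1\<^sub>m (rdim \<sigma>))"

definition qnum :: "real \<Rightarrow> nat \<Rightarrow> real" where
  "qnum h n = (exp (real n * h) - exp (- real n * h)) / (exp h - exp (- h))"

text \<open>The universal R-matrix
  \<open>q\<^bsup>H\<otimes>H/2\<^esup> \<Sum>\<^sub>n q\<^bsup>n(n-1)/2\<^esup> (1-q\<^bsup>-2\<^esup>)\<^bsup>n\<^esup>/[n]! (q\<^bsup>H/2\<^esup>X\<^sup>+)\<^bsup>n\<^esup> \<otimes> (q\<^bsup>-H/2\<^esup>X\<^sup>-)\<^bsup>n\<^esup>\<close>; the \<open>n\<close>-th term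
  vanishes once \<open>n\<close> reaches the dimension of the first representation.\<close>

definition rmat :: "real \<Rightarrow> rep \<Rightarrow> rep \<Rightarrow> complex mat" where
  "rmat h \<rho> \<sigma> = mexp (complex_of_real (h/2) \<cdot>\<^sub>m kron (opH \<rho>) (opH \<sigma>))
     * Matrix.mat (rdim \<rho> * rdim \<sigma>) (rdim \<rho> * rdim \<sigma>) (\<lambda>(i, j). \<Sum>n<rdim \<rho>.
         complex_of_real (exp (h * real n * (real n - 1) / 2) * (1 - exp (- 2 * h)) ^ n / (\<Prod>m=1..n. qnum h m))
         * kron ((qpow h (1/2) \<rho> * opX \<rho>) ^\<^sub>m n) ((qpow h (- 1/2) \<sigma> * opY \<sigma>) ^\<^sub>m n) $$ (i, j))"

definition is_twist :: "real \<Rightarrow> (rep \<Rightarrow> rep) \<Rightarrow> (rep \<Rightarrow> rep \<Rightarrow> complex mat) \<Rightarrow> bool" where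
  "is_twist h \<phi> F \<longleftrightarrow> F \<in> uhat2 is_rep \<and>
     (\<forall>\<rho> \<sigma>. is_rep \<rho> \<longrightarrow> is_rep \<sigma> \<longrightarrow>
        minvertible (F \<rho> \<sigma>)
        \<and> (\<forall>u\<in>uhat (is_qrep h). u (qtens h (\<phi> \<rho>) (\<phi> \<sigma>)) = F \<rho> \<sigma> * u (\<phi> (tens \<rho> \<sigma>)) * uinv2 F \<rho> \<sigma>)
        \<and> F triv \<sigma> = 1\<^sub>m (rdim \<sigma>) \<and> F \<rho> triv = 1\<^sub>m (rdim \<rho>)
        \<and> rmat h (\<phi> \<rho>) (\<phi> \<sigma>)
            = flip2 F \<rho> \<sigma> * mexp (complex_of_real (h/2) \<cdot>\<^sub>m tinv \<rho> \<sigma>) * uinv2 F \<rho> \<sigma>)"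

definition coassoc :: "(rep \<Rightarrow> rep \<Rightarrow> complex mat) \<Rightarrow> rep \<Rightarrow> rep \<Rightarrow> rep \<Rightarrow> complex mat" where
  "coassoc F \<rho> \<sigma> \<tau> = uinv2 F (tens \<rho> \<sigma>) \<tau> * kron (uinv2 F \<rho> \<sigma>) (1\<^sub>m (rdim \<tau>))
     * kron (1\<^sub>m (rdim \<rho>)) (F \<sigma> \<tau>) * F \<rho> (tens \<sigma> \<tau>)"

text \<open>The path-ordered exponential of \<open>\<integral>\<^sub>a\<^sup>b A(x) dx\<close>, with factors ordered along the path from left
  (\<open>x\<close> near \<open>a\<close>) to right (\<open>x\<close> near \<open>b\<close>). This is the order for which the limit in \<open>minimal\<close>
  exists: the singularity of \<open>t\<^sub>1\<^sub>2/x\<close> at \<open>x\<^sub>0\<close> is cancelled by the factor on the left.\<close>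

definition pexp :: "nat \<Rightarrow> (real \<Rightarrow> complex mat) \<Rightarrow> real \<Rightarrow> real \<Rightarrow> complex mat" where
  "pexp d A a b = (THE M. \<exists>U. (\<forall>x. U x \<in> carrier_mat d d) \<and> U a = 1\<^sub>m d \<and> U b = M \<and>
     (\<forall>i<d. \<forall>j<d. \<forall>x\<in>{a..b}.
        ((\<lambda>y. U y $$ (i, j)) has_vector_derivative (U x * A x) $$ (i, j)) (at x within {a..b})))"

definition minimal :: "real \<Rightarrow> (rep \<Rightarrow> rep \<Rightarrow> complex mat) \<Rightarrow> bool" where
  "minimal h F \<longleftrightarrow> (\<forall>\<rho> \<sigma> \<tau>. is_rep \<rho> \<longrightarrow> is_rep \<sigma> \<longrightarrow> is_rep \<tau> \<longrightarrow>
     (let d = rdim \<rho> * rdim \<sigma> * rdim \<tau>;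
          t12 = kron (tinv \<rho> \<sigma>) (1\<^sub>m (rdim \<tau>));
          t23 = kron (1\<^sub>m (rdim \<rho>)) (tinv \<sigma> \<tau>);
          \<kappa> = complex_of_real h / (2 * complex_of_real pi * \<i>)
      in \<forall>i<d. \<forall>j<d.
         ((\<lambda>(x0, y0). (mexp ((- \<kappa> * complex_of_real (ln x0)) \<cdot>\<^sub>m t12)
              * pexp d (\<lambda>x. (- \<kappa>) \<cdot>\<^sub>m (complex_of_real (1/x) \<cdot>\<^sub>m t12 + complex_of_real (1/(x-1)) \<cdot>\<^sub>m t23))
                  x0 (1 - y0)
              * mexp ((\<kappa> * complex_of_real (ln y0)) \<cdot>\<^sub>m t23)) $$ (i, j))
           \<longlongrightarrow> coassoc F \<rho> \<sigma> \<tau> $$ (i, j)) (at_right 0 \<times>\<^sub>F at_right 0)))"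

text \<open>A minimal twist for \<open>q = e\<^sup>h\<close> real near \<open>1\<close>: a family in \<open>h\<close> that satisfies all conditions for
  \<open>0 < \<bar>h\<bar> < \<delta>\<close> and is the identity to zeroth order in \<open>h\<close>, as is the isomorphism \<open>\<phi>\<close>.
  The deviation is of order \<open>h\<close>; it cannot be of smaller order, because the antisymmetric part
  of the first-order term of the R-matrix does not vanish.\<close>

definition minimal_twist_family ::
  "real \<Rightarrow> (real \<Rightarrow> rep \<Rightarrow> rep) \<Rightarrow> (real \<Rightarrow> rep \<Rightarrow> rep \<Rightarrow> complex mat) \<Rightarrow> bool" where
  "minimal_twist_family \<delta> \<phi> F \<longleftrightarrow> \<delta> > 0
     \<and> (\<forall>h. h \<noteq> 0 \<longrightarrow> \<bar>h\<bar> < \<delta> \<longrightarrow> alg_iso h (\<phi> h) \<and> is_twist h (\<phi> h) (F h) \<and> minimal h (F h))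
     \<and> (\<forall>\<rho>. is_rep \<rho> \<longrightarrow> (\<forall>i<rdim \<rho>. \<forall>j<rdim \<rho>.
          (\<lambda>h. opH (\<phi> h \<rho>) $$ (i, j) - opH \<rho> $$ (i, j)) \<in> O[at 0](\<lambda>h. complex_of_real h)
        \<and> (\<lambda>h. opX (\<phi> h \<rho>) $$ (i, j) - opX \<rho> $$ (i, j)) \<in> O[at 0](\<lambda>h. complex_of_real h)
        \<and> (\<lambda>h. opY (\<phi> h \<rho>) $$ (i, j) - opY \<rho> $$ (i, j)) \<in> O[at 0](\<lambda>h. complex_of_real h)))
     \<and> (\<forall>\<rho> \<sigma>. is_rep \<rho> \<longrightarrow> is_rep \<sigma> \<longrightarrow> (\<forall>i<rdim \<rho> * rdim \<sigma>. \<forall>j<rdim \<rho> * rdim \<sigma>.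
          (\<lambda>h. F h \<rho> \<sigma> $$ (i, j) - 1\<^sub>m (rdim \<rho> * rdim \<sigma>) $$ (i, j)) \<in> O[at 0](\<lambda>h. complex_of_real h)))"


section \<open>Modes, currents and the action of the enveloping algebra\<close>

text \<open>The basis vector of weight \<open>n\<close>, \<open>-K \<le> n \<le> K\<close>, of the spin \<open>K\<close> representation is numbered by
  \<open>i = K - n\<close>, \<open>0 \<le> i \<le> 2K\<close>.\<close>

definition spin :: "nat \<Rightarrow> rep" where
  "spin K = (let d = 2 * K + 1 in Rep
     (Matrix.mat d d (\<lambda>(i, j). if i = j then 2 * (of_nat K - of_nat i) else 0))
     (Matrix.mat d d (\<lambda>(i, j). if j = i + 1 then complex_of_real (sqrt (real j * real (d - j))) else 0))
     (Matrix.mat d d (\<lambda>(i, j). if i = j + 1 then complex_of_real (sqrt (real i * real (d - i))) else 0)))"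

text \<open>The real symmetric invariant tensor \<open>(g\<^sub>c)\<^sub>n\<^sub>m = (-1)\<^sup>n \<delta>\<^sub>n\<^sub>,\<^sub>-\<^sub>m\<close>. It is its own inverse, so
  \<open>gc\<close> also serves as \<open>(g\<^sub>c)\<^sup>n\<^sup>m\<close>.\<close>

definition gc :: "nat \<Rightarrow> nat \<Rightarrow> nat \<Rightarrow> complex" where
  "gc K i j = (if i + j = 2 * K then (- 1) ^ (K + i) else 0)"

text \<open>A variable \<open>x\<^bsub>K,n\<^esub>\<close> is denoted by \<open>(K, n)\<close>; the same polynomial ring is used for the
  modes \<open>a\<close> and for the currents \<open>j\<close>.\<close>

type_synonym var = "nat \<times> nat"
type_synonym mpol = "var multiset \<Rightarrow>\<^sub>0 complex"
type_synonym oper = "mpol \<Rightarrow> mpol"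

definition vars :: "nat \<Rightarrow> var set" where
  "vars N = {(K, n). K \<le> N \<and> n \<le> 2 * K}"

definition cmul :: "complex \<Rightarrow> mpol \<Rightarrow> mpol" where
  "cmul c p = Poly_Mapping.single {#} c * p"

definition peval :: "('v \<Rightarrow> complex) \<Rightarrow> ('v multiset \<Rightarrow>\<^sub>0 complex) \<Rightarrow> complex" where
  "peval y p = (\<Sum>M\<in>Poly_Mapping.keys p. Poly_Mapping.lookup p M * prod_mset (image_mset y M))"

text \<open>A word \<open>x\<^bsub>K\<^sub>1,n\<^sub>1\<^esub> \<dots> x\<^bsub>K\<^sub>r,n\<^sub>r\<^esub>\<close> stands for a basis vector of \<open>V\<^bsub>K\<^sub>1\<^esub> \<otimes> \<dots> \<otimes> V\<^bsub>K\<^sub>r\<^esub>\<close>,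
  whose number in the row-major order of \<open>kron\<close> is \<open>widx\<close>.\<close>

definition words :: "nat list \<Rightarrow> var list set" where
  "words Ks = {w. map fst w = Ks \<and> (\<forall>(K, n)\<in>set w. n \<le> 2 * K)}"

fun widx :: "var list \<Rightarrow> nat" where
  "widx [] = 0"
| "widx ((K, n) # w) = n * (\<Prod>(L, m)\<leftarrow>w. 2 * L + 1) + widx w"

definition tens_list :: "nat list \<Rightarrow> rep" where
  "tens_list Ks = foldr (\<lambda>K. tens (spin K)) Ks triv"

text \<open>\<open>u \<triangleright> p\<close>: a monomial of degree \<open>r\<close> is the image of a vector of an \<open>r\<close>-fold tensor product
  of spin representations, on which \<open>u\<close> acts by its iterated coproduct. As \<open>\<Delta>\<close> is
  cocommutative, the order chosen for the factors does not matter for \<open>u \<in> uhat is_rep\<close>.\<close>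

definition act :: "(rep \<Rightarrow> complex mat) \<Rightarrow> oper" where
  "act u p = (\<Sum>M\<in>Poly_Mapping.keys p. let w = (SOME w. mset w = M); Ks = map fst w in
     \<Sum>w'\<in>words Ks. Poly_Mapping.single (mset w')
       (Poly_Mapping.lookup p M * u (tens_list Ks) $$ (widx w', widx w)))"

definition mulv :: "var \<Rightarrow> oper" where
  "mulv v p = Poly_Mapping.single {#v#} 1 * p"

definition pdiff :: "var \<Rightarrow> oper" where
  "pdiff v p = (\<Sum>M\<in>Poly_Mapping.keys p.
     Poly_Mapping.single (M - {#v#}) (of_nat (count M v) * Poly_Mapping.lookup p M))"

text \<open>\<open>\<partial>\<^bsub>K,n\<^esub>\<close> acts by \<open>\<partial>\<^bsub>K,n\<^esub> j\<^bsub>K',m\<^esub> = \<delta>\<^bsub>KK'\<^esub> (g\<^sub>c)\<^sub>n\<^sub>m\<close>.\<close>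

definition derv :: "var \<Rightarrow> oper" where
  "derv v p = (case v of (K, n) \<Rightarrow> \<Sum>m\<le>2 * K. cmul (gc K n m) (pdiff (K, m) p))"


section \<open>Deformed tensors and twisted operators\<close>

text \<open>\<open>\<F>\<close> below is the twist of \<open>U\<^sub>q(su(2))\<close>; \<open>tilde_inv \<F>\<close> is the inverse of
  \<open>\<F>\<^sub>2\<^sub>1\<close>.\<close>

definition tilde_inv :: "(rep \<Rightarrow> rep \<Rightarrow> complex mat) \<Rightarrow> rep \<Rightarrow> rep \<Rightarrow> complex mat" where
  "tilde_inv \<F> = uinv2 (flip2 \<F>)"

text \<open>For \<open>G = G\<^sub>1 \<otimes> G\<^sub>2\<close>, the element \<open>\<pi>\<^sup>m\<^sub>n(G\<^sub>1) G\<^sub>2\<close>.\<close>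

definition slice :: "(rep \<Rightarrow> rep \<Rightarrow> complex mat) \<Rightarrow> nat \<Rightarrow> nat \<Rightarrow> nat \<Rightarrow> rep \<Rightarrow> complex mat" where
  "slice G K m n \<rho> = Matrix.mat (rdim \<rho>) (rdim \<rho>)
     (\<lambda>(i, j). G (spin K) \<rho> $$ (m * rdim \<rho> + i, n * rdim \<rho> + j))"

definition gt :: "(rep \<Rightarrow> rep \<Rightarrow> complex mat) \<Rightarrow> nat \<Rightarrow> nat \<Rightarrow> nat \<Rightarrow> complex" where
  "gt \<F> K n m = (\<Sum>r\<le>2 * K. \<Sum>s\<le>2 * K. gc K r s * slice (tilde_inv \<F>) K r n (spin K) $$ (s, m))"

definition gt_inv :: "(rep \<Rightarrow> rep \<Rightarrow> complex mat) \<Rightarrow> nat \<Rightarrow> nat \<Rightarrow> nat \<Rightarrow> complex" where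
  "gt_inv \<F> K n m = minv (Matrix.mat (2 * K + 1) (2 * K + 1) (\<lambda>(i, j). gt \<F> K i j)) $$ (n, m)"

text \<open>\<open>hat \<F> x (K, n)\<close> is the twisted operator of \<open>x\<^sup>K\<^sup>,\<^sup>n\<close>, for \<open>x = mulv\<close> (modes, currents) or
  \<open>x = derv\<close>. It combines \<open>x\<^sup>K\<^sup>,\<^sup>n = g\<^sup>n\<^sup>m x\<^bsub>K,m\<^esub>\<close> (with \<open>g\<^sup>n\<^sup>m\<close> the inverse of \<open>gt\<close>) and
  \<open>u \<triangleright> x\<^bsub>K,m\<^esub> = x\<^bsub>K,l\<^esub> \<pi>\<^sup>l\<^sub>m(u)\<close>.\<close>

definition hat :: "(rep \<Rightarrow> rep \<Rightarrow> complex mat) \<Rightarrow> (var \<Rightarrow> oper) \<Rightarrow> var \<Rightarrow> oper" where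
  "hat \<F> x v p = (case v of (K, n) \<Rightarrow> \<Sum>m\<le>2 * K. cmul (gt_inv \<F> K n m)
     (\<Sum>l\<le>2 * K. x (K, l) (act (slice (tilde_inv \<F>) K l m) p)))"

definition bhat :: "(rep \<Rightarrow> rep \<Rightarrow> complex mat) \<Rightarrow> (nat \<Rightarrow> complex) \<Rightarrow> var \<Rightarrow> oper" where
  "bhat \<F> D v p = cmul (1 / D (fst v)) (hat \<F> mulv v p) + hat \<F> derv v p"

text \<open>The operator \<open>\<Sum>\<^sub>K c\<^sub>K g\<^sup>K\<^sub>m\<^sub>n X\<^sup>K\<^sup>,\<^sup>n X\<^sup>K\<^sup>,\<^sup>m\<close> with the deformed tensor \<open>g = gt\<close>.\<close>

definition quad :: "(rep \<Rightarrow> rep \<Rightarrow> complex mat) \<Rightarrow> nat \<Rightarrow> (nat \<Rightarrow> complex) \<Rightarrow> (var \<Rightarrow> oper) \<Rightarrow> oper" where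
  "quad \<F> N c X p = (\<Sum>K\<le>N. \<Sum>m\<le>2 * K. \<Sum>n\<le>2 * K. cmul (c K * gt \<F> K m n) (X (K, n) (X (K, m) p)))"

text \<open>A noncommutative polynomial is a finite linear combination of words; the letter \<open>(K, n)\<close>
  stands for the upper-index variable \<open>x\<^sup>K\<^sup>,\<^sup>n\<close>.\<close>

type_synonym ncpol = "var list \<Rightarrow>\<^sub>0 complex"

definition ncpols :: "nat \<Rightarrow> ncpol set" where
  "ncpols N = {P. \<forall>w\<in>Poly_Mapping.keys P. set w \<subseteq> vars N}"

definition ncone :: ncpol where
  "ncone = Poly_Mapping.single [] 1"

definition subst :: "ncpol \<Rightarrow> (var \<Rightarrow> oper) \<Rightarrow> oper" where
  "subst P X p = (\<Sum>w\<in>Poly_Mapping.keys P. cmul (Poly_Mapping.lookup P w) (foldr X w p))"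

text \<open>The coefficients of \<open>P\<close> with respect to the words in the lower-index variables. They form
  vectors in tensor products of spin representations, on which \<open>\<tilde>U\<^sub>q(su(2))\<close> acts through the
  iterated flipped coproduct and \<open>\<phi>\<close>.\<close>

definition lowcoeff :: "(rep \<Rightarrow> rep \<Rightarrow> complex mat) \<Rightarrow> ncpol \<Rightarrow> var list \<Rightarrow> complex" where
  "lowcoeff \<F> P w = (\<Sum>w'\<in>words (map fst w).
     Poly_Mapping.lookup P w' * (\<Prod>((K, n), (L, m))\<leftarrow>zip w' w. gt_inv \<F> K n m))"

definition qtens_list :: "real \<Rightarrow> (rep \<Rightarrow> rep) \<Rightarrow> nat list \<Rightarrow> rep" where
  "qtens_list h \<phi> Ks = foldr (\<lambda>K. qtens_flip h (\<phi> (spin K))) Ks triv"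

definition q_invariant :: "real \<Rightarrow> (rep \<Rightarrow> rep) \<Rightarrow> (rep \<Rightarrow> rep \<Rightarrow> complex mat) \<Rightarrow> ncpol \<Rightarrow> bool" where
  "q_invariant h \<phi> \<F> P \<longleftrightarrow> (\<forall>u\<in>uhat (is_qrep h). \<forall>Ks. \<forall>w\<in>words Ks.
     (\<Sum>w'\<in>words Ks. u (qtens_list h \<phi> Ks) $$ (widx w, widx w') * lowcoeff \<F> P w')
       = u triv $$ (0, 0) * lowcoeff \<F> P w)"


section \<open>Correlation functions\<close>

text \<open>Linear coordinates on \<open>\<Prod>\<^sub>K \<real>\<^bsup>2K+1\<^esup>\<close> with \<open>a\<^bsub>K,n\<^esub>\<^sup>* = (g\<^sub>c)\<^sup>n\<^sup>m a\<^bsub>K,m\<^esub>\<close>.\<close>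

definition coord :: "(var \<Rightarrow> real) \<Rightarrow> var \<Rightarrow> complex" where
  "coord r v = (case v of (K, i) \<Rightarrow>
     if i < K then Complex (r (K, i)) (r (K, 2 * K - i)) / complex_of_real (sqrt 2)
     else if i = K then complex_of_real (r (K, K))
     else (- 1) ^ (i - K) * cnj (Complex (r (K, 2 * K - i)) (r (K, i)) / complex_of_real (sqrt 2)))"

definition gauss_int :: "nat \<Rightarrow> mpol \<Rightarrow> mpol \<Rightarrow> complex" where
  "gauss_int N W f = (LINT r|(\<Pi>\<^sub>M v\<in>vars N. lborel). exp (- peval (coord r) W) * peval (coord r) f)"

text \<open>The formal Gaussian mean \<open>\<integral> e\<^bsup>-W\<^esup> f / \<integral> e\<^bsup>-W\<^esup>\<close> for a quadratic function \<open>W = W\<^sub>D\<close>. Where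
  the integrals converge, that is, for \<open>Re D\<^sub>K > 0\<close>, it is the quotient of the integrals; it is a
  polynomial in the \<open>1/D\<^sub>K\<close>, and this polynomial gives its value for all \<open>D\<^sub>K \<noteq> 0\<close>.\<close>

definition gauss_mean :: "nat \<Rightarrow> ((nat \<Rightarrow> complex) \<Rightarrow> mpol) \<Rightarrow> (nat \<Rightarrow> complex) \<Rightarrow> mpol \<Rightarrow> complex" where
  "gauss_mean N W D f = (THE v. \<exists>Q. v = peval (\<lambda>K. 1 / D K) Q \<and>
     (\<forall>D'. (\<forall>K\<le>N. Re (D' K) > 0) \<longrightarrow>
        peval (\<lambda>K. 1 / D' K) Q * gauss_int N (W D') 1 = gauss_int N (W D') f))"

text \<open>The \<open>k\<close>-th term of the exponential series.\<close>

definition expterm :: "nat \<Rightarrow> oper \<Rightarrow> oper" where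
  "expterm k X p = cmul (1 / fact k) ((X ^^ k) p)"

text \<open>The factors \<open>\<nu>\<^sub>K\<close> normalise the deformed quadratic forms; see \<open>free_classical\<close> below.\<close>

definition S_free :: "(rep \<Rightarrow> rep \<Rightarrow> complex mat) \<Rightarrow> nat \<Rightarrow> (nat \<Rightarrow> complex) \<Rightarrow> (nat \<Rightarrow> complex) \<Rightarrow> oper" where
  "S_free \<F> N \<nu> D = quad \<F> N (\<lambda>K. 1/2 * (D K * \<nu> K)) (hat \<F> mulv)"

definition JDJ :: "(rep \<Rightarrow> rep \<Rightarrow> complex mat) \<Rightarrow> nat \<Rightarrow> (nat \<Rightarrow> complex) \<Rightarrow> (nat \<Rightarrow> complex) \<Rightarrow> oper" where
  "JDJ \<F> N \<nu> D = quad \<F> N (\<lambda>K. 1 / D K * \<nu> K) (hat \<F> mulv)"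

text \<open>Perturbative expansions: power series in a formal parameter \<open>\<lambda>\<close> that multiplies \<open>S\<^sub>i\<^sub>n\<^sub>t\<close>.
  Operators are evaluated by applying them to the constant function \<open>1\<close>; the weight is the
  quadratic function \<open>S\<^sub>f\<^sub>r\<^sub>e\<^sub>e 1\<close>.\<close>

definition weighted :: "(rep \<Rightarrow> rep \<Rightarrow> complex mat) \<Rightarrow> nat \<Rightarrow> (nat \<Rightarrow> complex) \<Rightarrow> (nat \<Rightarrow> complex)
    \<Rightarrow> ncpol \<Rightarrow> ncpol \<Rightarrow> complex fps" where
  "weighted \<F> N \<nu> D Sint P = Abs_fps (\<lambda>k. gauss_mean N (\<lambda>D'. S_free \<F> N \<nu> D' 1) D
     (expterm k (\<lambda>p. - subst Sint (hat \<F> mulv) p) (subst P (hat \<F> mulv) 1)))"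

definition corr :: "(rep \<Rightarrow> rep \<Rightarrow> complex mat) \<Rightarrow> nat \<Rightarrow> (nat \<Rightarrow> complex) \<Rightarrow> (nat \<Rightarrow> complex)
    \<Rightarrow> ncpol \<Rightarrow> ncpol \<Rightarrow> complex fps" where
  "corr \<F> N \<nu> D Sint P = weighted \<F> N \<nu> D Sint P / weighted \<F> N \<nu> D Sint ncone"

definition bracket :: "oper \<Rightarrow> complex" where
  "bracket X = Poly_Mapping.lookup (X 1) {#}"

text \<open>The brackets of \<open>P(\<partial>) e\<^bsup>-S(\<partial>)\<^esup> e\<^bsup>JDJ/2\<^esup>\<close>, of \<open>e\<^bsup>JDJ/2\<^esup> P(b) e\<^bsup>-S(b)\<^esup>\<close>, and of
  \<open>P(b) e\<^bsup>-S(b)\<^esup>\<close>. The exponential of \<open>JDJ/2\<close> is a power series in the currents; only finitely many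
  terms of the sum over \<open>n\<close> are nonzero at \<open>j = 0\<close>.\<close>

definition bracket1 :: "(rep \<Rightarrow> rep \<Rightarrow> complex mat) \<Rightarrow> nat \<Rightarrow> (nat \<Rightarrow> complex) \<Rightarrow> (nat \<Rightarrow> complex)
    \<Rightarrow> ncpol \<Rightarrow> ncpol \<Rightarrow> complex fps" where
  "bracket1 \<F> N \<nu> D Sint P = Abs_fps (\<lambda>k. suminf (\<lambda>n. bracket (\<lambda>p. subst P (hat \<F> derv)
     (expterm k (\<lambda>p. - subst Sint (hat \<F> derv) p) (expterm n (\<lambda>p. cmul (1/2) (JDJ \<F> N \<nu> D p)) p)))))"

definition bracket2 :: "(rep \<Rightarrow> rep \<Rightarrow> complex mat) \<Rightarrow> nat \<Rightarrow> (nat \<Rightarrow> complex) \<Rightarrow> (nat \<Rightarrow> complex)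
    \<Rightarrow> ncpol \<Rightarrow> ncpol \<Rightarrow> complex fps" where
  "bracket2 \<F> N \<nu> D Sint P = Abs_fps (\<lambda>k. suminf (\<lambda>n. bracket (\<lambda>p.
     expterm n (\<lambda>p. cmul (1/2) (JDJ \<F> N \<nu> D p))
       (subst P (bhat \<F> D) (expterm k (\<lambda>p. - subst Sint (bhat \<F> D) p) p)))))"

definition bracket3 :: "(rep \<Rightarrow> rep \<Rightarrow> complex mat) \<Rightarrow> (nat \<Rightarrow> complex)
    \<Rightarrow> ncpol \<Rightarrow> ncpol \<Rightarrow> complex fps" where
  "bracket3 \<F> D Sint P = Abs_fps (\<lambda>k. bracket (\<lambda>p.
     subst P (bhat \<F> D) (expterm k (\<lambda>p. - subst Sint (bhat \<F> D) p) p)))"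

text \<open>\<open>S\<^sub>f\<^sub>r\<^sub>e\<^sub>e\<close> is the classical invariant quadratic function \<open>\<Sum>\<^sub>K D\<^sub>K (g\<^sub>c)\<^sup>n\<^sup>m a\<^sub>n a\<^sub>m / 2\<close>, whatever the
  \<open>D\<^sub>K\<close>. This fixes the \<open>\<nu>\<^sub>K\<close>: with \<open>\<nu>\<^sub>K = 1\<close> the deformed form would be \<open>[2K+1]\<^sub>q/(2K+1)\<close>
  times the classical one, since contracting \<open>gt\<close> with its inverse in the order
  \<open>g\<^sub>n\<^sub>m g\<^sup>n\<^sup>m\<close> gives the quantum dimension.\<close>

definition free_classical :: "(rep \<Rightarrow> rep \<Rightarrow> complex mat) \<Rightarrow> nat \<Rightarrow> (nat \<Rightarrow> complex) \<Rightarrow> bool" where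
  "free_classical \<F> N \<nu> \<longleftrightarrow> (\<forall>D. S_free \<F> N \<nu> D 1
     = (\<Sum>K\<le>N. \<Sum>n\<le>2 * K. \<Sum>m\<le>2 * K. cmul (1/2 * D K * gc K n m) (mulv (K, n) (mulv (K, m) 1))))"

end

(* Polynomials of bounded degree form a finite-dimensional representation, so an operator that
   commutes with the derivations H, X, Y commutes with every element of U(su(2)). In particular
   elements of U(su(2)) pass through multiplication by an invariant, and the twists drop out next
   to invariants such as the quadratic form W or e^(W/2).

   The Wick map f(a) |-> f(d + j/D) 1 is equivariant, hence carries each twisted mode to the
   twisted shifted derivative. Integration by parts identifies its constant term with the Gaussian
   mean, and d e^(W/2) = e^(W/2) (d + j/D) identifies the three brackets.

   What remains is the order of P and e^(-S_int), which is opposite on the two sides. The twist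
   relation turns invariance of S_int under the flipped coproduct into: the operator S_int(a) commutes
   with su(2). By complete reducibility an invariant functional sees only the invariant part of
   P(a) 1, and there S_int(a) is multiplication by the invariant S_int(a) 1, which commutes
   with P(a). *)

theory Submission
  imports Defs "HOL-Probability.Distributions"
begin

section \<open>Linear operators and derivations on polynomials\<close>

text \<open>Elements of the completed algebras are given only as families of matrices that are
  natural in the representation, and \<open>act\<close> fixes an arbitrary word for each monomial.
  Nothing can therefore be computed inside an algebra: identities are moved to matrices of operators
  on polynomials of bounded degree, where naturality along suitable intertwiners (words to
  monomials, the flip, multiplication by a variable) replaces algebra. The twist relation speaks
  only of the images \<open>\<phi>(u)\<close> of deformed elements, so the operator of S_int is
  first seen to commute with the images of the deformed generators; that \<open>\<phi>\<close> is
  invertible on intertwiners leads back to H, X, Y. Since q^(cH) is the sum of a series, its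
  functorial properties rest on the diagonalizability of H. As e^(W/2) is not a polynomial, it is
  handled through its homogeneous parts and a bookkeeping parameter t. Finally
  \<open>gauss_mean\<close> is a definite description of a polynomial in the 1/D, so the Wick mean
  has to be shown polynomial in them and determined by its values at positive D.\<close>

abbreviation mon :: "'v multiset \<Rightarrow> 'v multiset \<Rightarrow>\<^sub>0 complex" where
  "mon M \<equiv> Poly_Mapping.single M 1"

lemma lookup_single_mult: "Poly_Mapping.lookup (Poly_Mapping.single L c * p) (L + M) = c * Poly_Mapping.lookup p M"
  for p :: "'v multiset \<Rightarrow>\<^sub>0 complex"
proof -
  have "Poly_Mapping.lookup (Poly_Mapping.single L c * p) (L + M)
      = (\<Sum>l. c * (\<Sum>q. Poly_Mapping.lookup p q when L + M = l + q) when l = L)"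
    unfolding lookup_mult by (intro Sum_any.cong) (auto simp: lookup_single when_def)
  also have "\<dots> = c * (\<Sum>q. Poly_Mapping.lookup p q when q = M)"
    unfolding Sum_any_when_equal by (intro arg_cong[of _ _ "(*) c"] Sum_any.cong) (auto simp: when_def)
  finally show ?thesis by simp
qed

lemma lookup_cmul [simp]: "Poly_Mapping.lookup (cmul c p) M = c * Poly_Mapping.lookup p M"
  using lookup_single_mult[of "{#}" c p M] by (simp add: cmul_def)

lemma cmul_add: "cmul c (p + q) = cmul c p + cmul c q"
  and cmul_add_left: "cmul (c + d) p = cmul c p + cmul d p"
  and cmul_cmul: "cmul c (cmul d p) = cmul (c * d) p"
  and cmul_1 [simp]: "cmul 1 p = p"
  and cmul_0 [simp]: "cmul 0 p = 0"
  and cmul_zero [simp]: "cmul c 0 = 0"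
  and cmul_diff: "cmul c (p - q) = cmul c p - cmul c q"
  and cmul_minus: "cmul c (- p) = - cmul c p"
  by (rule poly_mapping_eqI; simp add: lookup_add lookup_minus algebra_simps)+

lemma cmul_mult_left: "cmul c p * q = cmul c (p * q)"
  and cmul_mult_right: "p * cmul c q = cmul c (p * q)"
  by (simp_all add: cmul_def ac_simps)

lemma cmul_sum: "cmul c (sum f A) = (\<Sum>i\<in>A. cmul c (f i))"
  by (simp add: cmul_def sum_distrib_left)

lemma cmul_sum_left: "cmul (sum f A) p = (\<Sum>i\<in>A. cmul (f i) p)"
  by (induction A rule: infinite_finite_induct) (auto simp: cmul_add_left)

lemma cmul_single: "cmul c (Poly_Mapping.single M d) = Poly_Mapping.single M (c * d)"
  by (simp add: cmul_def mult_single)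

lemma single_eq_cmul: "Poly_Mapping.single M c = cmul c (mon M)"
  by (simp add: cmul_single)

lemma minus_eq_cmul: "- p = cmul (- 1) p"
  by (rule poly_mapping_eqI) simp

lemma poly_expand: "p = (\<Sum>M\<in>Poly_Mapping.keys p. cmul (Poly_Mapping.lookup p M) (mon M))"
proof (rule poly_mapping_eqI)
  fix L
  have "(\<Sum>M\<in>Poly_Mapping.keys p. Poly_Mapping.lookup p M * (1 when M = L)) = Poly_Mapping.lookup p L"
    by (simp add: when_def in_keys_iff if_distrib cong: if_cong)
  then show "Poly_Mapping.lookup p L = Poly_Mapping.lookup (\<Sum>M\<in>Poly_Mapping.keys p. cmul (Poly_Mapping.lookup p M) (mon M)) L"
    by (simp add: lookup_sum lookup_single)
qed

definition lin :: "oper \<Rightarrow> bool" where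
  "lin X \<longleftrightarrow> (\<forall>p q. X (p + q) = X p + X q) \<and> (\<forall>c p. X (cmul c p) = cmul c (X p))"

lemma linI: "(\<And>p q. X (p + q) = X p + X q) \<Longrightarrow> (\<And>c p. X (cmul c p) = cmul c (X p)) \<Longrightarrow> lin X"
  by (simp add: lin_def)

lemma lin_add: "lin X \<Longrightarrow> X (p + q) = X p + X q"
  and lin_cmul: "lin X \<Longrightarrow> X (cmul c p) = cmul c (X p)"
  by (simp_all add: lin_def)

lemma lin_0: "lin X \<Longrightarrow> X 0 = 0"
  using lin_cmul[of X 0 0] by simp

lemma lin_minus: "lin X \<Longrightarrow> X (- p) = - X p"
  using lin_cmul[of X "- 1" p] by (simp add: minus_eq_cmul)

lemma lin_diff: "lin X \<Longrightarrow> X (p - q) = X p - X q"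
  using lin_add[of X p "- q"] by (simp add: lin_minus)

lemma lin_sum: "lin X \<Longrightarrow> X (sum f A) = (\<Sum>i\<in>A. X (f i))"
  by (induction A rule: infinite_finite_induct) (auto simp: lin_0 lin_add)

lemma lin_expand:
  assumes "lin X"
  shows "X p = (\<Sum>M\<in>Poly_Mapping.keys p. cmul (Poly_Mapping.lookup p M) (X (mon M)))"
  by (subst poly_expand) (simp add: lin_sum lin_cmul assms)

lemma lin_compose: "lin X \<Longrightarrow> lin Y \<Longrightarrow> lin (\<lambda>p. X (Y p))"
  and lin_plus: "lin X \<Longrightarrow> lin Y \<Longrightarrow> lin (\<lambda>p. X p + Y p)"
  and lin_minus_fun: "lin X \<Longrightarrow> lin Y \<Longrightarrow> lin (\<lambda>p. X p - Y p)"
  and lin_scale: "lin X \<Longrightarrow> lin (\<lambda>p. cmul c (X p))"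
  and lin_ident: "lin (\<lambda>p. p)"
  and lin_mult_left: "lin (\<lambda>p. r * p)"
  by (auto simp: lin_def cmul_add cmul_diff cmul_minus cmul_cmul algebra_simps cmul_mult_right)

lemma lin_sum_fun: "(\<And>i. i \<in> A \<Longrightarrow> lin (X i)) \<Longrightarrow> lin (\<lambda>p. \<Sum>i\<in>A. X i p)"
  by (auto simp: lin_def cmul_sum sum.distrib)

lemma lin_funpow: "lin X \<Longrightarrow> lin (X ^^ k)"
  by (induction k) (auto simp: lin_def)

lemma lin_foldr: "(\<And>v. v \<in> set w \<Longrightarrow> lin (X v)) \<Longrightarrow> lin (foldr X w)"
  by (induction w) (auto simp: lin_def)

text \<open>\<open>act\<close> and \<open>pdiff\<close> sum over the monomials that occur in their
  argument, and this set changes under addition. Recognizing them as extensions of a map on the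
  monomial basis gives their linearity at once.\<close>

definition linext :: "(var multiset \<Rightarrow> mpol) \<Rightarrow> oper" where
  "linext g p = (\<Sum>M\<in>Poly_Mapping.keys p. cmul (Poly_Mapping.lookup p M) (g M))"

lemma linext_superset:
  assumes "finite A" "Poly_Mapping.keys p \<subseteq> A"
  shows "linext g p = (\<Sum>M\<in>A. cmul (Poly_Mapping.lookup p M) (g M))"
  unfolding linext_def by (rule sum.mono_neutral_left) (use assms in \<open>auto simp: in_keys_iff\<close>)

lemma lin_linext: "lin (linext g)"
proof (rule linI)
  fix p q :: mpol and c
  let ?A = "Poly_Mapping.keys p \<union> Poly_Mapping.keys q"
  have "Poly_Mapping.keys (p + q) \<subseteq> ?A" by (rule Poly_Mapping.keys_add)
  then show "linext g (p + q) = linext g p + linext g q"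
    by (simp add: linext_superset[of ?A] lookup_add cmul_add_left sum.distrib)
  have "Poly_Mapping.keys (cmul c p) \<subseteq> Poly_Mapping.keys p" by (auto simp: in_keys_iff)
  then show "linext g (cmul c p) = cmul c (linext g p)"
    by (simp add: linext_superset[of "Poly_Mapping.keys p"] cmul_cmul cmul_sum)
qed

lemma linext_mon [simp]: "linext g (mon M) = g M"
  by (simp add: linext_def)

lemma lin_eqI:
  assumes "lin X" "lin Y" "\<And>M. M \<in> Poly_Mapping.keys p \<Longrightarrow> X (mon M) = Y (mon M)"
  shows "X p = Y p"
  using assms by (simp add: lin_expand[of X p] lin_expand[of Y p])

lemma mon_mult: "mon M * mon L = mon (M + L)"
  by (simp add: mult_single)

lemma mon_empty: "mon {#} = 1"
  by (metis single_one zero_multiset_def)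

lemma mulv_mon: "mulv v (mon M) = mon (add_mset v M)"
  by (simp add: mulv_def mon_mult)

lemma lin_mulv: "lin (mulv v)"
  unfolding mulv_def by (rule lin_mult_left)

lemma act_eq_linext: "act u = linext (\<lambda>M. let w = (SOME w. mset w = M); Ks = map fst w in
     \<Sum>w'\<in>words Ks. Poly_Mapping.single (mset w') (u (tens_list Ks) $$ (widx w', widx w)))"
  by (rule ext) (simp add: act_def linext_def Let_def cmul_sum cmul_single)

lemma lin_act: "lin (act u)"
  unfolding act_eq_linext by (rule lin_linext)

lemma pdiff_eq_linext: "pdiff v = linext (\<lambda>M. Poly_Mapping.single (M - {#v#}) (of_nat (count M v)))"
  by (rule ext) (simp add: pdiff_def linext_def cmul_single mult.commute)

lemma lin_pdiff: "lin (pdiff v)"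
  unfolding pdiff_eq_linext by (rule lin_linext)

lemma lin_derv: "lin (derv v)"
  unfolding derv_def by (cases v) (auto intro!: lin_sum_fun lin_scale lin_pdiff)

text \<open>The derivation of the polynomial ring with values \<open>\<delta> v\<close> on the
  variables. Summing over \<open>M\<close> with multiplicity replaces exponents. Partial
  derivatives, \<open>derv\<close> and the action of su(2) are all of this form.\<close>

definition deriv_ext :: "(var \<Rightarrow> mpol) \<Rightarrow> oper" where
  "deriv_ext \<delta> = linext (\<lambda>M. \<Sum>v\<in>#M. \<delta> v * mon (M - {#v#}))"

lemma lin_deriv_ext: "lin (deriv_ext \<delta>)"
  unfolding deriv_ext_def by (rule lin_linext)

lemma deriv_ext_add: "deriv_ext \<delta> (p + q) = deriv_ext \<delta> p + deriv_ext \<delta> q"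
  and deriv_ext_cmul: "deriv_ext \<delta> (cmul c p) = cmul c (deriv_ext \<delta> p)"
  using lin_deriv_ext by (auto simp: lin_def)

lemma mulv_add: "mulv v (p + q) = mulv v p + mulv v q"
  and mulv_cmul: "mulv v (cmul c p) = cmul c (mulv v p)"
  using lin_mulv by (auto simp: lin_def)

lemma deriv_ext_1 [simp]: "deriv_ext \<delta> 1 = 0"
  using linext_mon[of _ "{#}"] by (simp add: mon_empty deriv_ext_def)

lemma deriv_ext_mulv: "deriv_ext \<delta> (mulv v p) = \<delta> v * p + mulv v (deriv_ext \<delta> p)"
proof -
  have "deriv_ext \<delta> (mulv v (mon M)) = \<delta> v * mon M + mulv v (deriv_ext \<delta> (mon M))" for M
  proof -
    have "(\<Sum>w\<in>#M. \<delta> w * mon (add_mset v M - {#w#})) = (\<Sum>w\<in>#M. mulv v (\<delta> w * mon (M - {#w#})))"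
    proof (intro arg_cong[of _ _ sum_mset] image_mset_cong)
      fix w assume "w \<in># M"
      then have "add_mset v M - {#w#} = {#v#} + (M - {#w#})"
        by (auto simp: multiset_eq_iff)
      then show "\<delta> w * mon (add_mset v M - {#w#}) = mulv v (\<delta> w * mon (M - {#w#}))"
        by (simp only: mulv_def mon_mult[symmetric] mult.left_commute)
    qed
    also have "\<dots> = mulv v (\<Sum>w\<in>#M. \<delta> w * mon (M - {#w#}))"
      by (simp add: mulv_def sum_mset_distrib_left image_mset.compositionality comp_def)
    finally show ?thesis by (simp add: mulv_mon deriv_ext_def)
  qed
  then show ?thesis
    by - (rule lin_eqI[of "\<lambda>p. deriv_ext \<delta> (mulv v p)" "\<lambda>p. \<delta> v * p + mulv v (deriv_ext \<delta> p)"],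
      auto simp: lin_def deriv_ext_add deriv_ext_cmul mulv_add mulv_cmul cmul_add cmul_mult_right distrib_left)
qed

lemma mulv_mult: "mulv v (p * q) = mulv v p * q" "mulv v (p * q) = p * mulv v q"
  by (simp_all add: mulv_def ac_simps)

lemma deriv_ext_mult: "deriv_ext \<delta> (p * q) = deriv_ext \<delta> p * q + p * deriv_ext \<delta> q"
proof -
  have "deriv_ext \<delta> (mon M * q) = deriv_ext \<delta> (mon M) * q + mon M * deriv_ext \<delta> q" for M
  proof (induction M)
    case empty then show ?case by (simp add: mon_empty)
  next
    case (add v M)
    then show ?case
      by (simp add: mulv_mon[symmetric] mulv_mult(1)[symmetric] deriv_ext_mulv)
        (simp add: mulv_def algebra_simps)
  qed
  then have mon: "deriv_ext \<delta> (q * mon M) = q * deriv_ext \<delta> (mon M) + deriv_ext \<delta> q * mon M" for M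
    by (simp add: ac_simps)
  have "deriv_ext \<delta> (q * p) = q * deriv_ext \<delta> p + deriv_ext \<delta> q * p"
    by (rule lin_eqI[of "\<lambda>p. deriv_ext \<delta> (q * p)" "\<lambda>p. q * deriv_ext \<delta> p + deriv_ext \<delta> q * p"])
      (auto simp: mon lin_def deriv_ext_add deriv_ext_cmul cmul_add cmul_mult_right distrib_left add_ac)
  then show ?thesis by (simp add: ac_simps)
qed

definition xvar :: "var \<Rightarrow> mpol" where
  "xvar v = mon {#v#}"

lemma mulv_eq: "mulv v p = xvar v * p"
  by (simp add: mulv_def xvar_def)

lemma xvar_eq_mulv: "xvar v = mulv v 1"
  by (simp add: mulv_eq)

lemma deriv_ext_xvar [simp]: "deriv_ext \<delta> (xvar v) = \<delta> v"
  by (simp add: xvar_eq_mulv deriv_ext_mulv) (simp add: mulv_def)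

text \<open>The type \<open>mpol\<close> has a variable for every pair of numbers. Only pairs in
  \<open>vars N\<close> label basis vectors of spin representations, so that matrix entries such as
  \<open>g (spin K) $$ (l, n)\<close> stay within bounds, and they are finite in number.\<close>

definition polys :: "nat \<Rightarrow> mpol set" where
  "polys N = {p. \<forall>M\<in>Poly_Mapping.keys p. set_mset M \<subseteq> vars N}"

lemma lin_eqI_polys:
  assumes "lin X" "lin Y" "p \<in> polys N" "\<And>M. set_mset M \<subseteq> vars N \<Longrightarrow> X (mon M) = Y (mon M)"
  shows "X p = Y p"
  by (rule lin_eqI[OF assms(1,2)]) (use assms(3,4) in \<open>auto simp: polys_def\<close>)

lemma lin_eqI_polys_mulv:
  assumes "lin X" "lin Y" "p \<in> polys N" "X 1 = Y 1"
    and step: "\<And>v M. v \<in> vars N \<Longrightarrow> set_mset M \<subseteq> vars N \<Longrightarrow> X (mon M) = Y (mon M)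
      \<Longrightarrow> X (mulv v (mon M)) = Y (mulv v (mon M))"
  shows "X p = Y p"
proof (rule lin_eqI_polys[OF assms(1-3)])
  fix M assume "set_mset M \<subseteq> vars N"
  then show "X (mon M) = Y (mon M)"
    by (induction M) (use assms in \<open>auto simp: mon_empty mulv_mon[symmetric]\<close>)
qed

lemma polys_add: "p \<in> polys N \<Longrightarrow> q \<in> polys N \<Longrightarrow> p + q \<in> polys N"
  using Poly_Mapping.keys_add[of p q] by (auto simp: polys_def)

lemma polys_cmul: "p \<in> polys N \<Longrightarrow> cmul c p \<in> polys N"
  by (auto simp: polys_def in_keys_iff)

lemma polys_0 [simp]: "0 \<in> polys N" by (simp add: polys_def)

lemma polys_minus: "p \<in> polys N \<Longrightarrow> - p \<in> polys N"
  by (simp add: minus_eq_cmul polys_cmul)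

lemma polys_diff: "p \<in> polys N \<Longrightarrow> q \<in> polys N \<Longrightarrow> p - q \<in> polys N"
  using polys_add[OF _ polys_minus] by fastforce

lemma polys_sum: "(\<And>i. i \<in> A \<Longrightarrow> f i \<in> polys N) \<Longrightarrow> sum f A \<in> polys N"
  by (induction A rule: infinite_finite_induct) (auto simp: polys_add)

lemma polys_mult: "p \<in> polys N \<Longrightarrow> q \<in> polys N \<Longrightarrow> p * q \<in> polys N"
  using keys_mult[of p q] by (fastforce simp: polys_def)

lemma polys_mon: "set_mset M \<subseteq> vars N \<Longrightarrow> mon M \<in> polys N"
  by (simp add: polys_def)

lemma polys_1 [simp]: "1 \<in> polys N"
  using polys_mon[of "{#}"] by (simp add: mon_empty)

lemma polys_xvar: "v \<in> vars N \<Longrightarrow> xvar v \<in> polys N"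
  by (simp add: xvar_def polys_mon)

lemma polys_mulv: "v \<in> vars N \<Longrightarrow> p \<in> polys N \<Longrightarrow> mulv v p \<in> polys N"
  by (simp add: mulv_eq polys_mult polys_xvar)

lemma polys_linext: "p \<in> polys N \<Longrightarrow> (\<And>M. set_mset M \<subseteq> vars N \<Longrightarrow> g M \<in> polys N) \<Longrightarrow> linext g p \<in> polys N"
  unfolding linext_def by (intro polys_sum polys_cmul) (auto simp: polys_def)

lemma polys_sum_mset: "(\<And>i. i \<in># A \<Longrightarrow> f i \<in> polys N) \<Longrightarrow> (\<Sum>i\<in>#A. f i) \<in> polys N"
  by (induction A) (auto simp: polys_add)

lemma polys_deriv_ext:
  "p \<in> polys N \<Longrightarrow> (\<And>v. v \<in> vars N \<Longrightarrow> \<delta> v \<in> polys N) \<Longrightarrow> deriv_ext \<delta> p \<in> polys N"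
  unfolding deriv_ext_def
  by (intro polys_linext polys_sum_mset polys_mult polys_mon) (auto dest: in_diffD)

lemma polys_pdiff: "p \<in> polys N \<Longrightarrow> pdiff v p \<in> polys N"
  unfolding pdiff_eq_linext by (subst single_eq_cmul)
   (auto intro!: polys_linext polys_cmul polys_mon dest: in_diffD)

text \<open>The Leibniz rule is asked only for products with one variable. A commutator of two
  derivations satisfies it although it is not given in the form \<open>deriv_ext\<close>, so
  relations between derivations reduce to their values on variables.\<close>

lemma derivation_eqI:
  assumes "lin X" "lin Y" "p \<in> polys N" "X 1 = Y 1"
    and "\<And>v q. v \<in> vars N \<Longrightarrow> X (mulv v q) = X (xvar v) * q + mulv v (X q)"
    and "\<And>v q. v \<in> vars N \<Longrightarrow> Y (mulv v q) = Y (xvar v) * q + mulv v (Y q)"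
    and "\<And>v. v \<in> vars N \<Longrightarrow> X (xvar v) = Y (xvar v)"
  shows "X p = Y p"
  by (rule lin_eqI_polys_mulv[OF assms(1-4)]) (simp add: assms)

lemma pdiff_eq_deriv_ext: "pdiff v = deriv_ext (\<lambda>w. if w = v then 1 else 0)"
proof -
  have "(\<Sum>w\<in>#M. (if w = v then 1 else 0) * mon (L w)) = Poly_Mapping.single (L v) (of_nat (count M v))" for M and L :: "var \<Rightarrow> var multiset"
    by (induction M) (auto simp: single_add single_zero)
  then show ?thesis unfolding pdiff_eq_linext deriv_ext_def by simp
qed

lemma derv_eq_deriv_ext:
  "derv (K, n) = deriv_ext (\<lambda>(L, m). if L = K \<and> m \<le> 2 * K then cmul (gc K n m) 1 else 0)"
proof
  fix p :: mpol
  have lin1: "lin (derv (K, n))" by (rule lin_derv)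
  have leib: "derv (K, n) (mulv v q) = derv (K, n) (xvar v) * q + mulv v (derv (K, n) q)" for v q
    by (simp add: derv_def pdiff_eq_deriv_ext deriv_ext_mulv cmul_add sum.distrib sum_distrib_right cmul_mult_left)
      (simp add: mulv_eq sum_distrib_left cmul_mult_right)
  have "derv (K, n) (mon M) = deriv_ext (\<lambda>(L, m). if L = K \<and> m \<le> 2 * K then cmul (gc K n m) 1 else 0) (mon M)" for M
  proof (induction M)
    case empty then show ?case by (simp add: mon_empty derv_def pdiff_eq_deriv_ext)
  next
    case (add v M)
    have "derv (K, n) (xvar v) = (case v of (L, m) \<Rightarrow> if L = K \<and> m \<le> 2 * K then cmul (gc K n m) 1 else 0)"
    proof (cases v)
      case (Pair L m)
      have "(\<Sum>i\<le>2 * K. cmul (gc K n i) (if (L, m) = (K, i) then 1 else 0)) = 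
        (\<Sum>i\<le>2 * K. if i = m then (if L = K then cmul (gc K n m) 1 else 0) else 0)"
        by (intro sum.cong) auto
      then show ?thesis using Pair by (simp add: derv_def pdiff_eq_deriv_ext)
    qed
    with add show ?case by (simp add: mulv_mon[symmetric] leib deriv_ext_mulv)
  qed
  then show "derv (K, n) p = deriv_ext (\<lambda>(L, m). if L = K \<and> m \<le> 2 * K then cmul (gc K n m) 1 else 0) p"
    by (rule lin_eqI[OF lin1 lin_deriv_ext])
qed

lemma polys_derv: "p \<in> polys N \<Longrightarrow> derv v p \<in> polys N"
  unfolding derv_def by (cases v) (auto intro!: polys_sum polys_cmul polys_pdiff)

section \<open>Kronecker products and representations\<close>

lemma mat_mult_index:
  assumes "A \<in> carrier_mat n m" "B \<in> carrier_mat m p" "i < n" "j < p"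
  shows "(A * B) $$ (i, j) = (\<Sum>k<m. A $$ (i, k) * B $$ (k, j))"
  using assms by (auto simp: scalar_prod_def atLeast0LessThan intro!: sum.cong)

lemma sum_pair_index: "(\<Sum>k<m * n. f k) = (\<Sum>a<m. \<Sum>b<n. f (a * n + b))" for f :: "nat \<Rightarrow> 'a::comm_monoid_add"
proof -
  have "sum f {a * n..<a * n + n} = (\<Sum>b<n. f (a * n + b))" for a
    using sum.shift_bounds_nat_ivl[of f 0 "a * n" n] by (simp add: atLeast0LessThan add.commute)
  then show ?thesis using sum.nat_group[of f n m] by simp
qed

lemma pair_index_less: "a < m \<Longrightarrow> b < n \<Longrightarrow> a * n + b < m * (n::nat)"
proof -
  assume "a < m" "b < n"
  then have "a * n + b < Suc a * n" "Suc a * n \<le> m * n" by (simp, intro mult_le_mono1) simp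
  then show ?thesis by linarith
qed

lemma pair_index_cases:
  assumes "i < m * (n::nat)"
  obtains a b where "a < m" "b < n" "i = a * n + b"
proof
  have "n > 0" using assms by (cases n) auto
  then show "i mod n < n" "i div n < m" "i = i div n * n + i mod n"
    using assms by (auto simp: less_mult_imp_div_less)
qed

lemma kron_carrier [simp]:
  "A \<in> carrier_mat m n \<Longrightarrow> B \<in> carrier_mat p q \<Longrightarrow> kron A B \<in> carrier_mat (m * p) (n * q)"
  by (auto simp: kron_def)

lemma dim_kron [simp]: "dim_row (kron A B) = dim_row A * dim_row B" "dim_col (kron A B) = dim_col A * dim_col B"
  by (auto simp: kron_def)

lemma kron_index:
  assumes "A \<in> carrier_mat m n" "B \<in> carrier_mat p q" "a < m" "b < p" "c < n" "d < q"
  shows "kron A B $$ (a * p + b, c * q + d) = A $$ (a, c) * B $$ (b, d)"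
  using assms pair_index_less[of a m b p] pair_index_less[of c n d q] by (auto simp: kron_def)

lemma pair_eq_matI:
  assumes "A \<in> carrier_mat (m * p) (n * q)" "B \<in> carrier_mat (m * p) (n * q)"
    "\<And>a b c d. a < m \<Longrightarrow> b < p \<Longrightarrow> c < n \<Longrightarrow> d < q \<Longrightarrow> A $$ (a * p + b, c * q + d) = B $$ (a * p + b, c * q + d)"
  shows "A = B"
proof (rule eq_matI)
  fix i j assume "i < dim_row B" "j < dim_col B"
  then have "i < m * p" "j < n * q" using assms by auto
  then show "A $$ (i, j) = B $$ (i, j)" using assms(3) by (metis pair_index_cases)
qed (use assms in auto)

lemma kron_mult:
  assumes "A \<in> carrier_mat m n" "B \<in> carrier_mat p q" "C \<in> carrier_mat n r" "D \<in> carrier_mat q s"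
  shows "kron A B * kron C D = kron (A * C) (B * D)"
proof (rule pair_eq_matI[of _ m p r s])
  fix a b c d assume ab: "a < m" "b < p" "c < r" "d < s"
  have "(kron A B * kron C D) $$ (a * p + b, c * s + d)
      = (\<Sum>k<n * q. kron A B $$ (a * p + b, k) * kron C D $$ (k, c * s + d))"
    using ab assms by (intro mat_mult_index[of _ "m * p" "n * q" _ "r * s"] pair_index_less kron_carrier)
  also have "\<dots> = (\<Sum>k<n. \<Sum>l<q. (A $$ (a, k) * C $$ (k, c)) * (B $$ (b, l) * D $$ (l, d)))"
    unfolding sum_pair_index using ab assms
    by (intro sum.cong) (auto simp: kron_index[of A m n B p q] kron_index[of C n r D q s])
  also have "\<dots> = (\<Sum>k<n. A $$ (a, k) * C $$ (k, c)) * (\<Sum>l<q. B $$ (b, l) * D $$ (l, d))"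
    by (simp add: sum_product)
  also have "\<dots> = (A * C) $$ (a, c) * (B * D) $$ (b, d)"
    using ab assms by (simp only: mat_mult_index[of A m n C r] mat_mult_index[of B p q D s])
  also have "\<dots> = kron (A * C) (B * D) $$ (a * p + b, c * s + d)"
    using ab assms by (intro kron_index[symmetric, of _ m r]) auto
  finally show "(kron A B * kron C D) $$ (a * p + b, c * s + d) = kron (A * C) (B * D) $$ (a * p + b, c * s + d)" .
qed (use assms in auto)

lemma kron_one: "kron (1\<^sub>m m) (1\<^sub>m n) = 1\<^sub>m (m * n)"
proof (rule pair_eq_matI[of _ m n m n])
  fix a b c d assume *: "a < m" "b < n" "c < m" "d < n"
  then have "a * n + b = c * n + d \<longleftrightarrow> a = c \<and> b = d"
    by (metis div_mult_self3 div_less add_0 add.commute mod_mult_self3 mod_less not_less_zero)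
  with * pair_index_less[of a m b n] pair_index_less[of c m d n]
  show "kron (1\<^sub>m m) (1\<^sub>m n) $$ (a * n + b, c * n + d) = (1\<^sub>m (m * n) :: complex mat) $$ (a * n + b, c * n + d)"
    by (subst kron_index[of _ m m _ n n]) auto
qed auto

lemma kron_minus_left:
  assumes "A \<in> carrier_mat m n" "B \<in> carrier_mat m n" "C \<in> carrier_mat p q"
  shows "kron (A - B) C = kron A C - kron B C"
  using assms by (intro pair_eq_matI[of _ m p n q])
    (auto simp: kron_index[of _ m n C p q] pair_index_less distrib_right left_diff_distrib minus_carrier_mat)

lemma kron_minus_right:
  assumes "A \<in> carrier_mat m n" "B \<in> carrier_mat m n" "C \<in> carrier_mat p q"
  shows "kron C (A - B) = kron C A - kron C B"
  using assms by (intro pair_eq_matI[of _ p m q n])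
    (auto simp: kron_index[of C p q _ m n] pair_index_less right_diff_distrib minus_carrier_mat)

lemma kron_smult_left:
  assumes "A \<in> carrier_mat m n" "C \<in> carrier_mat p q"
  shows "kron (c \<cdot>\<^sub>m A) C = c \<cdot>\<^sub>m kron A C"
  using assms by (intro pair_eq_matI[of _ m p n q])
    (auto simp: kron_index[of _ m n C p q] pair_index_less)

lemma kron_smult_right:
  assumes "A \<in> carrier_mat m n" "C \<in> carrier_mat p q"
  shows "kron C (c \<cdot>\<^sub>m A) = c \<cdot>\<^sub>m kron C A"
  using assms by (intro pair_eq_matI[of _ p m q n])
    (auto simp: kron_index[of C p q _ m n] pair_index_less)

section \<open>Primitive elements and tensor products of representations\<close>

definition prim :: "complex mat \<Rightarrow> complex mat \<Rightarrow> complex mat" where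
  "prim A B = kron A (1\<^sub>m (dim_row B)) + kron (1\<^sub>m (dim_row A)) B"

lemma prim_carrier [simp]: "A \<in> carrier_mat m m \<Longrightarrow> B \<in> carrier_mat n n \<Longrightarrow> prim A B \<in> carrier_mat (m * n) (m * n)"
  by (auto simp: prim_def)

lemma prim_index:
  assumes "A \<in> carrier_mat m m" "B \<in> carrier_mat p p" "a < m" "b < p" "c < m" "d < p"
  shows "prim A B $$ (a * p + b, c * p + d)
    = A $$ (a, c) * (if b = d then 1 else 0) + (if a = c then 1 else 0) * B $$ (b, d)"
  using assms kron_index[of A m m "1\<^sub>m p" p p] kron_index[of "1\<^sub>m m" m m B p p]
    pair_index_less[of a m b p] pair_index_less[of c m d p] by (auto simp: prim_def)

lemma prim_mult:
  assumes "A \<in> carrier_mat m m" "B \<in> carrier_mat n n" "A' \<in> carrier_mat m m" "B' \<in> carrier_mat n n"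
  shows "prim A B * prim A' B' = kron (A * A') (1\<^sub>m n) + kron A B' + (kron A' B + kron (1\<^sub>m m) (B * B'))"
proof -
  have c: "kron A (1\<^sub>m n) \<in> carrier_mat (m * n) (m * n)" "kron (1\<^sub>m m) B \<in> carrier_mat (m * n) (m * n)"
    "kron A' (1\<^sub>m n) \<in> carrier_mat (m * n) (m * n)" "kron (1\<^sub>m m) B' \<in> carrier_mat (m * n) (m * n)"
    using assms by auto
  have d: "dim_row A = m" "dim_row A' = m" "dim_row B = n" "dim_row B' = n" using assms by auto
  show ?thesis unfolding prim_def d
    using assms c
    by (simp add: add_mult_distrib_mat[OF c(1) c(2) add_carrier_mat[OF c(4)]]
        mult_add_distrib_mat[OF c(1) c(3) c(4)] mult_add_distrib_mat[OF c(2) c(3) c(4)]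
        kron_mult[of _ m m _ n n _ m _ n])
qed

lemma prim_commutator:
  assumes "A \<in> carrier_mat m m" "B \<in> carrier_mat n n" "A' \<in> carrier_mat m m" "B' \<in> carrier_mat n n"
  shows "prim A B * prim A' B' - prim A' B' * prim A B = prim (A * A' - A' * A) (B * B' - B' * B)"
proof -
  have d: "dim_row (A * A' - A' * A) = m" "dim_row (B * B' - B' * B) = n" using assms by auto
  have "prim (A * A' - A' * A) (B * B' - B' * B) =
     (kron (A * A') (1\<^sub>m n) - kron (A' * A) (1\<^sub>m n)) + (kron (1\<^sub>m m) (B * B') - kron (1\<^sub>m m) (B' * B))"
    unfolding prim_def d using assms
    by (simp add: kron_minus_left[of _ m m _ _ n n] kron_minus_right[of _ n n _ _ m m])
  then show ?thesis using assms
    by (simp only: prim_mult[of _ m _ n]) (rule eq_matI; auto simp: index_add_mat)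
qed

lemma prim_smult:
  assumes "A \<in> carrier_mat m m" "B \<in> carrier_mat n n"
  shows "prim (c \<cdot>\<^sub>m A) (c \<cdot>\<^sub>m B) = c \<cdot>\<^sub>m prim A B"
proof -
  have d: "dim_row A = m" "dim_row B = n" using assms by auto
  show ?thesis unfolding prim_def index_smult_mat d using assms
    by (simp add: kron_smult_left[of _ m m _ n n] kron_smult_right[of _ n n _ m m])
      (rule eq_matI; auto simp: algebra_simps)
qed

text \<open>As functions on representations the generators are at the same time elements in the
  sense of \<open>uhat\<close>, and one proof can treat all three.\<close>

definition gens :: "(rep \<Rightarrow> complex mat) set" where
  "gens = {opH, opX, opY}"

lemma gens_cases: "g \<in> gens \<Longrightarrow> P opH \<Longrightarrow> P opX \<Longrightarrow> P opY \<Longrightarrow> P g"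
  by (auto simp: gens_def)

lemma rep_carrierD: "rep_carrier \<rho> \<Longrightarrow> g \<in> gens \<Longrightarrow> g \<rho> \<in> carrier_mat (rdim \<rho>) (rdim \<rho>)"
  by (auto simp: rep_carrier_def gens_def)

lemma intertwiner_iff:
  "intertwiner \<rho> \<sigma> T \<longleftrightarrow> T \<in> carrier_mat (rdim \<sigma>) (rdim \<rho>) \<and> (\<forall>g\<in>gens. T * g \<rho> = g \<sigma> * T)"
  by (auto simp: intertwiner_def gens_def)

lemma is_rep_carrier: "is_rep \<rho> \<Longrightarrow> rep_carrier \<rho>"
  by (simp add: is_rep_def)

lemma is_qrep_carrier: "is_qrep h \<rho> \<Longrightarrow> rep_carrier \<rho>"
  by (simp add: is_qrep_def)

lemma rdim_tens: "rep_carrier \<rho> \<Longrightarrow> rep_carrier \<sigma> \<Longrightarrow> rdim (tens \<rho> \<sigma>) = rdim \<rho> * rdim \<sigma>"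
  by (auto simp: rdim_def tens_def Let_def)

lemma gens_tens:
  assumes "rep_carrier \<rho>" "rep_carrier \<sigma>" "g \<in> gens"
  shows "g (tens \<rho> \<sigma>) = prim (g \<rho>) (g \<sigma>)"
  using assms(3)
  by (rule gens_cases) (use assms(1,2) in \<open>auto simp: tens_def prim_def rep_carrier_def Let_def\<close>)

lemma rep_carrier_tens:
  assumes "rep_carrier \<rho>" "rep_carrier \<sigma>"
  shows "rep_carrier (tens \<rho> \<sigma>)"
  using assms rep_carrierD[OF assms(1)] rep_carrierD[OF assms(2)]
  by (auto simp: rep_carrier_def rdim_tens[unfolded rep_carrier_def] gens_tens[unfolded rep_carrier_def] gens_def)

lemma is_rep_tens:
  assumes "is_rep \<rho>" "is_rep \<sigma>"
  shows "is_rep (tens \<rho> \<sigma>)"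
proof -
  have c: "rep_carrier \<rho>" "rep_carrier \<sigma>" using assms by (auto simp: is_rep_def)
  have g: "opH \<in> gens" "opX \<in> gens" "opY \<in> gens" by (auto simp: gens_def)
  note cm = rep_carrierD[OF c(1) g(1)] rep_carrierD[OF c(1) g(2)] rep_carrierD[OF c(1) g(3)]
    rep_carrierD[OF c(2) g(1)] rep_carrierD[OF c(2) g(2)] rep_carrierD[OF c(2) g(3)]
  show ?thesis
    using assms rep_carrier_tens[OF c] cm unfolding is_rep_def
    by (simp add: gens_tens[OF c] g prim_commutator[of _ "rdim \<rho>" _ "rdim \<sigma>"]
       prim_smult[of _ "rdim \<rho>" _ "rdim \<sigma>"])
qed

lemma is_rep_triv: "is_rep triv"
  by (auto simp: is_rep_def triv_def rep_carrier_def rdim_def)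

lemma rdim_spin [simp]: "rdim (spin K) = 2 * K + 1"
  by (simp add: rdim_def spin_def Let_def)

lemma spin_index:
  assumes "i \<le> 2 * K" "j \<le> 2 * K"
  shows "opH (spin K) $$ (i, j) = (if i = j then 2 * (of_nat K - of_nat i) else 0)"
    "opX (spin K) $$ (i, j) = (if j = i + 1 then complex_of_real (sqrt (real j * real (2 * K + 1 - j))) else 0)"
    "opY (spin K) $$ (i, j) = (if i = j + 1 then complex_of_real (sqrt (real i * real (2 * K + 1 - i))) else 0)"
  using assms by (auto simp: spin_def Let_def)

lemma spin_carrier: "g \<in> gens \<Longrightarrow> g (spin K) \<in> carrier_mat (2 * K + 1) (2 * K + 1)"
  by (auto simp: gens_def spin_def Let_def)

lemma rep_carrier_spin: "rep_carrier (spin K)"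
  using spin_carrier[of _ K] by (auto simp: rep_carrier_def gens_def simp del: mult_Suc_right)

lemma complex_sqrt_square:
  "complex_of_real (sqrt (real a * real b)) * complex_of_real (sqrt (real a * real b)) = of_nat (a * b)"
proof -
  have "sqrt (real a * real b) * sqrt (real a * real b) = real (a * b)" by simp
  then show ?thesis by (metis of_real_mult of_real_of_nat_eq)
qed

lemma is_rep_spin: "is_rep (spin K)"
proof -
  let ?d = "2 * K + 1"
  have g: "opH \<in> gens" "opX \<in> gens" "opY \<in> gens" by (auto simp: gens_def)
  note cm = spin_carrier[OF g(1), of K] spin_carrier[OF g(2), of K] spin_carrier[OF g(3), of K]
  have mi: "(A * B) $$ (i, j) = (\<Sum>k<?d. A $$ (i, k) * B $$ (k, j))"
    if "A \<in> carrier_mat ?d ?d" "B \<in> carrier_mat ?d ?d" "i < ?d" "j < ?d" for A B :: "complex mat" and i j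
    using that by (intro mat_mult_index)
  have HA: "(opH (spin K) * A) $$ (i, j) = 2 * (of_nat K - of_nat i) * A $$ (i, j)"
    and AH: "(A * opH (spin K)) $$ (i, j) = A $$ (i, j) * (2 * (of_nat K - of_nat j))"
    if "A \<in> carrier_mat ?d ?d" "i < ?d" "j < ?d" for A i j
  proof -
    have "(\<Sum>k<?d. opH (spin K) $$ (i, k) * A $$ (k, j)) = (\<Sum>k<?d. if k = i then 2 * (of_nat K - of_nat i) * A $$ (i, j) else 0)"
      using that by (intro sum.cong) (auto simp: spin_index)
    then show "(opH (spin K) * A) $$ (i, j) = 2 * (of_nat K - of_nat i) * A $$ (i, j)"
      using that cm by (subst mi) auto
    have "(\<Sum>k<?d. A $$ (i, k) * opH (spin K) $$ (k, j)) = (\<Sum>k<?d. if k = j then A $$ (i, j) * (2 * (of_nat K - of_nat j)) else 0)"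
      using that by (intro sum.cong) (auto simp: spin_index)
    then show "(A * opH (spin K)) $$ (i, j) = A $$ (i, j) * (2 * (of_nat K - of_nat j))"
      using that cm by (subst mi) auto
  qed
  have 1: "opH (spin K) * opX (spin K) - opX (spin K) * opH (spin K) = 2 \<cdot>\<^sub>m opX (spin K)"
  proof (rule eq_matI)
    fix i j assume "i < dim_row (2 \<cdot>\<^sub>m opX (spin K))" "j < dim_col (2 \<cdot>\<^sub>m opX (spin K))"
    then have ij: "i < ?d" "j < ?d" using cm by auto
    then show "(opH (spin K) * opX (spin K) - opX (spin K) * opH (spin K)) $$ (i, j) = (2 \<cdot>\<^sub>m opX (spin K)) $$ (i, j)"
      using ij cm by (subst index_minus_mat(1)) (auto simp: HA[OF cm(2) ij] AH[OF cm(2) ij] spin_index algebra_simps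
         simp del: index_mult_mat(1))
  qed (use cm in auto)
  have 2: "opH (spin K) * opY (spin K) - opY (spin K) * opH (spin K) = (- 2) \<cdot>\<^sub>m opY (spin K)"
  proof (rule eq_matI)
    fix i j assume "i < dim_row ((- 2) \<cdot>\<^sub>m opY (spin K))" "j < dim_col ((- 2) \<cdot>\<^sub>m opY (spin K))"
    then have ij: "i < ?d" "j < ?d" using cm by auto
    then show "(opH (spin K) * opY (spin K) - opY (spin K) * opH (spin K)) $$ (i, j) = ((- 2) \<cdot>\<^sub>m opY (spin K)) $$ (i, j)"
      using ij cm by (subst index_minus_mat(1)) (auto simp: HA[OF cm(3) ij] AH[OF cm(3) ij] spin_index algebra_simps
         simp del: index_mult_mat(1))
  qed (use cm in auto)
  have 3: "opX (spin K) * opY (spin K) - opY (spin K) * opX (spin K) = opH (spin K)"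
  proof (rule eq_matI)
    fix i j assume "i < dim_row (opH (spin K))" "j < dim_col (opH (spin K))"
    then have ij: "i < ?d" "j < ?d" using cm by auto
    \<comment> \<open>At \<open>i = 2 * K\<close> the index \<open>i + 1\<close> leaves the range of
      summation, in agreement with the value \<open>(i + 1) * (2 * K - i) = 0\<close>.\<close>
    have "opX (spin K) $$ (i, k) * opY (spin K) $$ (k, j) = (if k = i + 1 then
        (if i = j then of_nat ((i + 1) * (2 * K - i)) else 0) else 0)" if "k < ?d" for k
    proof (cases "k = i + 1 \<and> i = j")
      case True
      have "opX (spin K) $$ (i, k) = complex_of_real (sqrt (real (i + 1) * real (2 * K - i)))"
        "opY (spin K) $$ (k, j) = complex_of_real (sqrt (real (i + 1) * real (2 * K - i)))"
        using True ij that by (simp_all add: spin_index)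
      then show ?thesis using True by (simp only: complex_sqrt_square if_True refl)
    next
      case False
      then show ?thesis using ij that by (auto simp: spin_index)
    qed
    then have "(\<Sum>k<?d. opX (spin K) $$ (i, k) * opY (spin K) $$ (k, j)) = (\<Sum>k<?d. if k = i + 1 then
        (if i = j then of_nat ((i + 1) * (2 * K - i)) else 0) else 0)"
      by (intro sum.cong refl) simp
    then have "(opX (spin K) * opY (spin K)) $$ (i, j) = (\<Sum>k<?d. if k = i + 1 then
        (if i = j then of_nat ((i + 1) * (2 * K - i)) else 0) else 0)"
      using ij cm by (subst mi)
    then have a: "(opX (spin K) * opY (spin K)) $$ (i, j) = (if i = j then of_nat ((i + 1) * (2 * K - i)) else 0)"
      using ij by (cases "i < 2 * K") (auto simp del: of_nat_mult of_nat_Suc of_nat_add sum.lessThan_Suc)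
    \<comment> \<open>For \<open>i = 0\<close> the truncated difference \<open>i - 1\<close> is
      \<open>0\<close>, an index that does not contribute; the factor \<open>i\<close> makes the
      recorded value vanish as well.\<close>
    have "opY (spin K) $$ (i, k) * opX (spin K) $$ (k, j) = (if k = i - 1 then
        (if i = j then of_nat (i * (2 * K + 1 - i)) else 0) else 0)" if "k < ?d" for k
    proof (cases "i = k + 1 \<and> i = j")
      case True
      then have e: "i = k + 1" "j = k + 1" by auto
      have f: "opY (spin K) $$ (i, k) = complex_of_real (sqrt (real i * real (2 * K + 1 - i)))"
        "opX (spin K) $$ (k, j) = complex_of_real (sqrt (real i * real (2 * K + 1 - i)))"
        using ij that unfolding e by (simp_all add: spin_index)
      show ?thesis unfolding f complex_sqrt_square using e by simp
    next
      case False
      then show ?thesis using ij that by (auto simp: spin_index)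
    qed
    then have "(\<Sum>k<?d. opY (spin K) $$ (i, k) * opX (spin K) $$ (k, j)) = (\<Sum>k<?d. if k = i - 1 then
        (if i = j then of_nat (i * (2 * K + 1 - i)) else 0) else 0)"
      by (intro sum.cong refl) simp
    then have "(opY (spin K) * opX (spin K)) $$ (i, j) = (\<Sum>k<?d. if k = i - 1 then
        (if i = j then of_nat (i * (2 * K + 1 - i)) else 0) else 0)"
      using ij cm by (subst mi)
    then have b: "(opY (spin K) * opX (spin K)) $$ (i, j) = (if i = j then of_nat (i * (2 * K + 1 - i)) else 0)"
      using ij by auto
    have "(of_nat ((i + 1) * (2 * K - i)) :: complex) = (of_nat i + 1) * (2 * of_nat K - of_nat i)"
      "(of_nat (i * (2 * K + 1 - i)) :: complex) = of_nat i * (2 * of_nat K + 1 - of_nat i)"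
    proof -
      have "i \<le> 2 * K" "i \<le> 2 * K + 1" using ij by auto
      then show "(of_nat ((i + 1) * (2 * K - i)) :: complex) = (of_nat i + 1) * (2 * of_nat K - of_nat i)"
        "(of_nat (i * (2 * K + 1 - i)) :: complex) = of_nat i * (2 * of_nat K + 1 - of_nat i)"
        by (simp_all only: of_nat_mult of_nat_add of_nat_1 of_nat_diff of_nat_numeral)
    qed
    note ab = this
    have "(x + 1) * (2 * y - x) - x * (2 * y + 1 - x) = 2 * (y - x)" for x y :: complex
      by (simp add: algebra_simps)
    then have "(opX (spin K) * opY (spin K)) $$ (i, j) - (opY (spin K) * opX (spin K)) $$ (i, j)
       = (if i = j then 2 * (of_nat K - of_nat i) else 0)"
      unfolding a b ab by (cases "i = j") (simp_all only: if_True if_False refl diff_self)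
    then show "(opX (spin K) * opY (spin K) - opY (spin K) * opX (spin K)) $$ (i, j) = opH (spin K) $$ (i, j)"
      using ij cm by (subst index_minus_mat(1)) (auto simp: spin_index simp del: index_mult_mat(1))
  qed (use cm in auto)
  show ?thesis using rep_carrier_spin 1 2 3 by (simp add: is_rep_def)
qed

section \<open>The invariant tensor of the spin representations\<close>

lemma gc_mult_sum: "n \<le> 2 * K \<Longrightarrow> (\<Sum>l\<le>2 * K. f l * gc K n l) = f (2 * K - n) * (- 1) ^ (K + n)"
proof -
  assume "n \<le> 2 * K"
  then have "(\<Sum>l\<le>2 * K. f l * gc K n l) = (\<Sum>l\<le>2 * K. if l = 2 * K - n then f (2 * K - n) * (- 1) ^ (K + n) else 0)"
    by (intro sum.cong) (auto simp: gc_def)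
  then show ?thesis by simp
qed

lemma gc_sym: "gc K n m = gc K m n"
proof -
  have "(- 1 :: complex) ^ (K + n) = (- 1) ^ (K + m)" if "n + m = 2 * K"
  proof -
    have "even (K + n) \<longleftrightarrow> even (K + m)" using that by presburger
    then show ?thesis by (simp add: minus_one_power_iff)
  qed
  then show ?thesis by (auto simp: gc_def add.commute)
qed

text \<open>\<open>gc\<close> pairs the index \<open>n\<close> with \<open>2 * K - n\<close>, that
  is, opposite weights, so the two terms cancel for H. For the ladder operators the two entries
  involved are equal, being symmetric in \<open>n\<close> and \<open>m\<close>, while their signs
  differ because \<open>n + m\<close> is odd.\<close>

lemma gc_invariant:
  assumes "g \<in> gens" "n \<le> 2 * K" "m \<le> 2 * K"
  shows "(\<Sum>l\<le>2 * K. g (spin K) $$ (l, m) * gc K n l) + (\<Sum>l\<le>2 * K. g (spin K) $$ (l, n) * gc K m l) = 0"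
proof -
  have "g (spin K) $$ (2 * K - n, m) * (- 1) ^ (K + n) + g (spin K) $$ (2 * K - m, n) * (- 1) ^ (K + m) = 0"
    using assms(1)
  proof (rule gens_cases)
    show "opH (spin K) $$ (2 * K - n, m) * (- 1) ^ (K + n) + opH (spin K) $$ (2 * K - m, n) * (- 1) ^ (K + m) = 0"
    proof (cases "n + m = 2 * K")
      case True
      then have e: "even (K + n) \<longleftrightarrow> even (K + m)" by presburger
      have "2 * K - n = m" "2 * K - m = n" using True by auto
      moreover have "(of_nat n + of_nat m :: complex) = 2 * of_nat K" using True by (metis of_nat_add of_nat_mult of_nat_numeral)
      ultimately show ?thesis using assms e by (auto simp: spin_index minus_one_power_iff algebra_simps)
    next
      case False then show ?thesis using assms by (auto simp: spin_index)
    qed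
    have odd: "n + m = 2 * K + 1 \<Longrightarrow> even (K + n) \<longleftrightarrow> odd (K + m)" by presburger
    show "opX (spin K) $$ (2 * K - n, m) * (- 1) ^ (K + n) + opX (spin K) $$ (2 * K - m, n) * (- 1) ^ (K + m) = 0"
    proof (cases "n + m = 2 * K + 1")
      case True
      have "m = 2 * K - n + 1" "n = 2 * K - m + 1" "2 * K + 1 - n = m" "2 * K + 1 - m = n"
        using True assms by auto
      then have "opX (spin K) $$ (2 * K - n, m) = complex_of_real (sqrt (real m * real n))"
        "opX (spin K) $$ (2 * K - m, n) = complex_of_real (sqrt (real n * real m))"
        using assms by (auto simp: spin_index)
      then show ?thesis using odd[OF True] by (auto simp: minus_one_power_iff mult.commute)
    next
      case False then show ?thesis using assms by (auto simp: spin_index)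
    qed
    have odd': "n + m + 1 = 2 * K \<Longrightarrow> even (K + n) \<longleftrightarrow> odd (K + m)" by presburger
    show "opY (spin K) $$ (2 * K - n, m) * (- 1) ^ (K + n) + opY (spin K) $$ (2 * K - m, n) * (- 1) ^ (K + m) = 0"
    proof (cases "n + m + 1 = 2 * K")
      case True
      have e: "2 * K - n = m + 1" "2 * K - m = n + 1" "2 * K + 1 - (m + 1) = n + 1" "2 * K + 1 - (n + 1) = m + 1"
        using True assms by auto
      have "opY (spin K) $$ (m + 1, m) = complex_of_real (sqrt (real (m + 1) * real (n + 1)))"
        "opY (spin K) $$ (n + 1, n) = complex_of_real (sqrt (real (n + 1) * real (m + 1)))"
        using assms True e by (auto simp: spin_index)
      then show ?thesis using odd'[OF True] unfolding e by (auto simp: minus_one_power_iff mult.commute)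
    next
      case False then show ?thesis using assms by (auto simp: spin_index)
    qed
  qed
  then show ?thesis using assms by (simp add: gc_mult_sum)
qed

section \<open>Exponentials of diagonalizable matrices\<close>

definition dg :: "nat \<Rightarrow> (nat \<Rightarrow> complex) \<Rightarrow> complex mat" where
  "dg n d = Matrix.mat n n (\<lambda>(i, j). if i = j then d i else 0)"

text \<open>\<open>mexp\<close> is an entrywise \<open>suminf\<close>, which says nothing unless the
  series converges. For a diagonalized matrix everything reduces to the scalar exponential, and the
  clause on integral weights in \<open>is_qrep\<close> provides such a form of H.\<close>

definition diag_by :: "nat \<Rightarrow> complex mat \<Rightarrow> (nat \<Rightarrow> complex) \<Rightarrow> complex mat \<Rightarrow> complex mat \<Rightarrow> bool" where
  "diag_by n A d P Q \<longleftrightarrow> P \<in> carrier_mat n n \<and> Q \<in> carrier_mat n n \<and> P * Q = 1\<^sub>m n \<and> Q * P = 1\<^sub>m n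
    \<and> A = P * dg n d * Q"

definition diagable :: "nat \<Rightarrow> complex mat \<Rightarrow> bool" where
  "diagable n A \<longleftrightarrow> (\<exists>d P Q. diag_by n A d P Q)"

lemma dg_carrier [simp]: "dg n d \<in> carrier_mat n n"
  by (simp add: dg_def)

lemma dim_dg [simp]: "dim_row (dg n d) = n" "dim_col (dg n d) = n"
  by (simp_all add: dg_def)

lemma dg_index [simp]: "i < n \<Longrightarrow> j < n \<Longrightarrow> dg n d $$ (i, j) = (if i = j then d i else 0)"
  by (simp add: dg_def)

lemma mult_dg_index:
  assumes "A \<in> carrier_mat m n" "i < m" "j < n"
  shows "(A * dg n d) $$ (i, j) = A $$ (i, j) * d j"
proof -
  have "(\<Sum>k<n. A $$ (i, k) * dg n d $$ (k, j)) = (\<Sum>k<n. if k = j then A $$ (i, j) * d j else 0)"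
    using assms by (intro sum.cong) (auto simp: dg_def)
  then show ?thesis using assms by (subst mat_mult_index[of _ m n _ n]) auto
qed

lemma diag_form_index:
  assumes "P \<in> carrier_mat n n" "Q \<in> carrier_mat n n" "i < n" "j < n"
  shows "(P * dg n d * Q) $$ (i, j) = (\<Sum>a<n. P $$ (i, a) * d a * Q $$ (a, j))"
  using assms by (subst mat_mult_index[of _ n n _ n]) (auto simp: mult_dg_index simp del: index_mult_mat(1))

lemma dg_mult: "dg n d * dg n e = dg n (\<lambda>i. d i * e i)"
  by (rule eq_matI) (auto simp: mult_dg_index[OF dg_carrier] simp del: index_mult_mat(1))

lemma dg_one: "dg n (\<lambda>_. 1) = 1\<^sub>m n"
  by (rule eq_matI) (auto simp: dg_def)

lemma diag_by_carrier: "diag_by n A d P Q \<Longrightarrow> A \<in> carrier_mat n n"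
  by (auto simp: diag_by_def intro!: mult_carrier_mat)

lemma diagable_carrier: "diagable n A \<Longrightarrow> A \<in> carrier_mat n n"
  by (auto simp: diagable_def diag_by_carrier)

lemma diag_by_pow:
  assumes "diag_by n A d P Q"
  shows "A ^\<^sub>m k = P * dg n (\<lambda>i. d i ^ k) * Q"
proof (induction k)
  case 0
  have "P \<in> carrier_mat n n" "P * Q = 1\<^sub>m n" using assms by (simp_all add: diag_by_def)
  then show ?case using diag_by_carrier[OF assms] by (simp add: dg_one right_mult_one_mat[of P n n])
next
  case (Suc k)
  have c: "P \<in> carrier_mat n n" "Q \<in> carrier_mat n n" and QP: "Q * P = 1\<^sub>m n" and A: "A = P * dg n d * Q"
    using assms by (auto simp: diag_by_def)
  let ?D = "dg n (\<lambda>i. d i ^ k)"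
  have "(P * ?D * Q) * (P * dg n d * Q) = P * ?D * (Q * (P * (dg n d * Q)))"
    using c by (simp add: assoc_mult_mat[of _ n n _ n _ n] mult_carrier_mat[of _ n n _ n])
  also have "Q * (P * (dg n d * Q)) = dg n d * Q"
    using c QP by (simp add: assoc_mult_mat[of Q n n P n _ n, symmetric] mult_carrier_mat[of _ n n _ n])
  also have "P * ?D * (dg n d * Q) = P * (?D * dg n d) * Q"
    using c by (simp add: assoc_mult_mat[of _ n n _ n _ n] mult_carrier_mat[of _ n n _ n])
  finally show ?case using Suc A by (simp add: dg_mult mult.commute)
qed

lemma diag_by_mexp_sums:
  assumes "diag_by n A d P Q" "i < n" "j < n"
  shows "(\<lambda>k. (A ^\<^sub>m k) $$ (i, j) / fact k) sums (P * dg n (\<lambda>i. exp (d i)) * Q) $$ (i, j)"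
proof -
  have c: "P \<in> carrier_mat n n" "Q \<in> carrier_mat n n" using assms by (auto simp: diag_by_def)
  have "(\<lambda>k. \<Sum>a<n. P $$ (i, a) * ((d a ^ k) /\<^sub>R fact k) * Q $$ (a, j)) sums (\<Sum>a<n. P $$ (i, a) * exp (d a) * Q $$ (a, j))"
    by (intro sums_sum sums_mult sums_mult2 exp_converges)
  moreover have "(\<Sum>a<n. P $$ (i, a) * ((d a ^ k) /\<^sub>R fact k) * Q $$ (a, j)) = (A ^\<^sub>m k) $$ (i, j) / fact k" for k
    unfolding diag_by_pow[OF assms(1)] diag_form_index[OF c assms(2,3)]
    by (simp add: sum_divide_distrib scaleR_conv_of_real field_simps)
  ultimately show ?thesis by (simp add: diag_form_index[OF c assms(2,3)] del: index_mult_mat(1))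
qed

lemma mexp_carrier [simp]: "A \<in> carrier_mat n n \<Longrightarrow> mexp A \<in> carrier_mat n n"
  by (auto simp: mexp_def)

lemma diag_by_mexp:
  assumes "diag_by n A d P Q"
  shows "mexp A = P * dg n (\<lambda>i. exp (d i)) * Q"
proof (rule eq_matI)
  have c: "P \<in> carrier_mat n n" "Q \<in> carrier_mat n n" "A \<in> carrier_mat n n"
    using assms diag_by_carrier[OF assms] by (simp_all add: diag_by_def)
  then show "dim_row (mexp A) = dim_row (P * dg n (\<lambda>i. exp (d i)) * Q)" 
    "dim_col (mexp A) = dim_col (P * dg n (\<lambda>i. exp (d i)) * Q)" by (auto simp: mexp_def)
  fix i j assume "i < dim_row (P * dg n (\<lambda>i. exp (d i)) * Q)" "j < dim_col (P * dg n (\<lambda>i. exp (d i)) * Q)"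
  then have "i < n" "j < n" using c by auto
  then show "mexp A $$ (i, j) = (P * dg n (\<lambda>i. exp (d i)) * Q) $$ (i, j)"
    using diag_by_mexp_sums[OF assms, of i j] c by (simp add: mexp_def sums_iff)
qed

lemma mexp_sums:
  assumes "diagable n A" "i < n" "j < n"
  shows "(\<lambda>k. (A ^\<^sub>m k) $$ (i, j) / fact k) sums mexp A $$ (i, j)"
proof -
  obtain d P Q where *: "diag_by n A d P Q" using assms(1) by (auto simp: diagable_def)
  show ?thesis unfolding diag_by_mexp[OF *] by (rule diag_by_mexp_sums[OF * assms(2,3)])
qed

lemma pow_mat_natural:
  assumes "T \<in> carrier_mat m n" "A \<in> carrier_mat n n" "B \<in> carrier_mat m m" "T * A = B * T"
  shows "T * A ^\<^sub>m k = B ^\<^sub>m k * T"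
proof (induction k)
  case 0 then show ?case using assms by auto
next
  case (Suc k)
  have "T * (A ^\<^sub>m k * A) = T * A ^\<^sub>m k * A"
    using assms by (intro assoc_mult_mat[symmetric, of _ m n _ n _ n]) auto
  also have "\<dots> = B ^\<^sub>m k * (T * A)"
    using assms Suc by (simp add: assoc_mult_mat[of _ m m T n A n])
  also have "\<dots> = B ^\<^sub>m k * B * T"
    using assms by (simp add: assoc_mult_mat[of _ m m _ m T n])
  finally show ?case by simp
qed

text \<open>The relation passes to all powers and then to the sums of the series. \<open>T\<close>
  may be rectangular, as is needed for intertwiners between different representations.\<close>

lemma mexp_natural:
  assumes "T \<in> carrier_mat m n" "diagable n A" "diagable m B" "T * A = B * T"
  shows "T * mexp A = mexp B * T"
proof (rule eq_matI)
  note c = diagable_carrier[OF assms(2)] diagable_carrier[OF assms(3)]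
  show "dim_row (T * mexp A) = dim_row (mexp B * T)" "dim_col (T * mexp A) = dim_col (mexp B * T)"
    using assms(1) c by (auto simp: mexp_def)
  fix i j assume "i < dim_row (mexp B * T)" "j < dim_col (mexp B * T)"
  then have ij: "i < m" "j < n" using assms(1) c by (auto simp: mexp_def)
  have s1: "(\<lambda>k. \<Sum>l<n. T $$ (i, l) * ((A ^\<^sub>m k) $$ (l, j) / fact k)) sums (\<Sum>l<n. T $$ (i, l) * mexp A $$ (l, j))"
    using ij assms by (intro sums_sum sums_mult mexp_sums[of n]) auto
  have s2: "(\<lambda>k. \<Sum>l<m. ((B ^\<^sub>m k) $$ (i, l) / fact k) * T $$ (l, j)) sums (\<Sum>l<m. mexp B $$ (i, l) * T $$ (l, j))"
    using ij assms by (intro sums_sum sums_mult2 mexp_sums[of m]) auto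
  have e: "(\<Sum>l<n. T $$ (i, l) * ((A ^\<^sub>m k) $$ (l, j) / fact k)) = (\<Sum>l<m. ((B ^\<^sub>m k) $$ (i, l) / fact k) * T $$ (l, j))" for k
  proof -
    have "(\<Sum>l<n. T $$ (i, l) * ((A ^\<^sub>m k) $$ (l, j) / fact k)) = (T * A ^\<^sub>m k) $$ (i, j) / fact k"
      using ij assms(1) c by (subst mat_mult_index[of _ m n _ n]) (auto simp: sum_divide_distrib)
    also have "\<dots> = (B ^\<^sub>m k * T) $$ (i, j) / fact k"
      using pow_mat_natural[OF assms(1) c assms(4)] by simp
    also have "\<dots> = (\<Sum>l<m. ((B ^\<^sub>m k) $$ (i, l) / fact k) * T $$ (l, j))"
      using ij assms(1) c by (subst mat_mult_index[of _ m m _ n]) (auto simp: sum_divide_distrib)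
    finally show ?thesis .
  qed
  have "(\<Sum>l<n. T $$ (i, l) * mexp A $$ (l, j)) = (\<Sum>l<m. mexp B $$ (i, l) * T $$ (l, j))"
    by (rule sums_unique2[OF s1 s2[folded e]])
  then show "(T * mexp A) $$ (i, j) = (mexp B * T) $$ (i, j)"
    using ij assms(1) c by (simp only: mat_mult_index[of T m n _ n] mat_mult_index[of _ m m T n] mexp_carrier)
qed

lemma diagable_smult:
  assumes "diagable n A"
  shows "diagable n (c \<cdot>\<^sub>m A)"
proof -
  obtain d P Q where *: "diag_by n A d P Q" using assms by (auto simp: diagable_def)
  then have c: "P \<in> carrier_mat n n" "Q \<in> carrier_mat n n" by (auto simp: diag_by_def)
  have "c \<cdot>\<^sub>m A = P * dg n (\<lambda>i. c * d i) * Q"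
  proof (rule eq_matI)
    fix i j assume "i < dim_row (P * dg n (\<lambda>i. c * d i) * Q)" "j < dim_col (P * dg n (\<lambda>i. c * d i) * Q)"
    then have "i < n" "j < n" using c by auto
    then show "(c \<cdot>\<^sub>m A) $$ (i, j) = (P * dg n (\<lambda>i. c * d i) * Q) $$ (i, j)"
      using * diag_by_carrier[OF *] c
      by (simp add: diag_form_index[OF c] diag_by_def sum_distrib_left mult_ac del: index_mult_mat(1))
  qed (use c diag_by_carrier[OF *] in auto)
  with * show ?thesis by (auto simp: diagable_def diag_by_def)
qed

text \<open>Tensor products of eigenvectors are eigenvectors, with the sum of the eigenvalues. This
  gives the diagonalizability of H on tensor products and, through \<open>mexp_prim\<close>, that
  q^(cH) is group-like.\<close>

lemma prim_diag_by:
  assumes "diag_by m A d P Q" "diag_by n B e P' Q'"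
  shows "diag_by (m * n) (prim A B) (\<lambda>i. d (i div n) + e (i mod n)) (kron P P') (kron Q Q')"
proof -
  have c: "P \<in> carrier_mat m m" "Q \<in> carrier_mat m m" "P' \<in> carrier_mat n n" "Q' \<in> carrier_mat n n"
    "A \<in> carrier_mat m m" "B \<in> carrier_mat n n"
    using assms diag_by_carrier[OF assms(1)] diag_by_carrier[OF assms(2)] by (simp_all add: diag_by_def)
  have PQ: "P * Q = 1\<^sub>m m" "P' * Q' = 1\<^sub>m n" "Q * P = 1\<^sub>m m" "Q' * P' = 1\<^sub>m n"
    and AB: "A = P * dg m d * Q" "B = P' * dg n e * Q'"
    using assms by (auto simp: diag_by_def)
  have "prim A B = kron P P' * dg (m * n) (\<lambda>i. d (i div n) + e (i mod n)) * kron Q Q'"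
  proof (rule pair_eq_matI[of _ m n m n])
    fix a b a' b' assume ab: "a < m" "b < n" "a' < m" "b' < n"
    \<comment> \<open>The identity factors of \<open>prim\<close> are expanded as
      \<open>P * Q\<close> and \<open>P' * Q'\<close>, so that both of its terms become double sums
      over eigenvectors.\<close>
    have one: "(if a = a' then 1 else 0) = (\<Sum>k<m. P $$ (a, k) * Q $$ (k, a'))"
      "(if b = b' then 1 else 0) = (\<Sum>l<n. P' $$ (b, l) * Q' $$ (l, b'))"
      using PQ ab c mat_mult_index[of P m m Q m a a'] mat_mult_index[of P' n n Q' n b b'] by auto
    have "(kron P P' * dg (m * n) (\<lambda>i. d (i div n) + e (i mod n)) * kron Q Q') $$ (a * n + b, a' * n + b')
      = (\<Sum>i<m * n. kron P P' $$ (a * n + b, i) * (d (i div n) + e (i mod n)) * kron Q Q' $$ (i, a' * n + b'))"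
      using ab c by (intro diag_form_index pair_index_less kron_carrier)
    also have "\<dots> = (\<Sum>k<m. \<Sum>l<n. P $$ (a, k) * P' $$ (b, l) * (d k + e l) * (Q $$ (k, a') * Q' $$ (l, b')))"
      unfolding sum_pair_index using ab c
      by (intro sum.cong) (auto simp: kron_index[of _ m m _ n n])
    also have "\<dots> = (\<Sum>k<m. P $$ (a, k) * d k * Q $$ (k, a')) * (\<Sum>l<n. P' $$ (b, l) * Q' $$ (l, b'))
       + (\<Sum>k<m. P $$ (a, k) * Q $$ (k, a')) * (\<Sum>l<n. P' $$ (b, l) * e l * Q' $$ (l, b'))"
      unfolding sum_product sum.distrib[symmetric]
      by (intro sum.cong refl) (simp add: algebra_simps)
    also have "\<dots> = prim A B $$ (a * n + b, a' * n + b')"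
      using ab c by (subst prim_index[of A m B n])
        (auto simp: one[symmetric] AB diag_form_index[OF c(1,2)] diag_form_index[OF c(3,4)] simp del: index_mult_mat(1))
    finally show "prim A B $$ (a * n + b, a' * n + b') = 
      (kron P P' * dg (m * n) (\<lambda>i. d (i div n) + e (i mod n)) * kron Q Q') $$ (a * n + b, a' * n + b')" by simp
  qed (use c in \<open>auto intro!: mult_carrier_mat\<close>)
  then show ?thesis using c PQ
    by (auto simp: diag_by_def kron_mult[of _ m m _ n n _ m _ n] kron_one)
qed

lemma diagable_prim: "diagable m A \<Longrightarrow> diagable n B \<Longrightarrow> diagable (m * n) (prim A B)"
  unfolding diagable_def using prim_diag_by by blast

lemma mexp_prim:
  assumes "diagable m A" "diagable n B"
  shows "mexp (prim A B) = kron (mexp A) (mexp B)"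
proof -
  obtain d P Q e P' Q' where A: "diag_by m A d P Q" and B: "diag_by n B e P' Q'"
    using assms by (auto simp: diagable_def)
  have c: "P \<in> carrier_mat m m" "Q \<in> carrier_mat m m" "P' \<in> carrier_mat n n" "Q' \<in> carrier_mat n n"
    using A B by (auto simp: diag_by_def)
  have "dg (m * n) (\<lambda>i. exp (d (i div n) + e (i mod n))) = kron (dg m (\<lambda>i. exp (d i))) (dg n (\<lambda>i. exp (e i)))"
  proof (rule pair_eq_matI[of _ m n m n])
    fix a b a' b' assume ab: "a < m" "b < n" "a' < m" "b' < n"
    then have "a * n + b = a' * n + b' \<longleftrightarrow> a = a' \<and> b = b'"
      by (metis div_mult_self3 div_less add_0 add.commute mod_mult_self3 mod_less not_less_zero)
    then show "dg (m * n) (\<lambda>i. exp (d (i div n) + e (i mod n))) $$ (a * n + b, a' * n + b')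
      = kron (dg m (\<lambda>i. exp (d i))) (dg n (\<lambda>i. exp (e i))) $$ (a * n + b, a' * n + b')"
      using ab by (subst kron_index[of _ m m _ n n]) (auto simp: dg_def pair_index_less exp_add)
  qed auto
  then show ?thesis
    unfolding diag_by_mexp[OF prim_diag_by[OF A B]] diag_by_mexp[OF A] diag_by_mexp[OF B]
    using c by (simp add: kron_mult[of _ m m _ n n _ m _ n])
qed

section \<open>Representations with diagonalizable H and the group-like elements q^(cH)\<close>

lemma is_qrep_diagable: "is_qrep h \<rho> \<Longrightarrow> diagable (rdim \<rho>) (opH \<rho>)"
proof -
  assume *: "is_qrep h \<rho>"
  then obtain D where D: "similar_mat (opH \<rho>) D" "diagonal_mat D" by (auto simp: is_qrep_def)
  then obtain P Q where w: "similar_mat_wit (opH \<rho>) D P Q" by (auto simp: similar_mat_def)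
  have c: "opH \<rho> \<in> carrier_mat (rdim \<rho>) (rdim \<rho>)" using * by (auto simp: is_qrep_def rep_carrier_def)
  have "D = dg (rdim \<rho>) (\<lambda>i. D $$ (i, i))"
    using similar_mat_witD2[OF c w] D(2) by (intro eq_matI) (auto simp: dg_def diagonal_mat_def)
  then have "diag_by (rdim \<rho>) (opH \<rho>) (\<lambda>i. D $$ (i, i)) P Q"
    using similar_mat_witD2[OF c w] by (simp add: diag_by_def)
  then show ?thesis by (auto simp: diagable_def)
qed

text \<open>Iterated deformed tensor products only need a diagonalizable H for q^(cH) to behave
  well. Working in this larger class avoids verifying the relations of \<open>is_qrep\<close> for
  them.\<close>

definition diagrep :: "rep \<Rightarrow> bool" where
  "diagrep \<rho> \<longleftrightarrow> rep_carrier \<rho> \<and> diagable (rdim \<rho>) (opH \<rho>)"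

lemma is_qrep_diagrep: "is_qrep h \<rho> \<Longrightarrow> diagrep \<rho>"
  by (simp add: diagrep_def is_qrep_diagable is_qrep_carrier)

lemma qpow_carrier: "rep_carrier \<rho> \<Longrightarrow> qpow h c \<rho> \<in> carrier_mat (rdim \<rho>) (rdim \<rho>)"
  by (auto simp: qpow_def rep_carrier_def)

lemma qpow_natural:
  assumes "diagrep \<rho>" "diagrep \<sigma>" "T \<in> carrier_mat (rdim \<sigma>) (rdim \<rho>)" "T * opH \<rho> = opH \<sigma> * T"
  shows "T * qpow h c \<rho> = qpow h c \<sigma> * T"
proof -
  have c: "opH \<rho> \<in> carrier_mat (rdim \<rho>) (rdim \<rho>)" "opH \<sigma> \<in> carrier_mat (rdim \<sigma>) (rdim \<sigma>)"
    using assms by (auto simp: diagrep_def rep_carrier_def)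
  show ?thesis unfolding qpow_def using assms c
    by (intro mexp_natural[of _ "rdim \<sigma>" "rdim \<rho>"] diagable_smult)
      (auto simp: diagrep_def mult_smult_distrib[OF assms(3) c(1)] mult_smult_assoc_mat[OF c(2) assms(3)])
qed

lemma qpow_prim:
  assumes "diagrep \<rho>" "diagrep \<sigma>" "opH \<tau> = prim (opH \<rho>) (opH \<sigma>)"
  shows "qpow h c \<tau> = kron (qpow h c \<rho>) (qpow h c \<sigma>)"
proof -
  have c: "opH \<rho> \<in> carrier_mat (rdim \<rho>) (rdim \<rho>)" "opH \<sigma> \<in> carrier_mat (rdim \<sigma>) (rdim \<sigma>)"
    using assms by (auto simp: diagrep_def rep_carrier_def)
  show ?thesis using assms unfolding qpow_def assms(3)
    by (subst prim_smult[OF c, symmetric], intro mexp_prim[of "rdim \<rho>" _ "rdim \<sigma>"] diagable_smult)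
      (auto simp: diagrep_def)
qed

lemma opH_qtens:
  assumes "rep_carrier \<rho>" "rep_carrier \<sigma>"
  shows "opH (qtens h \<rho> \<sigma>) = prim (opH \<rho>) (opH \<sigma>)" "opH (qtens_flip h \<rho> \<sigma>) = prim (opH \<rho>) (opH \<sigma>)"
  using assms by (auto simp: qtens_def qtens_flip_def prim_def rep_carrier_def Let_def)

lemma opXY_qtens_flip:
  assumes "g \<in> {opX, opY}"
  shows "g (qtens_flip h \<rho> \<sigma>) = kron (g \<rho>) (qpow h (- 1/2) \<sigma>) + kron (qpow h (1/2) \<rho>) (g \<sigma>)"
  using assms by (auto simp: qtens_flip_def Let_def)

lemma opXY_qtens:
  assumes "g \<in> {opX, opY}"
  shows "g (qtens h \<rho> \<sigma>) = kron (g \<rho>) (qpow h (1/2) \<sigma>) + kron (qpow h (- 1/2) \<rho>) (g \<sigma>)"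
  using assms by (auto simp: qtens_def Let_def)

lemma diagrep_qtens_flip:
  assumes "diagrep \<rho>" "diagrep \<sigma>"
  shows "diagrep (qtens_flip h \<rho> \<sigma>)" "rdim (qtens_flip h \<rho> \<sigma>) = rdim \<rho> * rdim \<sigma>"
proof -
  have c: "rep_carrier \<rho>" "rep_carrier \<sigma>" using assms by (auto simp: diagrep_def)
  note cs = c[unfolded rep_carrier_def] qpow_carrier[OF c(1)] qpow_carrier[OF c(2)]
  show r: "rdim (qtens_flip h \<rho> \<sigma>) = rdim \<rho> * rdim \<sigma>"
    unfolding rdim_def[of "qtens_flip h \<rho> \<sigma>"] opH_qtens(2)[OF c] using cs by (auto simp: prim_def)
  have "rep_carrier (qtens_flip h \<rho> \<sigma>)"
    unfolding rep_carrier_def r opH_qtens(2)[OF c] using cs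
    by (auto simp: opXY_qtens_flip[where g = opX] opXY_qtens_flip[where g = opY] intro!: add_carrier_mat kron_carrier)
  then show "diagrep (qtens_flip h \<rho> \<sigma>)"
    using assms by (auto simp: diagrep_def r opH_qtens(2)[OF c] diagable_prim)
qed

lemma minv_inverse:
  assumes "A \<in> carrier_mat n n" "minvertible A"
  shows "minv A \<in> carrier_mat n n" "A * minv A = 1\<^sub>m n" "minv A * A = 1\<^sub>m n"
proof -
  have "\<exists>B. B \<in> carrier_mat (dim_row A) (dim_row A) \<and> inverts_mat A B \<and> inverts_mat B A"
    using assms(2) by (simp add: minvertible_def)
  from someI_ex[OF this] have *: "minv A \<in> carrier_mat (dim_row A) (dim_row A)" "inverts_mat A (minv A)" "inverts_mat (minv A) A"
    by (simp_all add: minv_def)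
  then show "minv A \<in> carrier_mat n n" "A * minv A = 1\<^sub>m n" "minv A * A = 1\<^sub>m n"
    using assms(1) by (auto simp: inverts_mat_def)
qed

section \<open>The flip\<close>

text \<open>From \<open>V \<otimes> W\<close> to \<open>W \<otimes> V\<close>, for \<open>dim V = m\<close> and \<open>dim W = n\<close>.\<close>

definition swap_mat :: "nat \<Rightarrow> nat \<Rightarrow> complex mat" where
  "swap_mat m n = Matrix.mat (n * m) (m * n) (\<lambda>(i, j). if i div m = j mod n \<and> i mod m = j div n then 1 else 0)"

lemma swap_mat_carrier [simp]: "swap_mat m n \<in> carrier_mat (n * m) (m * n)"
  by (simp add: swap_mat_def)

lemma swap_mat_index:
  assumes "b < n" "a < m" "c < m" "d < n"
  shows "swap_mat m n $$ (b * m + a, c * n + d) = (if a = c \<and> b = d then 1 else 0)"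
  using assms pair_index_less[of b n a m] pair_index_less[of c m d n] by (auto simp: swap_mat_def)

lemma swap_mat_mult_index:
  assumes "M \<in> carrier_mat (m * n) q" "a < m" "b < n" "j < q"
  shows "(swap_mat m n * M) $$ (b * m + a, j) = M $$ (a * n + b, j)"
proof -
  have "(swap_mat m n * M) $$ (b * m + a, j) = (\<Sum>k<m * n. swap_mat m n $$ (b * m + a, k) * M $$ (k, j))"
    using assms by (intro mat_mult_index[of _ "n * m" _ _ q] pair_index_less) auto
  also have "\<dots> = (\<Sum>c<m. \<Sum>d<n. if d = b then (if c = a then M $$ (a * n + b, j) else 0) else 0)"
    unfolding sum_pair_index using assms by (intro sum.cong) (auto simp: swap_mat_index)
  also have "\<dots> = M $$ (a * n + b, j)" using assms by simp
  finally show ?thesis .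
qed

lemma mult_swap_mat_index:
  assumes "M \<in> carrier_mat q (n * m)" "a < m" "b < n" "i < q"
  shows "(M * swap_mat m n) $$ (i, a * n + b) = M $$ (i, b * m + a)"
proof -
  have "(M * swap_mat m n) $$ (i, a * n + b) = (\<Sum>k<n * m. M $$ (i, k) * swap_mat m n $$ (k, a * n + b))"
    using assms by (intro mat_mult_index[of _ q _ _ "m * n"] pair_index_less) auto
  also have "\<dots> = (\<Sum>d<n. \<Sum>c<m. if c = a then (if d = b then M $$ (i, b * m + a) else 0) else 0)"
    unfolding sum_pair_index using assms by (intro sum.cong) (auto simp: swap_mat_index)
  also have "\<dots> = M $$ (i, b * m + a)" using assms by simp
  finally show ?thesis .
qed

lemma swap_mat_kron:
  assumes "A \<in> carrier_mat m m'" "B \<in> carrier_mat n n'"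
  shows "swap_mat m n * kron A B = kron B A * swap_mat m' n'"
proof (rule pair_eq_matI[of _ n m m' n'])
  show "swap_mat m n * kron A B \<in> carrier_mat (n * m) (m' * n')"
    by (rule mult_carrier_mat[OF swap_mat_carrier kron_carrier[OF assms]])
  show "kron B A * swap_mat m' n' \<in> carrier_mat (n * m) (m' * n')"
    by (rule mult_carrier_mat[OF kron_carrier[OF assms(2,1)] swap_mat_carrier])
  fix b a c d assume *: "b < n" "a < m" "c < m'" "d < n'"
  have "(swap_mat m n * kron A B) $$ (b * m + a, c * n' + d) = kron A B $$ (a * n + b, c * n' + d)"
    using * assms by (intro swap_mat_mult_index[of _ _ _ "m' * n'"] pair_index_less) auto
  also have "\<dots> = kron B A $$ (b * m + a, d * m' + c)"
    using * by (simp add: kron_index[OF assms] kron_index[OF assms(2,1)])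
  also have "\<dots> = (kron B A * swap_mat m' n') $$ (b * m + a, c * n' + d)"
    using * assms by (intro mult_swap_mat_index[symmetric, of _ "n * m"] pair_index_less) auto
  finally show "(swap_mat m n * kron A B) $$ (b * m + a, c * n' + d) = (kron B A * swap_mat m' n') $$ (b * m + a, c * n' + d)" .
qed

lemma swap_mat_inverse: "swap_mat n m * swap_mat m n = 1\<^sub>m (m * n)"
proof (rule pair_eq_matI[of _ m n m n])
  fix a b c d assume *: "a < m" "b < n" "c < m" "d < n"
  then have "a * n + b = c * n + d \<longleftrightarrow> a = c \<and> b = d"
    by (metis div_mult_self3 div_less add_0 add.commute mod_mult_self3 mod_less not_less_zero)
  then show "(swap_mat n m * swap_mat m n) $$ (a * n + b, c * n + d) = 1\<^sub>m (m * n) $$ (a * n + b, c * n + d)"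
    using * by (subst swap_mat_mult_index[of _ n m "m * n"]) (auto simp: swap_mat_index pair_index_less)
qed (auto intro!: mult_carrier_mat[of _ _ "n * m"])

text \<open>Writes the permutation of indices in \<open>flip2\<close> as conjugation by the flip,
  the form in which naturality and inverses can be handled.\<close>

lemma flip2_eq:
  assumes "F \<sigma> \<rho> \<in> carrier_mat (rdim \<sigma> * rdim \<rho>) (rdim \<sigma> * rdim \<rho>)"
  shows "flip2 F \<rho> \<sigma> = swap_mat (rdim \<sigma>) (rdim \<rho>) * F \<sigma> \<rho> * swap_mat (rdim \<rho>) (rdim \<sigma>)"
proof (rule pair_eq_matI[of _ "rdim \<rho>" "rdim \<sigma>" "rdim \<rho>" "rdim \<sigma>"])
  let ?m = "rdim \<sigma>" and ?n = "rdim \<rho>"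
  have c: "swap_mat ?m ?n * F \<sigma> \<rho> \<in> carrier_mat (?n * ?m) (?m * ?n)"
    using assms by (intro mult_carrier_mat[of _ _ "?m * ?n"]) auto
  show "swap_mat ?m ?n * F \<sigma> \<rho> * swap_mat ?n ?m \<in> carrier_mat (?n * ?m) (?n * ?m)"
    by (rule mult_carrier_mat[OF c]) simp
  fix a b a' b' assume *: "a < ?n" "b < ?m" "a' < ?n" "b' < ?m"
  have "(swap_mat ?m ?n * F \<sigma> \<rho> * swap_mat ?n ?m) $$ (a * ?m + b, a' * ?m + b')
     = (swap_mat ?m ?n * F \<sigma> \<rho>) $$ (a * ?m + b, b' * ?n + a')"
    using * c by (intro mult_swap_mat_index[of _ "?n * ?m"] pair_index_less) auto
  also have "\<dots> = F \<sigma> \<rho> $$ (b * ?n + a, b' * ?n + a')"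
    using * assms by (intro swap_mat_mult_index[of _ _ _ "?m * ?n"] pair_index_less) auto
  finally show "flip2 F \<rho> \<sigma> $$ (a * ?m + b, a' * ?m + b')
     = (swap_mat ?m ?n * F \<sigma> \<rho> * swap_mat ?n ?m) $$ (a * ?m + b, a' * ?m + b')"
    using * by (simp add: flip2_def pair_index_less)
qed (simp add: flip2_def)

section \<open>The action on polynomials\<close>

definition span_of :: "var multiset set \<Rightarrow> mpol set" where
  "span_of S = {p. Poly_Mapping.keys p \<subseteq> S}"

lemma span_of_0 [simp]: "0 \<in> span_of S" by (simp add: span_of_def)

lemma span_of_add: "p \<in> span_of S \<Longrightarrow> q \<in> span_of S \<Longrightarrow> p + q \<in> span_of S"
  using Poly_Mapping.keys_add[of p q] by (auto simp: span_of_def)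

lemma span_of_cmul: "p \<in> span_of S \<Longrightarrow> cmul c p \<in> span_of S"
  by (auto simp: span_of_def in_keys_iff)

lemma span_of_sum: "(\<And>i. i \<in> A \<Longrightarrow> f i \<in> span_of S) \<Longrightarrow> sum f A \<in> span_of S"
  by (induction A rule: infinite_finite_induct) (auto simp: span_of_add)

lemma span_of_sum_mset: "(\<And>i. i \<in># A \<Longrightarrow> f i \<in> span_of S) \<Longrightarrow> (\<Sum>i\<in>#A. f i) \<in> span_of S"
  by (induction A) (auto simp: span_of_add)

lemma span_of_mon: "M \<in> S \<Longrightarrow> mon M \<in> span_of S"
  by (simp add: span_of_def)

lemma span_of_mono: "S \<subseteq> T \<Longrightarrow> p \<in> span_of S \<Longrightarrow> p \<in> span_of T"
  by (auto simp: span_of_def)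

lemma lin_span_of:
  assumes "lin X" "p \<in> span_of S" "\<And>M. M \<in> S \<Longrightarrow> X (mon M) \<in> span_of T"
  shows "X p \<in> span_of T"
  using assms(2) unfolding lin_expand[OF assms(1), of p]
  by (intro span_of_sum span_of_cmul assms(3)) (auto simp: span_of_def)

lemma polys_eq_span_of: "polys N = span_of {M. set_mset M \<subseteq> vars N}"
  by (auto simp: polys_def span_of_def)

text \<open>A generator is primitive, so it acts on products by a derivation. Defining the action
  this way makes it independent of the word that \<open>act\<close> chooses for each
  monomial.\<close>

definition gen_op :: "(rep \<Rightarrow> complex mat) \<Rightarrow> oper" where
  "gen_op g = deriv_ext (\<lambda>(K, n). \<Sum>l\<le>2 * K. cmul (g (spin K) $$ (l, n)) (xvar (K, l)))"

lemma lin_gen_op: "lin (gen_op g)"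
  unfolding gen_op_def by (rule lin_deriv_ext)

lemma gen_op_mult: "gen_op g (p * q) = gen_op g p * q + p * gen_op g q"
  unfolding gen_op_def by (rule deriv_ext_mult)

lemma gen_op_1 [simp]: "gen_op g 1 = 0"
  by (simp add: gen_op_def)

lemma gen_op_mulv: "gen_op g (mulv (K, n) p) =
    (\<Sum>l\<le>2 * K. cmul (g (spin K) $$ (l, n)) (mulv (K, l) p)) + mulv (K, n) (gen_op g p)"
  by (simp add: gen_op_def deriv_ext_mult sum_distrib_right cmul_mult_left mulv_eq)

lemma gen_op_xvar: "gen_op g (xvar (K, n)) = (\<Sum>l\<le>2 * K. cmul (g (spin K) $$ (l, n)) (xvar (K, l)))"
  by (simp add: gen_op_def)

lemma vars_iff [simp]: "(K, n) \<in> vars N \<longleftrightarrow> K \<le> N \<and> n \<le> 2 * K"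
  by (simp add: vars_def)

lemma polys_gen_op: "p \<in> polys N \<Longrightarrow> gen_op g p \<in> polys N"
  unfolding gen_op_def by (rule polys_deriv_ext) (auto intro!: polys_sum polys_cmul polys_xvar)

text \<open>Commutators of derivations obey the Leibniz rule, so it suffices to compare on
  variables, where the claim is the matrix relation in \<open>spin K\<close>.\<close>

lemma gen_op_commutator:
  assumes "p \<in> polys N" "g1 \<in> gens" "g2 \<in> gens"
    and "\<And>K. g1 (spin K) * g2 (spin K) - g2 (spin K) * g1 (spin K) = c \<cdot>\<^sub>m g3 (spin K)" "g3 \<in> gens"
  shows "gen_op g1 (gen_op g2 p) - gen_op g2 (gen_op g1 p) = cmul c (gen_op g3 p)"
proof (rule derivation_eqI[of "\<lambda>p. gen_op g1 (gen_op g2 p) - gen_op g2 (gen_op g1 p)" "\<lambda>p. cmul c (gen_op g3 p)", OF _ _ assms(1)])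
  show "lin (\<lambda>p. gen_op g1 (gen_op g2 p) - gen_op g2 (gen_op g1 p))" "lin (\<lambda>p. cmul c (gen_op g3 p))"
    by (intro lin_minus_fun lin_compose[OF lin_gen_op lin_gen_op] lin_scale lin_gen_op)+
  show "gen_op g1 (gen_op g2 1) - gen_op g2 (gen_op g1 1) = cmul c (gen_op g3 1)"
    by (simp add: lin_0[OF lin_gen_op])
  show "gen_op g1 (gen_op g2 (mulv v q)) - gen_op g2 (gen_op g1 (mulv v q)) =
    (gen_op g1 (gen_op g2 (xvar v)) - gen_op g2 (gen_op g1 (xvar v))) * q
    + mulv v (gen_op g1 (gen_op g2 q) - gen_op g2 (gen_op g1 q))" for v q
    by (simp add: mulv_eq gen_op_mult lin_add[OF lin_gen_op] algebra_simps)
  show "cmul c (gen_op g3 (mulv v q)) = cmul c (gen_op g3 (xvar v)) * q + mulv v (cmul c (gen_op g3 q))" for v q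
    by (simp add: mulv_eq gen_op_mult cmul_add cmul_mult_left cmul_mult_right)
  fix v assume "v \<in> vars N"
  then obtain K n where v: "v = (K, n)" "n \<le> 2 * K" by (cases v) auto
  have AB: "gen_op g (gen_op g' (xvar (K, n))) = (\<Sum>k\<le>2 * K. cmul ((g (spin K) * g' (spin K)) $$ (k, n)) (xvar (K, k)))"
    if "g \<in> gens" "g' \<in> gens" for g g'
  proof -
    have "(g (spin K) * g' (spin K)) $$ (k, n) = (\<Sum>l\<le>2 * K. g (spin K) $$ (k, l) * g' (spin K) $$ (l, n))"
      if "k \<le> 2 * K" for k
      using mat_mult_index[OF spin_carrier[OF \<open>g \<in> gens\<close>] spin_carrier[OF \<open>g' \<in> gens\<close>], of k K n] that v
      by (simp add: lessThan_Suc_atMost del: index_mult_mat(1))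
    then have "(\<Sum>k\<le>2 * K. cmul ((g (spin K) * g' (spin K)) $$ (k, n)) (xvar (K, k)))
      = (\<Sum>k\<le>2 * K. \<Sum>l\<le>2 * K. cmul (g (spin K) $$ (k, l) * g' (spin K) $$ (l, n)) (xvar (K, k)))"
      by (intro sum.cong refl) (simp add: cmul_sum_left del: index_mult_mat(1))
    also have "\<dots> = gen_op g (gen_op g' (xvar (K, n)))"
      by (subst sum.swap) (simp add: gen_op_xvar lin_sum[OF lin_gen_op] lin_cmul[OF lin_gen_op] cmul_sum cmul_cmul mult.commute)
    finally show ?thesis ..
  qed
  have "cmul ((g1 (spin K) * g2 (spin K)) $$ (k, n)) (xvar (K, k)) - cmul ((g2 (spin K) * g1 (spin K)) $$ (k, n)) (xvar (K, k))
     = cmul c (cmul (g3 (spin K) $$ (k, n)) (xvar (K, k)))" if "k \<le> 2 * K" for k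
  proof -
    have "(g1 (spin K) * g2 (spin K)) $$ (k, n) - (g2 (spin K) * g1 (spin K)) $$ (k, n) = (c \<cdot>\<^sub>m g3 (spin K)) $$ (k, n)"
      unfolding assms(4)[symmetric] using that v spin_carrier[OF assms(2), of K] spin_carrier[OF assms(3), of K]
      by (subst index_minus_mat(1)) auto
    also have "\<dots> = c * g3 (spin K) $$ (k, n)"
      using that v spin_carrier[OF assms(5), of K] by simp
    finally show ?thesis
      by (simp add: cmul_cmul del: index_mult_mat(1)) (metis cmul_add_left add_diff_cancel diff_add_cancel)
  qed
  then show "gen_op g1 (gen_op g2 (xvar v)) - gen_op g2 (gen_op g1 (xvar v)) = cmul c (gen_op g3 (xvar v))"
    unfolding v AB[OF assms(2,3)] AB[OF assms(3,2)] sum_subtractf[symmetric]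
    by (simp add: gen_op_xvar cmul_sum)
qed

lemma gen_op_relations:
  assumes "p \<in> polys N"
  shows "gen_op opH (gen_op opX p) - gen_op opX (gen_op opH p) = cmul 2 (gen_op opX p)"
    "gen_op opH (gen_op opY p) - gen_op opY (gen_op opH p) = cmul (- 2) (gen_op opY p)"
    "gen_op opX (gen_op opY p) - gen_op opY (gen_op opX p) = gen_op opH p"
proof -
  have g: "opH \<in> gens" "opX \<in> gens" "opY \<in> gens" by (auto simp: gens_def)
  show "gen_op opH (gen_op opX p) - gen_op opX (gen_op opH p) = cmul 2 (gen_op opX p)"
    using is_rep_spin by (intro gen_op_commutator[OF assms] g) (auto simp: is_rep_def)
  show "gen_op opH (gen_op opY p) - gen_op opY (gen_op opH p) = cmul (- 2) (gen_op opY p)"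
    using is_rep_spin by (intro gen_op_commutator[OF assms] g) (auto simp: is_rep_def)
  have "1 \<cdot>\<^sub>m opH (spin K) = opH (spin K)" for K by (rule eq_matI) auto
  then show "gen_op opX (gen_op opY p) - gen_op opY (gen_op opX p) = gen_op opH p"
    using is_rep_spin gen_op_commutator[OF assms g(2,3) _ g(1), of 1] by (auto simp: is_rep_def)
qed

section \<open>Polynomials of bounded degree as a finite-dimensional representation\<close>

definition mons :: "nat \<Rightarrow> nat \<Rightarrow> var multiset set" where
  "mons N n = {M. set_mset M \<subseteq> vars N \<and> size M \<le> n}"

lemma finite_vars: "finite (vars N)"
  by (rule finite_subset[of _ "{..N} \<times> {..2 * N}"]) (auto simp: vars_def)

lemma finite_mons: "finite (mons N n)"
proof (rule finite_subset)
  show "mons N n \<subseteq> mset ` {w. set w \<subseteq> vars N \<and> length w \<le> n}"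
  proof
    fix M assume "M \<in> mons N n"
    moreover obtain w where "mset w = M" using ex_mset by blast
    ultimately show "M \<in> mset ` {w. set w \<subseteq> vars N \<and> length w \<le> n}" by (auto simp: mons_def)
  qed
qed (simp add: finite_lists_length_le finite_vars)

definition mdim :: "nat \<Rightarrow> nat \<Rightarrow> nat" where
  "mdim N n = card (mons N n)"

definition mnum :: "nat \<Rightarrow> nat \<Rightarrow> nat \<Rightarrow> var multiset" where
  "mnum N n = (SOME e. bij_betw e {..<mdim N n} (mons N n))"

lemma bij_mnum: "bij_betw (mnum N n) {..<mdim N n} (mons N n)"
proof -
  have "\<exists>e. bij_betw e {..<mdim N n} (mons N n)"
    using ex_bij_betw_nat_finite[OF finite_mons, of N n] by (simp add: mdim_def atLeast0LessThan)
  then show ?thesis unfolding mnum_def by (rule someI_ex)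
qed

lemma mnum_in: "i < mdim N n \<Longrightarrow> mnum N n i \<in> mons N n"
  using bij_mnum[of N n] by (auto simp: bij_betw_def)

lemma mnum_eq_iff: "i < mdim N n \<Longrightarrow> j < mdim N n \<Longrightarrow> mnum N n i = mnum N n j \<longleftrightarrow> i = j"
  using bij_mnum[of N n] by (auto simp: bij_betw_def inj_on_def)

lemma mnum_cases:
  assumes "M \<in> mons N n" obtains i where "i < mdim N n" "M = mnum N n i"
  using assms bij_mnum[of N n] by (auto simp: bij_betw_def)

lemma sum_mons: "(\<Sum>M\<in>mons N n. f M) = (\<Sum>i<mdim N n. f (mnum N n i))"
  by (rule sum.reindex_bij_betw[OF bij_mnum, symmetric])

definition op_mat :: "nat \<Rightarrow> nat \<Rightarrow> nat \<Rightarrow> oper \<Rightarrow> complex mat" where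
  "op_mat N n m X = Matrix.mat (mdim N m) (mdim N n) (\<lambda>(i, j). Poly_Mapping.lookup (X (mon (mnum N n j))) (mnum N m i))"

text \<open>\<open>op_mat\<close> silently drops components outside \<open>mons N m\<close>. This
  condition excludes such a loss; it makes \<open>op_mat\<close> multiplicative and lets equal
  matrices imply equal operators. Degrees are bounded rather than fixed because \<open>wick\<close>
  and \<open>subst\<close> are not homogeneous.\<close>

definition maps_mons :: "nat \<Rightarrow> nat \<Rightarrow> nat \<Rightarrow> oper \<Rightarrow> bool" where
  "maps_mons N n m X \<longleftrightarrow> (\<forall>M\<in>mons N n. X (mon M) \<in> span_of (mons N m))"

lemma op_mat_carrier [simp]: "op_mat N n m X \<in> carrier_mat (mdim N m) (mdim N n)"
  by (simp add: op_mat_def)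

lemma dim_op_mat [simp]: "dim_row (op_mat N n m X) = mdim N m" "dim_col (op_mat N n m X) = mdim N n"
  by (simp_all add: op_mat_def)

lemma op_mat_index: "i < mdim N m \<Longrightarrow> j < mdim N n \<Longrightarrow>
    op_mat N n m X $$ (i, j) = Poly_Mapping.lookup (X (mon (mnum N n j))) (mnum N m i)"
  by (simp add: op_mat_def)

lemma maps_monsD: "maps_mons N n m X \<Longrightarrow> lin X \<Longrightarrow> p \<in> span_of (mons N n) \<Longrightarrow> X p \<in> span_of (mons N m)"
  by (erule lin_span_of) (auto simp: maps_mons_def)

lemma lookup_lin:
  assumes "lin X" "p \<in> span_of (mons N n)"
  shows "Poly_Mapping.lookup (X p) L = (\<Sum>j<mdim N n. Poly_Mapping.lookup p (mnum N n j) * Poly_Mapping.lookup (X (mon (mnum N n j))) L)"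
proof -
  have "Poly_Mapping.lookup (X p) L = (\<Sum>M\<in>Poly_Mapping.keys p. Poly_Mapping.lookup p M * Poly_Mapping.lookup (X (mon M)) L)"
    by (subst lin_expand[OF assms(1)]) (simp add: lookup_sum)
  also have "\<dots> = (\<Sum>M\<in>mons N n. Poly_Mapping.lookup p M * Poly_Mapping.lookup (X (mon M)) L)"
    using assms(2) by (intro sum.mono_neutral_left finite_mons) (auto simp: span_of_def in_keys_iff)
  finally show ?thesis by (simp add: sum_mons)
qed

lemma op_mat_compose:
  assumes "lin X" "maps_mons N n m Y"
  shows "op_mat N n k (\<lambda>p. X (Y p)) = op_mat N m k X * op_mat N n m Y"
proof (rule eq_matI)
  fix i j assume "i < dim_row (op_mat N m k X * op_mat N n m Y)" "j < dim_col (op_mat N m k X * op_mat N n m Y)"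
  then have ij: "i < mdim N k" "j < mdim N n" by (auto simp: op_mat_def)
  then have "Y (mon (mnum N n j)) \<in> span_of (mons N m)"
    using assms(2) mnum_in by (auto simp: maps_mons_def)
  then show "op_mat N n k (\<lambda>p. X (Y p)) $$ (i, j) = (op_mat N m k X * op_mat N n m Y) $$ (i, j)"
    using ij by (subst mat_mult_index[of _ "mdim N k" "mdim N m" _ "mdim N n"])
      (auto simp: op_mat_index lookup_lin[OF assms(1)] mult.commute)
qed (auto simp: op_mat_def)

lemma op_mat_diff: "op_mat N n m (\<lambda>p. X p - Y p) = op_mat N n m X - op_mat N n m Y"
  by (rule eq_matI) (auto simp: op_mat_def lookup_minus)

lemma op_mat_scale: "op_mat N n m (\<lambda>p. cmul c (X p)) = c \<cdot>\<^sub>m op_mat N n m X"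
  by (rule eq_matI) (auto simp: op_mat_def)

lemma op_mat_eqD:
  assumes "op_mat N n m X = op_mat N n m Y" "maps_mons N n m X" "maps_mons N n m Y"
    "lin X" "lin Y" "p \<in> span_of (mons N n)"
  shows "X p = Y p"
proof (rule lin_eqI[OF assms(4,5)])
  fix M assume "M \<in> Poly_Mapping.keys p"
  then have M: "M \<in> mons N n" using assms(6) by (auto simp: span_of_def)
  then obtain j where j: "j < mdim N n" "M = mnum N n j" by (rule mnum_cases)
  show "X (mon M) = Y (mon M)"
  proof (rule poly_mapping_eqI)
    fix L
    show "Poly_Mapping.lookup (X (mon M)) L = Poly_Mapping.lookup (Y (mon M)) L"
    proof (cases "L \<in> mons N m")
      case True
      then obtain i where i: "i < mdim N m" "L = mnum N m i" by (rule mnum_cases)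
      have "op_mat N n m X $$ (i, j) = op_mat N n m Y $$ (i, j)" using assms(1) by simp
      then show ?thesis using i j by (simp add: op_mat_index)
    next
      case False
      then have "L \<notin> Poly_Mapping.keys (X (mon M))" "L \<notin> Poly_Mapping.keys (Y (mon M))"
        using assms(2,3) M by (auto simp: maps_mons_def span_of_def)
      then show ?thesis by (simp add: in_keys_iff)
    qed
  qed
qed

lemma op_mat_cong: "(\<And>p. p \<in> span_of (mons N n) \<Longrightarrow> X p = Y p) \<Longrightarrow> op_mat N n m X = op_mat N n m Y"
  by (rule eq_matI) (auto simp: op_mat_def span_of_mon mnum_in)

lemma mons_mono: "n \<le> m \<Longrightarrow> mons N n \<subseteq> mons N m"
  by (auto simp: mons_def)

lemma span_mons_polys: "p \<in> span_of (mons N n) \<Longrightarrow> p \<in> polys N"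
  by (auto simp: polys_def span_of_def mons_def)

lemma polys_obtain_mons:
  assumes "p \<in> polys N" obtains n where "p \<in> span_of (mons N n)"
proof
  show "p \<in> span_of (mons N (Max (insert 0 (size ` Poly_Mapping.keys p))))"
    using assms by (auto simp: span_of_def mons_def polys_def intro!: Max_ge)
qed

text \<open>A degree bound for all images exists because there are only finitely many monomials of
  degree at most \<open>n\<close> in the variables \<open>vars N\<close>.\<close>

lemma polys_maps_mons:
  assumes "\<And>p. p \<in> polys N \<Longrightarrow> X p \<in> polys N"
  obtains m where "maps_mons N n m X" "m \<ge> k"
proof -
  have "\<exists>m. \<forall>M\<in>A. X (mon M) \<in> span_of (mons N m)" if "finite A" "A \<subseteq> mons N n" for A
    using that
  proof (induction rule: finite_induct)
    case (insert M A)
    then obtain m where m: "\<forall>M\<in>A. X (mon M) \<in> span_of (mons N m)" by auto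
    have "X (mon M) \<in> polys N" using insert.prems by (intro assms polys_mon) (auto simp: mons_def)
    then obtain m' where "X (mon M) \<in> span_of (mons N m')" by (rule polys_obtain_mons)
    then show ?case using m
      by (intro exI[of _ "max m m'"]) (auto intro: span_of_mono[OF mons_mono, of m "max m m'"] span_of_mono[OF mons_mono, of m' "max m m'"])
  qed simp
  from this[OF finite_mons order_refl] obtain m where "maps_mons N n m X" by (auto simp: maps_mons_def)
  then show ?thesis
    using that[of "max m k"] span_of_mono[OF mons_mono[of m "max m k" N]] by (auto simp: maps_mons_def)
qed

lemma maps_mons_gen_op: "maps_mons N n n (gen_op g)"
  unfolding maps_mons_def
proof
  fix M assume M: "M \<in> mons N n"
  have "(\<Sum>v\<in>#M. (case v of (K, n) \<Rightarrow> \<Sum>l\<le>2 * K. cmul (g (spin K) $$ (l, n)) (xvar (K, l))) * mon (M - {#v#})) \<in> span_of (mons N n)"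
  proof (rule span_of_sum_mset)
    fix v assume v: "v \<in># M"
    obtain K m where Km: "v = (K, m)" by (cases v)
    have "add_mset (K, l) (M - {#v#}) \<in> mons N n" if "l \<le> 2 * K" for l
      using M v that Km by (auto simp: mons_def size_Diff_singleton Suc_le_eq dest: in_diffD size_Diff1_less)
    then show "(case v of (K, n) \<Rightarrow> \<Sum>l\<le>2 * K. cmul (g (spin K) $$ (l, n)) (xvar (K, l))) * mon (M - {#v#}) \<in> span_of (mons N n)"
      unfolding Km by (simp add: sum_distrib_right cmul_mult_left mulv_eq[symmetric] mulv_mon)
        (intro span_of_sum span_of_cmul span_of_mon, simp)
  qed
  then show "gen_op g (mon M) \<in> span_of (mons N n)"
    unfolding gen_op_def deriv_ext_def linext_mon .
qed

text \<open>As an object of type \<open>rep\<close>, the space of polynomials becomes an argument to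
  which elements of \<open>uhat\<close>, and the pullback \<open>\<phi>\<close>, can be
  applied.\<close>

definition mrep :: "nat \<Rightarrow> nat \<Rightarrow> rep" where
  "mrep N n = Rep (op_mat N n n (gen_op opH)) (op_mat N n n (gen_op opX)) (op_mat N n n (gen_op opY))"

lemma rdim_mrep [simp]: "rdim (mrep N n) = mdim N n"
  by (simp add: rdim_def mrep_def op_mat_def)

lemma gens_mrep: "g \<in> gens \<Longrightarrow> g (mrep N n) = op_mat N n n (gen_op g)"
  by (auto simp: gens_def mrep_def)

lemma is_rep_mrep: "is_rep (mrep N n)"
proof -
  let ?m = "\<lambda>X. op_mat N n n X"
  have c: "?m (gen_op g) * ?m (gen_op g') - ?m (gen_op g') * ?m (gen_op g)
     = ?m (\<lambda>p. gen_op g (gen_op g' p) - gen_op g' (gen_op g p))" for g g'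
    by (simp add: op_mat_diff op_mat_compose[OF lin_gen_op maps_mons_gen_op])
  have "?m (gen_op opH) * ?m (gen_op opX) - ?m (gen_op opX) * ?m (gen_op opH) = 2 \<cdot>\<^sub>m ?m (gen_op opX)"
    "?m (gen_op opH) * ?m (gen_op opY) - ?m (gen_op opY) * ?m (gen_op opH) = (- 2) \<cdot>\<^sub>m ?m (gen_op opY)"
    "?m (gen_op opX) * ?m (gen_op opY) - ?m (gen_op opY) * ?m (gen_op opX) = ?m (gen_op opH)"
    unfolding c op_mat_scale[symmetric]
    by (rule op_mat_cong; rule gen_op_relations[OF span_mons_polys]; assumption)+
  then show ?thesis by (simp add: is_rep_def rep_carrier_def) (simp add: mrep_def)
qed

subsection \<open>Words\<close>

definition wdim :: "nat list \<Rightarrow> nat" where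
  "wdim Ks = (\<Prod>K\<leftarrow>Ks. 2 * K + 1)"

lemma wdim_Nil: "wdim [] = 1"
  and wdim_Cons: "wdim (K # Ks) = (2 * K + 1) * wdim Ks"
  by (simp_all add: wdim_def)

text \<open>The inverse of \<open>widx\<close> on words with labels \<open>Ks\<close>; it turns sums
  over words into sums over matrix indices.\<close>

fun word_of :: "nat list \<Rightarrow> nat \<Rightarrow> var list" where
  "word_of [] k = []"
| "word_of (K # Ks) k = (K, k div wdim Ks) # word_of Ks (k mod wdim Ks)"

lemma wdim_pos: "wdim Ks > 0"
  by (induction Ks) (auto simp: wdim_Nil wdim_Cons)

lemma words_Nil [simp]: "words [] = {[]}"
  by (auto simp: words_def)

lemma Cons_words: "v # w \<in> words (K # Ks) \<longleftrightarrow> fst v = K \<and> snd v \<le> 2 * K \<and> w \<in> words Ks"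
  by (cases v) (auto simp: words_def)

lemma words_Cons_cases:
  assumes "w \<in> words (K # Ks)" obtains n w' where "w = (K, n) # w'" "n \<le> 2 * K" "w' \<in> words Ks"
  using assms by (cases w) (auto simp: words_def)

lemma widx_Cons: "w \<in> words Ks \<Longrightarrow> widx ((K, n) # w) = n * wdim Ks + widx w"
  by (auto simp: words_def split_def comp_def wdim_def)

lemma widx_less: "w \<in> words Ks \<Longrightarrow> widx w < wdim Ks"
proof (induction Ks arbitrary: w)
  case (Cons K Ks)
  then obtain n w' where w: "w = (K, n) # w'" "n \<le> 2 * K" "w' \<in> words Ks" by (auto elim: words_Cons_cases)
  then show ?case using pair_index_less[of n "2 * K + 1" "widx w'" "wdim Ks"] Cons.IH[OF w(3)]
    by (simp only: widx_Cons wdim_Cons)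
qed (simp add: wdim_Nil)

lemma word_of_widx: "w \<in> words Ks \<Longrightarrow> word_of Ks (widx w) = w"
proof (induction Ks arbitrary: w)
  case (Cons K Ks)
  then obtain n w' where w: "w = (K, n) # w'" "n \<le> 2 * K" "w' \<in> words Ks" by (auto elim: words_Cons_cases)
  then show ?case using widx_less[OF w(3)] wdim_pos[of Ks] Cons.IH[OF w(3)]
    by (simp only: widx_Cons word_of.simps) (simp add: add.commute)
qed simp

lemma word_of_words: "k < wdim Ks \<Longrightarrow> word_of Ks k \<in> words Ks"
proof (induction Ks arbitrary: k)
  case (Cons K Ks)
  then have "k div wdim Ks < 2 * K + 1" by (intro less_mult_imp_div_less) (simp only: wdim_Cons)
  then show ?case using Cons wdim_pos[of Ks] by (simp add: Cons_words)
qed simp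

lemma widx_word_of: "k < wdim Ks \<Longrightarrow> widx (word_of Ks k) = k"
proof (induction Ks arbitrary: k)
  case (Cons K Ks)
  have *: "k mod wdim Ks < wdim Ks" using wdim_pos by simp
  show ?case using Cons.IH[OF *] by (simp only: word_of.simps widx_Cons[OF word_of_words[OF *]]) simp
qed (simp add: wdim_Nil)

lemma sum_words: "(\<Sum>w\<in>words Ks. f w) = (\<Sum>k<wdim Ks. f (word_of Ks k))"
  by (rule sum.reindex_bij_witness[of _ "word_of Ks" widx])
    (auto simp: word_of_widx word_of_words widx_word_of widx_less)

lemma length_words: "w \<in> words Ks \<Longrightarrow> length w = length Ks"
  by (auto simp: words_def dest: arg_cong[of _ _ length])

lemma set_words: "w \<in> words Ks \<Longrightarrow> set Ks \<subseteq> {..N} \<Longrightarrow> set w \<subseteq> vars N"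
  by (fastforce simp: words_def vars_def)

lemma mset_words_mons: "w \<in> words Ks \<Longrightarrow> set Ks \<subseteq> {..N} \<Longrightarrow> length Ks \<le> n \<Longrightarrow> mset w \<in> mons N n"
  using set_words[of w Ks N] length_words[of w Ks] by (auto simp: mons_def)

lemma is_rep_tens_list: "is_rep (tens_list Ks)"
  by (induction Ks) (auto simp: tens_list_def is_rep_triv is_rep_tens is_rep_spin)

lemma tens_list_Cons: "tens_list (K # Ks) = tens (spin K) (tens_list Ks)"
  by (simp add: tens_list_def)

lemma rdim_tens_list: "rdim (tens_list Ks) = wdim Ks"
proof (induction Ks)
  case Nil then show ?case by (simp add: tens_list_def triv_def rdim_def wdim_Nil)
next
  case (Cons K Ks)
  then show ?case
    by (simp only: tens_list_Cons rdim_tens is_rep_carrier is_rep_spin is_rep_tens_list wdim_Cons rdim_spin)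
qed

lemma gens_tens_list_carrier: "g \<in> gens \<Longrightarrow> g (tens_list Ks) \<in> carrier_mat (wdim Ks) (wdim Ks)"
  using rep_carrierD[OF is_rep_carrier[OF is_rep_tens_list[of Ks]], of g] by (simp add: rdim_tens_list)

text \<open>The Leibniz rule applied to the first letter has the same two terms as the primitive
  coproduct in \<open>tens_list\<close>. In other words, the passage from words to commutative
  monomials is equivariant.\<close>

lemma gen_op_word:
  assumes "g \<in> gens" "j < wdim Ks"
  shows "gen_op g (mon (mset (word_of Ks j))) = (\<Sum>k<wdim Ks. cmul (g (tens_list Ks) $$ (k, j)) (mon (mset (word_of Ks k))))"
  using assms(2)
proof (induction Ks arbitrary: j)
  case Nil
  have "g triv $$ (0, 0) = 0" using assms(1) by (auto simp: gens_def triv_def)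
  then show ?case using Nil by (simp add: tens_list_def mon_empty wdim_Nil)
next
  case (Cons K Ks)
  let ?D = "wdim Ks" and ?d = "2 * K + 1"
  have "j < ?d * ?D" using Cons.prems by (simp only: wdim_Cons)
  then obtain c d where cd: "c < ?d" "d < ?D" "j = c * ?D + d" by (rule pair_index_cases)
  have wo: "word_of (K # Ks) (a * ?D + b) = (K, a) # word_of Ks b" if "b < ?D" for a b
    using that by simp
  have ent: "g (tens_list (K # Ks)) $$ (a * ?D + b, c * ?D + d) =
     g (spin K) $$ (a, c) * (if b = d then 1 else 0) + (if a = c then 1 else 0) * g (tens_list Ks) $$ (b, d)"
    if "a < ?d" "b < ?D" for a b
    unfolding tens_list_Cons gens_tens[OF rep_carrier_spin is_rep_carrier[OF is_rep_tens_list] assms(1)]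
    using that cd spin_carrier[OF assms(1)] gens_tens_list_carrier[OF assms(1)] by (intro prim_index[of _ ?d])
  have "(\<Sum>k<?d * ?D. cmul (g (tens_list (K # Ks)) $$ (k, j)) (mon (mset (word_of (K # Ks) k))))
     = (\<Sum>a<?d. \<Sum>b<?D. (if b = d then cmul (g (spin K) $$ (a, c)) (mulv (K, a) (mon (mset (word_of Ks d)))) else 0)
        + (if a = c then mulv (K, c) (cmul (g (tens_list Ks) $$ (b, d)) (mon (mset (word_of Ks b)))) else 0))"
    unfolding sum_pair_index cd(3)
    by (intro sum.cong refl) (simp only: lessThan_iff ent wo, auto simp: mulv_mon cmul_add_left mulv_cmul)
  also have "\<dots> = (\<Sum>a<?d. cmul (g (spin K) $$ (a, c)) (mulv (K, a) (mon (mset (word_of Ks d)))))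
      + mulv (K, c) (\<Sum>b<?D. cmul (g (tens_list Ks) $$ (b, d)) (mon (mset (word_of Ks b))))"
  proof -
    have "(\<Sum>a<?d. \<Sum>b<?D. if a = c then f b else 0) = (\<Sum>b<?D. f b)" for f :: "nat \<Rightarrow> mpol"
      using cd(1) by (subst sum.swap) (simp del: sum.lessThan_Suc)
    then show ?thesis
      using cd(2) unfolding sum.distrib lin_sum[OF lin_mulv] by simp
  qed
  also have "\<dots> = gen_op g (mon (mset (word_of (K # Ks) j)))"
    unfolding Cons.IH[OF cd(2), symmetric] cd(3) wo[OF cd(2)]
    by (simp add: mulv_mon[symmetric] gen_op_mulv lessThan_Suc_atMost)
  finally show ?case by (simp only: wdim_Cons)
qed

lemma uhatD: "u \<in> uhat S \<Longrightarrow> S \<rho> \<Longrightarrow> u \<rho> \<in> carrier_mat (rdim \<rho>) (rdim \<rho>)"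
  and uhat_natural: "u \<in> uhat S \<Longrightarrow> S \<rho> \<Longrightarrow> S \<sigma> \<Longrightarrow> intertwiner \<rho> \<sigma> T \<Longrightarrow> T * u \<rho> = u \<sigma> * T"
  by (auto simp: uhat_def)

text \<open>Words are mapped to monomials by an intertwiner \<open>\<iota>\<close>; so the ordering chosen in \<open>act\<close> is
  immaterial.\<close>

lemma act_mrep:
  assumes u: "u \<in> uhat is_rep"
  shows "op_mat N n n (act u) = u (mrep N n)" "maps_mons N n n (act u)"
proof -
  have uc: "u (mrep N n) \<in> carrier_mat (mdim N n) (mdim N n)"
    using uhatD[OF u is_rep_mrep, of N n] by simp
  have main: "act u (mon M) \<in> span_of (mons N n) \<and> (\<forall>i<mdim N n. \<forall>j<mdim N n. mnum N n j = M \<longrightarrow>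
     Poly_Mapping.lookup (act u (mon M)) (mnum N n i) = u (mrep N n) $$ (i, j))" if M: "M \<in> mons N n" for M
  proof -
    define w where "w = (SOME w. mset w = M)"
    have w: "mset w = M" unfolding w_def by (rule someI_ex[OF ex_mset])
    define Ks where "Ks = map fst w"
    have vars: "set w \<subseteq> vars N" using w M by (auto simp: mons_def)
    then have wK: "w \<in> words Ks" "set Ks \<subseteq> {..N}" by (fastforce simp: words_def Ks_def vars_def)+
    have len: "length Ks \<le> n" using w M by (auto simp: Ks_def mons_def)
    let ?D = "wdim Ks"
    define \<iota> where "\<iota> = Matrix.mat (mdim N n) ?D (\<lambda>(i, k). if mset (word_of Ks k) = mnum N n i then 1 else 0 :: complex)"
    have \<iota>: "\<iota> \<in> carrier_mat (mdim N n) ?D" by (simp add: \<iota>_def)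
    have wm: "mset (word_of Ks k) \<in> mons N n" if "k < ?D" for k
      by (rule mset_words_mons[OF word_of_words[OF that] wK(2) len])
    have \<iota>R: "(A * \<iota>) $$ (i, j) = A $$ (i, l)"
      if "A \<in> carrier_mat (mdim N n) (mdim N n)" "i < mdim N n" "j < ?D" "l < mdim N n" "mset (word_of Ks j) = mnum N n l" for A i j l
    proof -
      have "(A * \<iota>) $$ (i, j) = (\<Sum>k<mdim N n. A $$ (i, k) * \<iota> $$ (k, j))"
        using that \<iota> by (intro mat_mult_index)
      also have "\<dots> = (\<Sum>k<mdim N n. if k = l then A $$ (i, l) else 0)"
        using that by (intro sum.cong refl) (auto simp: \<iota>_def mnum_eq_iff)
      finally show ?thesis using that by simp
    qed
    have \<iota>L: "(\<iota> * A) $$ (i, j) = Poly_Mapping.lookup (\<Sum>k<?D. cmul (A $$ (k, j)) (mon (mset (word_of Ks k)))) (mnum N n i)"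
      if "A \<in> carrier_mat ?D ?D" "i < mdim N n" "j < ?D" for A i j
      using that \<iota> by (subst mat_mult_index[of \<iota> "mdim N n" ?D _ ?D])
        (auto intro!: sum.cong simp: \<iota>_def lookup_sum lookup_single when_def)
    have "intertwiner (tens_list Ks) (mrep N n) \<iota>"
      unfolding intertwiner_iff
    proof (intro conjI ballI)
      show "\<iota> \<in> carrier_mat (rdim (mrep N n)) (rdim (tens_list Ks))" using \<iota> by (simp add: rdim_tens_list)
      fix g assume g: "g \<in> gens"
      note gc = gens_tens_list_carrier[OF g, of Ks]
      show "\<iota> * g (tens_list Ks) = g (mrep N n) * \<iota>"
      proof (rule eq_matI)
        fix i j assume "i < dim_row (g (mrep N n) * \<iota>)" "j < dim_col (g (mrep N n) * \<iota>)"
        then have ij: "i < mdim N n" "j < ?D" using \<iota> by (auto simp: gens_mrep[OF g] op_mat_def)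
        obtain l where l: "l < mdim N n" "mset (word_of Ks j) = mnum N n l" using wm[OF ij(2)] by (rule mnum_cases)
        have "(\<iota> * g (tens_list Ks)) $$ (i, j) = op_mat N n n (gen_op g) $$ (i, l)"
          unfolding \<iota>L[OF gc ij] gen_op_word[OF g ij(2), symmetric] using ij l by (simp add: op_mat_index)
        also have "\<dots> = (g (mrep N n) * \<iota>) $$ (i, j)"
          unfolding gens_mrep[OF g] by (rule \<iota>R[symmetric, OF _ ij l]) simp
        finally show "(\<iota> * g (tens_list Ks)) $$ (i, j) = (g (mrep N n) * \<iota>) $$ (i, j)" .
      qed (use \<iota> gc in \<open>auto simp: gens_mrep[OF g] op_mat_def\<close>)
    qed
    then have eq: "\<iota> * u (tens_list Ks) = u (mrep N n) * \<iota>"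
      by (rule uhat_natural[OF u is_rep_tens_list is_rep_mrep])
    have uT: "u (tens_list Ks) \<in> carrier_mat ?D ?D"
      using uhatD[OF u is_rep_tens_list, of Ks] by (simp add: rdim_tens_list)
    have "act u (mon M) = (\<Sum>w'\<in>words Ks. Poly_Mapping.single (mset w') (u (tens_list Ks) $$ (widx w', widx w)))"
      unfolding act_eq_linext linext_mon w_def[symmetric] Let_def Ks_def ..
    also have "\<dots> = (\<Sum>k<?D. cmul (u (tens_list Ks) $$ (k, widx w)) (mon (mset (word_of Ks k))))"
      unfolding sum_words by (intro sum.cong refl) (auto simp: widx_word_of cmul_single)
    finally have a: "act u (mon M) = (\<Sum>k<?D. cmul (u (tens_list Ks) $$ (k, widx w)) (mon (mset (word_of Ks k))))" .
    show ?thesis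
    proof (intro conjI allI impI)
      show "act u (mon M) \<in> span_of (mons N n)"
        unfolding a by (intro span_of_sum span_of_cmul span_of_mon wm) simp
      fix i j assume i: "i < mdim N n" and j: "j < mdim N n" and Mj: "mnum N n j = M"
      have "(\<iota> * u (tens_list Ks)) $$ (i, widx w) = u (mrep N n) $$ (i, j)"
        unfolding eq by (rule \<iota>R[OF uc i widx_less[OF wK(1)] j]) (simp add: word_of_widx[OF wK(1)] w Mj)
      then show "Poly_Mapping.lookup (act u (mon M)) (mnum N n i) = u (mrep N n) $$ (i, j)"
        unfolding a using \<iota>L[OF uT i widx_less[OF wK(1)]] by simp
    qed
  qed
  then show "maps_mons N n n (act u)" by (auto simp: maps_mons_def)
  show "op_mat N n n (act u) = u (mrep N n)"
    using uc main mnum_in op_mat_carrier[of N n n "act u"] by (intro eq_matI) (auto simp: op_mat_index)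
qed

text \<open>The hypothesis on the generators makes the matrix of \<open>\<Theta>\<close> an
  intertwiner between two of the representations \<open>mrep\<close>, and elements of
  \<open>uhat\<close> are natural along intertwiners by definition.\<close>

lemma act_equivariant_mons:
  assumes "u \<in> uhat is_rep" "lin \<Theta>" "maps_mons N n m \<Theta>" "p \<in> span_of (mons N n)"
    and "\<And>g q. g \<in> gens \<Longrightarrow> q \<in> span_of (mons N n) \<Longrightarrow> \<Theta> (gen_op g q) = gen_op g (\<Theta> q)"
  shows "\<Theta> (act u p) = act u (\<Theta> p)"
proof -
  have "intertwiner (mrep N n) (mrep N m) (op_mat N n m \<Theta>)"
    unfolding intertwiner_iff
  proof (intro conjI ballI)
    fix g assume g: "g \<in> gens"
    have "op_mat N n m (\<lambda>p. \<Theta> (gen_op g p)) = op_mat N n m (\<lambda>p. gen_op g (\<Theta> p))"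
      by (rule op_mat_cong) (simp add: assms(5)[OF g])
    then show "op_mat N n m \<Theta> * g (mrep N n) = g (mrep N m) * op_mat N n m \<Theta>"
      unfolding gens_mrep[OF g]
      by (simp add: op_mat_compose[OF assms(2) maps_mons_gen_op] op_mat_compose[OF lin_gen_op assms(3)])
  qed simp
  then have "op_mat N n m \<Theta> * u (mrep N n) = u (mrep N m) * op_mat N n m \<Theta>"
    by (rule uhat_natural[OF assms(1) is_rep_mrep is_rep_mrep])
  then have "op_mat N n m (\<lambda>p. \<Theta> (act u p)) = op_mat N n m (\<lambda>p. act u (\<Theta> p))"
    by (simp add: act_mrep(1)[OF assms(1), symmetric] op_mat_compose[OF assms(2) act_mrep(2)[OF assms(1)]]
        op_mat_compose[OF lin_act assms(3)])
  then show ?thesis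
  proof (rule op_mat_eqD[OF _ _ _ lin_compose[OF assms(2) lin_act] lin_compose[OF lin_act assms(2)] assms(4)])
    show "maps_mons N n m (\<lambda>p. \<Theta> (act u p))" "maps_mons N n m (\<lambda>p. act u (\<Theta> p))"
      using act_mrep(2)[OF assms(1)] assms(3)
      by (auto simp: maps_mons_def intro: maps_monsD[OF assms(3,2)] maps_monsD[OF act_mrep(2)[OF assms(1)] lin_act])
  qed
qed

lemma act_equivariant:
  assumes "u \<in> uhat is_rep" "lin \<Theta>" "p \<in> polys N" "\<And>q. q \<in> polys N \<Longrightarrow> \<Theta> q \<in> polys N"
    and "\<And>g q. g \<in> gens \<Longrightarrow> q \<in> polys N \<Longrightarrow> \<Theta> (gen_op g q) = gen_op g (\<Theta> q)"
  shows "\<Theta> (act u p) = act u (\<Theta> p)"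
proof -
  obtain n where n: "p \<in> span_of (mons N n)" using assms(3) by (rule polys_obtain_mons)
  obtain m where "maps_mons N n m \<Theta>" using assms(4) by (rule polys_maps_mons[of N \<Theta> n 0])
  then show ?thesis
    by (rule act_equivariant_mons[OF assms(1,2) _ n]) (auto intro: assms(5) span_mons_polys)
qed

lemma polys_act: "u \<in> uhat is_rep \<Longrightarrow> p \<in> polys N \<Longrightarrow> act u p \<in> polys N"
  by (metis polys_obtain_mons maps_monsD act_mrep(2) lin_act span_mons_polys)

definition invariant :: "mpol \<Rightarrow> bool" where
  "invariant p \<longleftrightarrow> (\<forall>g\<in>gens. gen_op g p = 0)"

lemma act_mult_invariant:
  assumes "u \<in> uhat is_rep" "p \<in> polys N" "i \<in> polys N" "invariant i"
  shows "act u (i * p) = i * act u p"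
  by (rule act_equivariant[of u "\<lambda>p. i * p" p N, symmetric, OF assms(1) lin_mult_left assms(2) polys_mult[OF assms(3)]])
    (use assms(4) in \<open>auto simp: invariant_def gen_op_mult\<close>)

section \<open>Twisted multiplication\<close>

lemma gens_uhat: "g \<in> gens \<Longrightarrow> g \<in> uhat (is_qrep h)"
  by (auto simp: uhat_def intertwiner_iff rep_carrierD is_qrep_carrier)

text \<open>The powers of q^H have to be treated along with the generators, since they occur in the
  deformed coproducts of X and Y.\<close>

lemma qpow_uhat: "qpow h c \<in> uhat (is_qrep h')"
  by (auto simp: uhat_def intertwiner_def qpow_carrier is_qrep_carrier is_qrep_diagrep intro!: qpow_natural)

text \<open>Pure matrix algebra. \<open>A\<close> is the twist with inverse \<open>B\<close>,
  \<open>P\<close> the flip with inverse \<open>P'\<close>, and \<open>G\<close> the inverse of the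
  flipped twist \<open>P * A * P'\<close>. \<open>S\<close> and \<open>S'\<close> are the values of
  an element on the two orders of the undeformed tensor product, \<open>Q'\<close> its value on the
  flipped deformed one.\<close>

lemma twist_conjugate:
  fixes d :: nat and P P' A B S S' Q' G :: "complex mat"
  assumes c: "P \<in> carrier_mat d d" "P' \<in> carrier_mat d d" "A \<in> carrier_mat d d" "B \<in> carrier_mat d d"
      "S \<in> carrier_mat d d" "S' \<in> carrier_mat d d" "Q' \<in> carrier_mat d d" "G \<in> carrier_mat d d"
    and BA: "B * A = 1\<^sub>m d" and PP: "P * P' = 1\<^sub>m d" "P' * P = 1\<^sub>m d"
    and PQ: "P * (A * S * B) = Q' * P" and PS: "P * S = S' * P"
    and G: "G * (P * A * P') = 1\<^sub>m d" "(P * A * P') * G = 1\<^sub>m d"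
  shows "S' * G = G * Q'"
proof -
  note as = assoc_mult_mat[of _ d d _ d _ d] mult_carrier_mat[of _ d d _ d]
  have can: "X * (Y * Z) = Z" if "X * Y = 1\<^sub>m d" "X \<in> carrier_mat d d" "Y \<in> carrier_mat d d" "Z \<in> carrier_mat d d" for X Y Z :: "complex mat"
    using that by (simp add: as(1)[symmetric])
  define T where "T = P * A * P'"
  have T: "T \<in> carrier_mat d d" using c by (simp add: T_def as(2))
  have "Q' * T = Q' * P * (A * P')" using c by (simp add: T_def as)
  also have "\<dots> = P * (A * S * B) * (A * P')" by (simp add: PQ)
  also have "\<dots> = P * (A * (S * (B * (A * P'))))" using c by (simp add: as)
  also have "B * (A * P') = P'" using c by (intro can[OF BA])
  also have "S * P' = P' * (P * (S * P'))" using c by (intro can[OF PP(2), symmetric]) (auto simp: as(2))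
  also have "P * (S * P') = S' * (P * P')"
    using c by (simp add: assoc_mult_mat[of P d d S d P' d, symmetric] PS assoc_mult_mat[of S' d d P d P' d])
  also have "\<dots> = S'" using c PP by simp
  also have "P * (A * (P' * S')) = T * S'" using c by (simp add: T_def as)
  finally have QT: "Q' * T = T * S'" .
  have "G * Q' = G * (Q' * (T * G))" using c G by (simp add: T_def[symmetric])
  also have "\<dots> = G * ((Q' * T) * G)" using c T by (simp add: as)
  also have "\<dots> = G * (T * (S' * G))" using c T by (simp add: QT as)
  also have "\<dots> = S' * G" using c T G by (intro can) (auto simp: T_def[symmetric] as(2))
  finally show ?thesis ..
qed

section \<open>The twist relation for the flipped coproduct\<close>

locale drinfeld_twist =
  fixes h :: real and \<phi> :: "rep \<Rightarrow> rep" and F :: "rep \<Rightarrow> rep \<Rightarrow> complex mat"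
  assumes iso: "alg_iso h \<phi>" and twist: "is_twist h \<phi> F"
begin

abbreviation "G \<equiv> tilde_inv F"

lemma phi_qrep: "is_rep \<rho> \<Longrightarrow> is_qrep h (\<phi> \<rho>)"
  and rdim_phi: "is_rep \<rho> \<Longrightarrow> rdim (\<phi> \<rho>) = rdim \<rho>"
  and phi_intertwiner: "is_rep \<rho> \<Longrightarrow> is_rep \<sigma> \<Longrightarrow> intertwiner \<rho> \<sigma> T \<Longrightarrow> intertwiner (\<phi> \<rho>) (\<phi> \<sigma>) T"
  using iso by (auto simp: alg_iso_def alg_hom_def)

text \<open>The inverse isomorphism is applied to the intertwiner. This is the way back from
  commuting with the deformed generators to commuting with those of su(2).\<close>

lemma phi_intertwinerD:
  assumes "is_rep \<rho>" "is_rep \<sigma>" "intertwiner (\<phi> \<rho>) (\<phi> \<sigma>) T"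
  shows "intertwiner \<rho> \<sigma> T"
proof -
  obtain \<psi> where \<psi>: "alg_hom (is_qrep h) is_rep \<psi>" "\<And>\<rho>. is_rep \<rho> \<Longrightarrow> \<psi> (\<phi> \<rho>) = \<rho>"
    using iso by (auto simp: alg_iso_def)
  then have "intertwiner (\<psi> (\<phi> \<rho>)) (\<psi> (\<phi> \<sigma>)) T"
    using assms(3) phi_qrep[OF assms(1)] phi_qrep[OF assms(2)] unfolding alg_hom_def by blast
  then show ?thesis using \<psi>(2) assms by simp
qed

lemma phi_carrier: "is_rep \<rho> \<Longrightarrow> rep_carrier (\<phi> \<rho>)"
  and phi_diagrep: "is_rep \<rho> \<Longrightarrow> diagrep (\<phi> \<rho>)"
  using phi_qrep is_qrep_carrier is_qrep_diagrep by blast+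

text \<open>The map \<open>\<phi>\<close> on elements; naturality survives because
  \<open>\<phi>\<close> preserves intertwiners and dimensions of representations.\<close>

lemma pullback_uhat: "u \<in> uhat (is_qrep h) \<Longrightarrow> (\<lambda>\<rho>. u (\<phi> \<rho>)) \<in> uhat is_rep"
  using phi_qrep rdim_phi phi_intertwiner by (fastforce simp: uhat_def)

lemma F_carrier: "is_rep \<rho> \<Longrightarrow> is_rep \<sigma> \<Longrightarrow> F \<rho> \<sigma> \<in> carrier_mat (rdim \<rho> * rdim \<sigma>) (rdim \<rho> * rdim \<sigma>)"
  using twist by (auto simp: is_twist_def uhat2_def)

lemma F_invertible: "is_rep \<rho> \<Longrightarrow> is_rep \<sigma> \<Longrightarrow> minvertible (F \<rho> \<sigma>)"
  using twist by (auto simp: is_twist_def)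

lemma F_natural_left:
  assumes "is_rep \<rho>" "is_rep \<rho>'" "is_rep \<sigma>" "intertwiner \<rho> \<rho>' T"
  shows "kron T (1\<^sub>m (rdim \<sigma>)) * F \<rho> \<sigma> = F \<rho>' \<sigma> * kron T (1\<^sub>m (rdim \<sigma>))"
proof -
  have "intertwiner \<sigma> \<sigma> (1\<^sub>m (rdim \<sigma>))"
    using assms(3) by (auto simp: intertwiner_def is_rep_def rep_carrier_def)
  then show ?thesis using twist assms by (auto simp: is_twist_def uhat2_def)
qed

lemma F_twist: "is_rep \<rho> \<Longrightarrow> is_rep \<sigma> \<Longrightarrow> u \<in> uhat (is_qrep h) \<Longrightarrow>
    u (qtens h (\<phi> \<rho>) (\<phi> \<sigma>)) = F \<rho> \<sigma> * u (\<phi> (tens \<rho> \<sigma>)) * minv (F \<rho> \<sigma>)"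
  using twist by (auto simp: is_twist_def uinv2_def)

lemma swap_inverse:
  "swap_mat m n * swap_mat n m = 1\<^sub>m (m * n)" "swap_mat n m * swap_mat m n = 1\<^sub>m (m * n)"
  using swap_mat_inverse[of n m] swap_mat_inverse[of m n] by (simp_all only: mult.commute[of n m])

lemma G_inverse:
  assumes "is_rep \<rho>" "is_rep \<sigma>"
  defines "d \<equiv> rdim \<sigma> * rdim \<rho>"
  shows "G \<rho> \<sigma> \<in> carrier_mat d d" "flip2 F \<rho> \<sigma> \<in> carrier_mat d d"
    "flip2 F \<rho> \<sigma> * G \<rho> \<sigma> = 1\<^sub>m d" "G \<rho> \<sigma> * flip2 F \<rho> \<sigma> = 1\<^sub>m d"
proof -
  let ?P = "swap_mat (rdim \<sigma>) (rdim \<rho>)" and ?P' = "swap_mat (rdim \<rho>) (rdim \<sigma>)"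
  let ?A = "F \<sigma> \<rho>" and ?B = "minv (F \<sigma> \<rho>)"
  note as = assoc_mult_mat[of _ d d _ d _ d] mult_carrier_mat[of _ d d _ d]
  have c: "?P \<in> carrier_mat d d" "?P' \<in> carrier_mat d d" "?A \<in> carrier_mat d d"
    using swap_mat_carrier[of "rdim \<sigma>" "rdim \<rho>"] swap_mat_carrier[of "rdim \<rho>" "rdim \<sigma>"] F_carrier[OF assms(2,1)]
    by (simp_all add: d_def mult.commute)
  note B = minv_inverse[OF c(3) F_invertible[OF assms(2,1)]]
  have PP: "?P * ?P' = 1\<^sub>m d" "?P' * ?P = 1\<^sub>m d" by (simp_all add: swap_inverse d_def mult.commute)
  have can: "X * (Y * Z) = Z" if "X * Y = 1\<^sub>m d" "X \<in> carrier_mat d d" "Y \<in> carrier_mat d d" "Z \<in> carrier_mat d d" for X Y Z :: "complex mat"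
    using that by (simp add: as(1)[symmetric])
  have fl: "flip2 F \<rho> \<sigma> = ?P * ?A * ?P'" by (rule flip2_eq[of F \<sigma> \<rho>, OF F_carrier[OF assms(2,1)]])
  show fc: "flip2 F \<rho> \<sigma> \<in> carrier_mat d d" unfolding fl using c by (simp add: as(2))
  have "(?P * X * ?P') * (?P * Y * ?P') = 1\<^sub>m d" if "X * Y = 1\<^sub>m d" "X \<in> carrier_mat d d" "Y \<in> carrier_mat d d" for X Y
  proof -
    have "(?P * X * ?P') * (?P * Y * ?P') = ?P * (X * (?P' * (?P * (Y * ?P'))))" using c that by (simp add: as)
    also have "?P' * (?P * (Y * ?P')) = Y * ?P'" using c that by (intro can[OF PP(2)]) (auto simp: as(2))
    also have "X * (Y * ?P') = ?P'" using c that by (intro can)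
    finally show ?thesis by (simp add: PP)
  qed
  from this[OF B(2) c(3) B(1)] this[OF B(3) B(1) c(3)]
  have "minvertible (flip2 F \<rho> \<sigma>)"
    using c fc B(1) unfolding minvertible_def inverts_mat_def fl
    by (intro exI[of _ "?P * ?B * ?P'"]) (auto simp: as(2))
  from minv_inverse[OF fc this] show "G \<rho> \<sigma> \<in> carrier_mat d d" "flip2 F \<rho> \<sigma> * G \<rho> \<sigma> = 1\<^sub>m d" "G \<rho> \<sigma> * flip2 F \<rho> \<sigma> = 1\<^sub>m d"
    by (simp_all add: tilde_inv_def uinv2_def)
qed

text \<open>Cocommutativity of the undeformed coproduct. For the deformed one the same flip leads
  from \<open>qtens\<close> to \<open>qtens_flip\<close>.\<close>

lemma swap_intertwiner:
  assumes "is_rep \<rho>" "is_rep \<sigma>"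
  shows "intertwiner (tens \<sigma> \<rho>) (tens \<rho> \<sigma>) (swap_mat (rdim \<sigma>) (rdim \<rho>))"
  unfolding intertwiner_iff
proof (intro conjI ballI)
  note c = is_rep_carrier[OF assms(1)] is_rep_carrier[OF assms(2)]
  let ?m = "rdim \<sigma>" and ?n = "rdim \<rho>"
  show "swap_mat ?m ?n \<in> carrier_mat (rdim (tens \<rho> \<sigma>)) (rdim (tens \<sigma> \<rho>))"
    by (simp add: rdim_tens c)
  fix g assume g: "g \<in> gens"
  note gc = rep_carrierD[OF c(1) g] rep_carrierD[OF c(2) g]
  have "swap_mat ?m ?n * prim (g \<sigma>) (g \<rho>) = swap_mat ?m ?n * kron (g \<sigma>) (1\<^sub>m ?n) + swap_mat ?m ?n * kron (1\<^sub>m ?m) (g \<rho>)"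
    unfolding prim_def using gc by (simp add: mult_add_distrib_mat[of _ "?n * ?m" "?m * ?n" _ "?m * ?n"])
  also have "\<dots> = kron (1\<^sub>m ?n) (g \<sigma>) * swap_mat ?m ?n + kron (g \<rho>) (1\<^sub>m ?m) * swap_mat ?m ?n"
    using gc by (simp add: swap_mat_kron[of _ ?m ?m _ ?n ?n])
  also have "\<dots> = (kron (1\<^sub>m ?n) (g \<sigma>) + kron (g \<rho>) (1\<^sub>m ?m)) * swap_mat ?m ?n"
    using gc by (intro add_mult_distrib_mat[symmetric, of _ "?n * ?m" "?n * ?m" _ _ "?m * ?n"]) auto
  also have "kron (1\<^sub>m ?n) (g \<sigma>) + kron (g \<rho>) (1\<^sub>m ?m) = prim (g \<rho>) (g \<sigma>)"
    unfolding prim_def using gc by (simp add: comm_add_mat[of _ "?n * ?m" "?n * ?m"])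
  finally show "swap_mat ?m ?n * g (tens \<sigma> \<rho>) = g (tens \<rho> \<sigma>) * swap_mat ?m ?n"
    by (simp add: gens_tens[OF _ _ g] c)
qed

text \<open>The twist relation conjugated by the flip: the undeformed coproduct of
  \<open>\<phi>(u)\<close> passes through the inverse of the flipped twist and becomes the flipped
  deformed coproduct of \<open>u\<close>. The last hypothesis would be an instance of naturality if
  \<open>qtens\<close> and \<open>qtens_flip\<close> were known to satisfy \<open>is_qrep\<close>;
  instead it is verified for each element in use.\<close>

lemma G_twist:
  assumes "is_rep \<rho>" "is_rep \<sigma>" "u \<in> uhat (is_qrep h)"
    and "u (qtens_flip h (\<phi> \<rho>) (\<phi> \<sigma>)) \<in> carrier_mat (rdim \<rho> * rdim \<sigma>) (rdim \<rho> * rdim \<sigma>)"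
    and "swap_mat (rdim \<sigma>) (rdim \<rho>) * u (qtens h (\<phi> \<sigma>) (\<phi> \<rho>)) = u (qtens_flip h (\<phi> \<rho>) (\<phi> \<sigma>)) * swap_mat (rdim \<sigma>) (rdim \<rho>)"
  shows "u (\<phi> (tens \<rho> \<sigma>)) * G \<rho> \<sigma> = G \<rho> \<sigma> * u (qtens_flip h (\<phi> \<rho>) (\<phi> \<sigma>))"
proof -
  define d where "d = rdim \<sigma> * rdim \<rho>"
  let ?P = "swap_mat (rdim \<sigma>) (rdim \<rho>)" and ?P' = "swap_mat (rdim \<rho>) (rdim \<sigma>)"
  note r = assms(1,2)
  have uc: "u (\<phi> (tens \<rho>' \<sigma>')) \<in> carrier_mat (rdim \<rho>' * rdim \<sigma>') (rdim \<rho>' * rdim \<sigma>')" if "is_rep \<rho>'" "is_rep \<sigma>'" for \<rho>' \<sigma>'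
    using uhatD[OF pullback_uhat[OF assms(3)] is_rep_tens[OF that]] that by (simp add: rdim_tens is_rep_carrier)
  have c: "?P \<in> carrier_mat d d" "?P' \<in> carrier_mat d d" "F \<sigma> \<rho> \<in> carrier_mat d d"
    "u (\<phi> (tens \<sigma> \<rho>)) \<in> carrier_mat d d" "u (\<phi> (tens \<rho> \<sigma>)) \<in> carrier_mat d d"
    "u (qtens_flip h (\<phi> \<rho>) (\<phi> \<sigma>)) \<in> carrier_mat d d"
    using swap_mat_carrier[of "rdim \<sigma>" "rdim \<rho>"] swap_mat_carrier[of "rdim \<rho>" "rdim \<sigma>"] F_carrier[OF r(2,1)]
      uc[OF r] uc[OF r(2,1)] assms(4)
    by (simp_all add: d_def mult.commute)
  note B = minv_inverse[OF c(3) F_invertible[OF r(2,1)]]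
  note Gi = G_inverse[OF r, folded d_def]
  have fl: "flip2 F \<rho> \<sigma> = ?P * F \<sigma> \<rho> * ?P'" by (rule flip2_eq[of F \<sigma> \<rho>, OF F_carrier[OF r(2,1)]])
  show ?thesis
  proof (rule twist_conjugate[OF c(1-3) B(1) c(4-6) Gi(1) B(3)])
    show "?P * ?P' = 1\<^sub>m d" "?P' * ?P = 1\<^sub>m d" by (simp_all add: swap_inverse d_def mult.commute)
    show "?P * (F \<sigma> \<rho> * u (\<phi> (tens \<sigma> \<rho>)) * minv (F \<sigma> \<rho>)) = u (qtens_flip h (\<phi> \<rho>) (\<phi> \<sigma>)) * ?P"
      using assms(5) F_twist[OF r(2,1) assms(3)] by simp
    show "?P * u (\<phi> (tens \<sigma> \<rho>)) = u (\<phi> (tens \<rho> \<sigma>)) * ?P"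
      by (rule uhat_natural[OF pullback_uhat[OF assms(3)] is_rep_tens is_rep_tens swap_intertwiner]) (rule r)+
    show "G \<rho> \<sigma> * (?P * F \<sigma> \<rho> * ?P') = 1\<^sub>m d" "?P * F \<sigma> \<rho> * ?P' * G \<rho> \<sigma> = 1\<^sub>m d"
      using Gi fl by simp_all
  qed
qed

lemma G_twist_XY:
  assumes "is_rep \<rho>" "is_rep \<sigma>" "g \<in> {opX, opY}"
  shows "g (\<phi> (tens \<rho> \<sigma>)) * G \<rho> \<sigma> = G \<rho> \<sigma> *
    (kron (g (\<phi> \<rho>)) (qpow h (- 1/2) (\<phi> \<sigma>)) + kron (qpow h (1/2) (\<phi> \<rho>)) (g (\<phi> \<sigma>)))"
proof -
  have g: "g \<in> gens" using assms(3) by (auto simp: gens_def)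
  let ?m = "rdim \<sigma>" and ?n = "rdim \<rho>"
  note c = phi_carrier[OF assms(1)] phi_carrier[OF assms(2)]
  have cc: "g (\<phi> \<rho>) \<in> carrier_mat ?n ?n" "g (\<phi> \<sigma>) \<in> carrier_mat ?m ?m"
    "qpow h a (\<phi> \<rho>) \<in> carrier_mat ?n ?n" "qpow h a (\<phi> \<sigma>) \<in> carrier_mat ?m ?m" for a
    using rep_carrierD[OF c(1) g] rep_carrierD[OF c(2) g] qpow_carrier[OF c(1), of h a] qpow_carrier[OF c(2), of h a]
    by (simp_all add: rdim_phi assms)
  have "swap_mat ?m ?n * g (qtens h (\<phi> \<sigma>) (\<phi> \<rho>)) = swap_mat ?m ?n * kron (g (\<phi> \<sigma>)) (qpow h (1/2) (\<phi> \<rho>))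
      + swap_mat ?m ?n * kron (qpow h (- 1/2) (\<phi> \<sigma>)) (g (\<phi> \<rho>))"
    unfolding opXY_qtens[OF assms(3)] using cc by (intro mult_add_distrib_mat[of _ "?n * ?m" "?m * ?n" _ "?m * ?n"]) auto
  also have "\<dots> = kron (qpow h (1/2) (\<phi> \<rho>)) (g (\<phi> \<sigma>)) * swap_mat ?m ?n + kron (g (\<phi> \<rho>)) (qpow h (- 1/2) (\<phi> \<sigma>)) * swap_mat ?m ?n"
    using cc by (simp only: swap_mat_kron[of _ ?m ?m _ ?n ?n])
  also have "\<dots> = (kron (qpow h (1/2) (\<phi> \<rho>)) (g (\<phi> \<sigma>)) + kron (g (\<phi> \<rho>)) (qpow h (- 1/2) (\<phi> \<sigma>))) * swap_mat ?m ?n"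
    using cc by (intro add_mult_distrib_mat[symmetric, of _ "?n * ?m" "?n * ?m" _ _ "?m * ?n"]) auto
  also have "kron (qpow h (1/2) (\<phi> \<rho>)) (g (\<phi> \<sigma>)) + kron (g (\<phi> \<rho>)) (qpow h (- 1/2) (\<phi> \<sigma>)) = g (qtens_flip h (\<phi> \<rho>) (\<phi> \<sigma>))"
    unfolding opXY_qtens_flip[OF assms(3)] using cc by (intro comm_add_mat[of _ "?n * ?m" "?n * ?m"]) auto
  finally have sw: "swap_mat ?m ?n * g (qtens h (\<phi> \<sigma>) (\<phi> \<rho>)) = g (qtens_flip h (\<phi> \<rho>) (\<phi> \<sigma>)) * swap_mat ?m ?n" .
  show ?thesis
    unfolding opXY_qtens_flip[OF assms(3), symmetric]
    by (rule G_twist[OF assms(1,2) gens_uhat[OF g] _ sw])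
      (use cc in \<open>auto simp: opXY_qtens_flip[OF assms(3)] intro!: add_carrier_mat kron_carrier\<close>)
qed

lemma G_twist_H:
  assumes "is_rep \<rho>" "is_rep \<sigma>"
  shows "opH (\<phi> (tens \<rho> \<sigma>)) * G \<rho> \<sigma> = G \<rho> \<sigma> *
    (kron (opH (\<phi> \<rho>)) (1\<^sub>m (rdim \<sigma>)) + kron (1\<^sub>m (rdim \<rho>)) (opH (\<phi> \<sigma>)))"
proof -
  have g: "opH \<in> gens" by (auto simp: gens_def)
  let ?m = "rdim \<sigma>" and ?n = "rdim \<rho>"
  note c = phi_carrier[OF assms(1)] phi_carrier[OF assms(2)]
  have cc: "opH (\<phi> \<rho>) \<in> carrier_mat ?n ?n" "opH (\<phi> \<sigma>) \<in> carrier_mat ?m ?m"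
    using rep_carrierD[OF c(1) g] rep_carrierD[OF c(2) g] by (simp_all add: rdim_phi assms)
  have "swap_mat ?m ?n * prim (opH (\<phi> \<sigma>)) (opH (\<phi> \<rho>)) = swap_mat ?m ?n * kron (opH (\<phi> \<sigma>)) (1\<^sub>m ?n)
      + swap_mat ?m ?n * kron (1\<^sub>m ?m) (opH (\<phi> \<rho>))"
    unfolding prim_def using cc by (simp add: mult_add_distrib_mat[of _ "?n * ?m" "?m * ?n" _ "?m * ?n"])
  also have "\<dots> = kron (1\<^sub>m ?n) (opH (\<phi> \<sigma>)) * swap_mat ?m ?n + kron (opH (\<phi> \<rho>)) (1\<^sub>m ?m) * swap_mat ?m ?n"
    using cc by (simp add: swap_mat_kron[of _ ?m ?m _ ?n ?n])
  also have "\<dots> = (kron (1\<^sub>m ?n) (opH (\<phi> \<sigma>)) + kron (opH (\<phi> \<rho>)) (1\<^sub>m ?m)) * swap_mat ?m ?n"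
    using cc by (intro add_mult_distrib_mat[symmetric, of _ "?n * ?m" "?n * ?m" _ _ "?m * ?n"]) auto
  also have "kron (1\<^sub>m ?n) (opH (\<phi> \<sigma>)) + kron (opH (\<phi> \<rho>)) (1\<^sub>m ?m) = prim (opH (\<phi> \<rho>)) (opH (\<phi> \<sigma>))"
    unfolding prim_def using cc by (simp add: comm_add_mat[of _ "?n * ?m" "?n * ?m"])
  finally have sw: "swap_mat ?m ?n * opH (qtens h (\<phi> \<sigma>) (\<phi> \<rho>)) = opH (qtens_flip h (\<phi> \<rho>) (\<phi> \<sigma>)) * swap_mat ?m ?n"
    by (simp add: opH_qtens c)
  have e: "kron (opH (\<phi> \<rho>)) (1\<^sub>m ?m) + kron (1\<^sub>m ?n) (opH (\<phi> \<sigma>)) = opH (qtens_flip h (\<phi> \<rho>) (\<phi> \<sigma>))"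
    using cc by (simp add: opH_qtens c prim_def)
  show ?thesis
    unfolding e by (rule G_twist[OF assms gens_uhat[OF g] _ sw]) (use cc in \<open>simp add: opH_qtens c\<close>)
qed

lemma G_twist_qpow:
  assumes "is_rep \<rho>" "is_rep \<sigma>"
  shows "qpow h a (\<phi> (tens \<rho> \<sigma>)) * G \<rho> \<sigma> = G \<rho> \<sigma> * kron (qpow h a (\<phi> \<rho>)) (qpow h a (\<phi> \<sigma>))"
proof -
  let ?m = "rdim \<sigma>" and ?n = "rdim \<rho>"
  note c = phi_carrier[OF assms(1)] phi_carrier[OF assms(2)]
  note d = phi_diagrep[OF assms(1)] phi_diagrep[OF assms(2)]
  have cc: "qpow h a (\<phi> \<rho>) \<in> carrier_mat ?n ?n" "qpow h a (\<phi> \<sigma>) \<in> carrier_mat ?m ?m"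
    using qpow_carrier[OF c(1), of h a] qpow_carrier[OF c(2), of h a] by (simp_all add: rdim_phi assms)
  have e: "qpow h a (qtens_flip h (\<phi> \<rho>) (\<phi> \<sigma>)) = kron (qpow h a (\<phi> \<rho>)) (qpow h a (\<phi> \<sigma>))"
    by (rule qpow_prim[OF d]) (simp add: opH_qtens c)
  have e': "qpow h a (qtens h (\<phi> \<sigma>) (\<phi> \<rho>)) = kron (qpow h a (\<phi> \<sigma>)) (qpow h a (\<phi> \<rho>))"
    by (rule qpow_prim[OF d(2,1)]) (simp add: opH_qtens c)
  show ?thesis unfolding e[symmetric]
    by (rule G_twist[OF assms qpow_uhat]) (use cc in \<open>auto simp: e e' swap_mat_kron[of _ ?m ?m _ ?n ?n]\<close>)
qed

text \<open>Flipping turns naturality of the twist in its first argument into naturality of the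
  flipped twist in its second, and passing to inverses preserves it.\<close>

lemma G_natural:
  assumes "is_rep \<rho>" "is_rep \<sigma>" "is_rep \<sigma>'" "intertwiner \<sigma> \<sigma>' T"
  shows "kron (1\<^sub>m (rdim \<rho>)) T * G \<rho> \<sigma> = G \<rho> \<sigma>' * kron (1\<^sub>m (rdim \<rho>)) T"
proof -
  let ?n = "rdim \<rho>" and ?m = "rdim \<sigma>" and ?m' = "rdim \<sigma>'"
  define d d' where "d = ?m * ?n" and "d' = ?m' * ?n"
  have T: "T \<in> carrier_mat ?m' ?m" using assms(4) by (simp add: intertwiner_def)
  let ?K = "kron (1\<^sub>m ?n) T" and ?L = "kron T (1\<^sub>m ?n)"
  let ?P = "swap_mat ?m ?n" and ?Q = "swap_mat ?n ?m" and ?P' = "swap_mat ?m' ?n" and ?Q' = "swap_mat ?n ?m'"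
  have KL: "?K \<in> carrier_mat d' d" "?L \<in> carrier_mat d' d"
    using kron_carrier[OF one_carrier_mat[of ?n] T] kron_carrier[OF T one_carrier_mat[of ?n]]
    by (simp_all add: d_def d'_def mult.commute)
  have c: "?P \<in> carrier_mat d d" "?Q \<in> carrier_mat d d" "?P' \<in> carrier_mat d' d'" "?Q' \<in> carrier_mat d' d'"
    "F \<sigma> \<rho> \<in> carrier_mat d d" "F \<sigma>' \<rho> \<in> carrier_mat d' d'"
    using swap_mat_carrier[of ?m ?n] swap_mat_carrier[of ?n ?m] swap_mat_carrier[of ?m' ?n] swap_mat_carrier[of ?n ?m']
      F_carrier[OF assms(2,1)] F_carrier[OF assms(3,1)]
    by (simp_all add: d_def d'_def mult.commute)
  note Gi = G_inverse[OF assms(1,2), folded d_def] and Gi' = G_inverse[OF assms(1,3), folded d'_def]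
  have s: "?P' * ?L = ?K * ?P" "?Q' * ?K = ?L * ?Q"
    by (rule swap_mat_kron[OF T one_carrier_mat] swap_mat_kron[OF one_carrier_mat T])+
  have fn: "?L * F \<sigma> \<rho> = F \<sigma>' \<rho> * ?L" by (rule F_natural_left[OF assms(2,3,1,4)])
  note as = assoc_mult_mat[of _ d' d _ d _ d] assoc_mult_mat[of _ d' d' _ d _ d] assoc_mult_mat[of _ d' d' _ d' _ d]
    mult_carrier_mat[of _ d d _ d] mult_carrier_mat[of _ d' d' _ d'] mult_carrier_mat[of _ d' d _ d] mult_carrier_mat[of _ d' d' _ d]
  have "?K * flip2 F \<rho> \<sigma> = (?K * ?P) * (F \<sigma> \<rho> * ?Q)"
    unfolding flip2_eq[of F \<sigma> \<rho>, OF F_carrier[OF assms(2,1)]] using c KL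
    by (simp add: assoc_mult_mat[of _ d d _ d _ d] assoc_mult_mat[of _ d' d _ d _ d] as(4))
  also have "\<dots> = ?P' * ((?L * F \<sigma> \<rho>) * ?Q)"
    using c KL by (simp add: s(1)[symmetric] assoc_mult_mat[of _ d' d' _ d _ d] assoc_mult_mat[of _ d' d _ d _ d] as(4-7))
  also have "\<dots> = ?P' * (F \<sigma>' \<rho> * (?L * ?Q))"
    using c KL by (simp add: fn assoc_mult_mat[of _ d' d' _ d _ d])
  also have "\<dots> = (?P' * F \<sigma>' \<rho> * ?Q') * ?K"
    using c KL by (simp add: s(2)[symmetric] assoc_mult_mat[of _ d' d' _ d' _ d] as(4-7))
  finally have fl: "?K * flip2 F \<rho> \<sigma> = flip2 F \<rho> \<sigma>' * ?K"
    unfolding flip2_eq[of F \<sigma>' \<rho>, OF F_carrier[OF assms(3,1)]] .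
  have "?K * G \<rho> \<sigma> = G \<rho> \<sigma>' * (flip2 F \<rho> \<sigma>' * (?K * G \<rho> \<sigma>))"
    using Gi Gi' KL by (simp add: assoc_mult_mat[of _ d' d' _ d' _ d, symmetric] as(6) left_mult_one_mat[of _ d' d])
  also have "flip2 F \<rho> \<sigma>' * (?K * G \<rho> \<sigma>) = ?K * (flip2 F \<rho> \<sigma> * G \<rho> \<sigma>)"
    using Gi(1,2) Gi'(2) KL(1) by (simp add: assoc_mult_mat[of "flip2 F \<rho> \<sigma>'" d' d' ?K d _ d, symmetric] fl[symmetric]
      assoc_mult_mat[of ?K d' d "flip2 F \<rho> \<sigma>" d _ d])
  finally show ?thesis using Gi by (simp add: right_mult_one_mat[OF KL(1)])
qed

text \<open>A Kronecker product of the identity with \<open>T\<close> acts inside the blocks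
  belonging to the first tensor factor. Comparing single blocks in \<open>G_natural\<close>
  therefore gives naturality of each slice, so the slices are legitimate arguments of
  \<open>act\<close>.\<close>

lemma slice_uhat:
  assumes "m \<le> 2 * K" "n \<le> 2 * K"
  shows "slice G K m n \<in> uhat is_rep"
  unfolding uhat_def
proof (intro CollectI conjI allI impI)
  show "slice G K m n \<rho> \<in> carrier_mat (rdim \<rho>) (rdim \<rho>)" for \<rho> by (simp add: slice_def)
  fix \<sigma> \<sigma>' T assume r: "is_rep \<sigma>" "is_rep \<sigma>'" "intertwiner \<sigma> \<sigma>' T"
  then have T: "T \<in> carrier_mat (rdim \<sigma>') (rdim \<sigma>)" by (simp add: intertwiner_def)
  let ?d = "2 * K + 1" and ?D = "rdim \<sigma>" and ?D' = "rdim \<sigma>'"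
  have Gc: "G (spin K) \<sigma> \<in> carrier_mat (?d * ?D) (?d * ?D)" "G (spin K) \<sigma>' \<in> carrier_mat (?d * ?D') (?d * ?D')"
    using G_inverse(1)[OF is_rep_spin r(1)] G_inverse(1)[OF is_rep_spin r(2)] by (simp_all only: rdim_spin mult.commute)
  have K: "kron (1\<^sub>m ?d) T \<in> carrier_mat (?d * ?D') (?d * ?D)" using T by (intro kron_carrier) auto
  have mn: "m < ?d" "n < ?d" using assms by auto
  show "T * slice G K m n \<sigma> = slice G K m n \<sigma>' * T"
  proof (rule eq_matI)
    fix i j assume "i < dim_row (slice G K m n \<sigma>' * T)" "j < dim_col (slice G K m n \<sigma>' * T)"
    then have ij: "i < ?D'" "j < ?D" using T by (auto simp: slice_def)
    have "(kron (1\<^sub>m ?d) T * G (spin K) \<sigma>) $$ (m * ?D' + i, n * ?D + j)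
      = (\<Sum>k<?d * ?D. kron (1\<^sub>m ?d) T $$ (m * ?D' + i, k) * G (spin K) \<sigma> $$ (k, n * ?D + j))"
      using ij mn by (intro mat_mult_index[OF K Gc(1)] pair_index_less)
    also have "\<dots> = (\<Sum>a<?d. if a = m then (\<Sum>b<?D. T $$ (i, b) * G (spin K) \<sigma> $$ (a * ?D + b, n * ?D + j)) else 0)"
      unfolding sum_pair_index using ij mn T by (intro sum.cong refl) (auto simp: kron_index[OF one_carrier_mat T])
    also have "\<dots> = (\<Sum>b<?D. T $$ (i, b) * G (spin K) \<sigma> $$ (m * ?D + b, n * ?D + j))" using mn by (simp del: sum.lessThan_Suc)
    also have "\<dots> = (T * slice G K m n \<sigma>) $$ (i, j)"
      using ij T by (subst mat_mult_index[OF T, of _ ?D]) (auto simp: slice_def)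
    finally have L: "(kron (1\<^sub>m ?d) T * G (spin K) \<sigma>) $$ (m * ?D' + i, n * ?D + j) = (T * slice G K m n \<sigma>) $$ (i, j)" .
    have "(G (spin K) \<sigma>' * kron (1\<^sub>m ?d) T) $$ (m * ?D' + i, n * ?D + j)
      = (\<Sum>k<?d * ?D'. G (spin K) \<sigma>' $$ (m * ?D' + i, k) * kron (1\<^sub>m ?d) T $$ (k, n * ?D + j))"
      using ij mn by (intro mat_mult_index[OF Gc(2) K] pair_index_less)
    also have "\<dots> = (\<Sum>a<?d. if a = n then (\<Sum>b<?D'. G (spin K) \<sigma>' $$ (m * ?D' + i, a * ?D' + b) * T $$ (b, j)) else 0)"
      unfolding sum_pair_index using ij mn T by (intro sum.cong refl) (auto simp: kron_index[OF one_carrier_mat T])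
    also have "\<dots> = (\<Sum>b<?D'. G (spin K) \<sigma>' $$ (m * ?D' + i, n * ?D' + b) * T $$ (b, j))" using mn by (simp del: sum.lessThan_Suc)
    also have "\<dots> = (slice G K m n \<sigma>' * T) $$ (i, j)"
      using ij T by (subst mat_mult_index[of _ ?D' ?D' T ?D]) (auto simp: slice_def)
    finally have R: "(G (spin K) \<sigma>' * kron (1\<^sub>m ?d) T) $$ (m * ?D' + i, n * ?D + j) = (slice G K m n \<sigma>' * T) $$ (i, j)" .
    show "(T * slice G K m n \<sigma>) $$ (i, j) = (slice G K m n \<sigma>' * T) $$ (i, j)"
      using G_natural[OF is_rep_spin r, of K] unfolding L[symmetric] R[symmetric] by (simp only: rdim_spin)
  qed (use T in \<open>auto simp: slice_def\<close>)
qed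

end

section \<open>Covariance of twisted multiplication under the deformed algebra\<close>

definition mul_mat :: "nat \<Rightarrow> nat \<Rightarrow> nat \<Rightarrow> complex mat" where
  "mul_mat N n K = Matrix.mat (mdim N (Suc n)) ((2 * K + 1) * mdim N n) (\<lambda>(i, j).
     Poly_Mapping.lookup (mulv (K, j div mdim N n) (mon (mnum N n (j mod mdim N n)))) (mnum N (Suc n) i))"

lemma mul_mat_carrier [simp]: "mul_mat N n K \<in> carrier_mat (mdim N (Suc n)) ((2 * K + 1) * mdim N n)"
  by (simp add: mul_mat_def)

lemma mul_mat_index:
  assumes "i < mdim N (Suc n)" "a < 2 * K + 1" "b < mdim N n"
  shows "mul_mat N n K $$ (i, a * mdim N n + b) = Poly_Mapping.lookup (mulv (K, a) (mon (mnum N n b))) (mnum N (Suc n) i)"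
  using assms pair_index_less[OF assms(2,3)] by (simp add: mul_mat_def)

lemma mulv_span_mons:
  assumes "K \<le> N" "a \<le> 2 * K" "p \<in> span_of (mons N n)"
  shows "mulv (K, a) p \<in> span_of (mons N (Suc n))"
  by (rule lin_span_of[OF lin_mulv assms(3)]) (use assms in \<open>auto simp: mulv_mon mons_def intro!: span_of_mon\<close>)

lemma mul_mat_mult_index:
  assumes "A \<in> carrier_mat ((2 * K + 1) * mdim N n) q" "i < mdim N (Suc n)" "j < q"
  shows "(mul_mat N n K * A) $$ (i, j) = Poly_Mapping.lookup (\<Sum>a<2 * K + 1. \<Sum>b<mdim N n.
      cmul (A $$ (a * mdim N n + b, j)) (mulv (K, a) (mon (mnum N n b)))) (mnum N (Suc n) i)"
proof -
  have "(mul_mat N n K * A) $$ (i, j) = (\<Sum>k<(2 * K + 1) * mdim N n. mul_mat N n K $$ (i, k) * A $$ (k, j))"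
    by (rule mat_mult_index[OF mul_mat_carrier assms])
  also have "\<dots> = (\<Sum>a<2 * K + 1. \<Sum>b<mdim N n. A $$ (a * mdim N n + b, j) *
      Poly_Mapping.lookup (mulv (K, a) (mon (mnum N n b))) (mnum N (Suc n) i))"
    unfolding sum_pair_index using assms by (intro sum.cong refl) (simp only: mul_mat_index lessThan_iff mult.commute)
  finally show ?thesis by (simp add: lookup_sum del: sum.lessThan_Suc)
qed

lemma mult_mul_mat_index:
  assumes "lin X" "i < mdim N (Suc n)" "c < 2 * K + 1" "d < mdim N n" "K \<le> N"
  shows "(op_mat N (Suc n) (Suc n) X * mul_mat N n K) $$ (i, c * mdim N n + d)
    = Poly_Mapping.lookup (X (mulv (K, c) (mon (mnum N n d)))) (mnum N (Suc n) i)"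
proof -
  let ?p = "mulv (K, c) (mon (mnum N n d))"
  have "?p \<in> span_of (mons N (Suc n))"
    using assms by (intro mulv_span_mons span_of_mon mnum_in) auto
  from lookup_lin[OF assms(1) this, of "mnum N (Suc n) i"] show ?thesis
    using assms by (subst mat_mult_index[OF op_mat_carrier mul_mat_carrier _ pair_index_less])
      (auto simp: mul_mat_index op_mat_index mult.commute intro!: sum.cong)
qed

text \<open>The Leibniz rule once more: a generator acts on the product of a variable and a
  polynomial by its primitive coproduct.\<close>

lemma mul_mat_intertwiner:
  assumes K: "K \<le> N"
  shows "intertwiner (tens (spin K) (mrep N n)) (mrep N (Suc n)) (mul_mat N n K)"
  unfolding intertwiner_iff
proof (intro conjI ballI)
  let ?d = "2 * K + 1" and ?D = "mdim N n"
  show "mul_mat N n K \<in> carrier_mat (rdim (mrep N (Suc n))) (rdim (tens (spin K) (mrep N n)))"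
    using mul_mat_carrier[of N n K] by (simp only: rdim_mrep rdim_tens is_rep_carrier is_rep_spin is_rep_mrep rdim_spin)
  fix g assume g: "g \<in> gens"
  have pc: "prim (g (spin K)) (g (mrep N n)) \<in> carrier_mat (?d * ?D) (?d * ?D)"
    by (rule prim_carrier[OF spin_carrier[OF g]]) (simp add: gens_mrep[OF g])
  have "mul_mat N n K * prim (g (spin K)) (g (mrep N n)) = op_mat N (Suc n) (Suc n) (gen_op g) * mul_mat N n K"
  proof (rule eq_matI)
    fix i j assume "i < dim_row (op_mat N (Suc n) (Suc n) (gen_op g) * mul_mat N n K)"
      "j < dim_col (op_mat N (Suc n) (Suc n) (gen_op g) * mul_mat N n K)"
    then have ij: "i < mdim N (Suc n)" "j < ?d * ?D" by (auto simp: mul_mat_def)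
    from ij(2) obtain c d where cd: "c < ?d" "d < ?D" "j = c * ?D + d" by (rule pair_index_cases)
    let ?p = "mon (mnum N n d)"
    have gp: "gen_op g ?p = (\<Sum>b<?D. cmul (g (mrep N n) $$ (b, d)) (mon (mnum N n b)))"
    proof (rule poly_mapping_eqI)
      fix L
      have "gen_op g ?p \<in> span_of (mons N n)" using maps_mons_gen_op mnum_in[OF cd(2)] by (auto simp: maps_mons_def)
      from lookup_lin[OF lin_ident this, of L]
      show "Poly_Mapping.lookup (gen_op g ?p) L = Poly_Mapping.lookup (\<Sum>b<?D. cmul (g (mrep N n) $$ (b, d)) (mon (mnum N n b))) L"
        using cd(2) by (simp add: lookup_sum gens_mrep[OF g] op_mat_index)
    qed
    have "prim (g (spin K)) (g (mrep N n)) $$ (a * ?D + b, c * ?D + d) =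
       g (spin K) $$ (a, c) * (if b = d then 1 else 0) + (if a = c then 1 else 0) * g (mrep N n) $$ (b, d)"
      if "a < ?d" "b < ?D" for a b
      using that cd by (intro prim_index[OF spin_carrier[OF g]]) (auto simp: gens_mrep[OF g])
    then have "(\<Sum>a<?d. \<Sum>b<?D. cmul (prim (g (spin K)) (g (mrep N n)) $$ (a * ?D + b, j)) (mulv (K, a) (mon (mnum N n b))))
      = (\<Sum>a<?d. \<Sum>b<?D. (if b = d then cmul (g (spin K) $$ (a, c)) (mulv (K, a) ?p) else 0)
        + (if a = c then mulv (K, c) (cmul (g (mrep N n) $$ (b, d)) (mon (mnum N n b))) else 0))"
      unfolding cd(3) by (intro sum.cong refl) (auto simp: cmul_add_left mulv_cmul)
    also have "\<dots> = (\<Sum>a<?d. cmul (g (spin K) $$ (a, c)) (mulv (K, a) ?p)) + mulv (K, c) (gen_op g ?p)"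
    proof -
      have "(\<Sum>a<?d. \<Sum>b<?D. if a = c then f b else 0) = (\<Sum>b<?D. f b)" for f :: "nat \<Rightarrow> mpol"
        using cd(1) by (subst sum.swap) (simp del: sum.lessThan_Suc)
      then show ?thesis
        using cd(2) unfolding sum.distrib gp lin_sum[OF lin_mulv] by simp
    qed
    also have "\<dots> = gen_op g (mulv (K, c) ?p)" by (simp add: gen_op_mulv lessThan_Suc_atMost)
    finally show "(mul_mat N n K * prim (g (spin K)) (g (mrep N n))) $$ (i, j) = (op_mat N (Suc n) (Suc n) (gen_op g) * mul_mat N n K) $$ (i, j)"
      unfolding mul_mat_mult_index[OF pc ij] using mult_mul_mat_index[OF lin_gen_op ij(1) cd(1,2) K] cd(3) by simp
  qed (use pc in \<open>auto simp: mul_mat_def\<close>)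
  then show "mul_mat N n K * g (tens (spin K) (mrep N n)) = g (mrep N (Suc n)) * mul_mat N n K"
    by (simp add: gens_tens[OF rep_carrier_spin is_rep_carrier[OF is_rep_mrep] g] gens_mrep[OF g])
qed

text \<open>The twisted operator of the lower-index variable: \<open>(F\<^sub>1 \<triangleright> x\<^sub>m) F\<^sub>2\<close> for \<open>F = tilde_inv \<F>\<close>.\<close>

definition tw :: "(rep \<Rightarrow> rep \<Rightarrow> complex mat) \<Rightarrow> (var \<Rightarrow> oper) \<Rightarrow> var \<Rightarrow> oper" where
  "tw F x v p = (case v of (K, m) \<Rightarrow> \<Sum>l\<le>2 * K. x (K, l) (act (slice (tilde_inv F) K l m) p))"

lemma hat_eq_tw: "hat F x (K, n) p = (\<Sum>m\<le>2 * K. cmul (gt_inv F K n m) (tw F x (K, m) p))"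
  by (simp add: hat_def tw_def)

lemma lin_tw: "(\<And>v. lin (x v)) \<Longrightarrow> lin (tw F x v)"
  unfolding tw_def by (cases v) (auto intro!: lin_sum_fun lin_compose[OF _ lin_act])

lemma lin_hat: "(\<And>v. lin (x v)) \<Longrightarrow> lin (hat F x v)"
proof (cases v)
  case (Pair K n)
  have "hat F x v = (\<lambda>p. \<Sum>m\<le>2 * K. cmul (gt_inv F K n m) (tw F x (K, m) p))"
    by (rule ext) (simp add: Pair hat_eq_tw)
  then show "(\<And>v. lin (x v)) \<Longrightarrow> lin (hat F x v)"
    by (simp add: lin_sum_fun lin_scale lin_tw)
qed

context drinfeld_twist
begin

lemma G_spin_carrier: "G (spin K) (mrep N n) \<in> carrier_mat ((2 * K + 1) * mdim N n) ((2 * K + 1) * mdim N n)"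
  using G_inverse(1)[OF is_rep_spin is_rep_mrep, of K N n] by (simp only: rdim_spin rdim_mrep mult.commute)

lemma act_slice_mon:
  assumes "j < mdim N n" "l \<le> 2 * K" "m \<le> 2 * K"
  shows "act (slice G K l m) (mon (mnum N n j))
    = (\<Sum>b<mdim N n. cmul (G (spin K) (mrep N n) $$ (l * mdim N n + b, m * mdim N n + j)) (mon (mnum N n b)))"
proof (rule poly_mapping_eqI)
  fix L
  let ?u = "slice G K l m"
  have u: "?u \<in> uhat is_rep" by (rule slice_uhat[OF assms(2,3)])
  have "act ?u (mon (mnum N n j)) \<in> span_of (mons N n)"
    using act_mrep(2)[OF u] mnum_in[OF assms(1)] by (auto simp: maps_mons_def)
  from lookup_lin[OF lin_ident this, of L]
  have "Poly_Mapping.lookup (act ?u (mon (mnum N n j))) L = (\<Sum>b<mdim N n. op_mat N n n (act ?u) $$ (b, j) * Poly_Mapping.lookup (mon (mnum N n b)) L)"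
    using assms by (simp add: op_mat_index)
  also have "\<dots> = (\<Sum>b<mdim N n. G (spin K) (mrep N n) $$ (l * mdim N n + b, m * mdim N n + j) * Poly_Mapping.lookup (mon (mnum N n b)) L)"
    unfolding act_mrep(1)[OF u] using assms by (intro sum.cong refl) (simp add: slice_def)
  finally show "Poly_Mapping.lookup (act ?u (mon (mnum N n j))) L = Poly_Mapping.lookup
     (\<Sum>b<mdim N n. cmul (G (spin K) (mrep N n) $$ (l * mdim N n + b, m * mdim N n + j)) (mon (mnum N n b))) L"
    by (simp add: lookup_sum)
qed

lemma tw_mulv_mon:
  assumes "j < mdim N n" "m \<le> 2 * K"
  shows "tw F mulv (K, m) (mon (mnum N n j)) = (\<Sum>a<2 * K + 1. \<Sum>b<mdim N n.
     cmul (G (spin K) (mrep N n) $$ (a * mdim N n + b, m * mdim N n + j)) (mulv (K, a) (mon (mnum N n b))))"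
  using assms by (simp add: tw_def act_slice_mon lin_sum[OF lin_mulv] mulv_cmul lessThan_Suc_atMost)

lemma tw_mulv_span:
  assumes "K \<le> N" "m \<le> 2 * K"
  shows "maps_mons N n (Suc n) (tw F mulv (K, m))"
  unfolding maps_mons_def
proof
  fix M assume "M \<in> mons N n"
  then obtain j where "j < mdim N n" "M = mnum N n j" by (rule mnum_cases)
  then show "tw F mulv (K, m) (mon M) \<in> span_of (mons N (Suc n))"
    using assms by (simp only: tw_mulv_mon)
      (intro span_of_sum span_of_cmul mulv_span_mons span_of_mon mnum_in; auto)
qed

text \<open>The inverse flipped twist followed by the product. By \<open>tw_mat_index\<close> its
  columns hold the values of \<open>tw F mulv\<close>, with the variable and the polynomial as the
  two tensor factors.\<close>

definition tw_mat :: "nat \<Rightarrow> nat \<Rightarrow> nat \<Rightarrow> complex mat" where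
  "tw_mat N n K = mul_mat N n K * G (spin K) (mrep N n)"

lemma tw_mat_carrier: "tw_mat N n K \<in> carrier_mat (mdim N (Suc n)) ((2 * K + 1) * mdim N n)"
  unfolding tw_mat_def by (rule mult_carrier_mat[OF mul_mat_carrier G_spin_carrier])

lemma tw_mat_index:
  assumes "i < mdim N (Suc n)" "m < 2 * K + 1" "j < mdim N n"
  shows "tw_mat N n K $$ (i, m * mdim N n + j) = Poly_Mapping.lookup (tw F mulv (K, m) (mon (mnum N n j))) (mnum N (Suc n) i)"
  unfolding tw_mat_def mul_mat_mult_index[OF G_spin_carrier assms(1) pair_index_less[OF assms(2,3)]]
  by (subst tw_mulv_mon) (use assms in auto)

lemma tw_mat_kron_index:
  assumes "i < mdim N (Suc n)" "m < 2 * K + 1" "j < mdim N n"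
    and A: "A \<in> carrier_mat (2 * K + 1) (2 * K + 1)" and B: "maps_mons N n n B"
  shows "(tw_mat N n K * kron A (op_mat N n n B)) $$ (i, m * mdim N n + j)
    = Poly_Mapping.lookup (\<Sum>a\<le>2 * K. cmul (A $$ (a, m)) (tw F mulv (K, a) (B (mon (mnum N n j))))) (mnum N (Suc n) i)"
proof -
  let ?d = "2 * K + 1" and ?D = "mdim N n"
  have lt: "lin (tw F mulv v)" for v by (intro lin_tw lin_mulv)
  have Bj: "B (mon (mnum N n j)) \<in> span_of (mons N n)" using B mnum_in[OF assms(3)] by (auto simp: maps_mons_def)
  have kc: "kron A (op_mat N n n B) \<in> carrier_mat (?d * ?D) (?d * ?D)" by (rule kron_carrier[OF A op_mat_carrier])
  have "(tw_mat N n K * kron A (op_mat N n n B)) $$ (i, m * ?D + j)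
     = (\<Sum>k<?d * ?D. tw_mat N n K $$ (i, k) * kron A (op_mat N n n B) $$ (k, m * ?D + j))"
    by (rule mat_mult_index[OF tw_mat_carrier kc assms(1) pair_index_less[OF assms(2,3)]])
  also have "\<dots> = (\<Sum>a<?d. \<Sum>b<?D. A $$ (a, m) * (Poly_Mapping.lookup (B (mon (mnum N n j))) (mnum N n b) *
      Poly_Mapping.lookup (tw F mulv (K, a) (mon (mnum N n b))) (mnum N (Suc n) i)))"
    unfolding sum_pair_index using assms
    by (intro sum.cong refl) (simp only: lessThan_iff tw_mat_index kron_index[OF A op_mat_carrier] op_mat_index mult_ac)
  also have "\<dots> = (\<Sum>a<?d. A $$ (a, m) * Poly_Mapping.lookup (tw F mulv (K, a) (B (mon (mnum N n j)))) (mnum N (Suc n) i))"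
    unfolding lookup_lin[OF lt Bj] by (simp add: sum_distrib_left)
  finally show ?thesis by (simp add: lookup_sum lessThan_Suc_atMost del: sum.lessThan_Suc)
qed

text \<open>\<open>\<phi>(u)\<close> passes the product as its undeformed coproduct, because
  \<open>mul_mat\<close> is an intertwiner, and then passes the inverse twist by the hypothesis
  \<open>tw\<close>. The matrix \<open>C\<close> is what then acts on variable and
  polynomial.\<close>

lemma act_tw_index:
  assumes "u \<in> uhat (is_qrep h)" "K \<le> N" "i < mdim N (Suc n)" "m < 2 * K + 1" "j < mdim N n"
    and C: "C \<in> carrier_mat ((2 * K + 1) * mdim N n) ((2 * K + 1) * mdim N n)"
    and tw: "u (\<phi> (tens (spin K) (mrep N n))) * G (spin K) (mrep N n) = G (spin K) (mrep N n) * C"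
  shows "Poly_Mapping.lookup (act (\<lambda>\<rho>. u (\<phi> \<rho>)) (tw F mulv (K, m) (mon (mnum N n j)))) (mnum N (Suc n) i)
     = (tw_mat N n K * C) $$ (i, m * mdim N n + j)"
proof -
  let ?u = "\<lambda>\<rho>. u (\<phi> \<rho>)"
  let ?d = "2 * K + 1" and ?D = "mdim N n" and ?E = "mdim N (Suc n)" and ?\<mu> = "mul_mat N n K" and ?G = "G (spin K) (mrep N n)"
  let ?U = "op_mat N (Suc n) (Suc n) (act ?u)"
  note u = pullback_uhat[OF assms(1)]
  have uT: "?u (tens (spin K) (mrep N n)) \<in> carrier_mat (?d * ?D) (?d * ?D)"
    using uhatD[OF u is_rep_tens[OF is_rep_spin is_rep_mrep], of K N n]
    by (simp only: rdim_mrep rdim_tens is_rep_carrier is_rep_spin is_rep_mrep rdim_spin)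
  have nat: "?\<mu> * ?u (tens (spin K) (mrep N n)) = ?u (mrep N (Suc n)) * ?\<mu>"
    by (rule uhat_natural[OF u is_rep_tens[OF is_rep_spin is_rep_mrep] is_rep_mrep mul_mat_intertwiner[OF assms(2)]])
  have "?U * tw_mat N n K = ?U * ?\<mu> * ?G"
    unfolding tw_mat_def by (rule assoc_mult_mat[symmetric, OF op_mat_carrier mul_mat_carrier G_spin_carrier])
  also have "\<dots> = ?\<mu> * (?u (tens (spin K) (mrep N n)) * ?G)"
    unfolding act_mrep(1)[OF u] nat[symmetric] by (rule assoc_mult_mat[OF mul_mat_carrier uT G_spin_carrier])
  also have "\<dots> = tw_mat N n K * C"
    unfolding tw tw_mat_def by (rule assoc_mult_mat[symmetric, OF mul_mat_carrier G_spin_carrier C])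
  finally have e: "?U * tw_mat N n K = tw_mat N n K * C" .
  let ?p = "tw F mulv (K, m) (mon (mnum N n j))"
  have p: "?p \<in> span_of (mons N (Suc n))"
    using tw_mulv_span[OF assms(2), of m n] assms mnum_in[OF assms(5)] by (auto simp: maps_mons_def)
  have "(?U * tw_mat N n K) $$ (i, m * ?D + j) = (\<Sum>k<?E. ?U $$ (i, k) * tw_mat N n K $$ (k, m * ?D + j))"
    by (rule mat_mult_index[OF op_mat_carrier tw_mat_carrier assms(3) pair_index_less[OF assms(4,5)]])
  also have "\<dots> = Poly_Mapping.lookup (act ?u ?p) (mnum N (Suc n) i)"
    unfolding lookup_lin[OF lin_act p] using assms
    by (intro sum.cong refl) (simp only: lessThan_iff op_mat_index tw_mat_index mult.commute)
  finally show ?thesis using e by simp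
qed

lemma act_tw_eqI:
  assumes "u \<in> uhat (is_qrep h)" "K \<le> N" "m \<le> 2 * K" "p \<in> polys N" "lin R"
    and R: "\<And>n. maps_mons N n (Suc n) R"
    and ent: "\<And>n i j. i < mdim N (Suc n) \<Longrightarrow> j < mdim N n \<Longrightarrow>
      Poly_Mapping.lookup (act (\<lambda>\<rho>. u (\<phi> \<rho>)) (tw F mulv (K, m) (mon (mnum N n j)))) (mnum N (Suc n) i)
      = Poly_Mapping.lookup (R (mon (mnum N n j))) (mnum N (Suc n) i)"
  shows "act (\<lambda>\<rho>. u (\<phi> \<rho>)) (tw F mulv (K, m) p) = R p"
proof -
  obtain n where n: "p \<in> span_of (mons N n)" using assms(4) by (rule polys_obtain_mons)
  have lt: "lin (tw F mulv v)" for v by (intro lin_tw lin_mulv)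
  note u = pullback_uhat[OF assms(1)]
  show ?thesis
  proof (rule op_mat_eqD[OF _ _ R lin_compose[OF lin_act lt] assms(5) n])
    show "op_mat N n (Suc n) (\<lambda>p. act (\<lambda>\<rho>. u (\<phi> \<rho>)) (tw F mulv (K, m) p)) = op_mat N n (Suc n) R"
      by (rule eq_matI) (auto simp: op_mat_index ent)
    show "maps_mons N n (Suc n) (\<lambda>p. act (\<lambda>\<rho>. u (\<phi> \<rho>)) (tw F mulv (K, m) p))"
      using tw_mulv_span[OF assms(2,3), of n] maps_monsD[OF act_mrep(2)[OF u] lin_act] by (auto simp: maps_mons_def)
  qed
qed

lemma lin_tw_sum: "lin B \<Longrightarrow> lin (\<lambda>p. \<Sum>a\<le>2 * K. cmul (c a) (tw F mulv (K, a) (B p)))"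
  by (intro lin_sum_fun lin_scale lin_compose[OF lin_tw] lin_mulv)

lemma maps_tw_sum:
  assumes "K \<le> N" "maps_mons N n n B"
  shows "maps_mons N n (Suc n) (\<lambda>p. \<Sum>a\<le>2 * K. cmul (c a) (tw F mulv (K, a) (B p)))"
  unfolding maps_mons_def using assms
  by (auto intro!: span_of_sum span_of_cmul maps_monsD[OF tw_mulv_span lin_tw] lin_mulv simp: maps_mons_def[of _ n n])

lemma qpow_phi_spin_carrier: "qpow h c (\<phi> (spin K)) \<in> carrier_mat (2 * K + 1) (2 * K + 1)"
  using qpow_carrier[OF phi_carrier[OF is_rep_spin], of h c K] by (simp only: rdim_phi[OF is_rep_spin] rdim_spin)

lemma gens_phi_spin_carrier: "g \<in> gens \<Longrightarrow> g (\<phi> (spin K)) \<in> carrier_mat (2 * K + 1) (2 * K + 1)"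
  using rep_carrierD[OF phi_carrier[OF is_rep_spin], of g K] by (simp only: rdim_phi[OF is_rep_spin] rdim_spin)

lemma act_tw_qpow:
  assumes "K \<le> N" "m \<le> 2 * K" "p \<in> polys N"
  shows "act (\<lambda>\<rho>. qpow h c (\<phi> \<rho>)) (tw F mulv (K, m) p)
    = (\<Sum>a\<le>2 * K. cmul (qpow h c (\<phi> (spin K)) $$ (a, m)) (tw F mulv (K, a) (act (\<lambda>\<rho>. qpow h c (\<phi> \<rho>)) p)))"
proof (rule act_tw_eqI[OF qpow_uhat assms lin_tw_sum[OF lin_act] maps_tw_sum[OF assms(1) act_mrep(2)[OF pullback_uhat[OF qpow_uhat]]]])
  fix n i j assume ij: "i < mdim N (Suc n)" "j < mdim N n"
  let ?A = "qpow h c (\<phi> (spin K))" and ?B = "op_mat N n n (act (\<lambda>\<rho>. qpow h c (\<phi> \<rho>)))"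
  have m: "m < 2 * K + 1" using assms by simp
  note q = qpow_phi_spin_carrier
  show "Poly_Mapping.lookup (act (\<lambda>\<rho>. qpow h c (\<phi> \<rho>)) (tw F mulv (K, m) (mon (mnum N n j)))) (mnum N (Suc n) i)
    = Poly_Mapping.lookup (\<Sum>a\<le>2 * K. cmul (?A $$ (a, m)) (tw F mulv (K, a) (act (\<lambda>\<rho>. qpow h c (\<phi> \<rho>)) (mon (mnum N n j))))) (mnum N (Suc n) i)"
    unfolding tw_mat_kron_index[OF ij(1) m ij(2) q act_mrep(2)[OF pullback_uhat[OF qpow_uhat]], symmetric]
    by (rule act_tw_index[OF qpow_uhat assms(1) ij(1) m ij(2) kron_carrier[OF q op_mat_carrier]])
      (unfold act_mrep(1)[OF pullback_uhat[OF qpow_uhat]], rule G_twist_qpow[OF is_rep_spin is_rep_mrep])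
qed

text \<open>The coproducts of H, X and Y all have two terms; \<open>A\<close> and \<open>A'\<close>
  act on the index of the variable, \<open>B\<close> and \<open>B'\<close> on the polynomial behind
  it.\<close>

lemma act_tw_two:
  assumes "u \<in> uhat (is_qrep h)" "K \<le> N" "m \<le> 2 * K" "p \<in> polys N" "lin B" "lin B'"
    and A: "A \<in> carrier_mat (2 * K + 1) (2 * K + 1)" "A' \<in> carrier_mat (2 * K + 1) (2 * K + 1)"
    and B: "\<And>n. maps_mons N n n B" "\<And>n. maps_mons N n n B'"
    and tw: "\<And>n. u (\<phi> (tens (spin K) (mrep N n))) * G (spin K) (mrep N n)
       = G (spin K) (mrep N n) * (kron A (op_mat N n n B) + kron A' (op_mat N n n B'))"
  shows "act (\<lambda>\<rho>. u (\<phi> \<rho>)) (tw F mulv (K, m) p)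
    = (\<Sum>a\<le>2 * K. cmul (A $$ (a, m)) (tw F mulv (K, a) (B p)))
      + (\<Sum>a\<le>2 * K. cmul (A' $$ (a, m)) (tw F mulv (K, a) (B' p)))"
proof (rule act_tw_eqI[OF assms(1-4) lin_plus[OF lin_tw_sum[OF assms(5)] lin_tw_sum[OF assms(6)]]])
  show "maps_mons N n (Suc n) (\<lambda>p. (\<Sum>a\<le>2 * K. cmul (A $$ (a, m)) (tw F mulv (K, a) (B p)))
      + (\<Sum>a\<le>2 * K. cmul (A' $$ (a, m)) (tw F mulv (K, a) (B' p))))" for n
    using maps_tw_sum[OF assms(2) B(1), of n "\<lambda>a. A $$ (a, m)"] maps_tw_sum[OF assms(2) B(2), of n "\<lambda>a. A' $$ (a, m)"]
    by (auto simp: maps_mons_def[of N n "Suc n"] intro: span_of_add)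
  fix n i j assume ij: "i < mdim N (Suc n)" "j < mdim N n"
  have m: "m < 2 * K + 1" using assms by simp
  let ?k = "kron A (op_mat N n n B)" and ?k' = "kron A' (op_mat N n n B')"
  note kc = kron_carrier[OF A(1) op_mat_carrier[of N n n B]] kron_carrier[OF A(2) op_mat_carrier[of N n n B']]
  have "Poly_Mapping.lookup (act (\<lambda>\<rho>. u (\<phi> \<rho>)) (tw F mulv (K, m) (mon (mnum N n j)))) (mnum N (Suc n) i)
     = (tw_mat N n K * (?k + ?k')) $$ (i, m * mdim N n + j)"
    by (rule act_tw_index[OF assms(1,2) ij(1) m ij(2) add_carrier_mat[OF kc(2)] tw])
  also have "\<dots> = (tw_mat N n K * ?k) $$ (i, m * mdim N n + j) + (tw_mat N n K * ?k') $$ (i, m * mdim N n + j)"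
    unfolding mult_add_distrib_mat[OF tw_mat_carrier kc]
    using tw_mat_carrier[of N n K] kc ij pair_index_less[OF m ij(2)]
    by (subst index_add_mat(1)) auto
  finally show "Poly_Mapping.lookup (act (\<lambda>\<rho>. u (\<phi> \<rho>)) (tw F mulv (K, m) (mon (mnum N n j)))) (mnum N (Suc n) i)
     = Poly_Mapping.lookup ((\<Sum>a\<le>2 * K. cmul (A $$ (a, m)) (tw F mulv (K, a) (B (mon (mnum N n j)))))
      + (\<Sum>a\<le>2 * K. cmul (A' $$ (a, m)) (tw F mulv (K, a) (B' (mon (mnum N n j)))))) (mnum N (Suc n) i)"
    by (simp only: tw_mat_kron_index[OF ij(1) m ij(2) A(1) B(1)] tw_mat_kron_index[OF ij(1) m ij(2) A(2) B(2)] lookup_add)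
qed

text \<open>Twisted modes are covariant for the flipped coproduct X \<otimes> q^(-H/2) + q^(H/2)
  \<otimes> X: the left factors act on the index of the mode and the right ones on its
  argument.\<close>

lemma act_tw_XY:
  assumes "K \<le> N" "m \<le> 2 * K" "p \<in> polys N" "g \<in> {opX, opY}"
  shows "act (\<lambda>\<rho>. g (\<phi> \<rho>)) (tw F mulv (K, m) p)
    = (\<Sum>a\<le>2 * K. cmul (g (\<phi> (spin K)) $$ (a, m)) (tw F mulv (K, a) (act (\<lambda>\<rho>. qpow h (- 1/2) (\<phi> \<rho>)) p)))
      + (\<Sum>a\<le>2 * K. cmul (qpow h (1/2) (\<phi> (spin K)) $$ (a, m)) (tw F mulv (K, a) (act (\<lambda>\<rho>. g (\<phi> \<rho>)) p)))"
proof -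
  have g: "g \<in> gens" using assms(4) by (auto simp: gens_def)
  note ua = pullback_uhat[OF gens_uhat[OF g]] and uq = pullback_uhat[OF qpow_uhat]
  show ?thesis
    by (rule act_tw_two[OF gens_uhat[OF g] assms(1-3) lin_act lin_act gens_phi_spin_carrier[OF g] qpow_phi_spin_carrier
          act_mrep(2)[OF uq] act_mrep(2)[OF ua]])
      (simp only: act_mrep(1)[OF ua] act_mrep(1)[OF uq] G_twist_XY[OF is_rep_spin is_rep_mrep assms(4)])
qed

lemma act_tw_H:
  assumes "K \<le> N" "m \<le> 2 * K" "p \<in> polys N"
  shows "act (\<lambda>\<rho>. opH (\<phi> \<rho>)) (tw F mulv (K, m) p)
    = (\<Sum>a\<le>2 * K. cmul (opH (\<phi> (spin K)) $$ (a, m)) (tw F mulv (K, a) p))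
      + tw F mulv (K, m) (act (\<lambda>\<rho>. opH (\<phi> \<rho>)) p)"
proof -
  have g: "opH \<in> gens" by (auto simp: gens_def)
  note ua = pullback_uhat[OF gens_uhat[OF g]]
  \<comment> \<open>The coproduct of H has identity factors, which must be presented as matrices of
    operators to fit \<open>act_tw_two\<close>.\<close>
  have one: "op_mat N n n (\<lambda>p. p) = 1\<^sub>m (mdim N n)" "maps_mons N n n (\<lambda>p. p)" for n
    by (rule eq_matI) (auto simp: op_mat_index lookup_single when_def mnum_eq_iff maps_mons_def span_of_mon)
  have "act (\<lambda>\<rho>. opH (\<phi> \<rho>)) (tw F mulv (K, m) p)
    = (\<Sum>a\<le>2 * K. cmul (opH (\<phi> (spin K)) $$ (a, m)) (tw F mulv (K, a) p))
      + (\<Sum>a\<le>2 * K. cmul (1\<^sub>m (2 * K + 1) $$ (a, m)) (tw F mulv (K, a) (act (\<lambda>\<rho>. opH (\<phi> \<rho>)) p)))"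
    by (rule act_tw_two[OF gens_uhat[OF g] assms(1-3) lin_ident lin_act gens_phi_spin_carrier[OF g] one_carrier_mat
          one(2) act_mrep(2)[OF ua]])
      (use G_twist_H[OF is_rep_spin is_rep_mrep] in \<open>simp only: act_mrep(1)[OF ua] one(1) rdim_spin rdim_mrep\<close>)
  also have "(\<Sum>a\<le>2 * K. cmul (1\<^sub>m (2 * K + 1) $$ (a, m)) (tw F mulv (K, a) (act (\<lambda>\<rho>. opH (\<phi> \<rho>)) p)))
    = (\<Sum>a\<le>2 * K. if a = m then tw F mulv (K, m) (act (\<lambda>\<rho>. opH (\<phi> \<rho>)) p) else 0)"
    using assms by (intro sum.cong refl) auto
  finally show ?thesis using assms by simp
qed

end

section \<open>Words of twisted modes and their contraction with invariant tensors\<close>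

lemma sum_word_Cons:
  "(\<Sum>k<wdim (K # Ks). f k (word_of (K # Ks) k))
    = (\<Sum>a\<le>2 * K. \<Sum>b<wdim Ks. f (a * wdim Ks + b) ((K, a) # word_of Ks b))"
proof -
  have "(\<Sum>k<wdim (K # Ks). f k (word_of (K # Ks) k)) = (\<Sum>a<2 * K + 1. \<Sum>b<wdim Ks. f (a * wdim Ks + b) ((K, a) # word_of Ks b))"
    unfolding wdim_Cons sum_pair_index by (intro sum.cong refl) simp
  then show ?thesis by (simp add: lessThan_Suc_atMost)
qed

lemma diagrep_triv: "diagrep triv"
proof -
  have "diag_by 1 (0\<^sub>m 1 1) (\<lambda>_. 0) (1\<^sub>m 1) (1\<^sub>m 1)"
    by (auto simp: diag_by_def intro!: eq_matI)
  then show ?thesis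
    by (auto simp: diagrep_def diagable_def triv_def rep_carrier_def rdim_def)
qed

lemma qpow_triv: "qpow h c triv = 1\<^sub>m 1"
proof -
  have *: "diag_by 1 (complex_of_real (c * h) \<cdot>\<^sub>m opH triv) (\<lambda>_. 0) (1\<^sub>m 1) (1\<^sub>m 1)"
    by (auto simp: diag_by_def triv_def intro!: eq_matI)
  show ?thesis unfolding qpow_def diag_by_mexp[OF *] by (auto intro!: eq_matI)
qed

text \<open>The product of inverse metrics in \<open>lowcoeff\<close>, written recursively to fit
  inductions over the labels; the second clause is reached when one of the words is
  exhausted.\<close>

fun metric :: "(rep \<Rightarrow> rep \<Rightarrow> complex mat) \<Rightarrow> var list \<Rightarrow> var list \<Rightarrow> complex" where
  "metric F ((K, n) # w) ((L, m) # w') = gt_inv F K n m * metric F w w'"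
| "metric F _ _ = 1"

lemma metric_eq: "metric F w w' = (\<Prod>((K, n), (L, m))\<leftarrow>zip w w'. gt_inv F K n m)"
  by (induction F w w' rule: metric.induct) auto

lemma lowcoeff_eq:
  assumes "w \<in> words Ks"
  shows "lowcoeff F P w = (\<Sum>k<wdim Ks. Poly_Mapping.lookup P (word_of Ks k) * metric F (word_of Ks k) w)"
proof -
  have "map fst w = Ks" using assms by (auto simp: words_def)
  then show ?thesis unfolding lowcoeff_def metric_eq[symmetric] sum_words by simp
qed

lemma foldr_hat:
  assumes x: "\<And>v. lin (x v)"
  shows "w \<in> words Ks \<Longrightarrow> foldr (hat F x) w p = (\<Sum>k<wdim Ks. cmul (metric F w (word_of Ks k)) (foldr (tw F x) (word_of Ks k) p))"
proof (induction Ks arbitrary: w)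
  case Nil then show ?case by (simp add: wdim_Nil)
next
  case (Cons K Ks)
  then obtain n w' where w: "w = (K, n) # w'" "w' \<in> words Ks" by (auto elim: words_Cons_cases)
  show ?case
    unfolding sum_word_Cons[of "\<lambda>k w'. cmul (metric F w w') (foldr (tw F x) w' p)"]
    by (simp add: w hat_eq_tw Cons.IH[OF w(2)] lin_sum[OF lin_tw[OF x]] lin_cmul[OF lin_tw[OF x]] cmul_sum cmul_cmul)
qed

definition lists_of :: "ncpol \<Rightarrow> nat list set" where
  "lists_of P = map fst ` Poly_Mapping.keys P"

text \<open>Moves the inverse metrics from the operators to the coefficients:
  \<open>q_invariant\<close> speaks of lower-index coefficients, and the operators \<open>tw\<close>
  of lower-index variables are the ones known to be covariant.\<close>

lemma subst_eq_lowcoeff: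
  assumes P: "P \<in> ncpols N" and x: "\<And>v. lin (x v)"
  shows "subst P (hat F x) p = (\<Sum>Ks\<in>lists_of P. \<Sum>k<wdim Ks. cmul (lowcoeff F P (word_of Ks k)) (foldr (tw F x) (word_of Ks k) p))"
proof -
  let ?f = "\<lambda>w. cmul (Poly_Mapping.lookup P w) (foldr (hat F x) w p)"
  have fin: "finite (words Ks)" for Ks :: "nat list"
  proof (rule finite_subset)
    show "words Ks \<subseteq> word_of Ks ` {..<wdim Ks}"
      using word_of_widx widx_less by (metis image_eqI lessThan_iff subsetI)
  qed simp
  have sub: "Poly_Mapping.keys P \<subseteq> \<Union> (words ` lists_of P)"
  proof
    fix w assume "w \<in> Poly_Mapping.keys P"
    moreover from this have "w \<in> words (map fst w)" using P by (fastforce simp: ncpols_def words_def vars_def)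
    ultimately show "w \<in> \<Union> (words ` lists_of P)" by (auto simp: lists_of_def)
  qed
  have finl: "finite (lists_of P)" by (simp add: lists_of_def)
  \<comment> \<open>The sum is extended to all words that share their labels with a word of
    \<open>P\<close>, because the metrics mix such words; the added coefficients are zero.\<close>
  have "subst P (hat F x) p = (\<Sum>w\<in>\<Union> (words ` lists_of P). ?f w)"
    unfolding subst_def using finl fin sub by (intro sum.mono_neutral_left) (auto simp: in_keys_iff)
  also have "\<dots> = (\<Sum>Ks\<in>lists_of P. \<Sum>w\<in>words Ks. ?f w)"
    using finl fin by (intro sum.UNION_disjoint) (auto simp: words_def)
  also have "\<dots> = (\<Sum>Ks\<in>lists_of P. \<Sum>k<wdim Ks. cmul (lowcoeff F P (word_of Ks k)) (foldr (tw F x) (word_of Ks k) p))"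
  proof (rule sum.cong[OF refl])
    fix Ks
    have "(\<Sum>w\<in>words Ks. ?f w) = (\<Sum>j<wdim Ks. \<Sum>k<wdim Ks. cmul (Poly_Mapping.lookup P (word_of Ks j) * metric F (word_of Ks j) (word_of Ks k)) (foldr (tw F x) (word_of Ks k) p))"
      unfolding sum_words by (intro sum.cong refl) (simp add: foldr_hat[OF x word_of_words] cmul_sum cmul_cmul)
    also have "\<dots> = (\<Sum>k<wdim Ks. cmul (lowcoeff F P (word_of Ks k)) (foldr (tw F x) (word_of Ks k) p))"
      by (subst sum.swap) (intro sum.cong refl, simp add: lowcoeff_eq[OF word_of_words] cmul_sum_left)
    finally show "(\<Sum>w\<in>words Ks. ?f w) = (\<Sum>k<wdim Ks. cmul (lowcoeff F P (word_of Ks k)) (foldr (tw F x) (word_of Ks k) p))" .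
  qed
  finally show ?thesis .
qed

lemma lin_subst: "(\<And>v. lin (x v)) \<Longrightarrow> lin (subst P x)"
  unfolding subst_def by (intro lin_sum_fun lin_scale lin_foldr)

lemma lists_of_ncpols: "P \<in> ncpols N \<Longrightarrow> Ks \<in> lists_of P \<Longrightarrow> set Ks \<subseteq> {..N}"
  by (fastforce simp: ncpols_def lists_of_def vars_def)

context drinfeld_twist
begin

abbreviation "Q \<equiv> qtens_list h \<phi>"

lemma Q_Cons: "Q (K # Ks) = qtens_flip h (\<phi> (spin K)) (Q Ks)"
  by (simp add: qtens_list_def)

lemma diagrep_Q: "diagrep (Q Ks)" and rdim_Q: "rdim (Q Ks) = wdim Ks"
proof -
  have "diagrep (Q Ks) \<and> rdim (Q Ks) = wdim Ks"
  proof (induction Ks)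
    case Nil then show ?case using diagrep_triv by (simp add: qtens_list_def wdim_Nil) (simp add: triv_def rdim_def)
  next
    case (Cons K Ks)
    then show ?case
      using diagrep_qtens_flip[OF phi_diagrep[OF is_rep_spin[of K]], of "Q Ks" h]
      unfolding Q_Cons wdim_Cons by (simp add: rdim_phi is_rep_spin del: mult_Suc)
  qed
  then show "diagrep (Q Ks)" "rdim (Q Ks) = wdim Ks" by auto
qed

lemma Q_carrier: "rep_carrier (Q Ks)"
  using diagrep_Q[of Ks] by (simp add: diagrep_def)

lemma gens_Q_carrier: "g \<in> gens \<Longrightarrow> g (Q Ks) \<in> carrier_mat (wdim Ks) (wdim Ks)"
  using rep_carrierD[OF Q_carrier] by (simp add: rdim_Q)

lemma qpow_Q_carrier: "qpow h c (Q Ks) \<in> carrier_mat (wdim Ks) (wdim Ks)"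
  using qpow_carrier[OF Q_carrier, of h c Ks] by (simp add: rdim_Q)

lemma qpow_Q_Cons: "qpow h c (Q (K # Ks)) = kron (qpow h c (\<phi> (spin K))) (qpow h c (Q Ks))"
  by (rule qpow_prim[OF phi_diagrep[OF is_rep_spin] diagrep_Q])
    (simp add: Q_Cons opH_qtens(2)[OF phi_carrier[OF is_rep_spin] Q_carrier])

lemma qpow_Q_index:
  assumes "a < 2 * K + 1" "b < wdim Ks" "c < 2 * K + 1" "d < wdim Ks"
  shows "qpow h x (Q (K # Ks)) $$ (a * wdim Ks + b, c * wdim Ks + d)
    = qpow h x (\<phi> (spin K)) $$ (a, c) * qpow h x (Q Ks) $$ (b, d)"
  unfolding qpow_Q_Cons by (rule kron_index[OF qpow_phi_spin_carrier qpow_Q_carrier assms(1,2,3,4)])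

lemma XY_Q_index:
  assumes g: "g \<in> {opX, opY}" and "a < 2 * K + 1" "b < wdim Ks" "c < 2 * K + 1" "d < wdim Ks"
  shows "g (Q (K # Ks)) $$ (a * wdim Ks + b, c * wdim Ks + d)
    = g (\<phi> (spin K)) $$ (a, c) * qpow h (- 1/2) (Q Ks) $$ (b, d) + qpow h (1/2) (\<phi> (spin K)) $$ (a, c) * g (Q Ks) $$ (b, d)"
proof -
  have gg: "g \<in> gens" using g by (auto simp: gens_def)
  note c = gens_phi_spin_carrier[OF gg, of K] qpow_Q_carrier[of "- 1/2" Ks] qpow_phi_spin_carrier[of "1/2" K] gens_Q_carrier[OF gg, of Ks]
  note l = pair_index_less[OF assms(2,3)] pair_index_less[OF assms(4,5)]
  show ?thesis unfolding Q_Cons opXY_qtens_flip[OF g]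
    unfolding kron_index[OF c(1,2) assms(2,3,4,5), symmetric] kron_index[OF c(3,4) assms(2,3,4,5), symmetric]
    by (rule index_add_mat(1)) (use kron_carrier[OF c(3,4)] l in auto)
qed

lemma H_Q_index:
  assumes "a < 2 * K + 1" "b < wdim Ks" "c < 2 * K + 1" "d < wdim Ks"
  shows "opH (Q (K # Ks)) $$ (a * wdim Ks + b, c * wdim Ks + d)
    = opH (\<phi> (spin K)) $$ (a, c) * (if b = d then 1 else 0) + (if a = c then 1 else 0) * opH (Q Ks) $$ (b, d)"
proof -
  have gg: "opH \<in> gens" by (auto simp: gens_def)
  show ?thesis unfolding Q_Cons opH_qtens(2)[OF phi_carrier[OF is_rep_spin] Q_carrier]
    by (rule prim_index[OF gens_phi_spin_carrier[OF gg] gens_Q_carrier[OF gg] assms])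
qed

abbreviation "tws \<equiv> foldr (tw F mulv)"

lemma lin_tw_mulv: "lin (tw F mulv v)"
  by (intro lin_tw lin_mulv)

lemma polys_tw_gen:
  assumes "v \<in> vars N" "p \<in> polys N" "\<And>v p. v \<in> vars N \<Longrightarrow> p \<in> polys N \<Longrightarrow> x v p \<in> polys N"
  shows "tw F x v p \<in> polys N"
  unfolding tw_def using assms by (cases v) (auto intro!: assms(3) polys_sum polys_act slice_uhat)

lemma polys_tw: "v \<in> vars N \<Longrightarrow> p \<in> polys N \<Longrightarrow> tw F mulv v p \<in> polys N"
  by (rule polys_tw_gen) (auto intro: polys_mulv)

lemma polys_tws: "set w \<subseteq> vars N \<Longrightarrow> p \<in> polys N \<Longrightarrow> tws w p \<in> polys N"
  by (induction w) (auto intro: polys_tw)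

lemma polys_word_of: "set Ks \<subseteq> {..N} \<Longrightarrow> k < wdim Ks \<Longrightarrow> p \<in> polys N \<Longrightarrow> tws (word_of Ks k) p \<in> polys N"
  by (intro polys_tws set_words[OF word_of_words])

lemma act_tws_qpow:
  assumes "set Ks \<subseteq> {..N}" "j < wdim Ks" "p \<in> polys N"
  shows "act (\<lambda>\<rho>. qpow h c (\<phi> \<rho>)) (tws (word_of Ks j) p)
    = (\<Sum>k<wdim Ks. cmul (qpow h c (Q Ks) $$ (k, j)) (tws (word_of Ks k) (act (\<lambda>\<rho>. qpow h c (\<phi> \<rho>)) p)))"
  using assms(1,2)
proof (induction Ks arbitrary: j)
  case Nil
  then show ?case by (simp add: wdim_Nil qtens_list_def qpow_triv)
next
  case (Cons K Ks)
  let ?D = "wdim Ks"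
  have "j < (2 * K + 1) * ?D" using Cons.prems by (simp only: wdim_Cons)
  then obtain c' d where cd: "c' < 2 * K + 1" "d < ?D" "j = c' * ?D + d" by (rule pair_index_cases)
  have K: "K \<le> N" "set Ks \<subseteq> {..N}" "c' \<le> 2 * K" using Cons.prems cd by auto
  have wo: "word_of (K # Ks) j = (K, c') # word_of Ks d" using cd by simp
  have P: "tws (word_of Ks d) p \<in> polys N" by (rule polys_word_of[OF K(2) cd(2) assms(3)])
  have ent: "qpow h c (Q (K # Ks)) $$ (a * ?D + b, j) = qpow h c (\<phi> (spin K)) $$ (a, c') * qpow h c (Q Ks) $$ (b, d)"
    if "a \<le> 2 * K" "b < ?D" for a b
    unfolding cd(3) using that cd by (intro qpow_Q_index) auto
  show ?case
    unfolding sum_word_Cons[of "\<lambda>k w. cmul (qpow h c (Q (K # Ks)) $$ (k, j)) (tws w (act (\<lambda>\<rho>. qpow h c (\<phi> \<rho>)) p))"] wo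
    by (simp add: act_tw_qpow[OF K(1,3) P] Cons.IH[OF K(2) cd(2)] lin_sum[OF lin_tw_mulv] lin_cmul[OF lin_tw_mulv]
        cmul_sum cmul_cmul ent)
qed

text \<open>The coproduct of X or Y, split between a word and the polynomial behind it. In the
  induction the first letter leaves q^(-H/2) acting on the shorter word, which is where
  \<open>act_tws_qpow\<close> enters.\<close>

lemma act_tws_XY:
  assumes g: "g \<in> {opX, opY}" and "set Ks \<subseteq> {..N}" "j < wdim Ks" "p \<in> polys N"
  shows "act (\<lambda>\<rho>. g (\<phi> \<rho>)) (tws (word_of Ks j) p)
    = (\<Sum>k<wdim Ks. cmul (g (Q Ks) $$ (k, j)) (tws (word_of Ks k) (act (\<lambda>\<rho>. qpow h (- 1/2) (\<phi> \<rho>)) p)))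
     + (\<Sum>k<wdim Ks. cmul (qpow h (1/2) (Q Ks) $$ (k, j)) (tws (word_of Ks k) (act (\<lambda>\<rho>. g (\<phi> \<rho>)) p)))"
  using assms(2,3)
proof (induction Ks arbitrary: j)
  case Nil
  have "g triv $$ (0, 0) = 0" using g by (auto simp: triv_def)
  then show ?case using Nil by (simp add: wdim_Nil qtens_list_def qpow_triv)
next
  case (Cons K Ks)
  let ?D = "wdim Ks" and ?k = "act (\<lambda>\<rho>. qpow h (- 1/2) (\<phi> \<rho>))" and ?g = "act (\<lambda>\<rho>. g (\<phi> \<rho>))"
  have "j < (2 * K + 1) * ?D" using Cons.prems by (simp only: wdim_Cons)
  then obtain c' d where cd: "c' < 2 * K + 1" "d < ?D" "j = c' * ?D + d" by (rule pair_index_cases)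
  have K: "K \<le> N" "set Ks \<subseteq> {..N}" "c' \<le> 2 * K" using Cons.prems cd by auto
  have wo: "word_of (K # Ks) j = (K, c') # word_of Ks d" using cd by simp
  have P: "tws (word_of Ks d) p \<in> polys N" by (rule polys_word_of[OF K(2) cd(2) assms(4)])
  have ent: "qpow h (1/2) (Q (K # Ks)) $$ (a * ?D + b, j) = qpow h (1/2) (\<phi> (spin K)) $$ (a, c') * qpow h (1/2) (Q Ks) $$ (b, d)"
    "g (Q (K # Ks)) $$ (a * ?D + b, j) =
      g (\<phi> (spin K)) $$ (a, c') * qpow h (- 1/2) (Q Ks) $$ (b, d) + qpow h (1/2) (\<phi> (spin K)) $$ (a, c') * g (Q Ks) $$ (b, d)"
    if "a \<le> 2 * K" "b < ?D" for a b
    unfolding cd(3) using that cd by (intro qpow_Q_index XY_Q_index[OF g]; simp)+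
  show ?case
    unfolding sum_word_Cons[of "\<lambda>k w. cmul (g (Q (K # Ks)) $$ (k, j)) (tws w (?k p))"]
      sum_word_Cons[of "\<lambda>k w. cmul (qpow h (1/2) (Q (K # Ks)) $$ (k, j)) (tws w (?g p))"] wo
    by (simp add: act_tw_XY[OF K(1,3) P g] Cons.IH[OF K(2) cd(2)] act_tws_qpow[OF K(2) cd(2) assms(4)]
        lin_add[OF lin_tw_mulv] lin_sum[OF lin_tw_mulv] lin_cmul[OF lin_tw_mulv]
        cmul_sum cmul_add cmul_cmul ent cmul_add_left sum.distrib add.assoc)
qed

lemma act_tws_H:
  assumes "set Ks \<subseteq> {..N}" "j < wdim Ks" "p \<in> polys N"
  shows "act (\<lambda>\<rho>. opH (\<phi> \<rho>)) (tws (word_of Ks j) p)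
    = (\<Sum>k<wdim Ks. cmul (opH (Q Ks) $$ (k, j)) (tws (word_of Ks k) p)) + tws (word_of Ks j) (act (\<lambda>\<rho>. opH (\<phi> \<rho>)) p)"
  using assms(1,2)
proof (induction Ks arbitrary: j)
  case Nil
  then show ?case by (simp add: wdim_Nil qtens_list_def triv_def)
next
  case (Cons K Ks)
  let ?D = "wdim Ks" and ?g = "act (\<lambda>\<rho>. opH (\<phi> \<rho>))"
  have "j < (2 * K + 1) * ?D" using Cons.prems by (simp only: wdim_Cons)
  then obtain c' d where cd: "c' < 2 * K + 1" "d < ?D" "j = c' * ?D + d" by (rule pair_index_cases)
  have K: "K \<le> N" "set Ks \<subseteq> {..N}" "c' \<le> 2 * K" using Cons.prems cd by auto
  have wo: "word_of (K # Ks) j = (K, c') # word_of Ks d" using cd by simp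
  have P: "tws (word_of Ks d) p \<in> polys N" by (rule polys_word_of[OF K(2) cd(2) assms(3)])
  let ?tt = "\<lambda>a b. tw F mulv (K, a) (tws (word_of Ks b) p)"
  have ent: "cmul (opH (Q (K # Ks)) $$ (a * ?D + b, j)) (?tt a b) =
      (if b = d then cmul (opH (\<phi> (spin K)) $$ (a, c')) (?tt a d) else 0) + (if a = c' then cmul (opH (Q Ks) $$ (b, d)) (?tt c' b) else 0)"
    if "a \<le> 2 * K" "b < ?D" for a b
  proof -
    have "opH (Q (K # Ks)) $$ (a * ?D + b, j) =
      opH (\<phi> (spin K)) $$ (a, c') * (if b = d then 1 else 0) + (if a = c' then 1 else 0) * opH (Q Ks) $$ (b, d)"
      unfolding cd(3) using that cd by (intro H_Q_index) auto
    then show ?thesis by (auto simp: cmul_add_left)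
  qed
  have "(\<Sum>k<wdim (K # Ks). cmul (opH (Q (K # Ks)) $$ (k, j)) (tws (word_of (K # Ks) k) p))
    = (\<Sum>a\<le>2 * K. \<Sum>b<?D. cmul (opH (Q (K # Ks)) $$ (a * ?D + b, j)) (?tt a b))"
    unfolding sum_word_Cons[of "\<lambda>k w. cmul (opH (Q (K # Ks)) $$ (k, j)) (tws w p)"] by simp
  also have "\<dots> = (\<Sum>a\<le>2 * K. cmul (opH (\<phi> (spin K)) $$ (a, c')) (?tt a d)) + (\<Sum>b<?D. cmul (opH (Q Ks) $$ (b, d)) (?tt c' b))"
  proof -
    have "(\<Sum>a\<le>2 * K. \<Sum>b<?D. if a = c' then f b else 0) = (\<Sum>b<?D. f b)" for f :: "nat \<Rightarrow> mpol"
      using K(3) by (subst sum.swap) simp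
    moreover have "(\<Sum>a\<le>2 * K. \<Sum>b<?D. cmul (opH (Q (K # Ks)) $$ (a * ?D + b, j)) (?tt a b))
      = (\<Sum>a\<le>2 * K. \<Sum>b<?D. (if b = d then cmul (opH (\<phi> (spin K)) $$ (a, c')) (?tt a d) else 0)
        + (if a = c' then cmul (opH (Q Ks) $$ (b, d)) (?tt c' b) else 0))"
      by (intro sum.cong refl ent) auto
    ultimately show ?thesis using cd(2) by (simp add: sum.distrib)
  qed
  finally show ?case
    unfolding wo by (simp add: act_tw_H[OF K(1,3) P] Cons.IH[OF K(2) cd(2)]
        lin_add[OF lin_tw_mulv] lin_sum[OF lin_tw_mulv] lin_cmul[OF lin_tw_mulv] add.assoc)
qed

text \<open>The hypothesis concerns the deformed generators: it makes the matrix of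
  \<open>\<Theta>\<close> an intertwiner between the \<open>\<phi>\<close>-images of two polynomial
  representations. By \<open>phi_intertwinerD\<close> it is one between the representations
  themselves.\<close>

lemma equivariantI:
  assumes "lin \<Theta>" "\<And>p. p \<in> polys N \<Longrightarrow> \<Theta> p \<in> polys N" "g \<in> gens" "p \<in> polys N"
    and q: "\<And>g p. g \<in> gens \<Longrightarrow> p \<in> polys N \<Longrightarrow> \<Theta> (act (\<lambda>\<rho>. g (\<phi> \<rho>)) p) = act (\<lambda>\<rho>. g (\<phi> \<rho>)) (\<Theta> p)"
  shows "\<Theta> (gen_op g p) = gen_op g (\<Theta> p)"
proof -
  obtain n where n: "p \<in> span_of (mons N n)" using assms(4) by (rule polys_obtain_mons)
  obtain m where m: "maps_mons N n m \<Theta>" using assms(2) by (rule polys_maps_mons[of N \<Theta> n 0])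
  have "intertwiner (\<phi> (mrep N n)) (\<phi> (mrep N m)) (op_mat N n m \<Theta>)"
    unfolding intertwiner_iff
  proof (intro conjI ballI)
    show "op_mat N n m \<Theta> \<in> carrier_mat (rdim (\<phi> (mrep N m))) (rdim (\<phi> (mrep N n)))"
      by (simp add: rdim_phi is_rep_mrep)
    fix g assume g: "g \<in> gens"
    note u = pullback_uhat[OF gens_uhat[OF g]]
    have "op_mat N n m (\<lambda>p. \<Theta> (act (\<lambda>\<rho>. g (\<phi> \<rho>)) p)) = op_mat N n m (\<lambda>p. act (\<lambda>\<rho>. g (\<phi> \<rho>)) (\<Theta> p))"
      by (rule op_mat_cong) (simp add: q[OF g] span_mons_polys)
    then show "op_mat N n m \<Theta> * g (\<phi> (mrep N n)) = g (\<phi> (mrep N m)) * op_mat N n m \<Theta>"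
      unfolding act_mrep(1)[OF u, symmetric]
      by (simp only: op_mat_compose[OF assms(1) act_mrep(2)[OF u]] op_mat_compose[OF lin_act m])
  qed
  then have "intertwiner (mrep N n) (mrep N m) (op_mat N n m \<Theta>)"
    by (rule phi_intertwinerD[OF is_rep_mrep is_rep_mrep])
  then have "op_mat N n m \<Theta> * op_mat N n n (gen_op g) = op_mat N m m (gen_op g) * op_mat N n m \<Theta>"
    unfolding intertwiner_iff gens_mrep[OF assms(3), symmetric] using assms(3) by blast
  then have "op_mat N n m (\<lambda>p. \<Theta> (gen_op g p)) = op_mat N n m (\<lambda>p. gen_op g (\<Theta> p))"
    by (simp only: op_mat_compose[OF assms(1) maps_mons_gen_op] op_mat_compose[OF lin_gen_op m])
  then show ?thesis
  proof (rule op_mat_eqD[OF _ _ _ lin_compose[OF assms(1) lin_gen_op] lin_compose[OF lin_gen_op assms(1)] n])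
    show "maps_mons N n m (\<lambda>p. \<Theta> (gen_op g p))" "maps_mons N n m (\<lambda>p. gen_op g (\<Theta> p))"
      using maps_mons_gen_op[of N n g] m
      by (auto simp: maps_mons_def intro: maps_monsD[OF m assms(1)] maps_monsD[OF maps_mons_gen_op lin_gen_op])
  qed
qed

lemma polys_subst_gen:
  assumes "P \<in> ncpols N" "p \<in> polys N" "\<And>v p. v \<in> vars N \<Longrightarrow> p \<in> polys N \<Longrightarrow> x v p \<in> polys N"
  shows "subst P (hat F x) p \<in> polys N"
proof -
  have "hat F x v p \<in> polys N" if "v \<in> vars N" "p \<in> polys N" for v p
    using that assms(3) by (cases v) (auto simp: hat_eq_tw intro!: polys_sum polys_cmul polys_tw_gen)
  then have "set w \<subseteq> vars N \<Longrightarrow> foldr (hat F x) w p \<in> polys N" for w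
    using assms(2) by (induction w) auto
  then show ?thesis
    unfolding subst_def using assms(1) by (intro polys_sum polys_cmul) (auto simp: ncpols_def)
qed

lemma polys_subst: "P \<in> ncpols N \<Longrightarrow> p \<in> polys N \<Longrightarrow> subst P (hat F mulv) p \<in> polys N"
  by (rule polys_subst_gen) (auto intro: polys_mulv)

text \<open>In the coproduct as split by \<open>act_tws_XY\<close> and \<open>act_tws_H\<close>, the
  left factor acts on the coefficient vector of \<open>S\<close>, where invariance replaces it by
  its counit. What is left is the generator acting on the polynomial behind the words.\<close>

theorem invariant_subst_equivariant:
  assumes S: "S \<in> ncpols N" "q_invariant h \<phi> F S" and g: "g \<in> gens" and p: "p \<in> polys N"
  shows "subst S (hat F mulv) (gen_op g p) = gen_op g (subst S (hat F mulv) p)"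
proof (rule equivariantI[OF lin_subst[OF lin_hat[OF lin_mulv]] polys_subst[OF S(1)] g p])
  fix g :: "rep \<Rightarrow> complex mat" and p assume g: "g \<in> gens" and p: "p \<in> polys N"
  let ?s = "\<lambda>Ks k. lowcoeff F S (word_of Ks k)"
  have inv: "(\<Sum>j<wdim Ks. u (Q Ks) $$ (k, j) * ?s Ks j) = u triv $$ (0, 0) * ?s Ks k"
    if "u \<in> uhat (is_qrep h)" "k < wdim Ks" for u Ks k
  proof -
    have "(\<Sum>w'\<in>words Ks. u (Q Ks) $$ (widx (word_of Ks k), widx w') * lowcoeff F S w') = u triv $$ (0, 0) * ?s Ks k"
      using S(2) that word_of_words[OF that(2)] by (auto simp: q_invariant_def)
    then show ?thesis unfolding sum_words using that by (simp add: widx_word_of cong: sum.cong_simp)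
  qed
  have g0: "g' triv $$ (0, 0) = 0" if "g' \<in> gens" for g' using that by (auto simp: gens_def triv_def)
  have swap: "(\<Sum>j<wdim Ks. cmul (?s Ks j) (\<Sum>k<wdim Ks. cmul (u (Q Ks) $$ (k, j)) (f k)))
      = (\<Sum>k<wdim Ks. cmul (u triv $$ (0, 0) * ?s Ks k) (f k))" if "u \<in> uhat (is_qrep h)" for u Ks and f :: "nat \<Rightarrow> mpol"
  proof -
    have "(\<Sum>j<wdim Ks. cmul (?s Ks j) (\<Sum>k<wdim Ks. cmul (u (Q Ks) $$ (k, j)) (f k)))
      = (\<Sum>k<wdim Ks. cmul (\<Sum>j<wdim Ks. u (Q Ks) $$ (k, j) * ?s Ks j) (f k))"
      by (simp add: cmul_sum cmul_cmul cmul_sum_left mult.commute) (rule sum.swap)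
    then show ?thesis using inv[OF that] by (simp cong: sum.cong_simp)
  qed
  have main: "act (\<lambda>\<rho>. g (\<phi> \<rho>)) (\<Sum>j<wdim Ks. cmul (?s Ks j) (tws (word_of Ks j) p))
      = (\<Sum>j<wdim Ks. cmul (?s Ks j) (tws (word_of Ks j) (act (\<lambda>\<rho>. g (\<phi> \<rho>)) p)))" if "Ks \<in> lists_of S" for Ks
  proof -
    have Ks: "set Ks \<subseteq> {..N}" by (rule lists_of_ncpols[OF S(1) that])
    consider "g \<in> {opX, opY}" | "g = opH" using g by (auto simp: gens_def)
    then show ?thesis
    proof cases
      case 1
      have "act (\<lambda>\<rho>. g (\<phi> \<rho>)) (\<Sum>j<wdim Ks. cmul (?s Ks j) (tws (word_of Ks j) p))
        = (\<Sum>j<wdim Ks. cmul (?s Ks j) (\<Sum>k<wdim Ks. cmul (g (Q Ks) $$ (k, j)) (tws (word_of Ks k) (act (\<lambda>\<rho>. qpow h (- 1/2) (\<phi> \<rho>)) p))))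
        + (\<Sum>j<wdim Ks. cmul (?s Ks j) (\<Sum>k<wdim Ks. cmul (qpow h (1/2) (Q Ks) $$ (k, j)) (tws (word_of Ks k) (act (\<lambda>\<rho>. g (\<phi> \<rho>)) p))))"
        by (simp add: lin_sum[OF lin_act] lin_cmul[OF lin_act] act_tws_XY[OF 1 Ks _ p] cmul_add sum.distrib)
      then show ?thesis
        \<comment> \<open>The counit of X and Y is \<open>0\<close> and that of q^(H/2) is
          \<open>1\<close>, so the first sum vanishes and the second survives.\<close>
        unfolding swap[OF gens_uhat[OF g]] swap[OF qpow_uhat] by (simp add: g0[OF g] qpow_triv)
    next
      case 2
      have "act (\<lambda>\<rho>. g (\<phi> \<rho>)) (\<Sum>j<wdim Ks. cmul (?s Ks j) (tws (word_of Ks j) p))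
        = (\<Sum>j<wdim Ks. cmul (?s Ks j) (\<Sum>k<wdim Ks. cmul (opH (Q Ks) $$ (k, j)) (tws (word_of Ks k) p)))
        + (\<Sum>j<wdim Ks. cmul (?s Ks j) (tws (word_of Ks j) (act (\<lambda>\<rho>. g (\<phi> \<rho>)) p)))"
        unfolding sum.distrib[symmetric] cmul_add[symmetric] 2
        by (simp add: lin_sum[OF lin_act] lin_cmul[OF lin_act] act_tws_H[OF Ks _ p])
      then show ?thesis
        unfolding swap[OF gens_uhat[OF g[unfolded 2]]] by (simp add: g0[OF g[unfolded 2]])
    qed
  qed
  show "subst S (hat F mulv) (act (\<lambda>\<rho>. g (\<phi> \<rho>)) p) = act (\<lambda>\<rho>. g (\<phi> \<rho>)) (subst S (hat F mulv) p)"
    unfolding subst_eq_lowcoeff[OF S(1) lin_mulv] lin_sum[OF lin_act, of _ _ "lists_of S"]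
    by (intro sum.cong refl) (simp add: main)
qed

lemma tw_mult_invariant:
  assumes "v \<in> vars N" "p \<in> polys N" "i \<in> polys N" "invariant i"
  shows "tw F mulv v (i * p) = i * tw F mulv v p"
  using assms by (cases v)
    (auto simp: tw_def act_mult_invariant[OF slice_uhat] mulv_mult(2) sum_distrib_left intro!: sum.cong)

end

section \<open>Invariants split off\<close>

lemma gens_mem [simp]: "opH \<in> gens" "opX \<in> gens" "opY \<in> gens"
  by (auto simp: gens_def)

definition weight :: "var multiset \<Rightarrow> complex" where
  "weight M = (\<Sum>v\<in>#M. 2 * (of_nat (fst v) - of_nat (snd v)))"

lemma gen_op_H_mon:
  assumes "set_mset M \<subseteq> vars N"
  shows "gen_op opH (mon M) = cmul (weight M) (mon M)"
  using assms
proof (induction M)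
  case empty then show ?case by (simp add: mon_empty weight_def)
next
  case (add v M)
  obtain K n where v: "v = (K, n)" by (cases v)
  have n: "n \<le> 2 * K" using add.prems v by auto
  have "(\<Sum>l\<le>2 * K. cmul (opH (spin K) $$ (l, n)) (mulv (K, l) (mon M)))
    = (\<Sum>l\<le>2 * K. if l = n then cmul (2 * (of_nat K - of_nat n)) (mulv (K, n) (mon M)) else 0)"
    using n by (intro sum.cong) (auto simp: spin_index)
  then show ?case
    using add n by (simp add: v mulv_mon[symmetric] gen_op_mulv weight_def mulv_cmul cmul_add_left)
qed

lemma gen_op_lowers:
  fixes f :: "var \<Rightarrow> nat"
  assumes "\<And>K l n. l \<le> 2 * K \<Longrightarrow> n \<le> 2 * K \<Longrightarrow> g (spin K) $$ (l, n) \<noteq> 0 \<Longrightarrow> f (K, n) = Suc (f (K, l))"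
    and "set_mset M \<subseteq> vars N"
  shows "gen_op g (mon M) \<in> span_of {L. set_mset L \<subseteq> vars N \<and> Suc (\<Sum>v\<in>#L. f v) = (\<Sum>v\<in>#M. f v)}"
  using assms(2)
proof (induction M)
  case empty then show ?case by (simp add: mon_empty)
next
  case (add v M)
  obtain K n where v: "v = (K, n)" by (cases v)
  have n: "n \<le> 2 * K" "K \<le> N" "set_mset M \<subseteq> vars N" using add.prems v by auto
  let ?S = "{L. set_mset L \<subseteq> vars N \<and> Suc (\<Sum>v\<in>#L. f v) = (\<Sum>v\<in>#add_mset v M. f v)}"
  have "cmul (g (spin K) $$ (l, n)) (mulv (K, l) (mon M)) \<in> span_of ?S" if "l \<le> 2 * K" for l
  proof (cases "g (spin K) $$ (l, n) = 0")
    case False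
    then have "f (K, n) = Suc (f (K, l))" by (rule assms(1)[OF that n(1)])
    then show ?thesis using n that by (auto simp: v mulv_mon intro!: span_of_cmul span_of_mon)
  qed simp
  moreover have "mulv (K, n) (gen_op g (mon M)) \<in> span_of ?S"
    by (rule lin_span_of[OF lin_mulv add.IH[OF n(3)]]) (use n v in \<open>auto simp: mulv_mon intro!: span_of_mon\<close>)
  ultimately show ?case
    unfolding v mulv_mon[symmetric] gen_op_mulv by (intro span_of_add span_of_sum) auto
qed

text \<open>Each application lowers the total of \<open>f\<close> over a monomial by one, and this
  total cannot become negative. For X the index \<open>n\<close> itself serves as \<open>f\<close>,
  for Y the difference \<open>2 * K - n\<close>.\<close>

lemma gen_op_nilpotent:
  fixes f :: "var \<Rightarrow> nat"
  assumes "\<And>K l n. l \<le> 2 * K \<Longrightarrow> n \<le> 2 * K \<Longrightarrow> g (spin K) $$ (l, n) \<noteq> 0 \<Longrightarrow> f (K, n) = Suc (f (K, l))"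
    and "p \<in> polys N"
  obtains k where "(gen_op g ^^ k) p = 0"
proof -
  have nil: "(gen_op g ^^ k) p = 0" if "p \<in> span_of {L. set_mset L \<subseteq> vars N \<and> (\<Sum>v\<in>#L. f v) < k}" for k p
    using that
  proof (induction k arbitrary: p)
    case 0
    then have "Poly_Mapping.keys p = {}" by (auto simp: span_of_def)
    then show ?case by simp
  next
    case (Suc k)
    have "gen_op g p \<in> span_of {L. set_mset L \<subseteq> vars N \<and> (\<Sum>v\<in>#L. f v) < k}"
    proof (rule lin_span_of[OF lin_gen_op Suc.prems])
      fix M assume M: "M \<in> {L. set_mset L \<subseteq> vars N \<and> (\<Sum>v\<in>#L. f v) < Suc k}"
      then have "gen_op g (mon M) \<in> span_of {L. set_mset L \<subseteq> vars N \<and> Suc (\<Sum>v\<in>#L. f v) = (\<Sum>v\<in>#M. f v)}"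
        by (intro gen_op_lowers assms(1)) auto
      then show "gen_op g (mon M) \<in> span_of {L. set_mset L \<subseteq> vars N \<and> (\<Sum>v\<in>#L. f v) < k}"
        by (rule span_of_mono[rotated]) (use M in auto)
    qed
    then show ?case using Suc.IH by (simp add: funpow_swap1)
  qed
  let ?m = "Max (insert 0 ((\<lambda>L. \<Sum>v\<in>#L. f v) ` Poly_Mapping.keys p))"
  have "(\<Sum>v\<in>#L. f v) \<le> ?m" if "L \<in> Poly_Mapping.keys p" for L
    using that by (intro Max_ge) auto
  then have "p \<in> span_of {L. set_mset L \<subseteq> vars N \<and> (\<Sum>v\<in>#L. f v) < Suc ?m}"
    using assms(2) by (auto simp: span_of_def polys_def less_Suc_eq_le)
  then show ?thesis using nil that by blast
qed

lemma opX_nilpotent: assumes "p \<in> polys N" obtains k where "(gen_op opX ^^ k) p = 0"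
  by (rule gen_op_nilpotent[of opX snd, OF _ assms]) (auto simp: spin_index split: if_splits)

lemma opY_nilpotent: assumes "p \<in> polys N" obtains k where "(gen_op opY ^^ k) p = 0"
  by (rule gen_op_nilpotent[of opY "\<lambda>(K, n). 2 * K - n", OF _ assms]) (auto simp: spin_index split: if_splits)

lemma polys_funpow: "(\<And>p. p \<in> polys N \<Longrightarrow> X p \<in> polys N) \<Longrightarrow> p \<in> polys N \<Longrightarrow> (X ^^ k) p \<in> polys N"
  by (induction k) auto

section \<open>Highest weight theory on polynomials\<close>

context
  fixes N :: nat
begin

private abbreviation "H \<equiv> gen_op opH"
private abbreviation "X \<equiv> gen_op opX"
private abbreviation "Y \<equiv> gen_op opY"

private lemma HX: "p \<in> polys N \<Longrightarrow> H (X p) = X (H p) + cmul 2 (X p)"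
  and HY: "p \<in> polys N \<Longrightarrow> H (Y p) = Y (H p) + cmul (- 2) (Y p)"
  and XY: "p \<in> polys N \<Longrightarrow> X (Y p) = Y (X p) + H p"
  using gen_op_relations[of p N] by (auto simp: diff_eq_eq add.commute)

private lemma polys_Y: "p \<in> polys N \<Longrightarrow> (Y ^^ k) p \<in> polys N"
  by (intro polys_funpow polys_gen_op)

private lemma weight_Y: "w \<in> polys N \<Longrightarrow> H w = cmul c w \<Longrightarrow> H ((Y ^^ k) w) = cmul (c - 2 * of_nat k) ((Y ^^ k) w)"
proof (induction k)
  case (Suc k)
  then show ?case
    by (simp add: HY[OF polys_Y] lin_cmul[OF lin_gen_op] cmul_add_left[symmetric] algebra_simps)
qed simp

private lemma weight_X: "w \<in> polys N \<Longrightarrow> H w = 0 \<Longrightarrow> H ((X ^^ k) w) = cmul (2 * of_nat k) ((X ^^ k) w)"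
proof (induction k)
  case (Suc k)
  have "(X ^^ k) w \<in> polys N" using Suc.prems by (intro polys_funpow polys_gen_op)
  with Suc show ?case
    by (simp add: HX lin_cmul[OF lin_gen_op] cmul_add_left[symmetric] algebra_simps)
qed simp

text \<open>The factor is the sum of the weights c - 2i for i \<le> k, collected while X moves past
  the factors Y.\<close>

private lemma X_Y_power:
  assumes "w \<in> polys N" "H w = cmul c w" "X w = 0"
  shows "X ((Y ^^ Suc k) w) = cmul (of_nat (Suc k) * (c - of_nat k)) ((Y ^^ k) w)"
proof (induction k)
  case 0 then show ?case using assms by (simp add: XY lin_0[OF lin_gen_op])
next
  case (Suc k)
  have "X ((Y ^^ Suc (Suc k)) w) = Y (X ((Y ^^ Suc k) w)) + H ((Y ^^ Suc k) w)"
    using XY[OF polys_Y[OF assms(1), of "Suc k"]] by simp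
  also have "\<dots> = cmul (of_nat (Suc k) * (c - of_nat k) + (c - 2 * of_nat (Suc k))) ((Y ^^ Suc k) w)"
    unfolding Suc weight_Y[OF assms(1,2)] lin_cmul[OF lin_gen_op] cmul_add_left by simp
  also have "of_nat (Suc k) * (c - of_nat k) + (c - 2 * of_nat (Suc k)) = of_nat (Suc (Suc k)) * (c - of_nat (Suc k))"
    by (simp add: algebra_simps)
  finally show ?case .
qed

text \<open>For weight - 2 the ladder factors (k + 1)(- 2 - k) never vanish, so a vanishing power of
  Y, which exists by nilpotency, can be climbed back down to \<open>w = 0\<close>.\<close>

private lemma no_negative_highest_weight:
  assumes "w \<in> polys N" "H w = cmul (- 2) w" "X w = 0"
  shows "w = 0"
proof -
  obtain k where "(Y ^^ k) w = 0" using assms(1) by (rule opY_nilpotent)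
  moreover have "(Y ^^ k) w = 0 \<Longrightarrow> w = 0" for k
  proof (induction k)
    case (Suc k)
    have "cmul (of_nat (Suc k) * (- 2 - of_nat k)) ((Y ^^ k) w) = 0"
      using X_Y_power[OF assms, of k] Suc.prems by (simp add: lin_0[OF lin_gen_op])
    then have "cmul (1 / (of_nat (Suc k) * (- 2 - of_nat k))) (cmul (of_nat (Suc k) * (- 2 - of_nat k)) ((Y ^^ k) w)) = 0"
      by simp
    moreover have "of_nat (Suc k) * (- 2 - of_nat k) \<noteq> (0::complex)"
    proof -
      have "- 2 - of_nat k = - (of_nat (Suc (Suc k)) :: complex)" by simp
      then show ?thesis by (metis mult_eq_0_iff neg_equal_0_iff_equal of_nat_neq_0)
    qed
    ultimately have "(Y ^^ k) w = 0" by (simp only: cmul_cmul) simp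
    then show ?case by (rule Suc.IH)
  qed simp
  ultimately show ?thesis by blast
qed

text \<open>Y v has weight - 2, and X (Y v) = Y (X v) + H v = 0, so it is a highest weight vector of
  negative weight and vanishes.\<close>

private lemma highest_weight_0_invariant:
  assumes "v \<in> polys N" "H v = 0" "X v = 0"
  shows "invariant v"
proof -
  have "Y v = 0"
    by (rule no_negative_highest_weight) (use assms in \<open>auto simp: HY XY polys_gen_op lin_0[OF lin_gen_op]\<close>)
  then show ?thesis using assms by (auto simp: invariant_def gens_def)
qed

private lemma X_Y_powers:
  assumes "w \<in> polys N" "H w = cmul c w" "X w = 0"
  shows "(X ^^ k) ((Y ^^ k) w) = cmul (\<Prod>i<k. of_nat (Suc i) * (c - of_nat i)) w"
proof (induction k)
  case (Suc k)
  have "(X ^^ Suc k) ((Y ^^ Suc k) w) = (X ^^ k) (X ((Y ^^ Suc k) w))" by (simp add: funpow_swap1)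
  also have "\<dots> = cmul (of_nat (Suc k) * (c - of_nat k)) ((X ^^ k) ((Y ^^ k) w))"
    unfolding X_Y_power[OF assms] by (rule lin_cmul[OF lin_funpow[OF lin_gen_op]])
  finally show ?case unfolding Suc by (simp add: cmul_cmul mult_ac)
qed simp

text \<open>If \<open>X\<^bsup>k+1\<^esup> v = 0\<close>, then \<open>X\<^sup>k\<close> kills \<open>v\<close> up to a multiple of \<open>Y\<^sup>k X\<^sup>k v\<close>, which is an image under \<open>Y\<close>.\<close>

private lemma weight_0_decompose:
  "v \<in> polys N \<Longrightarrow> H v = 0 \<Longrightarrow> (X ^^ k) v = 0 \<Longrightarrow> \<exists>q\<in>polys N. invariant (v - Y q)"
proof (induction k arbitrary: v)
  case 0 then show ?case by (intro bexI[of _ 0]) (auto simp: invariant_def lin_0[OF lin_gen_op])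
next
  case (Suc k)
  show ?case
  proof (cases k)
    case 0
    then show ?thesis using Suc.prems highest_weight_0_invariant
      by (intro bexI[of _ 0]) (auto simp: lin_0[OF lin_gen_op])
  next
    case (Suc j)
    define w where "w = (X ^^ k) v"
    have w: "w \<in> polys N" "H w = cmul (2 * of_nat k) w" "X w = 0"
      using Suc.prems weight_X by (auto simp: w_def intro!: polys_funpow polys_gen_op)
    \<comment> \<open>The scalar by which X^k Y^k multiplies \<open>w\<close>, a highest weight
      vector of weight 2k; its factors do not vanish because i < k. Dividing by it makes X^k kill
      \<open>v - Y q\<close>.\<close>
    define c where "c = (\<Prod>i<k. of_nat (Suc i) * (2 * of_nat k - of_nat i) :: complex)"
    have "of_nat (Suc i) * (2 * of_nat k - of_nat i) \<noteq> (0 :: complex)" if "i < k" for i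
    proof -
      have "2 * of_nat k - of_nat i = (of_nat (2 * k - i) :: complex)" using that by (simp add: of_nat_diff)
      moreover have "of_nat (2 * k - i) \<noteq> (0 :: complex)" using that unfolding of_nat_eq_0_iff by simp
      ultimately show ?thesis by (metis mult_eq_0_iff of_nat_neq_0)
    qed
    then have c: "c \<noteq> 0" by (auto simp: c_def)
    define q where "q = cmul (1 / c) ((Y ^^ j) w)"
    have q: "q \<in> polys N" using w by (auto simp: q_def intro!: polys_cmul polys_Y)
    have Yq: "Y q = cmul (1 / c) ((Y ^^ k) w)" by (simp add: q_def Suc lin_cmul[OF lin_gen_op])
    have "(X ^^ k) (v - Y q) = 0"
      unfolding lin_diff[OF lin_funpow[OF lin_gen_op]] Yq lin_cmul[OF lin_funpow[OF lin_gen_op]]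
        X_Y_powers[OF w] c_def[symmetric] using c by (simp add: w_def cmul_cmul)
    moreover have "H (v - Y q) = 0"
      unfolding lin_diff[OF lin_gen_op] Yq lin_cmul[OF lin_gen_op] weight_Y[OF w(1,2)] using Suc.prems by simp
    moreover have vq: "v - Y q \<in> polys N" using q Suc.prems by (intro polys_diff polys_gen_op)
    ultimately obtain q' where q': "q' \<in> polys N" "invariant (v - Y q - Y q')"
      using Suc.IH by blast
    moreover have "v - Y q - Y q' = v - Y (q + q')" by (simp add: lin_add[OF lin_gen_op] diff_diff_eq)
    ultimately show ?thesis using q polys_add by metis
  qed
qed

text \<open>A monomial is a weight vector. If its weight is not zero, it is an image under H;
  otherwise \<open>weight_0_decompose\<close> applies. Images under Y and H are what an invariant
  functional annihilates.\<close>

lemma polys_decompose: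
  assumes "p \<in> polys N"
  obtains p0 q r where "p0 \<in> polys N" "q \<in> polys N" "r \<in> polys N" "invariant p0"
    "p = p0 + gen_op opY q + gen_op opH r"
proof -
  define D where "D = {p. \<exists>p0\<in>polys N. \<exists>q\<in>polys N. \<exists>r\<in>polys N. invariant p0 \<and> p = p0 + Y q + H r}"
  have inv: "invariant (i + j)" "invariant (cmul c i)" if "invariant i" "invariant j" for i j c
    using that by (auto simp: invariant_def lin_add[OF lin_gen_op] lin_cmul[OF lin_gen_op])
  have add: "a + b \<in> D" if ab: "a \<in> D" "b \<in> D" for a b
  proof -
    obtain p0 q r where a: "p0 \<in> polys N" "q \<in> polys N" "r \<in> polys N" "invariant p0" "a = p0 + Y q + H r"
      using ab(1) by (auto simp: D_def)
    obtain p1 q1 r1 where b: "p1 \<in> polys N" "q1 \<in> polys N" "r1 \<in> polys N" "invariant p1" "b = p1 + Y q1 + H r1"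
      using ab(2) by (auto simp: D_def)
    have "a + b = (p0 + p1) + Y (q + q1) + H (r + r1)" by (simp add: a b lin_add[OF lin_gen_op])
    then show ?thesis using a b inv(1) unfolding D_def by (blast intro: polys_add)
  qed
  have scale: "cmul c a \<in> D" if a: "a \<in> D" for c a
  proof -
    obtain p0 q r where a: "p0 \<in> polys N" "q \<in> polys N" "r \<in> polys N" "invariant p0" "a = p0 + Y q + H r"
      using a by (auto simp: D_def)
    have "cmul c a = cmul c p0 + Y (cmul c q) + H (cmul c r)" by (simp add: a cmul_add lin_cmul[OF lin_gen_op])
    then show ?thesis using a inv(2) unfolding D_def by (blast intro: polys_cmul)
  qed
  have zero: "0 \<in> D" unfolding D_def
    by (auto intro!: bexI[of _ 0] simp: lin_0[OF lin_gen_op] invariant_def)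
  have monD: "mon M \<in> D" if M: "set_mset M \<subseteq> vars N" for M
  proof (cases "weight M = 0")
    case True
    then have "H (mon M) = 0" using gen_op_H_mon[OF M] by simp
    moreover obtain k where "(X ^^ k) (mon M) = 0" using polys_mon[OF M] by (rule opX_nilpotent)
    ultimately obtain q where "q \<in> polys N" "invariant (mon M - Y q)"
      using weight_0_decompose[OF polys_mon[OF M]] by blast
    then show ?thesis unfolding D_def using polys_mon[OF M]
      by (intro CollectI bexI[of _ "mon M - Y q"] bexI[of _ q] bexI[of _ 0])
        (auto simp: lin_0[OF lin_gen_op] polys_diff polys_gen_op)
  next
    case False
    have "mon M = 0 + Y 0 + H (cmul (1 / weight M) (mon M))"
      using False by (simp add: lin_0[OF lin_gen_op] lin_cmul[OF lin_gen_op] gen_op_H_mon[OF M] cmul_cmul)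
    moreover have "invariant 0" by (simp add: invariant_def lin_0[OF lin_gen_op])
    ultimately show ?thesis unfolding D_def using polys_mon[OF M]
      by (blast intro: polys_cmul polys_0)
  qed
  have sumD: "sum f A \<in> D" if "\<And>i. i \<in> A \<Longrightarrow> f i \<in> D" for f and A :: "var multiset set"
    using that by (induction A rule: infinite_finite_induct) (auto simp: zero add)
  have "p \<in> D"
    by (subst poly_expand, intro sumD scale monD) (use assms in \<open>auto simp: polys_def\<close>)
  then show ?thesis using that by (auto simp: D_def)
qed

end

text \<open>Linearity over the invariants is a separate requirement: it does not follow from
  commuting with su(2), and an invariant Laplacian would violate it. It makes \<open>T\<close> act
  on invariants as multiplication by \<open>T 1\<close>.\<close>

definition equivariant_op :: "nat \<Rightarrow> oper \<Rightarrow> bool" where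
  "equivariant_op N T \<longleftrightarrow> lin T \<and> (\<forall>p\<in>polys N. T p \<in> polys N \<and> (\<forall>g\<in>gens. T (gen_op g p) = gen_op g (T p))
     \<and> (\<forall>i\<in>polys N. invariant i \<longrightarrow> T (i * p) = i * T p))"

text \<open>An invariant functional sees only the invariant part of \<open>p\<close>, where \<open>T\<close> is multiplication
  by \<open>T 1\<close>.\<close>

lemma invariant_functional_equivariant:
  fixes L :: "mpol \<Rightarrow> complex"
  assumes L: "\<And>p q. L (p + q) = L p + L q" "\<And>g p. g \<in> gens \<Longrightarrow> p \<in> polys N \<Longrightarrow> L (gen_op g p) = 0"
    and T: "equivariant_op N T" and p: "p \<in> polys N"
  shows "L (T p) = L (T 1 * p)"
proof -
  have T': "lin T" "\<And>p. p \<in> polys N \<Longrightarrow> T p \<in> polys N" "\<And>g p. g \<in> gens \<Longrightarrow> p \<in> polys N \<Longrightarrow> T (gen_op g p) = gen_op g (T p)"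
    "\<And>i p. i \<in> polys N \<Longrightarrow> p \<in> polys N \<Longrightarrow> invariant i \<Longrightarrow> T (i * p) = i * T p"
    using T by (auto simp: equivariant_op_def)
  obtain p0 q r where d: "p0 \<in> polys N" "q \<in> polys N" "r \<in> polys N" "invariant p0" "p = p0 + gen_op opY q + gen_op opH r"
    using p by (rule polys_decompose)
  have gT: "gen_op g (T 1) = 0" if "g \<in> gens" for g
    using T'(3)[OF that, of 1] lin_0[OF T'(1)] by simp
  have mul: "T 1 * gen_op g a = gen_op g (T 1 * a)" if "g \<in> gens" for g a
    by (simp add: gen_op_mult gT[OF that])
  have "L (T p) = L (T p0)"
    using d by (simp add: lin_add[OF T'(1)] L T')
  also have "T p0 = T 1 * p0" using T'(4)[OF d(1) polys_1 d(4)] by (simp add: mult.commute)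
  also have "L (T 1 * p0) = L (T 1 * p)"
    using d T'(2)[OF polys_1] by (simp add: d(5) distrib_left L mul polys_mult)
  finally show ?thesis .
qed

lemma equivariant_op_funpow:
  assumes "equivariant_op N T"
  shows "equivariant_op N (T ^^ k)"
proof (induction k)
  case 0 then show ?case by (auto simp: equivariant_op_def lin_def)
next
  case (Suc k)
  have "lin (T ^^ Suc k)" using assms by (intro lin_funpow) (simp add: equivariant_op_def)
  with Suc show ?case using assms by (simp add: equivariant_op_def comp_def)
qed

lemma equivariant_op_scale: "equivariant_op N T \<Longrightarrow> equivariant_op N (\<lambda>p. cmul c (T p))"
  by (auto simp: equivariant_op_def lin_scale polys_cmul lin_cmul[OF lin_gen_op] cmul_mult_right)

context drinfeld_twist
begin

lemma hat_mult_invariant: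
  assumes "v \<in> vars N" "p \<in> polys N" "i \<in> polys N" "invariant i"
  shows "hat F mulv v (i * p) = i * hat F mulv v p"
  using assms by (cases v)
    (auto simp: hat_eq_tw tw_mult_invariant sum_distrib_left cmul_mult_right intro!: sum.cong)

lemma polys_hat_gen:
  assumes "v \<in> vars N" "p \<in> polys N" "\<And>v p. v \<in> vars N \<Longrightarrow> p \<in> polys N \<Longrightarrow> x v p \<in> polys N"
  shows "hat F x v p \<in> polys N"
  using assms by (cases v) (auto simp: hat_eq_tw intro!: polys_sum polys_cmul polys_tw_gen)

lemma polys_hat: "v \<in> vars N \<Longrightarrow> p \<in> polys N \<Longrightarrow> hat F mulv v p \<in> polys N"
  by (rule polys_hat_gen) (auto intro: polys_mulv)

lemma subst_mult_invariant:
  assumes "P \<in> ncpols N" "p \<in> polys N" "i \<in> polys N" "invariant i"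
  shows "subst P (hat F mulv) (i * p) = i * subst P (hat F mulv) p"
proof -
  have "set w \<subseteq> vars N \<Longrightarrow> foldr (hat F mulv) w (i * p) = i * foldr (hat F mulv) w p \<and> foldr (hat F mulv) w p \<in> polys N" for w
    using assms by (induction w) (auto simp: hat_mult_invariant polys_hat)
  then show ?thesis
    unfolding subst_def sum_distrib_left using assms(1)
    by (intro sum.cong refl) (auto simp: ncpols_def cmul_mult_right)
qed

lemma equivariant_subst:
  assumes "S \<in> ncpols N" "q_invariant h \<phi> F S"
  shows "equivariant_op N (subst S (hat F mulv))"
  unfolding equivariant_op_def
  using assms by (auto intro!: lin_subst lin_hat lin_mulv polys_subst invariant_subst_equivariant subst_mult_invariant)

end

section \<open>Shifted derivatives\<close>

lemma cmul_minus_left: "cmul (- c) p = - cmul c p"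
  by (rule poly_mapping_eqI) simp

text \<open>For \<open>d K = 1 / D K\<close> its twisted version is \<open>bhat\<close>. The vector
  \<open>d\<close> stays free, because the resulting mean must be seen to be polynomial in
  it.\<close>

definition shift_op :: "(nat \<Rightarrow> complex) \<Rightarrow> var \<Rightarrow> oper" where
  "shift_op d v p = derv v p + cmul (d (fst v)) (mulv v p)"

definition gcv :: "var \<Rightarrow> var \<Rightarrow> complex" where
  "gcv v w = (if fst v = fst w then gc (fst v) (snd v) (snd w) else 0)"

lemma gcv_sym: "gcv v w = gcv w v"
  using gc_sym by (auto simp: gcv_def)

lemma derv_mult: "derv v (p * q) = derv v p * q + p * derv v q"
  by (cases v) (simp add: derv_eq_deriv_ext deriv_ext_mult)

lemma derv_xvar: "derv v (xvar w) = cmul (gcv v w) 1"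
proof (cases v; cases w)
  fix K n L m assume "v = (K, n)" "w = (L, m)"
  then show ?thesis by (auto simp: derv_eq_deriv_ext gcv_def gc_def)
qed

lemma derv_1 [simp]: "derv v 1 = 0"
  by (cases v) (simp add: derv_eq_deriv_ext)

lemma derv_mulv: "derv v (mulv w p) = cmul (gcv v w) p + mulv w (derv v p)"
  by (simp add: mulv_eq derv_mult derv_xvar cmul_mult_left)

lemma derv_commute: "derv v (derv w p) = derv w (derv v p)"
proof (rule lin_eqI[OF lin_compose[OF lin_derv lin_derv] lin_compose[OF lin_derv lin_derv]])
  fix M
  show "derv v (derv w (mon M)) = derv w (derv v (mon M))"
    by (induction M)
      (auto simp: mon_empty lin_0[OF lin_derv] mulv_mon[symmetric] derv_mulv lin_add[OF lin_derv] lin_cmul[OF lin_derv])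
qed

lemma lin_shift_op: "lin (shift_op d v)"
  unfolding shift_op_def by (intro lin_plus lin_derv lin_scale lin_mulv)

lemma mulv_commute: "mulv v (mulv w p) = mulv w (mulv v p)"
  by (simp add: mulv_def ac_simps)

text \<open>The two cross terms carry the factor \<open>d\<close> at the label of \<open>v\<close>
  and at that of \<open>w\<close>; they agree because \<open>gc\<close> is symmetric and pairs only
  equal labels.\<close>

lemma shift_op_commute: "shift_op d v (shift_op d w p) = shift_op d w (shift_op d v p)"
proof -
  have "cmul (d (fst w)) (cmul (gcv v w) p) = cmul (d (fst v)) (cmul (gcv w v) p)"
    by (auto simp: gcv_sym[of v w]) (auto simp: gcv_def)
  then show ?thesis
    by (simp add: shift_op_def lin_add[OF lin_derv] lin_add[OF lin_mulv] lin_cmul[OF lin_derv] lin_cmul[OF lin_mulv]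
        derv_mulv cmul_add derv_commute[of v w] mulv_commute[of v w] cmul_cmul mult.commute add_ac)
qed

text \<open>Evaluation of a polynomial at the operators \<open>shift_op d v\<close>, applied to
  \<open>1\<close>. The fold over a multiset is meaningful because these operators commute.\<close>

definition wick :: "(nat \<Rightarrow> complex) \<Rightarrow> oper" where
  "wick d = linext (\<lambda>M. fold_mset (shift_op d) 1 M)"

lemma lin_wick: "lin (wick d)"
  unfolding wick_def by (rule lin_linext)

lemma wick_1 [simp]: "wick d 1 = 1"
  using linext_mon[of "\<lambda>M. fold_mset (shift_op d) 1 M" "{#}"] by (simp add: wick_def mon_empty)

lemma wick_mulv: "wick d (mulv v p) = shift_op d v (wick d p)"
proof (rule lin_eqI[OF lin_compose[OF lin_wick lin_mulv] lin_compose[OF lin_shift_op lin_wick]])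
  fix M
  interpret comp_fun_commute "shift_op d"
    by unfold_locales (auto simp: shift_op_commute)
  show "wick d (mulv v (mon M)) = shift_op d v (wick d (mon M))"
    by (simp add: mulv_mon wick_def)
qed

lemma derv_shift_op: "derv v (shift_op d w p) = cmul (d (fst v) * gcv v w) p + shift_op d w (derv v p)"
proof -
  have "d (fst w) * gcv v w = d (fst v) * gcv v w" by (auto simp: gcv_def)
  then show ?thesis
    by (simp only: shift_op_def lin_add[OF lin_derv] lin_cmul[OF lin_derv] derv_mulv cmul_add cmul_cmul derv_commute[of v w] add_ac)
qed

text \<open>The commutator of a derivative with a shifted derivative is a scalar, \<open>d\<close>
  times the derivative of a variable. Both sides thus satisfy the same recursion; integration by
  parts for the mean, \<open>wick_mean_mulv\<close>, is a consequence.\<close>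

lemma derv_wick: "derv v (wick d p) = cmul (d (fst v)) (wick d (derv v p))"
proof (rule lin_eqI[OF lin_compose[OF lin_derv lin_wick] lin_scale[OF lin_compose[OF lin_wick lin_derv]]])
  fix M
  show "derv v (wick d (mon M)) = cmul (d (fst v)) (wick d (derv v (mon M)))"
  proof (induction M)
    case empty then show ?case by (simp add: mon_empty lin_0[OF lin_wick])
  next
    case (add w M)
    then show ?case
      by (simp add: mulv_mon[symmetric] wick_mulv derv_shift_op derv_mulv lin_add[OF lin_wick] lin_cmul[OF lin_wick]
          lin_cmul[OF lin_shift_op] cmul_add cmul_cmul)
  qed
qed

lemma polys_shift_op: "v \<in> vars N \<Longrightarrow> p \<in> polys N \<Longrightarrow> shift_op d v p \<in> polys N"
  by (simp add: shift_op_def polys_add polys_cmul polys_derv polys_mulv)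

lemma polys_wick: "p \<in> polys N \<Longrightarrow> wick d p \<in> polys N"
  unfolding polys_eq_span_of
proof (erule lin_span_of[OF lin_wick], unfold polys_eq_span_of[symmetric])
  fix M assume "M \<in> {M. set_mset M \<subseteq> vars N}"
  then show "wick d (mon M) \<in> polys N"
    by (induction M) (auto simp: mon_empty mulv_mon[symmetric] wick_mulv polys_shift_op)
qed

text \<open>Derivatives transform like the variables because \<open>gc\<close> is invariant.
  Commutator and right-hand sum both obey the Leibniz rule, so a comparison on variables is enough,
  and there it is \<open>gc_invariant\<close>.\<close>

lemma gen_op_derv:
  assumes "g \<in> gens" "(K, n) \<in> vars N" "p \<in> polys N"
  shows "gen_op g (derv (K, n) p) = (\<Sum>l\<le>2 * K. cmul (g (spin K) $$ (l, n)) (derv (K, l) p)) + derv (K, n) (gen_op g p)"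
proof -
  have "gen_op g (derv (K, n) p) - derv (K, n) (gen_op g p) = (\<Sum>l\<le>2 * K. cmul (g (spin K) $$ (l, n)) (derv (K, l) p))"
  proof (rule derivation_eqI[of "\<lambda>p. gen_op g (derv (K, n) p) - derv (K, n) (gen_op g p)"
      "\<lambda>p. \<Sum>l\<le>2 * K. cmul (g (spin K) $$ (l, n)) (derv (K, l) p)", OF _ _ assms(3)])
    show "lin (\<lambda>p. gen_op g (derv (K, n) p) - derv (K, n) (gen_op g p))"
      by (rule lin_minus_fun[OF lin_compose[OF lin_gen_op lin_derv] lin_compose[OF lin_derv lin_gen_op]])
    show "lin (\<lambda>p. \<Sum>l\<le>2 * K. cmul (g (spin K) $$ (l, n)) (derv (K, l) p))"
      by (rule lin_sum_fun[OF lin_scale[OF lin_derv]])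
    show "gen_op g (derv (K, n) 1) - derv (K, n) (gen_op g 1) = (\<Sum>l\<le>2 * K. cmul (g (spin K) $$ (l, n)) (derv (K, l) 1))"
      by (simp add: lin_0[OF lin_gen_op] lin_0[OF lin_derv])
    show "gen_op g (derv (K, n) (mulv v q)) - derv (K, n) (gen_op g (mulv v q)) =
      (gen_op g (derv (K, n) (xvar v)) - derv (K, n) (gen_op g (xvar v))) * q
      + mulv v (gen_op g (derv (K, n) q) - derv (K, n) (gen_op g q))" for v q
      by (simp add: mulv_eq gen_op_mult derv_mult lin_add[OF lin_gen_op] lin_add[OF lin_derv] algebra_simps)
    show "(\<Sum>l\<le>2 * K. cmul (g (spin K) $$ (l, n)) (derv (K, l) (mulv v q)))
      = (\<Sum>l\<le>2 * K. cmul (g (spin K) $$ (l, n)) (derv (K, l) (xvar v))) * q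
      + mulv v (\<Sum>l\<le>2 * K. cmul (g (spin K) $$ (l, n)) (derv (K, l) q))" for v q
      by (simp add: mulv_eq derv_mult cmul_add sum.distrib sum_distrib_right sum_distrib_left cmul_mult_left cmul_mult_right)
    fix v assume v: "v \<in> vars N"
    obtain L m where Lm: "v = (L, m)" by (cases v)
    have a: "gen_op g (derv (K, n) (xvar v)) = 0"
      by (simp add: derv_xvar lin_cmul[OF lin_gen_op])
    have b: "derv (K, n) (gen_op g (xvar v)) = (if K = L then cmul (\<Sum>l\<le>2 * K. g (spin K) $$ (l, m) * gc K n l) 1 else 0)"
      by (simp add: Lm gen_op_xvar lin_sum[OF lin_derv] lin_cmul[OF lin_derv] derv_xvar gcv_def cmul_cmul cmul_sum_left)
    have c: "(\<Sum>l\<le>2 * K. cmul (g (spin K) $$ (l, n)) (derv (K, l) (xvar v)))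
      = (if K = L then cmul (\<Sum>l\<le>2 * K. g (spin K) $$ (l, n) * gc K m l) 1 else 0)"
    proof -
      have "cmul (g (spin K) $$ (l, n)) (derv (K, l) (xvar v)) = (if K = L then cmul (g (spin K) $$ (l, n) * gc K m l) 1 else 0)" for l
        using gc_sym[of L l m] by (simp add: Lm derv_xvar gcv_def cmul_cmul)
      then show ?thesis by (simp add: cmul_sum_left)
    qed
    have "- cmul (\<Sum>l\<le>2 * K. g (spin K) $$ (l, m) * gc K n l) 1 = cmul (\<Sum>l\<le>2 * K. g (spin K) $$ (l, n) * gc K m l) 1" if "K = L"
    proof -
      have "(\<Sum>l\<le>2 * K. g (spin K) $$ (l, m) * gc K n l) + (\<Sum>l\<le>2 * K. g (spin K) $$ (l, n) * gc K m l) = 0"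
        using assms(2) v Lm that by (intro gc_invariant[OF assms(1)]) auto
      then have "(\<Sum>l\<le>2 * K. g (spin K) $$ (l, n) * gc K m l) = - (\<Sum>l\<le>2 * K. g (spin K) $$ (l, m) * gc K n l)"
        by (rule minus_unique[symmetric])
      then show ?thesis by (simp only: cmul_minus_left)
    qed
    then show "gen_op g (derv (K, n) (xvar v)) - derv (K, n) (gen_op g (xvar v))
      = (\<Sum>l\<le>2 * K. cmul (g (spin K) $$ (l, n)) (derv (K, l) (xvar v)))"
      unfolding a b c by simp
  qed
  then show ?thesis by (simp add: diff_eq_eq)
qed

lemma gen_op_shift_op:
  assumes "g \<in> gens" "(K, n) \<in> vars N" "p \<in> polys N"
  shows "gen_op g (shift_op d (K, n) p) = (\<Sum>l\<le>2 * K. cmul (g (spin K) $$ (l, n)) (shift_op d (K, l) p)) + shift_op d (K, n) (gen_op g p)"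
  by (simp add: shift_op_def lin_add[OF lin_gen_op] lin_cmul[OF lin_gen_op] gen_op_derv[OF assms] gen_op_mulv
      cmul_add cmul_sum sum.distrib cmul_cmul mult.commute add_ac)

text \<open>Variables and shifted derivatives transform alike, so the recursion
  \<open>wick_mulv\<close> is equivariant at each step.\<close>

lemma wick_gen_op:
  assumes "g \<in> gens" "p \<in> polys N"
  shows "wick d (gen_op g p) = gen_op g (wick d p)"
proof (rule lin_eqI_polys_mulv[OF lin_compose[OF lin_wick lin_gen_op] lin_compose[OF lin_gen_op lin_wick] assms(2)])
  show "wick d (gen_op g 1) = gen_op g (wick d 1)" by (simp add: lin_0[OF lin_wick])
  fix v M assume v: "v \<in> vars N" and M: "set_mset M \<subseteq> vars N" and IH: "wick d (gen_op g (mon M)) = gen_op g (wick d (mon M))"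
  obtain K n where Kn: "v = (K, n)" by (cases v)
  show "wick d (gen_op g (mulv v (mon M))) = gen_op g (wick d (mulv v (mon M)))"
    unfolding wick_mulv Kn gen_op_mulv gen_op_shift_op[OF assms(1) v[unfolded Kn] polys_wick[OF polys_mon[OF M]]]
    by (simp add: lin_add[OF lin_wick] lin_sum[OF lin_wick] lin_cmul[OF lin_wick] wick_mulv IH)
qed

lemma act_wick: "u \<in> uhat is_rep \<Longrightarrow> p \<in> polys N \<Longrightarrow> wick d (act u p) = act u (wick d p)"
  by (rule act_equivariant[OF _ lin_wick]) (auto intro: polys_wick wick_gen_op)

text \<open>The Gaussian mean with covariance \<open>d K * gc K n m\<close> in algebraic form,
  meaningful for arbitrary complex \<open>d\<close>.\<close>

definition wick_mean :: "(nat \<Rightarrow> complex) \<Rightarrow> mpol \<Rightarrow> complex" where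
  "wick_mean d p = Poly_Mapping.lookup (wick d p) {#}"

lemma lookup_mulv_empty [simp]: "Poly_Mapping.lookup (mulv v p) {#} = 0"
  by (subst lin_expand[OF lin_mulv]) (simp add: lookup_sum mulv_mon lookup_single)

lemma lookup_gen_op_empty: "Poly_Mapping.lookup (gen_op g p) {#} = 0"
proof -
  have "Poly_Mapping.lookup (gen_op g (mon M)) {#} = 0" for M
  proof (cases M)
    case empty then show ?thesis by (simp add: mon_empty)
  next
    case (add v M')
    then show ?thesis by (cases v) (simp add: mulv_mon[symmetric] gen_op_mulv lookup_add lookup_sum)
  qed
  then show ?thesis by (subst lin_expand[OF lin_gen_op]) (simp add: lookup_sum)
qed

lemma wick_mean_add: "wick_mean d (p + q) = wick_mean d p + wick_mean d q"
  and wick_mean_1: "wick_mean d 1 = 1"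
  using lookup_single_eq[of "{#}" "1 :: complex"] unfolding mon_empty
  by (simp_all add: wick_mean_def lin_add[OF lin_wick] lin_cmul[OF lin_wick] lookup_add)

lemma wick_mean_gen_op: "g \<in> gens \<Longrightarrow> p \<in> polys N \<Longrightarrow> wick_mean d (gen_op g p) = 0"
  by (simp add: wick_mean_def wick_gen_op lookup_gen_op_empty)

lemma wick_mean_mulv: "wick_mean d (mulv v p) = d (fst v) * wick_mean d (derv v p)"
  by (simp add: wick_mean_def wick_mulv shift_op_def lookup_add derv_wick)

subsection \<open>The generating function\<close>

text \<open>It occurs in two roles: with \<open>d = D\<close> as the Gaussian weight, and with
  \<open>d K = 1 / D K\<close> as the exponent of the generating function.\<close>

definition quad_form :: "nat \<Rightarrow> (nat \<Rightarrow> complex) \<Rightarrow> mpol" where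
  "quad_form N d = (\<Sum>K\<le>N. \<Sum>n\<le>2 * K. \<Sum>m\<le>2 * K. cmul (1/2 * d K * gc K n m) (mulv (K, n) (mulv (K, m) 1)))"

lemma quad_form_xvar: "quad_form N d = (\<Sum>K\<le>N. \<Sum>n\<le>2 * K. \<Sum>m\<le>2 * K. cmul (1/2 * d K * gc K n m) (xvar (K, n) * xvar (K, m)))"
  by (simp add: quad_form_def mulv_eq)

lemma polys_quad_form: "quad_form N d \<in> polys N"
  unfolding quad_form_def by (intro polys_sum polys_cmul polys_mulv) auto

lemma gc_inverse:
  assumes "n \<le> 2 * K" "m \<le> 2 * K"
  shows "(\<Sum>a\<le>2 * K. gc K n a * gc K a m) = (if n = m then 1 else 0)"
proof -
  have "even (K + (2 * K - n) + (K + n))" using assms by presburger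
  then have p: "(- 1 :: complex) ^ (K + (2 * K - n)) * (- 1) ^ (K + n) = 1" by (simp only: power_add[symmetric] neg_one_even_power)
  have iff: "(2 * K - n + m = 2 * K) = (n = m)" using assms by auto
  have g: "gc K (2 * K - n) m * (- 1) ^ (K + n) = (if n = m then 1 else 0)"
  proof (cases "n = m")
    case True
    then show ?thesis using p unfolding gc_def iff by (simp only: refl if_True)
  next
    case False
    then show ?thesis unfolding gc_def iff by simp
  qed
  have "(\<Sum>a\<le>2 * K. gc K n a * gc K a m) = (\<Sum>a\<le>2 * K. gc K a m * gc K n a)" by (simp only: mult.commute)
  then show ?thesis by (simp only: gc_mult_sum[OF assms(1)] g)
qed

lemma derv_quad_form:
  assumes "v \<in> vars N"
  shows "derv v (quad_form N d) = cmul (d (fst v)) (xvar v)"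
proof -
  obtain K n where v: "v = (K, n)" "K \<le> N" "n \<le> 2 * K" using assms by (cases v) auto
  have half: "(\<Sum>a\<le>2 * K. \<Sum>b\<le>2 * K. cmul (gc K a b * gc K n a) (xvar (K, b))) = xvar (K, n)"
  proof -
    have "(\<Sum>a\<le>2 * K. \<Sum>b\<le>2 * K. cmul (gc K a b * gc K n a) (xvar (K, b))) = (\<Sum>b\<le>2 * K. cmul (\<Sum>a\<le>2 * K. gc K n a * gc K a b) (xvar (K, b)))"
      by (subst sum.swap) (simp add: cmul_sum_left mult.commute)
    also have "\<dots> = (\<Sum>b\<le>2 * K. if b = n then xvar (K, n) else 0)"
      using v by (intro sum.cong) (auto simp: gc_inverse)
    finally show ?thesis using v by simp
  qed
  have half': "(\<Sum>a\<le>2 * K. \<Sum>b\<le>2 * K. cmul (gc K a b * gc K n b) (xvar (K, a))) = xvar (K, n)"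
    using half by (subst sum.swap) (simp add: gc_sym)
  have K: "derv v (cmul (1/2 * d L * gc L a b) (xvar (L, a) * xvar (L, b))) =
     (if L = K then cmul (1/2 * d K) (cmul (gc K a b * gc K n a) (xvar (K, b)) + cmul (gc K a b * gc K n b) (xvar (K, a))) else 0)" for L a b
    by (auto simp: v lin_cmul[OF lin_derv] derv_mult derv_xvar gcv_def cmul_mult_left cmul_mult_right cmul_add cmul_cmul mult_ac)
  have "derv v (quad_form N d) = (\<Sum>L\<le>N. if L = K then cmul (1/2 * d K) ((\<Sum>a\<le>2 * K. \<Sum>b\<le>2 * K. cmul (gc K a b * gc K n a) (xvar (K, b)))
     + (\<Sum>a\<le>2 * K. \<Sum>b\<le>2 * K. cmul (gc K a b * gc K n b) (xvar (K, a)))) else 0)"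
    unfolding quad_form_xvar lin_sum[OF lin_derv] K
    by (intro sum.cong refl) (auto simp: cmul_sum cmul_add sum.distrib)
  also have "\<dots> = cmul (1/2 * d K) (xvar (K, n) + xvar (K, n))"
    using v by (simp add: half half')
  also have "\<dots> = cmul (d K) (xvar (K, n))"
    by (simp only: cmul_add cmul_add_left[symmetric]) simp
  finally show ?thesis by (simp add: v)
qed

text \<open>Lower-index invariance read at the reflected indices \<open>2 * K - a\<close> and
  \<open>2 * K - b\<close>; the rest is a comparison of signs.\<close>

lemma gc_invariant_upper:
  assumes "g \<in> gens" "a \<le> 2 * K" "b \<le> 2 * K"
  shows "(\<Sum>n\<le>2 * K. g (spin K) $$ (a, n) * gc K n b) + (\<Sum>n\<le>2 * K. g (spin K) $$ (b, n) * gc K a n) = 0"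
proof -
  have e: "even (K + b) \<longleftrightarrow> even (K + (2 * K - b))" "even (K + a) \<longleftrightarrow> even (K + (2 * K - a))" using assms by presburger+
  have "g (spin K) $$ (a, 2 * K - b) * (- 1) ^ (K + (2 * K - a)) + g (spin K) $$ (b, 2 * K - a) * (- 1) ^ (K + (2 * K - b)) = 0"
    using gc_invariant[OF assms(1), of "2 * K - a" K "2 * K - b"] assms by (simp add: gc_mult_sum)
  moreover have "(- 1 :: complex) ^ (K + (2 * K - a)) = (- 1) ^ (K + a)" "(- 1 :: complex) ^ (K + (2 * K - b)) = (- 1) ^ (K + b)"
    unfolding minus_one_power_iff e[symmetric] by (rule refl)+
  \<comment> \<open>Here \<open>s\<close> and \<open>t\<close> stand for the signs of
    \<open>a\<close> and \<open>b\<close>; as both square to one, the common factor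
    \<open>s * t\<close> exchanges the signs of the two terms.\<close>
  moreover have "x * t + y * s = s * t * (x * s + y * t)" if "s * s = 1" "t * t = 1" for x y s t :: complex
  proof -
    have "s * t * (x * s + y * t) = x * t * (s * s) + y * s * (t * t)" by (simp add: algebra_simps)
    then show ?thesis using that by simp
  qed
  moreover have "(- 1 :: complex) ^ (K + a) * (- 1) ^ (K + a) = 1" "(- 1 :: complex) ^ (K + b) * (- 1) ^ (K + b) = 1"
    by (simp_all flip: power_add)
  ultimately have "g (spin K) $$ (a, 2 * K - b) * (- 1) ^ (K + b) + g (spin K) $$ (b, 2 * K - a) * (- 1) ^ (K + a) = 0"
    by (metis mult_zero_right)
  moreover have "(\<Sum>n\<le>2 * K. g (spin K) $$ (a, n) * gc K n b) = g (spin K) $$ (a, 2 * K - b) * (- 1) ^ (K + b)"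
    "(\<Sum>n\<le>2 * K. g (spin K) $$ (b, n) * gc K a n) = g (spin K) $$ (b, 2 * K - a) * (- 1) ^ (K + a)"
    using assms by (simp_all add: gc_mult_sum gc_sym[of K _ b])
  ultimately show ?thesis by simp
qed

lemma invariant_quad_form: "invariant (quad_form N d)"
  unfolding invariant_def
proof
  fix g assume g: "g \<in> gens"
  have "(\<Sum>n\<le>2 * K. \<Sum>m\<le>2 * K. gen_op g (cmul (1/2 * d K * gc K n m) (xvar (K, n) * xvar (K, m)))) = 0" for K
  proof -
    let ?x = "\<lambda>a b. xvar (K, a) * xvar (K, b)" and ?g = "\<lambda>a n. g (spin K) $$ (a, n)"
    have "(\<Sum>n\<le>2 * K. \<Sum>m\<le>2 * K. gen_op g (cmul (1/2 * d K * gc K n m) (?x n m)))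
      = (\<Sum>n\<le>2 * K. \<Sum>m\<le>2 * K. \<Sum>a\<le>2 * K. cmul (1/2 * d K * (?g a n * gc K n m)) (?x a m))
      + (\<Sum>n\<le>2 * K. \<Sum>m\<le>2 * K. \<Sum>a\<le>2 * K. cmul (1/2 * d K * (?g a m * gc K n m)) (?x n a))"
      by (simp add: lin_cmul[OF lin_gen_op] gen_op_mult gen_op_xvar sum_distrib_left sum_distrib_right
          cmul_mult_left cmul_mult_right cmul_add cmul_sum cmul_cmul sum.distrib mult_ac)
    also have "(\<Sum>n\<le>2 * K. \<Sum>m\<le>2 * K. \<Sum>a\<le>2 * K. cmul (1/2 * d K * (?g a n * gc K n m)) (?x a m))
      = (\<Sum>a\<le>2 * K. \<Sum>m\<le>2 * K. cmul (1/2 * d K * (\<Sum>n\<le>2 * K. ?g a n * gc K n m)) (?x a m))"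
    proof -
      have "(\<Sum>n\<le>2 * K. \<Sum>m\<le>2 * K. \<Sum>a\<le>2 * K. f n m a) = (\<Sum>a\<le>2 * K. \<Sum>m\<le>2 * K. \<Sum>n\<le>2 * K. f n m a)" for f :: "nat \<Rightarrow> nat \<Rightarrow> nat \<Rightarrow> mpol"
        by (subst sum.swap, subst (2) sum.swap, subst sum.swap) (rule refl)
      then show ?thesis by (simp add: cmul_sum_left sum_distrib_left)
    qed
    also have "(\<Sum>n\<le>2 * K. \<Sum>m\<le>2 * K. \<Sum>a\<le>2 * K. cmul (1/2 * d K * (?g a m * gc K n m)) (?x n a))
      = (\<Sum>a\<le>2 * K. \<Sum>m\<le>2 * K. cmul (1/2 * d K * (\<Sum>n\<le>2 * K. ?g m n * gc K a n)) (?x a m))"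
    proof -
      have "(\<Sum>n\<le>2 * K. \<Sum>m\<le>2 * K. \<Sum>a\<le>2 * K. f n m a) = (\<Sum>n\<le>2 * K. \<Sum>a\<le>2 * K. \<Sum>m\<le>2 * K. f n m a)" for f :: "nat \<Rightarrow> nat \<Rightarrow> nat \<Rightarrow> mpol"
        by (rule sum.cong[OF refl], rule sum.swap)
      then show ?thesis by (simp add: cmul_sum_left sum_distrib_left)
    qed
    finally have "(\<Sum>n\<le>2 * K. \<Sum>m\<le>2 * K. gen_op g (cmul (1/2 * d K * gc K n m) (?x n m)))
      = (\<Sum>a\<le>2 * K. \<Sum>m\<le>2 * K. cmul (1/2 * d K * ((\<Sum>n\<le>2 * K. ?g a n * gc K n m) + (\<Sum>n\<le>2 * K. ?g m n * gc K a n))) (?x a m))"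
      by (simp add: sum.distrib cmul_add_left distrib_left)
    also have "\<dots> = 0" using gc_invariant_upper[OF g] by simp
    finally show ?thesis .
  qed
  then show "gen_op g (quad_form N d) = 0" by (simp add: quad_form_xvar lin_sum[OF lin_gen_op])
qed

text \<open>The coefficient of t^n in e^(tV) for the quadratic form V. The exponential itself is not
  an element of \<open>mpol\<close>, so a power series in t stands in for it.\<close>

definition exp_coeff :: "nat \<Rightarrow> (nat \<Rightarrow> complex) \<Rightarrow> nat \<Rightarrow> mpol" where
  "exp_coeff N d n = cmul (1 / fact n) (quad_form N d ^ n)"

lemma polys_power: "p \<in> polys N \<Longrightarrow> p ^ n \<in> polys N"
  by (induction n) (auto intro: polys_mult)

lemma invariant_power: "invariant p \<Longrightarrow> invariant (p ^ n)"
  by (induction n) (auto simp: invariant_def gen_op_mult)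

lemma polys_exp_coeff: "exp_coeff N d n \<in> polys N"
  by (simp add: exp_coeff_def polys_cmul polys_power polys_quad_form)

lemma invariant_exp_coeff: "invariant (exp_coeff N d n)"
  using invariant_power[OF invariant_quad_form, of N d n] by (auto simp: invariant_def exp_coeff_def lin_cmul[OF lin_gen_op])

lemma exp_coeff_0: "exp_coeff N d 0 = 1"
  by (simp add: exp_coeff_def)

lemma derv_power: "derv v (p ^ Suc n) = cmul (of_nat (Suc n)) (p ^ n * derv v p)"
proof (induction n)
  case (Suc n)
  have "derv v (p ^ Suc (Suc n)) = derv v p * p ^ Suc n + p * derv v (p ^ Suc n)"
    by (simp add: derv_mult)
  also have "\<dots> = cmul (of_nat (Suc (Suc n))) (p ^ Suc n * derv v p)"
    unfolding Suc of_nat_Suc[of "Suc n"] cmul_add_left by (simp add: cmul_mult_right ac_simps)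
  finally show ?case .
qed (simp add: derv_mult)

lemma derv_exp_coeff:
  assumes "v \<in> vars N"
  shows "derv v (exp_coeff N d (Suc n)) = cmul (d (fst v)) (exp_coeff N d n * xvar v)"
proof -
  have "1 / fact (Suc n) * of_nat (Suc n) = (1 / fact n :: complex)"
    by (simp add: field_simps del: of_nat_Suc)
  then show ?thesis
    unfolding exp_coeff_def lin_cmul[OF lin_derv] derv_power derv_quad_form[OF assms] cmul_cmul
    by (simp add: cmul_mult_left cmul_mult_right cmul_cmul mult.commute)
qed

lemma lookup_mult_empty: "Poly_Mapping.lookup (p * q) {#} = Poly_Mapping.lookup p {#} * Poly_Mapping.lookup q {#}" for p q :: mpol
proof -
  have "Poly_Mapping.lookup (p * mon M) {#} = Poly_Mapping.lookup p {#} * Poly_Mapping.lookup (mon M) {#}" for M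
  proof (cases M)
    case empty then show ?thesis by (simp add: mon_empty)
  next
    case (add v M')
    then show ?thesis by (simp add: mulv_mon[symmetric] mulv_mult(2)[symmetric])
  qed
  then have "Poly_Mapping.lookup (p * q) {#} = (\<Sum>M\<in>Poly_Mapping.keys q. Poly_Mapping.lookup q M * (Poly_Mapping.lookup p {#} * Poly_Mapping.lookup (mon M) {#}))"
    by (subst lin_expand[OF lin_mult_left, of p q]) (simp add: lookup_sum)
  also have "\<dots> = Poly_Mapping.lookup p {#} * Poly_Mapping.lookup (\<Sum>M\<in>Poly_Mapping.keys q. cmul (Poly_Mapping.lookup q M) (mon M)) {#}"
    by (simp add: lookup_sum sum_distrib_left mult_ac)
  finally show ?thesis by (simp only: poly_expand[symmetric])
qed

lemma lookup_1_empty: "Poly_Mapping.lookup (1 :: mpol) {#} = 1"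
  using lookup_single_eq[of "{#}" "1 :: complex"] unfolding mon_empty .

lemma lookup_exp_coeff: "Poly_Mapping.lookup (exp_coeff N d n) {#} = (if n = 0 then 1 else 0)"
proof (cases n)
  case 0 then show ?thesis by (simp add: exp_coeff_0 lookup_1_empty)
next
  case (Suc k)
  have "Poly_Mapping.lookup (quad_form N d) {#} = 0" by (simp add: quad_form_def lookup_sum)
  then show ?thesis by (simp add: Suc exp_coeff_def lookup_mult_empty)
qed

section \<open>The brackets\<close>

definition conv :: "nat \<Rightarrow> (nat \<Rightarrow> complex) \<Rightarrow> (nat \<Rightarrow> mpol) \<Rightarrow> nat \<Rightarrow> mpol" where
  "conv N d s n = (\<Sum>i\<le>n. exp_coeff N d (n - i) * s i)"

text \<open>\<open>s\<close> lists the coefficients, with respect to powers of \<open>t\<close>, of a polynomial in \<open>t\<close> with value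
  \<open>p\<close> at \<open>t = 1\<close>; \<open>conv\<close> multiplies by \<open>e\<^bsup>tV\<^esup>\<close> for the quadratic form \<open>V\<close>.\<close>

definition sums_to :: "nat \<Rightarrow> (nat \<Rightarrow> mpol) \<Rightarrow> mpol \<Rightarrow> bool" where
  "sums_to N s p \<longleftrightarrow> (\<forall>i. s i \<in> polys N) \<and> (\<exists>B. (\<forall>i>B. s i = 0) \<and> p = (\<Sum>i\<le>B. s i))"

text \<open>Expresses X e^(tV) = e^(tV) Y_t, where \<open>Y\<close> is the value of Y_t at t = 1. A
  shifted derivative contains t d x for general t, so of the expansion after applying
  \<open>Y\<close> only the sum at t = 1 is prescribed and its coefficients are merely asserted to
  exist.\<close>

definition conjugates :: "nat \<Rightarrow> (nat \<Rightarrow> complex) \<Rightarrow> oper \<Rightarrow> oper \<Rightarrow> bool" where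
  "conjugates N d X Y \<longleftrightarrow> (\<forall>s p. sums_to N s p \<longrightarrow> (\<exists>s'. sums_to N s' (Y p) \<and> (\<forall>n. X (conv N d s n) = conv N d s' n)))"

lemma sums_to_bound:
  assumes "sums_to N s p"
  obtains B where "\<And>C. C \<ge> B \<Longrightarrow> p = (\<Sum>i\<le>C. s i)" "\<And>i. i > B \<Longrightarrow> s i = 0"
proof -
  obtain B where B: "\<forall>i>B. s i = 0" "p = (\<Sum>i\<le>B. s i)" using assms by (auto simp: sums_to_def)
  have "(\<Sum>i\<le>B. s i) = (\<Sum>i\<le>C. s i)" if "C \<ge> B" for C
    using that B by (intro sum.mono_neutral_left) auto
  then show ?thesis using that[of B] B by auto
qed

lemma sums_to_add:
  assumes "sums_to N s p" "sums_to N t q"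
  shows "sums_to N (\<lambda>i. s i + t i) (p + q)"
proof -
  obtain B where B: "\<And>C. C \<ge> B \<Longrightarrow> p = (\<Sum>i\<le>C. s i)" "\<And>i. i > B \<Longrightarrow> s i = 0" using assms(1) by (rule sums_to_bound) blast
  obtain B' where B': "\<And>C. C \<ge> B' \<Longrightarrow> q = (\<Sum>i\<le>C. t i)" "\<And>i. i > B' \<Longrightarrow> t i = 0" using assms(2) by (rule sums_to_bound) blast
  have "p + q = (\<Sum>i\<le>max B B'. s i + t i)"
    using B(1)[of "max B B'"] B'(1)[of "max B B'"] by (simp add: sum.distrib)
  then show ?thesis using assms B(2) B'(2)
    unfolding sums_to_def by (auto intro!: exI[of _ "max B B'"] simp: polys_add)
qed

lemma sums_to_cmul: "sums_to N s p \<Longrightarrow> sums_to N (\<lambda>i. cmul c (s i)) (cmul c p)"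
proof -
  assume s: "sums_to N s p"
  then obtain B where "\<forall>i>B. s i = 0" "p = (\<Sum>i\<le>B. s i)" by (auto simp: sums_to_def)
  then show ?thesis using s unfolding sums_to_def by (auto intro!: exI[of _ B] simp: polys_cmul cmul_sum)
qed

lemma conv_add: "conv N d (\<lambda>i. s i + t i) n = conv N d s n + conv N d t n"
  by (simp add: conv_def distrib_left sum.distrib)

lemma conv_cmul: "conv N d (\<lambda>i. cmul c (s i)) n = cmul c (conv N d s n)"
  by (simp add: conv_def cmul_mult_right cmul_sum)

lemma conjugatesE:
  assumes "conjugates N d X Y" "sums_to N s p"
  obtains t where "sums_to N t (Y p)" "\<And>n. X (conv N d s n) = conv N d t n"
  using assms unfolding conjugates_def by blast

lemma conjugates_add:
  assumes "conjugates N d X Y" "conjugates N d X' Y'"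
  shows "conjugates N d (\<lambda>p. X p + X' p) (\<lambda>p. Y p + Y' p)"
  unfolding conjugates_def
proof (intro allI impI)
  fix s p assume s: "sums_to N s p"
  obtain t where "sums_to N t (Y p)" "\<And>n. X (conv N d s n) = conv N d t n"
    using assms(1) s by (rule conjugatesE) blast
  moreover obtain t' where "sums_to N t' (Y' p)" "\<And>n. X' (conv N d s n) = conv N d t' n"
    using assms(2) s by (rule conjugatesE) blast
  ultimately show "\<exists>s'. sums_to N s' (Y p + Y' p) \<and> (\<forall>n. X (conv N d s n) + X' (conv N d s n) = conv N d s' n)"
    by (intro exI[of _ "\<lambda>i. t i + t' i"]) (auto simp: conv_add sums_to_add)
qed

lemma conjugates_cmul:
  assumes "conjugates N d X Y"
  shows "conjugates N d (\<lambda>p. cmul c (X p)) (\<lambda>p. cmul c (Y p))"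
  unfolding conjugates_def
proof (intro allI impI)
  fix s p assume s: "sums_to N s p"
  obtain t where "sums_to N t (Y p)" "\<And>n. X (conv N d s n) = conv N d t n"
    using assms s by (rule conjugatesE) blast
  then show "\<exists>s'. sums_to N s' (cmul c (Y p)) \<and> (\<forall>n. cmul c (X (conv N d s n)) = conv N d s' n)"
    by (intro exI[of _ "\<lambda>i. cmul c (t i)"]) (auto simp: conv_cmul sums_to_cmul)
qed

lemma conjugates_0: "conjugates N d (\<lambda>p. 0) (\<lambda>p. 0)"
  unfolding conjugates_def by (auto intro!: exI[of _ "\<lambda>_. 0"] simp: sums_to_def conv_def)

lemma conjugates_sum:
  "(\<And>i. i \<in> A \<Longrightarrow> conjugates N d (X i) (Y i)) \<Longrightarrow> conjugates N d (\<lambda>p. \<Sum>i\<in>A. X i p) (\<lambda>p. \<Sum>i\<in>A. Y i p)"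
  by (induction A rule: infinite_finite_induct) (auto intro: conjugates_0 conjugates_add)

lemma conjugates_compose:
  assumes "conjugates N d X Y" "conjugates N d X' Y'"
  shows "conjugates N d (\<lambda>p. X (X' p)) (\<lambda>p. Y (Y' p))"
  unfolding conjugates_def
proof (intro allI impI)
  fix s p assume s: "sums_to N s p"
  obtain t where t: "sums_to N t (Y' p)" "\<And>n. X' (conv N d s n) = conv N d t n"
    using assms(2) s by (rule conjugatesE) blast
  obtain t' where "sums_to N t' (Y (Y' p))" "\<And>n. X (conv N d t n) = conv N d t' n"
    using assms(1) t(1) by (rule conjugatesE) blast
  then show "\<exists>s'. sums_to N s' (Y (Y' p)) \<and> (\<forall>n. X (X' (conv N d s n)) = conv N d s' n)"
    using t(2) by auto
qed

lemma conjugates_ident: "conjugates N d (\<lambda>p. p) (\<lambda>p. p)"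
  by (auto simp: conjugates_def)

lemma conjugates_funpow: "conjugates N d X Y \<Longrightarrow> conjugates N d (X ^^ k) (Y ^^ k)"
proof (induction k)
  case 0 then show ?case using conjugates_ident by (simp add: id_def)
next
  case (Suc k)
  then show ?case using conjugates_compose[of N d X Y "X ^^ k" "Y ^^ k"] by (simp add: comp_def)
qed

lemma conjugates_foldr: "(\<And>v. v \<in> set w \<Longrightarrow> conjugates N d (X v) (Y v)) \<Longrightarrow> conjugates N d (foldr X w) (foldr Y w)"
proof (induction w)
  case Nil then show ?case using conjugates_ident by (simp add: id_def)
next
  case (Cons v w)
  then show ?case using conjugates_compose[of N d "X v" "Y v" "foldr X w" "foldr Y w"] by (simp add: comp_def)
qed

lemma conjugates_subst:
  assumes "P \<in> ncpols N" "\<And>v. v \<in> vars N \<Longrightarrow> conjugates N d (X v) (Y v)"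
  shows "conjugates N d (subst P X) (subst P Y)"
  unfolding subst_def using assms
  by (intro conjugates_sum conjugates_cmul conjugates_foldr) (auto simp: ncpols_def)

lemma conjugates_expterm:
  assumes "conjugates N d X Y"
  shows "conjugates N d (expterm k (\<lambda>p. - X p)) (expterm k (\<lambda>p. - Y p))"
proof -
  have "conjugates N d (\<lambda>p. - X p) (\<lambda>p. - Y p)"
    using conjugates_cmul[OF assms, of "- 1"] by (simp add: minus_eq_cmul)
  then show ?thesis unfolding expterm_def by (intro conjugates_cmul conjugates_funpow)
qed

text \<open>The relation is applied to the constant expansion of \<open>1\<close>, whose product
  with e^(tV) has the coefficients \<open>exp_coeff\<close>. As V has no constant term, the constant
  term of the n-th coefficient of the result is that of \<open>s n\<close>, and finitely many of
  these add up to that of \<open>Y 1\<close>.\<close>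

lemma suminf_conjugates:
  assumes "conjugates N d X Y"
  shows "suminf (\<lambda>n. Poly_Mapping.lookup (X (exp_coeff N d n)) {#}) = Poly_Mapping.lookup (Y 1) {#}"
proof -
  let ?\<delta> = "\<lambda>i. if i = 0 then 1 else (0 :: mpol)"
  have "sums_to N ?\<delta> 1" by (auto simp: sums_to_def intro!: exI[of _ 0])
  then obtain s where s: "sums_to N s (Y 1)" "\<And>n. X (conv N d ?\<delta> n) = conv N d s n"
    using assms unfolding conjugates_def by blast
  have "conv N d ?\<delta> n = exp_coeff N d n" for n
  proof -
    have "conv N d ?\<delta> n = (\<Sum>i\<le>n. if i = 0 then exp_coeff N d n else 0)"
      unfolding conv_def by (intro sum.cong) auto
    then show ?thesis by simp
  qed
  then have X: "X (exp_coeff N d n) = conv N d s n" for n using s(2) by metis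
  have lk: "Poly_Mapping.lookup (conv N d s n) {#} = Poly_Mapping.lookup (s n) {#}" for n
  proof -
    have "Poly_Mapping.lookup (conv N d s n) {#} = (\<Sum>i\<le>n. if i = n then Poly_Mapping.lookup (s n) {#} else 0)"
      unfolding conv_def lookup_sum lookup_mult_empty lookup_exp_coeff by (intro sum.cong) auto
    then show ?thesis by simp
  qed
  obtain B where B: "\<And>C. C \<ge> B \<Longrightarrow> Y 1 = (\<Sum>i\<le>C. s i)" "\<And>i. i > B \<Longrightarrow> s i = 0" using s(1) by (rule sums_to_bound) blast
  have "suminf (\<lambda>n. Poly_Mapping.lookup (X (exp_coeff N d n)) {#}) = (\<Sum>n\<le>B. Poly_Mapping.lookup (s n) {#})"
    unfolding X lk by (rule suminf_finite) (use B(2) in auto)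
  also have "\<dots> = Poly_Mapping.lookup (Y 1) {#}" by (simp add: B(1)[OF order_refl] lookup_sum)
  finally show ?thesis .
qed

section \<open>Equality of the three brackets\<close>

lemma lookup_hat_mulv_empty: "Poly_Mapping.lookup (hat F mulv v p) {#} = 0"
  by (cases v) (simp add: hat_eq_tw tw_def lookup_sum)

lemma lookup_JDJ_empty: "Poly_Mapping.lookup (JDJ F N \<nu> D p) {#} = 0"
  by (simp add: JDJ_def quad_def lookup_sum lookup_hat_mulv_empty)

lemma bhat_eq: "bhat F D v p = hat F (shift_op (\<lambda>K. 1 / D K)) v p"
  by (cases v) (simp add: bhat_def hat_eq_tw tw_def shift_op_def cmul_add cmul_sum sum.distrib cmul_cmul mult.commute)

text \<open>In the second bracket the exponential stands on the left. Every term of positive order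
  ends with a multiplication by currents and vanishes at j = 0, so only \<open>n = 0\<close>
  remains.\<close>

lemma bracket2_eq_bracket3: "bracket2 F N \<nu> D S P = bracket3 F D S P"
proof -
  have "suminf (\<lambda>n. bracket (\<lambda>p. expterm n (\<lambda>p. cmul (1/2) (JDJ F N \<nu> D p)) (T p))) = bracket T" for T
  proof -
    let ?f = "\<lambda>n. bracket (\<lambda>p. expterm n (\<lambda>p. cmul (1/2) (JDJ F N \<nu> D p)) (T p))"
    have "?f n = 0" if "n \<notin> {0}" for n
      using that by (cases n) (auto simp: bracket_def expterm_def lookup_JDJ_empty)
    then have "suminf ?f = sum ?f {0}" by (intro suminf_finite) auto
    then show ?thesis by (simp add: bracket_def expterm_def)
  qed
  then show ?thesis by (simp add: bracket2_def bracket3_def)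
qed

context drinfeld_twist
begin

text \<open>The invariant factor passes through the slices unchanged, so the derivative meets it
  directly and produces a twisted multiplication with the next lower coefficient. For
  \<open>n = 0\<close> the factor is constant.\<close>

lemma tw_derv_exp_coeff:
  assumes "v \<in> vars N" "p \<in> polys N"
  shows "tw F derv v (exp_coeff N d n * p)
    = exp_coeff N d n * tw F derv v p
      + (if n = 0 then 0 else cmul (d (fst v)) (exp_coeff N d (n - 1) * tw F mulv v p))"
proof -
  obtain K m where v: "v = (K, m)" "K \<le> N" "m \<le> 2 * K" using assms(1) by (cases v) auto
  have "derv (K, l) (act (slice G K l m) (exp_coeff N d n * p))
     = exp_coeff N d n * derv (K, l) (act (slice G K l m) p)
      + (if n = 0 then 0 else cmul (d K) (exp_coeff N d (n - 1) * mulv (K, l) (act (slice G K l m) p)))"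
    if l: "l \<le> 2 * K" for l
  proof -
    have "act (slice G K l m) (exp_coeff N d n * p) = exp_coeff N d n * act (slice G K l m) p"
      by (rule act_mult_invariant[OF slice_uhat[OF l v(3)] assms(2) polys_exp_coeff invariant_exp_coeff])
    then show ?thesis
    proof (cases n)
      case (Suc k)
      have "(K, l) \<in> vars N" using l v by simp
      then show ?thesis using \<open>act (slice G K l m) (exp_coeff N d n * p) = _\<close>
        by (simp add: Suc derv_mult derv_exp_coeff mulv_eq cmul_mult_left mult.assoc add.commute)
    qed (simp add: exp_coeff_0)
  qed
  then show ?thesis
    by (simp add: tw_def v sum_distrib_left sum.distrib cmul_sum)
qed

lemma hat_derv_exp_coeff:
  assumes "v \<in> vars N" "p \<in> polys N"
  shows "hat F derv v (exp_coeff N d n * p)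
    = exp_coeff N d n * hat F derv v p
      + (if n = 0 then 0 else cmul (d (fst v)) (exp_coeff N d (n - 1) * hat F mulv v p))"
proof -
  obtain K m where v: "v = (K, m)" "K \<le> N" "m \<le> 2 * K" using assms(1) by (cases v) auto
  have "tw F derv (K, l) (exp_coeff N d n * p)
    = exp_coeff N d n * tw F derv (K, l) p
      + (if n = 0 then 0 else cmul (d K) (exp_coeff N d (n - 1) * tw F mulv (K, l) p))" if "l \<le> 2 * K" for l
    using tw_derv_exp_coeff[of "(K, l)" N p d n] that v assms(2) by simp
  then show ?thesis
    by (cases "n = 0") (simp_all add: v hat_eq_tw sum_distrib_left sum.distrib cmul_sum cmul_add cmul_mult_right cmul_cmul mult.commute)
qed

lemma conjugates_hat:
  assumes v: "v \<in> vars N"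
  shows "conjugates N d (hat F derv v) (hat F (shift_op d) v)"
  unfolding conjugates_def
proof (intro allI impI)
  fix s p assume s: "sums_to N s p"
  have sp: "s i \<in> polys N" for i using s by (simp add: sums_to_def)
  have lm: "lin (hat F mulv v)" and ld: "lin (hat F derv v)" by (intro lin_hat lin_mulv lin_derv)+
  let ?c = "d (fst v)"
  \<comment> \<open>The t-expansion of \<partial> + t d x applied to the sum of the t^i s_i: the
    multiplication part shifts the index by one, whence also the bound \<open>Suc B\<close>
    below.\<close>
  let ?s = "\<lambda>i. hat F derv v (s i) + (if i = 0 then 0 else cmul ?c (hat F mulv v (s (i - 1))))"
  obtain B where B: "\<And>C. C \<ge> B \<Longrightarrow> p = (\<Sum>i\<le>C. s i)" "\<And>i. i > B \<Longrightarrow> s i = 0" using s by (rule sums_to_bound) blast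
  have hs: "hat F (shift_op d) v p = hat F derv v p + cmul ?c (hat F mulv v p)"
    by (cases v) (simp add: hat_eq_tw tw_def shift_op_def cmul_add cmul_sum sum.distrib cmul_cmul mult.commute)
  have "sums_to N ?s (hat F (shift_op d) v p)"
    unfolding sums_to_def
  proof (intro conjI allI exI[of _ "Suc B"] impI)
    show "?s i \<in> polys N" for i
      using v sp by (auto intro!: polys_add polys_cmul polys_hat_gen polys_derv polys_mulv)
    show "?s i = 0" if "i > Suc B" for i using that B(2) by (simp add: lin_0[OF lm] lin_0[OF ld])
    have "(\<Sum>i\<le>Suc B. ?s i) = hat F derv v (\<Sum>i\<le>Suc B. s i) + cmul ?c (hat F mulv v (\<Sum>i\<le>B. s i))"
      unfolding sum.distrib lin_sum[OF ld] lin_sum[OF lm] cmul_sum sum.atMost_Suc_shift[of "\<lambda>i. if i = 0 then 0 else _ i"] by simp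
    then show "hat F (shift_op d) v p = (\<Sum>i\<le>Suc B. ?s i)"
      using B(1)[of B] B(1)[of "Suc B"] hs by simp
  qed
  moreover have "hat F derv v (conv N d s n) = conv N d ?s n" for n
  proof -
    have "hat F derv v (conv N d s n) = (\<Sum>i\<le>n. exp_coeff N d (n - i) * hat F derv v (s i))
      + (\<Sum>i\<le>n. if n - i = 0 then 0 else cmul ?c (exp_coeff N d (n - i - 1) * hat F mulv v (s i)))"
      unfolding conv_def lin_sum[OF ld] hat_derv_exp_coeff[OF v sp] sum.distrib ..
    also have "(\<Sum>i\<le>n. if n - i = 0 then 0 else cmul ?c (exp_coeff N d (n - i - 1) * hat F mulv v (s i)))
      = (\<Sum>i\<le>n. exp_coeff N d (n - i) * (if i = 0 then 0 else cmul ?c (hat F mulv v (s (i - 1)))))"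
    proof (cases n)
      case (Suc k)
      have "(\<Sum>i\<le>n. if n - i = 0 then 0 else cmul ?c (exp_coeff N d (n - i - 1) * hat F mulv v (s i)))
         = (\<Sum>i\<le>k. cmul ?c (exp_coeff N d (k - i) * hat F mulv v (s i)))"
      proof -
        have "(\<Sum>i\<le>k. if n - i = 0 then 0 else cmul ?c (exp_coeff N d (n - i - 1) * hat F mulv v (s i)))
          = (\<Sum>i\<le>k. cmul ?c (exp_coeff N d (k - i) * hat F mulv v (s i)))"
          by (rule sum.cong) (auto simp: Suc Suc_diff_le)
        then show ?thesis unfolding Suc sum.atMost_Suc by simp
      qed
      also have "\<dots> = (\<Sum>i\<le>n. exp_coeff N d (n - i) * (if i = 0 then 0 else cmul ?c (hat F mulv v (s (i - 1)))))"
        unfolding Suc sum.atMost_Suc_shift by (simp add: cmul_mult_right)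
      finally show ?thesis .
    qed simp
    finally show ?thesis by (simp add: conv_def distrib_left sum.distrib)
  qed
  ultimately show "\<exists>s'. sums_to N s' (hat F (shift_op d) v p) \<and> (\<forall>n. hat F derv v (conv N d s n) = conv N d s' n)"
    by blast
qed

lemma JDJ_invariant:
  assumes "i \<in> polys N" "invariant i"
  shows "JDJ F N \<nu> D i = i * JDJ F N \<nu> D 1"
proof -
  have "hat F mulv (K, n) (hat F mulv (K, m) i) = i * hat F mulv (K, n) (hat F mulv (K, m) 1)"
    if "K \<le> N" "m \<le> 2 * K" "n \<le> 2 * K" for K m n
  proof -
    have "hat F mulv (K, m) i = i * hat F mulv (K, m) 1"
      using hat_mult_invariant[of "(K, m)" N 1 i] that assms by simp
    then show ?thesis using hat_mult_invariant[of "(K, n)" N "hat F mulv (K, m) 1" i] that assms polys_hat[of "(K, m)" N 1] by simp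
  qed
  then show ?thesis by (simp add: JDJ_def quad_def sum_distrib_left cmul_mult_right)
qed

text \<open>Half of \<open>JDJ\<close> has the form of \<open>S_free\<close> with every
  \<open>D K\<close> replaced by its inverse, and \<open>free_classical\<close> is a statement about
  all \<open>D\<close>.\<close>

lemma JDJ_1:
  assumes "free_classical F N \<nu>"
  shows "cmul (1/2) (JDJ F N \<nu> D 1) = quad_form N (\<lambda>K. 1 / D K)"
proof -
  have "cmul (1/2) (JDJ F N \<nu> D 1) = S_free F N \<nu> (\<lambda>K. 1 / D K) 1"
    by (simp add: JDJ_def S_free_def quad_def cmul_sum cmul_cmul)
  also have "\<dots> = quad_form N (\<lambda>K. 1 / D K)"
    using assms unfolding free_classical_def quad_form_def by (simp add: mult.commute)
  finally show ?thesis .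
qed

text \<open>Powers of the quadratic form are invariant, so on each of them \<open>JDJ\<close> acts
  as multiplication by its value at \<open>1\<close>.\<close>

lemma expterm_JDJ:
  assumes "free_classical F N \<nu>"
  shows "expterm n (\<lambda>p. cmul (1/2) (JDJ F N \<nu> D p)) 1 = exp_coeff N (\<lambda>K. 1 / D K) n"
proof -
  let ?V = "quad_form N (\<lambda>K. 1 / D K)"
  have "((\<lambda>p. cmul (1/2) (JDJ F N \<nu> D p)) ^^ n) 1 = ?V ^ n"
  proof (induction n)
    case (Suc n)
    have "JDJ F N \<nu> D (?V ^ n) = ?V ^ n * JDJ F N \<nu> D 1"
      by (rule JDJ_invariant[OF polys_power[OF polys_quad_form] invariant_power[OF invariant_quad_form]])
    then have "cmul (1/2) (JDJ F N \<nu> D (?V ^ n)) = ?V ^ n * cmul (1/2) (JDJ F N \<nu> D 1)"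
      by (simp add: cmul_mult_right)
    then show ?case using Suc by (simp add: JDJ_1[OF assms] mult.commute)
  qed simp
  then show ?thesis by (simp add: expterm_def exp_coeff_def)
qed

theorem bracket1_eq_bracket3:
  assumes "free_classical F N \<nu>" "S \<in> ncpols N" "P \<in> ncpols N"
  shows "bracket1 F N \<nu> D S P = bracket3 F D S P"
proof -
  let ?d = "\<lambda>K. 1 / D K"
  have b: "bhat F D = hat F (shift_op ?d)" by (intro ext) (rule bhat_eq)
  have "suminf (\<lambda>n. bracket (\<lambda>p. subst P (hat F derv) (expterm k (\<lambda>p. - subst S (hat F derv) p)
      (expterm n (\<lambda>p. cmul (1/2) (JDJ F N \<nu> D p)) p))))
    = bracket (\<lambda>p. subst P (bhat F D) (expterm k (\<lambda>p. - subst S (bhat F D) p) p))" for k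
  proof -
    have "conjugates N ?d (\<lambda>p. subst P (hat F derv) (expterm k (\<lambda>p. - subst S (hat F derv) p) p))
      (\<lambda>p. subst P (bhat F D) (expterm k (\<lambda>p. - subst S (bhat F D) p) p))"
      unfolding b using assms
      by (intro conjugates_compose[OF conjugates_subst conjugates_expterm[OF conjugates_subst]] conjugates_hat)
    from suminf_conjugates[OF this] show ?thesis
      unfolding bracket_def expterm_JDJ[OF assms(1)] .
  qed
  then show ?thesis by (simp add: bracket1_def bracket3_def)
qed

section \<open>The Wick image of twisted operators and the reversal of their order\<close>

lemma wick_hat:
  assumes "v \<in> vars N" "p \<in> polys N"
  shows "wick d (hat F mulv v p) = hat F (shift_op d) v (wick d p)"
  using assms by (cases v) (auto simp: hat_eq_tw tw_def lin_sum[OF lin_wick] lin_cmul[OF lin_wick] wick_mulv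
    act_wick[OF slice_uhat] intro!: sum.cong)

lemma wick_subst:
  assumes "P \<in> ncpols N" "p \<in> polys N"
  shows "wick d (subst P (hat F mulv) p) = subst P (hat F (shift_op d)) (wick d p)"
proof -
  have "set w \<subseteq> vars N \<Longrightarrow> wick d (foldr (hat F mulv) w p) = foldr (hat F (shift_op d)) w (wick d p) \<and> foldr (hat F mulv) w p \<in> polys N" for w
    using assms by (induction w) (auto simp: wick_hat polys_hat)
  then show ?thesis
    unfolding subst_def lin_sum[OF lin_wick] using assms(1)
    by (intro sum.cong refl) (auto simp: ncpols_def lin_cmul[OF lin_wick])
qed

lemma polys_expterm: "S \<in> ncpols N \<Longrightarrow> p \<in> polys N \<Longrightarrow> expterm k (\<lambda>p. - subst S (hat F mulv) p) p \<in> polys N"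
  unfolding expterm_def by (intro polys_cmul polys_funpow polys_minus polys_subst)

lemma wick_expterm:
  assumes "S \<in> ncpols N" "p \<in> polys N"
  shows "wick d (expterm k (\<lambda>p. - subst S (hat F mulv) p) p) = expterm k (\<lambda>p. - subst S (hat F (shift_op d)) p) (wick d p)"
proof -
  have "wick d (((\<lambda>p. - subst S (hat F mulv) p) ^^ k) p) = ((\<lambda>p. - subst S (hat F (shift_op d)) p) ^^ k) (wick d p)
    \<and> ((\<lambda>p. - subst S (hat F mulv) p) ^^ k) p \<in> polys N"
    using assms by (induction k) (auto simp: lin_minus[OF lin_wick] wick_subst polys_minus polys_subst)
  then show ?thesis by (simp add: expterm_def lin_cmul[OF lin_wick])
qed

theorem wick_mean_eq_bracket3:
  assumes "S \<in> ncpols N" "q_invariant h \<phi> F S" "P \<in> ncpols N"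
  shows "wick_mean (\<lambda>K. 1 / D K) (expterm k (\<lambda>p. - subst S (hat F mulv) p) (subst P (hat F mulv) 1))
    = fps_nth (bracket3 F D S P) k"
proof -
  let ?d = "\<lambda>K. 1 / D K" and ?S = "\<lambda>p. - subst S (hat F mulv) p" and ?P = "subst P (hat F mulv)"
  have b: "bhat F D = hat F (shift_op ?d)" by (intro ext) (rule bhat_eq)
  let ?T = "expterm k ?S"
  have eS: "equivariant_op N ?S"
    using equivariant_op_scale[OF equivariant_subst[OF assms(1,2)], of "- 1"] by (simp add: minus_eq_cmul)
  have eT: "equivariant_op N ?T"
    unfolding expterm_def by (rule equivariant_op_scale[OF equivariant_op_funpow[OF eS]])
  have P1: "?P 1 \<in> polys N" by (rule polys_subst[OF assms(3) polys_1])
  have T1: "?T 1 \<in> polys N" "invariant (?T 1)"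
  proof -
    have "gen_op g (?T 1) = 0" if "g \<in> gens" for g
    proof -
      have "?T (gen_op g 1) = gen_op g (?T 1)" using eT that polys_1 unfolding equivariant_op_def by blast
      moreover have "?T (gen_op g 1) = 0" using eT unfolding equivariant_op_def gen_op_1 by (intro lin_0) simp
      ultimately show ?thesis by simp
    qed
    then show "invariant (?T 1)" by (simp add: invariant_def)
    show "?T 1 \<in> polys N" by (rule polys_expterm[OF assms(1) polys_1])
  qed
  have "wick_mean ?d (?T (?P 1)) = wick_mean ?d (?T 1 * ?P 1)"
    by (rule invariant_functional_equivariant[OF wick_mean_add wick_mean_gen_op eT P1])
  \<comment> \<open>The invariant \<open>?T 1\<close> moves through all operators of
    \<open>P\<close>, so that now the exponential acts first, as it does in the bracket.\<close>
  also have "?T 1 * ?P 1 = ?P (?T 1)"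
    using subst_mult_invariant[OF assms(3) polys_1 T1] by simp
  also have "wick_mean ?d (?P (?T 1)) = fps_nth (bracket3 F D S P) k"
    unfolding wick_mean_def bracket3_def bracket_def b
    by (simp add: wick_subst[OF assms(3) T1(1)] wick_expterm[OF assms(1) polys_1])
  finally show ?thesis .
qed

end

section \<open>Gaussian integrals\<close>

lemma peval_superset:
  assumes "finite A" "Poly_Mapping.keys p \<subseteq> A"
  shows "peval y p = (\<Sum>M\<in>A. Poly_Mapping.lookup p M * prod_mset (image_mset y M))"
  unfolding peval_def by (rule sum.mono_neutral_left) (use assms in \<open>auto simp: in_keys_iff\<close>)

lemma peval_add: "peval y (p + q) = peval y p + peval y q"
proof -
  let ?A = "Poly_Mapping.keys p \<union> Poly_Mapping.keys q"
  have "Poly_Mapping.keys (p + q) \<subseteq> ?A" by (rule Poly_Mapping.keys_add)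
  then show ?thesis
    by (simp add: peval_superset[of ?A] lookup_add distrib_right sum.distrib)
qed

lemma peval_0 [simp]: "peval y 0 = 0" by (simp add: peval_def)

lemma peval_sum: "peval y (sum f A) = (\<Sum>i\<in>A. peval y (f i))"
  by (induction A rule: infinite_finite_induct) (auto simp: peval_add)

lemma peval_single [simp]: "peval y (Poly_Mapping.single M c) = c * prod_mset (image_mset y M)"
  by (simp add: peval_def)

lemma peval_mult: "peval y (p * q) = peval y p * peval y q"
  for p q :: "'a multiset \<Rightarrow>\<^sub>0 complex"
proof -
  let ?s = "\<lambda>p. \<Sum>M\<in>Poly_Mapping.keys p. Poly_Mapping.single M (Poly_Mapping.lookup p M)"
  have expand: "?s p = p" for p :: "'a multiset \<Rightarrow>\<^sub>0 complex"
    by (rule poly_mapping_eqI) (simp add: lookup_sum lookup_single when_def in_keys_iff if_distrib cong: if_cong)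
  have "peval y (?s p * ?s q) = peval y (?s p) * peval y (?s q)"
    unfolding sum_product peval_sum mult_single peval_single by (simp add: mult_ac)
  then show ?thesis by (simp only: expand)
qed

lemma peval_uminus: "peval y (- p) = - peval y p"
  using peval_add[of y p "- p"] by (simp add: eq_neg_iff_add_eq_0 add.commute)

lemma peval_cmul: "peval y (cmul c p) = c * peval y p"
  by (simp add: cmul_def peval_mult)

lemma peval_xvar: "peval y (xvar v) = y v"
  by (simp add: xvar_def)

lemma peval_mulv: "peval y (mulv v p) = y v * peval y p"
  by (simp add: mulv_eq peval_mult peval_xvar)

lemma peval_1 [simp]: "peval y (1 :: mpol) = 1"
  using peval_single[of y "{#}" 1] unfolding mon_empty by simp

subsection \<open>Identity of polynomials\<close>

lemma peval_line:
  obtains q :: "complex poly" where "\<And>t. poly q t = peval (\<lambda>K. x K + t * z K) R"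
proof
  let ?q = "\<Sum>M\<in>Poly_Mapping.keys R. Polynomial.smult (Poly_Mapping.lookup R M) (prod_mset (image_mset (\<lambda>K. [:x K, z K:]) M))"
  have "poly (prod_mset (image_mset (\<lambda>K. [:x K, z K:]) M)) t = prod_mset (image_mset (\<lambda>K. x K + t * z K) M)" for M t
    by (induction M) (auto simp: algebra_simps)
  then show "poly ?q t = peval (\<lambda>K. x K + t * z K) R" for t
    by (simp add: peval_def poly_sum)
qed

text \<open>On a line the polynomial depends on one variable, hence vanishes identically once it has
  infinitely many zeros.\<close>

lemma peval_line_eq_0:
  assumes "infinite T" "\<And>t. t \<in> T \<Longrightarrow> peval (\<lambda>K. x K + t * z K) R = 0"
  shows "peval (\<lambda>K. x K + t * z K) R = 0"
proof -
  obtain q :: "complex poly" where q: "\<And>t. poly q t = peval (\<lambda>K. x K + t * z K) R" by (rule peval_line[of x z R]) blast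
  have "q = 0"
  proof (rule ccontr)
    assume "q \<noteq> 0"
    then have "finite {t. poly q t = 0}" by (rule poly_roots_finite)
    moreover have "T \<subseteq> {t. poly q t = 0}" using assms(2) q by auto
    ultimately show False using assms(1) finite_subset by blast
  qed
  then show ?thesis using q[of t] by simp
qed

lemma infinite_of_real_image: "infinite (A :: real set) \<Longrightarrow> infinite (complex_of_real ` A)"
  by (subst finite_image_iff) (auto intro: inj_onI)

text \<open>Two lines lead from positive to complex points: one through \<open>(1, \<dots>, 1)\<close> in the real domain,
  then one in the imaginary direction.\<close>

lemma peval_eq_0_everywhere:
  fixes N :: nat
  assumes zero: "\<And>y. (\<And>K. K \<le> N \<Longrightarrow> \<exists>a>0. y K = complex_of_real a) \<Longrightarrow> peval y R = 0"
  shows "peval y R = 0"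
proof -
  have real: "peval y R = 0" if y: "\<And>K. K \<le> N \<Longrightarrow> y K \<in> \<real>" for y
  proof -
    \<comment> \<open>Coordinates beyond \<open>N\<close> keep the value of \<open>y\<close>, since
      the hypothesis leaves them free. The number \<open>e\<close> is small enough for all other
      coordinates of \<open>x + t z\<close> to be positive when 0 < t < e.\<close>
    define x z where "x K = (if K \<le> N then 1 else y K)" and "z K = (if K \<le> N then y K - 1 else 0)" for K
    define e where "e = 1 / (1 + (\<Sum>K\<le>N. norm (z K)))"
    have e: "e > 0" by (auto simp: e_def intro!: divide_pos_pos add_pos_nonneg sum_nonneg)
    have pos: "\<exists>a>0. x K + complex_of_real t * z K = complex_of_real a" if t: "0 < t" "t < e" and K: "K \<le> N" for t K
    proof -
      have "norm (z K) \<le> (\<Sum>K\<le>N. norm (z K))" using K by (intro member_le_sum) auto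
      then have "t * norm (z K) \<le> t * (\<Sum>K\<le>N. norm (z K))" using t by simp
      also have "\<dots> < 1"
      proof -
        have s: "(\<Sum>K\<le>N. norm (z K)) \<ge> 0" by (rule sum_nonneg) simp
        have "t * (1 + (\<Sum>K\<le>N. norm (z K))) < 1"
          using t(2) s unfolding e_def by (subst (asm) pos_less_divide_eq) auto
        then show ?thesis using t(1) by (simp add: algebra_simps)
      qed
      finally have lt: "t * norm (z K) < 1" .
      obtain b where b: "z K = complex_of_real b" using y[OF K] K by (auto simp: z_def elim!: Reals_cases intro: that[of "_ - 1"])
      have "0 < 1 + t * b" using lt t unfolding b norm_of_real
        by (cases "b < 0") (auto simp: abs_if intro!: add_pos_nonneg)
      then show ?thesis using K b by (intro exI[of _ "1 + t * b"]) (auto simp: x_def)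
    qed
    have "peval (\<lambda>K. x K + 1 * z K) R = 0"
    proof (rule peval_line_eq_0)
      show "infinite (complex_of_real ` {0<..<e})"
        using e by (intro infinite_of_real_image infinite_Ioo)
      show "peval (\<lambda>K. x K + t * z K) R = 0" if "t \<in> complex_of_real ` {0<..<e}" for t
        using that pos by (intro zero) auto
    qed
    moreover have "(\<lambda>K. x K + 1 * z K) = y" by (auto simp: x_def z_def)
    ultimately show ?thesis by simp
  qed
  define x z where "x K = (if K \<le> N then complex_of_real (Re (y K)) else y K)"
    and "z K = (if K \<le> N then complex_of_real (Im (y K)) else 0)" for K
  have "peval (\<lambda>K. x K + \<i> * z K) R = 0"
  proof (rule peval_line_eq_0)
    show "infinite (complex_of_real ` UNIV)"
      by (intro infinite_of_real_image infinite_UNIV_char_0)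
    show "peval (\<lambda>K. x K + t * z K) R = 0" if "t \<in> complex_of_real ` UNIV" for t
      using that by (intro real) (auto simp: x_def z_def)
  qed
  moreover have "(\<lambda>K. x K + \<i> * z K) = y" by (auto simp: x_def z_def complex_eq[symmetric])
  ultimately show ?thesis by simp
qed

definition polynomial_in :: "((nat \<Rightarrow> complex) \<Rightarrow> complex) \<Rightarrow> bool" where
  "polynomial_in f \<longleftrightarrow> (\<exists>Q. \<forall>d. peval d Q = f d)"

lemma polynomial_in_add: "polynomial_in f \<Longrightarrow> polynomial_in g \<Longrightarrow> polynomial_in (\<lambda>d. f d + g d)"
  unfolding polynomial_in_def by (metis peval_add)

lemma polynomial_in_mult: "polynomial_in f \<Longrightarrow> polynomial_in g \<Longrightarrow> polynomial_in (\<lambda>d. f d * g d)"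
  unfolding polynomial_in_def by (metis peval_mult)

lemma polynomial_in_const: "polynomial_in (\<lambda>d. c)"
  unfolding polynomial_in_def by (rule exI[of _ "Poly_Mapping.single {#} c"]) simp

lemma polynomial_in_coord: "polynomial_in (\<lambda>d. d K)"
  unfolding polynomial_in_def by (rule exI[of _ "Poly_Mapping.single {#K#} 1"]) simp

lemma polynomial_in_sum: "(\<And>i. i \<in> A \<Longrightarrow> polynomial_in (f i)) \<Longrightarrow> polynomial_in (\<lambda>d. \<Sum>i\<in>A. f i d)"
  by (induction A rule: infinite_finite_induct) (auto intro: polynomial_in_const polynomial_in_add)

lemma derv_mon_span: "derv v (mon M) \<in> span_of {L. size L \<le> size M \<and> set_mset L \<subseteq> set_mset M}"
proof (induction M)
  case empty then show ?case by (simp add: mon_empty)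
next
  case (add w M)
  have "mulv w (derv v (mon M)) \<in> span_of {L. size L \<le> size (add_mset w M) \<and> set_mset L \<subseteq> set_mset (add_mset w M)}"
    by (rule lin_span_of[OF lin_mulv add.IH]) (auto simp: mulv_mon intro!: span_of_mon)
  then show ?case
    by (auto simp: mulv_mon[symmetric] derv_mulv intro!: span_of_add span_of_cmul span_of_mon)
qed

lemma wick_mean_expand: "wick_mean d p = (\<Sum>M\<in>Poly_Mapping.keys p. Poly_Mapping.lookup p M * wick_mean d (mon M))"
  unfolding wick_mean_def by (subst lin_expand[OF lin_wick]) (simp add: lookup_sum)

text \<open>By induction on the degree: \<open>wick_mean_mulv\<close> removes one variable and
  yields one factor \<open>d\<close>. At d = 1/D this is the polynomial that
  \<open>gauss_mean\<close> asks for.\<close>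

lemma wick_mean_polynomial: "polynomial_in (\<lambda>d. wick_mean d p)"
proof -
  have "\<forall>M\<in>Poly_Mapping.keys p. size M < n \<Longrightarrow> polynomial_in (\<lambda>d. wick_mean d p)" for n
  proof (induction n arbitrary: p)
    case 0
    then have "wick_mean d p = 0" for d by (subst wick_mean_expand) auto
    then show ?case using polynomial_in_const[of 0] by simp
  next
    case (Suc n)
    have "polynomial_in (\<lambda>d. wick_mean d (mon M))" if M: "M \<in> Poly_Mapping.keys p" for M
    proof (cases M)
      case empty then show ?thesis using polynomial_in_const[of 1] by (simp add: mon_empty wick_mean_1)
    next
      case (add v M')
      have "\<forall>L\<in>Poly_Mapping.keys (derv v (mon M')). size L < n"
        using derv_mon_span[of v M'] Suc.prems M add by (fastforce simp: span_of_def)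
      then show ?thesis
        unfolding add mulv_mon[symmetric] wick_mean_mulv
        by (intro polynomial_in_mult polynomial_in_coord Suc.IH)
    qed
    then show ?case
      by (subst wick_mean_expand) (intro polynomial_in_sum polynomial_in_mult polynomial_in_const)
  qed
  from this[of "Suc (Max (insert 0 (size ` Poly_Mapping.keys p)))"] show ?thesis
    by (auto simp: less_Suc_eq_le intro!: Max_ge)
qed

subsection \<open>One-dimensional moments\<close>

definition gauss_fun :: "complex \<Rightarrow> nat \<Rightarrow> real \<Rightarrow> complex" where
  "gauss_fun D k x = exp (- D * of_real (x\<^sup>2) / 2) * of_real x ^ k"

definition moment :: "complex \<Rightarrow> nat \<Rightarrow> complex" where
  "moment D k = (LINT x|lborel. gauss_fun D k x)"

lemma norm_gauss_fun: "norm (gauss_fun D k x) = exp (- Re D * x\<^sup>2 / 2) * \<bar>x\<bar> ^ k"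
  by (simp add: gauss_fun_def norm_mult norm_power)

lemma normal_density_scaled:
  assumes "a > 0"
  shows "sqrt (2 * pi / a) * normal_density 0 (1 / sqrt a) x = exp (- a * x\<^sup>2 / 2)"
proof -
  have "sqrt (2 * pi / a) * (1 / sqrt (2 * pi * (1 / sqrt a)\<^sup>2)) = 1"
    using assms by (simp add: power_divide real_sqrt_divide real_sqrt_mult)
  moreover have "- (x - 0)\<^sup>2 / (2 * (1 / sqrt a)\<^sup>2) = - a * x\<^sup>2 / 2"
    using assms by (simp add: power_divide field_simps)
  ultimately show ?thesis unfolding normal_density_def by (metis mult.assoc mult_1)
qed

lemma gauss_fun_measurable [measurable]: "gauss_fun D k \<in> borel_measurable borel"
  unfolding gauss_fun_def by (auto intro!: borel_measurable_continuous_onI continuous_intros)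

lemma integrable_gauss_fun:
  assumes "Re D > 0"
  shows "integrable lborel (gauss_fun D k)"
proof (rule Bochner_Integration.integrable_bound)
  show "integrable lborel (\<lambda>x. sqrt (2 * pi / Re D) * (normal_density 0 (1 / sqrt (Re D)) x * \<bar>x - 0\<bar> ^ k))"
    using assms by (intro integrable_mult_right integrable_normal_moment_abs) auto
  show "AE x in lborel. norm (gauss_fun D k x) \<le> norm (sqrt (2 * pi / Re D) * (normal_density 0 (1 / sqrt (Re D)) x * \<bar>x - 0\<bar> ^ k))"
    unfolding mult.assoc[symmetric] normal_density_scaled[OF assms] norm_gauss_fun by (auto simp: norm_mult)
qed simp

lemma gauss_fun_tendsto_0:
  assumes "Re D > 0"
  shows "(gauss_fun D k \<longlongrightarrow> 0) at_top" "(gauss_fun D k \<longlongrightarrow> 0) at_bot"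
proof -
  let ?b = "\<lambda>x::real. x ^ k / exp x"
  \<comment> \<open>Beyond 2 / Re D the exponent Re D x^2 / 2 is at least |x|, so the Gaussian is
    dominated by e^(-|x|).\<close>
  have bound: "norm (gauss_fun D k x) \<le> ?b \<bar>x\<bar>" if "\<bar>x\<bar> \<ge> 2 / Re D" for x
  proof -
    have "2 \<le> \<bar>x\<bar> * Re D" using that assms by (simp add: pos_divide_le_eq)
    then have "2 * \<bar>x\<bar> \<le> (\<bar>x\<bar> * Re D) * \<bar>x\<bar>" by (intro mult_right_mono) auto
    also have "\<dots> = Re D * x\<^sup>2" by (simp add: power2_eq_square mult_ac flip: abs_mult)
    finally have "exp (- Re D * x\<^sup>2 / 2) \<le> exp (- \<bar>x\<bar>)" by simp
    then have "exp (- Re D * x\<^sup>2 / 2) * \<bar>x\<bar> ^ k \<le> exp (- \<bar>x\<bar>) * \<bar>x\<bar> ^ k" by (intro mult_right_mono) auto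
    then show ?thesis by (simp add: norm_gauss_fun exp_minus field_simps)
  qed
  have lim: "(?b \<longlongrightarrow> 0) at_top" by (rule tendsto_power_div_exp_0)
  have ev: "eventually (\<lambda>x. x \<ge> 0 \<and> x \<ge> 2 / Re D) at_top"
    by (intro eventually_conj eventually_ge_at_top)
  show top: "(gauss_fun D k \<longlongrightarrow> 0) at_top"
  proof (rule Lim_null_comparison[OF _ lim])
    show "\<forall>\<^sub>F x in at_top. norm (gauss_fun D k x) \<le> ?b x"
      using ev
    proof eventually_elim
      case (elim x) then show ?case using bound[of x] by simp
    qed
  qed
  show "(gauss_fun D k \<longlongrightarrow> 0) at_bot"
    unfolding filterlim_at_bot_mirror
  proof (rule Lim_null_comparison[OF _ lim])
    show "\<forall>\<^sub>F x in at_top. norm (gauss_fun D k (- x)) \<le> ?b x"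
      using ev
    proof eventually_elim
      case (elim x) then show ?case using bound[of "- x"] by simp
    qed
  qed
qed

lemma gauss_fun_deriv:
  "(gauss_fun D k has_vector_derivative (of_nat k * gauss_fun D (k - 1) x - D * gauss_fun D (Suc k) x)) (at x)"
proof -
  have "((\<lambda>z. exp (- D * z\<^sup>2 / 2) * z ^ k) has_field_derivative
      (of_nat k * (exp (- D * z\<^sup>2 / 2) * z ^ (k - 1)) - D * (exp (- D * z\<^sup>2 / 2) * z ^ Suc k))) (at z)" for z :: complex
    by (auto intro!: derivative_eq_intros simp: algebra_simps)
  from has_vector_derivative_real_field[OF this] show ?thesis
    unfolding gauss_fun_def by (simp add: of_real_power)
qed

text \<open>The derivative of \<open>gauss_fun D k\<close> integrates to zero over the line, as the
  function vanishes at both ends. For \<open>k = 0\<close> the factor \<open>k\<close> makes the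
  truncated exponent \<open>k - 1\<close> harmless.\<close>

lemma moment_Suc:
  assumes D: "Re D > 0"
  shows "D * moment D (Suc k) = of_nat k * moment D (k - 1)"
proof -
  let ?f = "\<lambda>x. of_nat k * gauss_fun D (k - 1) x - D * gauss_fun D (Suc k) x"
  have int: "integrable lborel ?f"
    by (intro Bochner_Integration.integrable_diff integrable_mult_right integrable_gauss_fun D)
  have "(LBINT x=-\<infinity>..\<infinity>. ?f x) = 0 - 0"
  proof (rule interval_integral_FTC_integrable)
    show "(gauss_fun D k has_vector_derivative ?f x) (at x)" for x by (rule gauss_fun_deriv)
    show "isCont ?f x" for x unfolding gauss_fun_def by (auto intro!: continuous_intros)
    show "set_integrable lborel (einterval (-\<infinity>) \<infinity>) ?f" using int by (simp add: set_integrable_def)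
    show "((gauss_fun D k \<circ> real_of_ereal) \<longlongrightarrow> 0) (at_right (-\<infinity>))" "((gauss_fun D k \<circ> real_of_ereal) \<longlongrightarrow> 0) (at_left \<infinity>)"
      unfolding ereal_tendsto_simps by (rule gauss_fun_tendsto_0[OF D])+
  qed simp
  then have "(LINT x|lborel. ?f x) = 0"
    by (simp add: interval_lebesgue_integral_def set_lebesgue_integral_def)
  then show ?thesis
    using integrable_gauss_fun[OF D] by (simp add: moment_def)
qed

text \<open>At a positive real parameter the integral is that of a scaled normal density. Such
  points suffice to determine the polynomial in \<open>gauss_mean\<close>.\<close>

lemma moment_0_real:
  assumes "a > 0"
  shows "moment (complex_of_real a) 0 \<noteq> 0"
proof -
  have "gauss_fun (complex_of_real a) 0 = (\<lambda>x. complex_of_real (sqrt (2 * pi / a) * normal_density 0 (1 / sqrt a) x))"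
    unfolding normal_density_scaled[OF assms] gauss_fun_def by (auto simp: exp_of_real[symmetric])
  then have "moment (complex_of_real a) 0 = complex_of_real (sqrt (2 * pi / a))"
    unfolding moment_def using assms by (simp only: integral_complex_of_real integral_mult_right_zero) simp
  then show ?thesis using assms by simp
qed

subsection \<open>The Gaussian functional in real coordinates\<close>

definition real_gauss :: "nat \<Rightarrow> (nat \<Rightarrow> complex) \<Rightarrow> mpol \<Rightarrow> complex" where
  "real_gauss N D p = (LINT r|(\<Pi>\<^sub>M v\<in>vars N. lborel).
     exp (- (\<Sum>v\<in>vars N. D (fst v) * of_real ((r v)\<^sup>2) / 2)) * peval (\<lambda>v. of_real (r v)) p)"

text \<open>In these coordinates weight and monomial are both products over the variables, so
  Fubini's theorem for finite products reduces the integral to one-dimensional moments.\<close>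

lemma real_gauss_mon:
  assumes D: "\<forall>K\<le>N. Re (D K) > 0" and L: "set_mset L \<subseteq> vars N"
  shows "integrable (\<Pi>\<^sub>M v\<in>vars N. lborel) (\<lambda>r. exp (- (\<Sum>v\<in>vars N. D (fst v) * of_real ((r v)\<^sup>2) / 2)) * peval (\<lambda>v. of_real (r v)) (mon L))" (is "integrable _ ?f")
    and "real_gauss N D (mon L) = (\<Prod>v\<in>vars N. moment (D (fst v)) (count L v))"
proof -
  interpret product_sigma_finite "\<lambda>_ :: var. lborel :: real measure" ..
  let ?g = "\<lambda>v. gauss_fun (D (fst v)) (count L v)"
  have eq: "?f r = (\<Prod>v\<in>vars N. ?g v (r v))" for r :: "var \<Rightarrow> real"
  proof -
    have "prod_mset (image_mset (\<lambda>v. complex_of_real (r v)) L) = (\<Prod>v\<in>vars N. of_real (r v) ^ count L v)"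
      unfolding image_prod_mset_multiplicity using L finite_vars
      by (intro prod.mono_neutral_left) (auto simp: not_in_iff)
    moreover have "exp (- (\<Sum>v\<in>vars N. D (fst v) * of_real ((r v)\<^sup>2) / 2)) = (\<Prod>v\<in>vars N. exp (- D (fst v) * of_real ((r v)\<^sup>2) / 2))"
      by (simp add: exp_sum[OF finite_vars, symmetric] sum_negf)
    ultimately show ?thesis by (simp add: gauss_fun_def prod.distrib)
  qed
  have int: "integrable lborel (?g v)" if "v \<in> vars N" for v
    using that D by (intro integrable_gauss_fun) (cases v, simp)
  show "integrable (\<Pi>\<^sub>M v\<in>vars N. lborel) ?f"
    unfolding eq by (rule product_integrable_prod[OF finite_vars int])
  show "real_gauss N D (mon L) = (\<Prod>v\<in>vars N. moment (D (fst v)) (count L v))"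
    unfolding real_gauss_def eq moment_def by (rule product_integral_prod[OF finite_vars int])
qed

text \<open>Linearity of the integral rests on integrability, which is known for monomials when Re D
  > 0.\<close>

lemma real_gauss_expand:
  assumes D: "\<forall>K\<le>N. Re (D K) > 0" and p: "p \<in> polys N"
  shows "real_gauss N D p = (\<Sum>M\<in>Poly_Mapping.keys p. Poly_Mapping.lookup p M * real_gauss N D (mon M))"
proof -
  have "exp (- (\<Sum>v\<in>vars N. D (fst v) * of_real ((r v)\<^sup>2) / 2)) * peval (\<lambda>v. of_real (r v)) p
    = (\<Sum>M\<in>Poly_Mapping.keys p. Poly_Mapping.lookup p M *
      (exp (- (\<Sum>v\<in>vars N. D (fst v) * of_real ((r v)\<^sup>2) / 2)) * peval (\<lambda>v. of_real (r v)) (mon M)))" for r :: "var \<Rightarrow> real"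
    by (simp add: peval_def[of _ p] sum_distrib_left sum_distrib_right mult_ac)
  then have "real_gauss N D p = (LINT r|(\<Pi>\<^sub>M v\<in>vars N. lborel). (\<Sum>M\<in>Poly_Mapping.keys p. Poly_Mapping.lookup p M *
      (exp (- (\<Sum>v\<in>vars N. D (fst v) * of_real ((r v)\<^sup>2) / 2)) * peval (\<lambda>v. of_real (r v)) (mon M))))"
    unfolding real_gauss_def by simp
  also have "\<dots> = (\<Sum>M\<in>Poly_Mapping.keys p. LINT r|(\<Pi>\<^sub>M v\<in>vars N. lborel). Poly_Mapping.lookup p M *
      (exp (- (\<Sum>v\<in>vars N. D (fst v) * of_real ((r v)\<^sup>2) / 2)) * peval (\<lambda>v. of_real (r v)) (mon M)))"
    using p by (intro Bochner_Integration.integral_sum integrable_mult_right real_gauss_mon(1)[OF D]) (auto simp: polys_def)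
  finally show ?thesis by (simp add: real_gauss_def del: peval_single)
qed

lemma real_gauss_superset:
  assumes D: "\<forall>K\<le>N. Re (D K) > 0" and "finite A" "Poly_Mapping.keys p \<subseteq> A" "p \<in> polys N"
  shows "real_gauss N D p = (\<Sum>M\<in>A. Poly_Mapping.lookup p M * real_gauss N D (mon M))"
  unfolding real_gauss_expand[OF D assms(4)]
  by (rule sum.mono_neutral_left) (use assms in \<open>auto simp: in_keys_iff\<close>)

lemma real_gauss_add:
  assumes D: "\<forall>K\<le>N. Re (D K) > 0" and "p \<in> polys N" "q \<in> polys N"
  shows "real_gauss N D (p + q) = real_gauss N D p + real_gauss N D q"
proof -
  let ?A = "Poly_Mapping.keys p \<union> Poly_Mapping.keys q"
  have "Poly_Mapping.keys (p + q) \<subseteq> ?A" by (rule Poly_Mapping.keys_add)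
  then show ?thesis
    using assms by (simp add: real_gauss_superset[OF D, of ?A] polys_add lookup_add distrib_right sum.distrib)
qed

lemma real_gauss_cmul:
  assumes D: "\<forall>K\<le>N. Re (D K) > 0" and "p \<in> polys N"
  shows "real_gauss N D (cmul c p) = c * real_gauss N D p"
proof -
  have "Poly_Mapping.keys (cmul c p) \<subseteq> Poly_Mapping.keys p" by (auto simp: in_keys_iff)
  then show ?thesis
    using assms by (simp add: real_gauss_superset[OF D, of "Poly_Mapping.keys p"] polys_cmul sum_distrib_left mult.assoc)
qed

lemma real_gauss_sum:
  assumes D: "\<forall>K\<le>N. Re (D K) > 0" and "\<And>i. i \<in> A \<Longrightarrow> f i \<in> polys N"
  shows "real_gauss N D (sum f A) = (\<Sum>i\<in>A. real_gauss N D (f i))"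
  using assms(2)
proof (induction A rule: infinite_finite_induct)
  case (insert a A)
  then show ?case by (simp add: real_gauss_add[OF D] polys_sum)
qed (simp_all add: real_gauss_def)

text \<open>For a monomial only the factor of \<open>v\<close> in the product of moments changes,
  and there the claim is \<open>moment_Suc\<close>; the rest is linearity.\<close>

lemma real_gauss_mulv:
  assumes D: "\<forall>K\<le>N. Re (D K) > 0" and v: "v \<in> vars N" and p: "p \<in> polys N"
  shows "D (fst v) * real_gauss N D (mulv v p) = real_gauss N D (pdiff v p)"
proof -
  have Dv: "Re (D (fst v)) > 0" using v D by (cases v) simp
  have mon: "D (fst v) * real_gauss N D (mulv v (mon L)) = real_gauss N D (pdiff v (mon L))" if L: "set_mset L \<subseteq> vars N" for L
  proof -
    let ?m = "\<lambda>w. moment (D (fst w)) (count L w)"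
    have L': "set_mset (add_mset v L) \<subseteq> vars N" "set_mset (L - {#v#}) \<subseteq> vars N" using L v by (auto dest: in_diffD)
    have "real_gauss N D (mulv v (mon L)) = moment (D (fst v)) (Suc (count L v)) * (\<Prod>w\<in>vars N - {v}. ?m w)"
      unfolding mulv_mon real_gauss_mon(2)[OF D L'(1)] prod.remove[OF finite_vars v]
      by (intro arg_cong2[of _ _ _ _ "(*)"] prod.cong) auto
    moreover have "real_gauss N D (mon (L - {#v#})) = moment (D (fst v)) (count L v - 1) * (\<Prod>w\<in>vars N - {v}. ?m w)"
      unfolding real_gauss_mon(2)[OF D L'(2)] prod.remove[OF finite_vars v]
      by (intro arg_cong2[of _ _ _ _ "(*)"] prod.cong) auto
    moreover have "pdiff v (mon L) = cmul (of_nat (count L v)) (mon (L - {#v#}))"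
      by (simp add: pdiff_eq_linext cmul_single)
    ultimately show ?thesis
      using moment_Suc[OF Dv, of "count L v"] real_gauss_cmul[OF D polys_mon[OF L'(2)]]
      by (simp add: mult.assoc[symmetric])
  qed
  have pm: "cmul (Poly_Mapping.lookup p M) (mon M) \<in> polys N" if "M \<in> Poly_Mapping.keys p" for M
    using p that by (intro polys_cmul polys_mon) (auto simp: polys_def)
  have exp: "X p = (\<Sum>M\<in>Poly_Mapping.keys p. X (cmul (Poly_Mapping.lookup p M) (mon M)))" if "lin X" for X
    by (subst lin_expand[OF that, of p]) (simp add: lin_cmul[OF that])
  have "D (fst v) * real_gauss N D (mulv v p) = (\<Sum>M\<in>Poly_Mapping.keys p. D (fst v) * real_gauss N D (mulv v (cmul (Poly_Mapping.lookup p M) (mon M))))"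
    by (subst exp[OF lin_mulv], subst real_gauss_sum[OF D]) (auto intro!: polys_mulv v pm simp: sum_distrib_left)
  also have "\<dots> = (\<Sum>M\<in>Poly_Mapping.keys p. real_gauss N D (pdiff v (cmul (Poly_Mapping.lookup p M) (mon M))))"
  proof (rule sum.cong[OF refl])
    fix M assume "M \<in> Poly_Mapping.keys p"
    then have M: "set_mset M \<subseteq> vars N" using p by (auto simp: polys_def)
    show "D (fst v) * real_gauss N D (mulv v (cmul (Poly_Mapping.lookup p M) (mon M))) = real_gauss N D (pdiff v (cmul (Poly_Mapping.lookup p M) (mon M)))"
      unfolding lin_cmul[OF lin_pdiff] mulv_cmul
      using mon[OF M] by (subst (1 2) real_gauss_cmul[OF D]) (auto intro!: polys_mulv polys_pdiff polys_mon M v)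
  qed
  also have "\<dots> = real_gauss N D (pdiff v p)"
    by (subst exp[OF lin_pdiff], subst real_gauss_sum[OF D]) (auto intro!: polys_pdiff pm)
  finally show ?thesis .
qed

subsection \<open>The change of coordinates\<close>

text \<open>The matrix C that expresses \<open>coord\<close> in the real coordinates. It satisfies C
  C^T = \<open>gc\<close>, shown in \<open>coord_coeff_orthogonal\<close>, and turns the invariant
  form into a sum of squares.\<close>

definition coord_coeff :: "nat \<Rightarrow> nat \<Rightarrow> nat \<Rightarrow> complex" where
  "coord_coeff K i j = (if i < K then (if j = i then 1 else if j = 2 * K - i then \<i> else 0) / complex_of_real (sqrt 2)
     else if i = K then (if j = K then 1 else 0)
     else (- 1) ^ (i - K) * (if j = 2 * K - i then 1 else if j = i then - \<i> else 0) / complex_of_real (sqrt 2))"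

lemma coord_coeff_sum:
  assumes "i \<le> 2 * K"
  shows "(\<Sum>j\<le>2 * K. coord_coeff K i j * f j) = (if i < K then (f i + \<i> * f (2 * K - i)) / complex_of_real (sqrt 2)
     else if i = K then f K else (- 1) ^ (i - K) * (f (2 * K - i) - \<i> * f i) / complex_of_real (sqrt 2))"
proof -
  have two: "(\<Sum>j\<le>2 * K. (if j = a then x else if j = b then y else 0) * f j) = x * f a + y * f b"
    if "a \<noteq> b" "a \<le> 2 * K" "b \<le> 2 * K" for a b and x y :: complex
  proof -
    have "(\<Sum>j\<le>2 * K. (if j = a then x else if j = b then y else 0) * f j)
      = (\<Sum>j\<le>2 * K. (if j = a then x * f a else 0) + (if j = b then y * f b else 0))"
      using that by (intro sum.cong) auto
    then show ?thesis using that by (simp add: sum.distrib)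
  qed
  have pull: "(\<Sum>j\<le>2 * K. (c * e j / d) * f j) = c * (\<Sum>j\<le>2 * K. e j * f j) / d" for c d :: complex and e
    by (simp add: sum_distrib_left sum_divide_distrib mult_ac)
  consider "i < K" | "i = K" | "i > K" by linarith
  then show ?thesis
  proof cases
    case 1
    have "(\<Sum>j\<le>2 * K. coord_coeff K i j * f j)
      = (\<Sum>j\<le>2 * K. (1 * (if j = i then 1 else if j = 2 * K - i then \<i> else 0) / complex_of_real (sqrt 2)) * f j)"
      using 1 by (simp add: coord_coeff_def)
    also have "\<dots> = 1 * (\<Sum>j\<le>2 * K. (if j = i then 1 else if j = 2 * K - i then \<i> else 0) * f j) / complex_of_real (sqrt 2)"
      by (rule pull)
    also have "(\<Sum>j\<le>2 * K. (if j = i then 1 else if j = 2 * K - i then \<i> else 0) * f j) = 1 * f i + \<i> * f (2 * K - i)"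
      using 1 by (intro two) auto
    finally show ?thesis using 1 by simp
  next
    case 2
    have "(\<Sum>j\<le>2 * K. coord_coeff K i j * f j) = (\<Sum>j\<le>2 * K. if j = K then f K else 0)"
      using 2 by (intro sum.cong) (auto simp: coord_coeff_def)
    then show ?thesis using 2 by simp
  next
    case 3
    have "(\<Sum>j\<le>2 * K. coord_coeff K i j * f j)
      = (\<Sum>j\<le>2 * K. ((- 1) ^ (i - K) * (if j = 2 * K - i then 1 else if j = i then - \<i> else 0) / complex_of_real (sqrt 2)) * f j)"
      using 3 by (simp add: coord_coeff_def)
    also have "\<dots> = (- 1) ^ (i - K) * (\<Sum>j\<le>2 * K. (if j = 2 * K - i then 1 else if j = i then - \<i> else 0) * f j) / complex_of_real (sqrt 2)"
      by (rule pull)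
    also have "(\<Sum>j\<le>2 * K. (if j = 2 * K - i then 1 else if j = i then - \<i> else 0) * f j) = 1 * f (2 * K - i) + - \<i> * f i"
      using 3 assms by (intro two) auto
    finally show ?thesis using 3 by simp
  qed
qed

lemma coord_eq:
  assumes "i \<le> 2 * K"
  shows "coord r (K, i) = (\<Sum>j\<le>2 * K. coord_coeff K i j * of_real (r (K, j)))"
  unfolding coord_coeff_sum[OF assms] coord_def
  by (auto simp: complex_eq_iff)

lemma sqrt2_square: "complex_of_real (sqrt 2) * complex_of_real (sqrt 2) = 2"
  by (simp flip: of_real_mult)

text \<open>The product is bilinear, without conjugation: for \<open>i = i'\<close> away from
  \<open>K\<close> the contributions \<open>1\<close> and the square of \<open>\<i>\<close> cancel,
  while for \<open>i' = 2 * K - i\<close> they add up.\<close>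

lemma coord_coeff_orthogonal:
  assumes "i \<le> 2 * K" "i' \<le> 2 * K"
  shows "(\<Sum>j\<le>2 * K. coord_coeff K i j * coord_coeff K i' j) = gc K i i'"
proof -
  have p: "(- 1 :: complex) ^ (i - K) = (- 1) ^ (K + i)" if "i \<ge> K" for i
  proof -
    have "even (i - K) \<longleftrightarrow> even (K + i)" using that by presburger
    then show ?thesis by (simp add: minus_one_power_iff)
  qed
  consider "i < K" | "i = K" | "i > K" by linarith
  then show ?thesis
  proof cases
    case 1
    consider "i' < K" | "i' = K" | "i' > K" by linarith
    then show ?thesis
    proof cases
      case 1
      then have "coord_coeff K i' i + \<i> * coord_coeff K i' (2 * K - i) = 0"
        using \<open>i < K\<close> by (auto simp: coord_coeff_def)
      moreover have "i + i' \<noteq> 2 * K" using 1 \<open>i < K\<close> by simp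
      ultimately show ?thesis unfolding coord_coeff_sum[OF assms(1)] using \<open>i < K\<close> by (simp add: gc_def)
    next
      case 2
      then show ?thesis unfolding coord_coeff_sum[OF assms(1)] using \<open>i < K\<close> by (auto simp: gc_def coord_coeff_def)
    next
      case 3
      have e: "(- 1 :: complex) ^ (i' - K) = (- 1) ^ (K + i)" if "i + i' = 2 * K"
      proof -
        have "even (i' - K) \<longleftrightarrow> even (K + i)" using that 3 by presburger
        then show ?thesis by (simp add: minus_one_power_iff)
      qed
      have "coord_coeff K i' i + \<i> * coord_coeff K i' (2 * K - i)
         = (if i + i' = 2 * K then 2 * (- 1) ^ (i' - K) else 0) / complex_of_real (sqrt 2)"
        using 3 \<open>i < K\<close> assms by (auto simp: coord_coeff_def field_simps)
      then show ?thesis unfolding coord_coeff_sum[OF assms(1)] using 3 \<open>i < K\<close> e by (auto simp: gc_def sqrt2_square)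
    qed
  next
    case 2
    then show ?thesis unfolding coord_coeff_sum[OF assms(1)] using assms by (auto simp: gc_def coord_coeff_def)
  next
    case 3
    consider "i' < K" | "i' = K" | "i' > K" by linarith
    then show ?thesis
    proof cases
      case 1
      have "coord_coeff K i' (2 * K - i) - \<i> * coord_coeff K i' i = (if i + i' = 2 * K then 2 else 0) / complex_of_real (sqrt 2)"
        using 1 \<open>i > K\<close> assms by (auto simp: coord_coeff_def field_simps)
      then show ?thesis unfolding coord_coeff_sum[OF assms(1)] using 1 \<open>i > K\<close> p[of i] by (auto simp: gc_def sqrt2_square)
    next
      case 2
      then show ?thesis unfolding coord_coeff_sum[OF assms(1)] using \<open>i > K\<close> assms by (auto simp: gc_def coord_coeff_def)
    next
      case 3
      have "coord_coeff K i' (2 * K - i) - \<i> * coord_coeff K i' i = 0"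
        using 3 \<open>i > K\<close> assms by (auto simp: coord_coeff_def)
      moreover have "i + i' \<noteq> 2 * K" using 3 \<open>i > K\<close> by simp
      ultimately show ?thesis unfolding coord_coeff_sum[OF assms(1)] using \<open>i > K\<close> by (simp add: gc_def)
    qed
  qed
qed

lemma coord_quadratic:
  "(\<Sum>n\<le>2 * K. \<Sum>m\<le>2 * K. gc K n m * (coord r (K, n) * coord r (K, m))) = (\<Sum>j\<le>2 * K. complex_of_real ((r (K, j))\<^sup>2))"
proof -
  let ?r = "\<lambda>j. complex_of_real (r (K, j))"
  \<comment> \<open>Row \<open>n\<close> contributes the product of the coordinates \<open>n\<close>
    and \<open>2 * K - n\<close>, which are conjugate up to sign, hence half the sum of two squares.
    Each such pair occurs in two rows.\<close>
  have diag: "(\<Sum>m\<le>2 * K. gc K n m * (coord r (K, n) * coord r (K, m))) = ((?r n)\<^sup>2 + (?r (2 * K - n))\<^sup>2) / 2" if n: "n \<le> 2 * K" for n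
  proof -
    let ?s = "complex_of_real (sqrt 2)"
    have s: "a / ?s * (b / ?s) = a * b / 2" for a b by (simp add: sqrt2_square)
    have m: "2 * K - n \<le> 2 * K" by simp
    have "(\<Sum>m\<le>2 * K. gc K n m * (coord r (K, n) * coord r (K, m))) = (\<Sum>m\<le>2 * K. (coord r (K, n) * coord r (K, m)) * gc K n m)"
      by (simp only: mult.commute)
    then have e: "(\<Sum>m\<le>2 * K. gc K n m * (coord r (K, n) * coord r (K, m))) = coord r (K, n) * coord r (K, 2 * K - n) * (- 1) ^ (K + n)"
      by (simp only: gc_mult_sum[OF n])
    consider "n < K" | "n = K" | "n > K" by linarith
    then show ?thesis
    proof cases
      case 1
      then have f: "\<not> 2 * K - n < K" "2 * K - n \<noteq> K" "2 * K - (2 * K - n) = n" by auto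
      have p: "(- 1 :: complex) ^ (2 * K - n - K) * (- 1) ^ (K + n) = 1"
      proof -
        have "even (2 * K - n - K + (K + n))" using 1 by presburger
        then show ?thesis by (simp only: power_add[symmetric] neg_one_even_power)
      qed
      have "coord r (K, n) * coord r (K, 2 * K - n) * (- 1) ^ (K + n)
        = ((- 1) ^ (2 * K - n - K) * (- 1) ^ (K + n)) * ((?r n + \<i> * ?r (2 * K - n)) / ?s * ((?r n - \<i> * ?r (2 * K - n)) / ?s))"
        unfolding coord_eq[OF n] coord_eq[OF m] coord_coeff_sum[OF n] coord_coeff_sum[OF m] using 1 f by simp
      then show ?thesis unfolding e p s by (simp add: power2_eq_square algebra_simps)
    next
      case 2
      then have "2 * K - n = n" by simp
      have c: "coord r (K, n) = ?r K" unfolding coord_eq[OF n] coord_coeff_sum[OF n] using 2 by simp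
      have "even (K + n)" using 2 by simp
      then have p: "(- 1 :: complex) ^ (K + n) = 1" by (rule neg_one_even_power)
      have "coord r (K, n) * coord r (K, 2 * K - n) * (- 1) ^ (K + n) = ?r K * ?r K"
        unfolding \<open>2 * K - n = n\<close> c p by simp
      then show ?thesis unfolding e using 2 by (simp add: power2_eq_square)
    next
      case 3
      then have f: "2 * K - n < K" "2 * K - (2 * K - n) = n" using n by auto
      have p: "(- 1 :: complex) ^ (n - K) * (- 1) ^ (K + n) = 1"
      proof -
        have "even (n - K + (K + n))" using 3 by presburger
        then show ?thesis by (simp only: power_add[symmetric] neg_one_even_power)
      qed
      have "coord r (K, n) * coord r (K, 2 * K - n) * (- 1) ^ (K + n)
        = ((- 1) ^ (n - K) * (- 1) ^ (K + n)) * ((?r (2 * K - n) - \<i> * ?r n) / ?s * ((?r (2 * K - n) + \<i> * ?r n) / ?s))"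
        unfolding coord_eq[OF n] coord_eq[OF m] coord_coeff_sum[OF n] coord_coeff_sum[OF m] using 3 f by simp
      then show ?thesis unfolding e p s by (simp add: power2_eq_square algebra_simps)
    qed
  qed
  have "(\<Sum>n\<le>2 * K. (?r (2 * K - n))\<^sup>2) = (\<Sum>n\<le>2 * K. (?r n)\<^sup>2)"
    by (rule sum.reindex_bij_witness[of _ "\<lambda>n. 2 * K - n" "\<lambda>n. 2 * K - n"]) auto
  then show ?thesis
    by (simp add: diag sum.distrib sum_divide_distrib[symmetric])
qed

lemma sum_vars: "(\<Sum>v\<in>vars N. f v) = (\<Sum>K\<le>N. \<Sum>n\<le>2 * K. f (K, n))"
proof -
  have "vars N = Sigma {..N} (\<lambda>K. {..2 * K})" by (auto simp: vars_def)
  then show ?thesis by (simp add: sum.Sigma)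
qed

lemma peval_quad_form:
  "peval (coord r) (quad_form N D) = (\<Sum>v\<in>vars N. D (fst v) * of_real ((r v)\<^sup>2) / 2)"
proof -
  have "peval (coord r) (quad_form N D) = (\<Sum>K\<le>N. 1/2 * D K * (\<Sum>n\<le>2 * K. \<Sum>m\<le>2 * K. gc K n m * (coord r (K, n) * coord r (K, m))))"
    by (simp add: quad_form_xvar peval_sum peval_cmul peval_mult peval_xvar sum_distrib_left mult_ac)
  then show ?thesis unfolding coord_quadratic sum_vars by (simp add: sum_distrib_left mult_ac)
qed

definition lin_form :: "var \<Rightarrow> mpol" where
  "lin_form v = (case v of (K, i) \<Rightarrow> \<Sum>j\<le>2 * K. cmul (coord_coeff K i j) (xvar (K, j)))"

text \<open>The linear change of variables, performed on polynomials. All integrals can then be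
  taken in the real coordinates, where the Gaussian measure is a product.\<close>

definition real_coords :: oper where
  "real_coords = linext (\<lambda>M. prod_mset (image_mset lin_form M))"

lemma lin_real_coords: "lin real_coords"
  unfolding real_coords_def by (rule lin_linext)

lemma real_coords_1 [simp]: "real_coords 1 = 1"
  using linext_mon[of "\<lambda>M. prod_mset (image_mset lin_form M)" "{#}"] by (simp add: real_coords_def mon_empty)

lemma real_coords_mulv: "real_coords (mulv v p) = lin_form v * real_coords p"
proof (rule lin_eqI[OF lin_compose[OF lin_real_coords lin_mulv] lin_compose[OF lin_mult_left lin_real_coords]])
  show "real_coords (mulv v (mon M)) = lin_form v * real_coords (mon M)" for M
    by (simp add: mulv_mon real_coords_def)
qed

lemma polys_lin_form: "v \<in> vars N \<Longrightarrow> lin_form v \<in> polys N"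
  by (cases v) (auto simp: lin_form_def intro!: polys_sum polys_cmul polys_xvar)

lemma polys_real_coords: "p \<in> polys N \<Longrightarrow> real_coords p \<in> polys N"
  unfolding polys_eq_span_of
proof (erule lin_span_of[OF lin_real_coords], unfold polys_eq_span_of[symmetric])
  fix M assume "M \<in> {M. set_mset M \<subseteq> vars N}"
  then show "real_coords (mon M) \<in> polys N"
    by (induction M) (auto simp: mon_empty mulv_mon[symmetric] real_coords_mulv polys_mult polys_lin_form)
qed

lemma peval_real_coords:
  assumes "p \<in> polys N"
  shows "peval (coord r) p = peval (\<lambda>v. of_real (r v)) (real_coords p)"
proof -
  have mon: "peval (coord r) (mon M) = peval (\<lambda>v. of_real (r v)) (real_coords (mon M))" if "set_mset M \<subseteq> vars N" for M
    using that
  proof (induction M)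
    case empty then show ?case by (simp add: mon_empty)
  next
    case (add v M)
    obtain K i where v: "v = (K, i)" "i \<le> 2 * K" using add.prems by (cases v) auto
    have "peval (\<lambda>v. of_real (r v)) (lin_form v) = coord r v"
      by (simp add: v lin_form_def peval_sum peval_cmul peval_xvar coord_eq)
    then show ?case using add
      by (simp add: mulv_mon[symmetric] real_coords_mulv peval_mult peval_mulv del: peval_single)
  qed
  have "peval (coord r) p = (\<Sum>M\<in>Poly_Mapping.keys p. Poly_Mapping.lookup p M * peval (coord r) (mon M))"
    by (simp add: peval_def)
  also have "\<dots> = (\<Sum>M\<in>Poly_Mapping.keys p. Poly_Mapping.lookup p M * peval (\<lambda>v. of_real (r v)) (real_coords (mon M)))"
    using assms by (intro sum.cong refl) (simp add: mon polys_def del: peval_single)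
  also have "\<dots> = peval (\<lambda>v. of_real (r v)) (real_coords p)"
    by (subst lin_expand[OF lin_real_coords, of p]) (simp add: peval_sum peval_cmul)
  finally show ?thesis .
qed

lemma pdiff_mult: "pdiff w (p * q) = pdiff w p * q + p * pdiff w q"
  by (simp add: pdiff_eq_deriv_ext deriv_ext_mult)

lemma pdiff_xvar: "pdiff w (xvar v) = (if v = w then 1 else 0)"
  by (simp add: pdiff_eq_deriv_ext)

lemma pdiff_mulv: "pdiff w (mulv v p) = (if v = w then p else 0) + mulv v (pdiff w p)"
  by (simp add: mulv_eq pdiff_mult pdiff_xvar)

text \<open>The chain rule for a linear substitution, checked by adding one variable at a
  time.\<close>

lemma pdiff_real_coords:
  assumes "p \<in> polys N" "j \<le> 2 * K"
  shows "pdiff (K, j) (real_coords p) = (\<Sum>i\<le>2 * K. cmul (coord_coeff K i j) (real_coords (pdiff (K, i) p)))"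
proof (rule lin_eqI_polys_mulv[OF lin_compose[OF lin_pdiff lin_real_coords] _ assms(1)])
  show "lin (\<lambda>p. \<Sum>i\<le>2 * K. cmul (coord_coeff K i j) (real_coords (pdiff (K, i) p)))"
    by (rule lin_sum_fun[OF lin_scale[OF lin_compose[OF lin_real_coords lin_pdiff]]])
  have "pdiff w 1 = 0" for w by (simp add: pdiff_eq_deriv_ext)
  then show "pdiff (K, j) (real_coords 1) = (\<Sum>i\<le>2 * K. cmul (coord_coeff K i j) (real_coords (pdiff (K, i) 1)))"
    by (simp add: lin_0[OF lin_real_coords])
  fix v M assume v: "v \<in> vars N"
    and IH: "pdiff (K, j) (real_coords (mon M)) = (\<Sum>i\<le>2 * K. cmul (coord_coeff K i j) (real_coords (pdiff (K, i) (mon M))))"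
  obtain L m where Lm: "v = (L, m)" "m \<le> 2 * L" using v by (cases v) auto
  have "pdiff (K, j) (lin_form v) = (\<Sum>i\<le>2 * L. if i = j then (if L = K then cmul (coord_coeff K m j) 1 else 0) else 0)"
    unfolding Lm lin_form_def prod.case lin_sum[OF lin_pdiff]
    by (intro sum.cong) (auto simp: lin_cmul[OF lin_pdiff] pdiff_xvar)
  then have lf: "pdiff (K, j) (lin_form v) = (if L = K then cmul (coord_coeff K m j) 1 else 0)"
    using assms(2) by simp
  have "(\<Sum>i\<le>2 * K. cmul (coord_coeff K i j) (real_coords (pdiff (K, i) (mulv v (mon M)))))
    = (\<Sum>i\<le>2 * K. (if i = m then (if L = K then cmul (coord_coeff K m j) (real_coords (mon M)) else 0) else 0)
       + lin_form v * cmul (coord_coeff K i j) (real_coords (pdiff (K, i) (mon M))))"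
    by (intro sum.cong refl)
      (auto simp: pdiff_mulv Lm lin_add[OF lin_real_coords] lin_0[OF lin_real_coords] real_coords_mulv cmul_add cmul_mult_right)
  then show "pdiff (K, j) (real_coords (mulv v (mon M))) = (\<Sum>i\<le>2 * K. cmul (coord_coeff K i j) (real_coords (pdiff (K, i) (mulv v (mon M)))))"
    using Lm(2) by (auto simp: real_coords_mulv pdiff_mult lf IH sum.distrib sum_distrib_left[symmetric] cmul_mult_left)
qed

section \<open>Integration by parts and the Gaussian mean\<close>

lemma gauss_int_eq:
  assumes "p \<in> polys N"
  shows "gauss_int N (quad_form N D) p = real_gauss N D (real_coords p)"
  unfolding gauss_int_def real_gauss_def peval_quad_form peval_real_coords[OF assms] ..

text \<open>Integration by parts in each real coordinate, followed by the chain rule; the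
  coefficients recombine through C C^T = \<open>gc\<close> to the derivative
  \<open>derv v\<close>.\<close>

lemma real_gauss_derv:
  assumes D: "\<forall>K\<le>N. Re (D K) > 0" and v: "v \<in> vars N" and p: "p \<in> polys N"
  shows "D (fst v) * real_gauss N D (real_coords (mulv v p)) = real_gauss N D (real_coords (derv v p))"
proof -
  obtain K i where Ki: "v = (K, i)" "K \<le> N" "i \<le> 2 * K" using v by (cases v) auto
  have q: "real_coords p \<in> polys N" by (rule polys_real_coords[OF p])
  have kj: "(K, j) \<in> vars N" if "j \<le> 2 * K" for j using that Ki by simp
  let ?J = "real_gauss N D"
  have "real_coords (mulv v p) = (\<Sum>j\<le>2 * K. cmul (coord_coeff K i j) (mulv (K, j) (real_coords p)))"
    unfolding real_coords_mulv by (simp add: Ki lin_form_def sum_distrib_right cmul_mult_left mulv_eq)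
  moreover have "mulv (K, j) (real_coords p) \<in> polys N" if "j \<le> 2 * K" for j by (rule polys_mulv[OF kj[OF that] q])
  ultimately have "?J (real_coords (mulv v p)) = (\<Sum>j\<le>2 * K. coord_coeff K i j * ?J (mulv (K, j) (real_coords p)))"
    by (simp only:) (subst real_gauss_sum[OF D], auto simp: real_gauss_cmul[OF D] polys_cmul intro!: sum.cong)
  then have "D K * ?J (real_coords (mulv v p)) = (\<Sum>j\<le>2 * K. coord_coeff K i j * (D K * ?J (mulv (K, j) (real_coords p))))"
    by (simp add: sum_distrib_left mult_ac)
  also have "\<dots> = (\<Sum>j\<le>2 * K. coord_coeff K i j * ?J (pdiff (K, j) (real_coords p)))"
    using real_gauss_mulv[OF D kj q] by (intro sum.cong refl) simp
  also have "\<dots> = (\<Sum>j\<le>2 * K. \<Sum>i'\<le>2 * K. coord_coeff K i j * coord_coeff K i' j * ?J (real_coords (pdiff (K, i') p)))"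
    by (intro sum.cong refl)
      (simp add: pdiff_real_coords[OF p] real_gauss_sum[OF D] real_gauss_cmul[OF D] polys_cmul polys_real_coords polys_pdiff p sum_distrib_left mult.assoc)
  also have "\<dots> = (\<Sum>i'\<le>2 * K. gc K i i' * ?J (real_coords (pdiff (K, i') p)))"
    by (subst sum.swap) (intro sum.cong refl, simp add: coord_coeff_orthogonal[OF Ki(3), symmetric] sum_distrib_right)
  also have "\<dots> = ?J (real_coords (derv v p))"
    by (simp add: Ki derv_def lin_sum[OF lin_real_coords] lin_cmul[OF lin_real_coords] real_gauss_sum[OF D] real_gauss_cmul[OF D]
        polys_cmul polys_real_coords polys_pdiff p)
  finally show ?thesis by (simp add: Ki)
qed

text \<open>Both sides satisfy the same rule of integration by parts, which expresses a monomial
  through polynomials of smaller degree, and they agree at \<open>1\<close>.\<close>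

lemma real_gauss_wick:
  assumes D: "\<forall>K\<le>N. Re (D K) > 0" and p: "p \<in> polys N"
  shows "real_gauss N D (real_coords p) = wick_mean (\<lambda>K. 1 / D K) p * real_gauss N D 1"
proof -
  let ?d = "\<lambda>K. 1 / D K" and ?J = "\<lambda>p. real_gauss N D (real_coords p)"
  have exp: "?J p = (\<Sum>M\<in>Poly_Mapping.keys p. Poly_Mapping.lookup p M * ?J (mon M))" if p: "p \<in> polys N" for p
  proof -
    have "real_coords p = (\<Sum>M\<in>Poly_Mapping.keys p. cmul (Poly_Mapping.lookup p M) (real_coords (mon M)))"
      by (rule lin_expand[OF lin_real_coords])
    moreover have "real_coords (mon M) \<in> polys N" if "M \<in> Poly_Mapping.keys p" for M
      using p that by (intro polys_real_coords polys_mon) (auto simp: polys_def)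
    ultimately show ?thesis by (simp add: real_gauss_sum[OF D] real_gauss_cmul[OF D] polys_cmul)
  qed
  have "p \<in> polys N \<Longrightarrow> \<forall>M\<in>Poly_Mapping.keys p. size M < n \<Longrightarrow> ?J p = wick_mean ?d p * real_gauss N D 1" for n p
  proof (induction n arbitrary: p)
    case 0
    then have "p = 0" by auto
    then show ?case using exp[of 0] wick_mean_expand[of ?d 0] by simp
  next
    case (Suc n)
    have "?J (mon M) = wick_mean ?d (mon M) * real_gauss N D 1" if M: "M \<in> Poly_Mapping.keys p" for M
    proof (cases M)
      case empty then show ?thesis by (simp add: mon_empty wick_mean_1)
    next
      case (add v M')
      have "set_mset (add_mset v M') \<subseteq> vars N" using Suc.prems(1) M unfolding polys_def add by blast
      then have MN: "v \<in> vars N" "set_mset M' \<subseteq> vars N" by auto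
      then obtain K i where "v = (K, i)" "K \<le> N" by (cases v) auto
      then have Dv: "D (fst v) \<noteq> 0" using D by auto
      have "\<forall>L\<in>Poly_Mapping.keys (derv v (mon M')). size L < n"
        using derv_mon_span[of v M'] Suc.prems(2) M add by (fastforce simp: span_of_def)
      then have "?J (derv v (mon M')) = wick_mean ?d (derv v (mon M')) * real_gauss N D 1"
        by (intro Suc.IH polys_derv polys_mon MN)
      then have "D (fst v) * ?J (mulv v (mon M')) = wick_mean ?d (derv v (mon M')) * real_gauss N D 1"
        using real_gauss_derv[OF D MN(1) polys_mon[OF MN(2)]] by simp
      then show ?thesis unfolding add mulv_mon[symmetric] wick_mean_mulv using Dv by (simp add: field_simps)
    qed
    then show ?case
      unfolding exp[OF Suc.prems(1)] wick_mean_expand[of ?d p] sum_distrib_right by (intro sum.cong refl) simp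
  qed
  from this[OF p, of "Suc (Max (insert 0 (size ` Poly_Mapping.keys p)))"] show ?thesis
    by (auto simp: less_Suc_eq_le intro!: Max_ge)
qed

lemma real_gauss_1:
  assumes "\<And>K. K \<le> N \<Longrightarrow> \<exists>a>0. D K = complex_of_real a"
  shows "real_gauss N D 1 \<noteq> 0"
proof -
  have D: "\<forall>K\<le>N. Re (D K) > 0" using assms by fastforce
  have "moment (D (fst v)) 0 \<noteq> 0" if "v \<in> vars N" for v
    using that assms[of "fst v"] moment_0_real by (cases v) auto
  then show ?thesis
    using real_gauss_mon(2)[OF D, of "{#}"] finite_vars by (simp add: mon_empty)
qed

text \<open>Existence of the polynomial is \<open>wick_mean_polynomial\<close>. Two candidates agree
  wherever all 1/D are positive reals, as the normalizing integral does not vanish there, and hence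
  agree everywhere.\<close>

theorem gauss_mean_eq_wick_mean:
  assumes W: "\<And>D. W D = quad_form N D" and f: "f \<in> polys N"
  shows "gauss_mean N W D f = wick_mean (\<lambda>K. 1 / D K) f"
proof -
  obtain Q where Q: "\<And>d. peval d Q = wick_mean d f"
    using wick_mean_polynomial[of f] by (auto simp: polynomial_in_def)
  have gi: "gauss_int N (quad_form N D') f = wick_mean (\<lambda>K. 1 / D' K) f * gauss_int N (quad_form N D') 1"
    if "\<forall>K\<le>N. Re (D' K) > 0" for D'
    unfolding gauss_int_eq[OF f] gauss_int_eq[OF polys_1] real_gauss_wick[OF that f] by simp
  show ?thesis
    unfolding gauss_mean_def W
  proof (rule the_equality)
    show "\<exists>Q. wick_mean (\<lambda>K. 1 / D K) f = peval (\<lambda>K. 1 / D K) Q \<and>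
      (\<forall>D'. (\<forall>K\<le>N. 0 < Re (D' K)) \<longrightarrow> peval (\<lambda>K. 1 / D' K) Q * gauss_int N (quad_form N D') 1 = gauss_int N (quad_form N D') f)"
      using Q gi by (intro exI[of _ Q]) simp
    fix v assume "\<exists>Q. v = peval (\<lambda>K. 1 / D K) Q \<and>
      (\<forall>D'. (\<forall>K\<le>N. 0 < Re (D' K)) \<longrightarrow> peval (\<lambda>K. 1 / D' K) Q * gauss_int N (quad_form N D') 1 = gauss_int N (quad_form N D') f)"
    then obtain R where R: "v = peval (\<lambda>K. 1 / D K) R"
      "\<And>D'. \<forall>K\<le>N. 0 < Re (D' K) \<Longrightarrow> peval (\<lambda>K. 1 / D' K) R * gauss_int N (quad_form N D') 1 = gauss_int N (quad_form N D') f"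
      by blast
    have "peval y (R + - Q) = 0" if y: "\<And>K. K \<le> N \<Longrightarrow> \<exists>a>0. y K = complex_of_real a" for y
    proof -
      let ?D = "\<lambda>K. 1 / y K"
      have "\<exists>a>0. ?D K = complex_of_real a" if K: "K \<le> N" for K
      proof -
        obtain a where "a > 0" "y K = complex_of_real a" using y[OF K] by blast
        then show ?thesis by (intro exI[of _ "1 / a"]) simp
      qed
      note D = this
      then have D': "\<forall>K\<le>N. 0 < Re (?D K)" by fastforce
      have "gauss_int N (quad_form N ?D) 1 \<noteq> 0"
        unfolding gauss_int_eq[OF polys_1] real_coords_1 by (rule real_gauss_1[OF D])
      then have "peval (\<lambda>K. 1 / ?D K) R = peval (\<lambda>K. 1 / ?D K) Q"
        using R(2)[OF D'] gi[OF D'] by (simp add: Q)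
      then show ?thesis unfolding peval_add peval_uminus by simp
    qed
    then have "peval (\<lambda>K. 1 / D K) (R + - Q) = 0" by (rule peval_eq_0_everywhere[of N])
    then show "v = wick_mean (\<lambda>K. 1 / D K) f"
      unfolding R(1) peval_add peval_uminus Q by simp
  qed
qed

theorem mainTheorem7:
  fixes \<delta> h :: real
    and \<phi> :: "real \<Rightarrow> rep \<Rightarrow> rep"
    and F :: "real \<Rightarrow> rep \<Rightarrow> rep \<Rightarrow> complex mat"
    and N :: nat
    and D \<nu> :: "nat \<Rightarrow> complex"
    and Sint :: ncpol
  assumes twist: "minimal_twist_family \<delta> \<phi> F"
    and h: "h \<noteq> 0" "\<bar>h\<bar> < \<delta>"
    and D: "\<And>K. K \<le> N \<Longrightarrow> D K \<noteq> 0"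
    and free: "free_classical (F h) N \<nu>"
    and Sint: "Sint \<in> ncpols N" "q_invariant h (\<phi> h) (F h) Sint"
  shows "\<exists>\<N>' :: complex fps. fps_nth \<N>' 0 \<noteq> 0
    \<and> bracket1 (F h) N \<nu> D Sint ncone / \<N>' = 1
    \<and> (\<forall>P \<in> ncpols N.
        corr (F h) N \<nu> D Sint P = bracket1 (F h) N \<nu> D Sint P / \<N>'
        \<and> corr (F h) N \<nu> D Sint P = bracket2 (F h) N \<nu> D Sint P / \<N>'
        \<and> corr (F h) N \<nu> D Sint P = bracket3 (F h) D Sint P / bracket3 (F h) D Sint ncone)"
proof -
  interpret drinfeld_twist h "\<phi> h" "F h"
    using twist h by unfold_locales (simp_all add: minimal_twist_family_def)
  \<comment> \<open>\<open>gauss_mean\<close> varies the weights, so the quadratic form is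
    identified for every \<open>D'\<close> and not only for the given \<open>D\<close>.\<close>
  have S: "S_free (F h) N \<nu> D' 1 = quad_form N D'" for D'
    using free by (simp add: free_classical_def quad_form_def)
  have w: "weighted (F h) N \<nu> D Sint P = bracket3 (F h) D Sint P" if "P \<in> ncpols N" for P
  proof (rule fps_ext)
    fix k
    have "expterm k (\<lambda>p. - subst Sint (hat (F h) mulv) p) (subst P (hat (F h) mulv) 1) \<in> polys N"
      by (intro polys_expterm Sint(1) polys_subst that polys_1)
    then show "fps_nth (weighted (F h) N \<nu> D Sint P) k = fps_nth (bracket3 (F h) D Sint P) k"
      unfolding weighted_def fps_nth_Abs_fps gauss_mean_eq_wick_mean[OF S]
      by (simp add: gauss_mean_eq_wick_mean[OF S] wick_mean_eq_bracket3[OF Sint that])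
  qed
  have one: "ncone \<in> ncpols N" by (simp add: ncone_def ncpols_def)
  note b1 = bracket1_eq_bracket3[OF free Sint(1)]
  \<comment> \<open>At order zero in the coupling the bracket with \<open>ncone\<close> is
    \<open>1\<close>, which makes the series a unit in the ring of power series.\<close>
  have n0: "fps_nth (bracket1 (F h) N \<nu> D Sint ncone) 0 \<noteq> 0"
    unfolding b1[OF one] bracket3_def bracket_def
    by (simp add: expterm_def subst_def ncone_def lookup_1_empty)
  then have "bracket1 (F h) N \<nu> D Sint ncone / bracket1 (F h) N \<nu> D Sint ncone = 1"
    by (simp add: fps_divide_unit inverse_mult_eq_1')
  with n0 show ?thesis
    \<comment> \<open>The normalization constant is the first bracket at \<open>ncone\<close>. It
      equals the third bracket and the weighted series at \<open>ncone\<close>, so the quotients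
      coincide.\<close>
    by (intro exI[of _ "bracket1 (F h) N \<nu> D Sint ncone"])
      (auto simp: corr_def w one b1 bracket2_eq_bracket3)
qed

end
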